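(* Let $(\psi_j)_{j\ge1}$ be a family of functions in $L^\infty(D)$ with arbitrary support, and let $0<p<2$. If $(\|\psi_j\|_{L^\infty(D)})_{j\ge1}$ belongs to $\ell^q(\mathbb{N})$ with $\frac1q=\frac1p+\frac12$, then $(\|u_\nu\|_V)_{\nu\in\mathcal{F}}$ belongs to $\ell^p(\mathcal{F})$. In particular, best $n$-term Hermite approximations converge in $L^2(U,V,\gamma)$ with rate $n^{-s}$ for $s=\frac1q-1$: there is a constant $C$ such that $\|u-u_{\Lambda_n}\|_{L^2(U,V,\gamma)}\le Cn^{-s}$ for all $n\ge1$, where $u_{\Lambda_n}:=\sum_{\nu\in\Lambda_n}u_\nu H_\nu$ and $\Lambda_n$ is a set of indices corresponding to the $n$ largest values of $\|u_\nu\|_V$.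
   Context: $D\subset\mathbb{R}^d$ is a bounded Lipschitz domain, $V:=H^1_0(D)$ with norm $\|v\|_V:=\|\nabla v\|_{L^2(D)}$, and $f\in H^{-1}(D)$ is fixed. $U:=\mathbb{R}^{\mathbb{N}}$, $\mathbb{N}=\{1,2,\dots\}$, is equipped with the $\sigma$-algebra generated by the Borel cylinders and with $\gamma$, the countable product of standard Gaussian measures $\mathcal{N}(0,1)$ on $\mathbb{R}$. For $y=(y_j)_{j\ge1}\in U$ set $b(y):=\sum_{j\ge1}y_j\psi_j$ whenever this series converges in $L^\infty(D)$, set $a(y):=\exp(b(y))$, and let $u(y)\in V$ be the unique weak solution of $-\mathrm{div}(a(y)\nabla u(y))=f$ in $D$ with homogeneous Dirichlet boundary conditions, i.e. $\int_D a(y)\nabla u(y)\cdot\nabla v\,dx=\langle f,v\rangle$ for all $v\in V$. The map $y\mapsto u(y)$ need only be defined for $\gamma$-almost every $y$. $\mathcal{F}$ is the countable set of finitely supported sequences $\nu=(\nu_j)_{j\ge1}$ of nonnegative integers. $H_k$ are the univariate Hermite polynomials normalized in $L^2(\mathbb{R},g\,dt)$, where $g(t)=(2\pi)^{-1/2}e^{-t^2/2}$, i.e. $H_k=\frac{(-1)^k}{\sqrt{k!}}\frac{g^{(k)}}{g}$; $H_\nu(y):=\prod_{j\ge1}H_{\nu_j}(y_j)$; and $u_\nu:=\int_U u(y)H_\nu(y)\,d\gamma(y)\in V$. *)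

theory Defs
  imports "HOL-Probability.Probability"
begin

section \<open>The Hilbert spaces \<open>L\<^sup>2(\<real>\<^sup>d; \<real>\<^sup>m)\<close>\<close>

definition square_integrable :: "('a::euclidean_space \<Rightarrow> 'b::euclidean_space) \<Rightarrow> bool" where
  "square_integrable f \<longleftrightarrow> f \<in> borel_measurable lebesgue \<and> integrable lebesgue (\<lambda>x. (norm (f x))\<^sup>2)"

lemma square_integrable_zero: "square_integrable (\<lambda>x. 0)"
  by (simp add: square_integrable_def)

lemma square_integrable_add:
  assumes "square_integrable f" "square_integrable g"
  shows "square_integrable (\<lambda>x. f x + g x)"
proof -
  have m[measurable]: "f \<in> borel_measurable lebesgue" "g \<in> borel_measurable lebesgue"
    using assms by (auto simp: square_integrable_def)
  have "integrable lebesgue (\<lambda>x. 2 * (norm (f x))\<^sup>2 + 2 * (norm (g x))\<^sup>2)"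
    using assms by (auto simp: square_integrable_def)
  then have "integrable lebesgue (\<lambda>x. (norm (f x + g x))\<^sup>2)"
  proof (rule Bochner_Integration.integrable_bound)
    show "AE x in lebesgue. norm ((norm (f x + g x))\<^sup>2) \<le> norm (2 * (norm (f x))\<^sup>2 + 2 * (norm (g x))\<^sup>2)"
    proof (rule AE_I2)
      fix x
      have "(norm (f x + g x))\<^sup>2 \<le> (norm (f x) + norm (g x))\<^sup>2"
        by (intro power_mono norm_triangle_ineq) simp
      also have "\<dots> \<le> 2 * (norm (f x))\<^sup>2 + 2 * (norm (g x))\<^sup>2"
        using sum_squares_bound[of "norm (f x)" "norm (g x)"] by (simp add: power2_sum)
      finally show "norm ((norm (f x + g x))\<^sup>2) \<le> norm (2 * (norm (f x))\<^sup>2 + 2 * (norm (g x))\<^sup>2)"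
        by simp
    qed
  qed measurable
  then show ?thesis by (simp add: square_integrable_def)
qed

lemma square_integrable_scaleR:
  "square_integrable f \<Longrightarrow> square_integrable (\<lambda>x. c *\<^sub>R f x)"
  by (auto simp: square_integrable_def power_mult_distrib)

lemma square_integrable_minus:
  "square_integrable f \<Longrightarrow> square_integrable (\<lambda>x. - f x)"
  by (auto simp: square_integrable_def)

lemma square_integrable_diff:
  "square_integrable f \<Longrightarrow> square_integrable g \<Longrightarrow> square_integrable (\<lambda>x. f x - g x)"
  using square_integrable_add[of f "\<lambda>x. - g x"] by (simp add: square_integrable_minus)

lemma square_integrable_inner:
  assumes "square_integrable f" "square_integrable g"
  shows "integrable lebesgue (\<lambda>x. f x \<bullet> g x)"
proof (rule Bochner_Integration.integrable_bound)
  show "integrable lebesgue (\<lambda>x. (norm (f x))\<^sup>2 + (norm (g x))\<^sup>2)"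
    using assms by (auto simp: square_integrable_def)
  have [measurable]: "f \<in> borel_measurable lebesgue" "g \<in> borel_measurable lebesgue"
    using assms by (auto simp: square_integrable_def)
  show "(\<lambda>x. f x \<bullet> g x) \<in> borel_measurable lebesgue" by measurable
  show "AE x in lebesgue. norm (f x \<bullet> g x) \<le> norm ((norm (f x))\<^sup>2 + (norm (g x))\<^sup>2)"
  proof (rule AE_I2)
    fix x
    have "\<bar>f x \<bullet> g x\<bar> \<le> norm (f x) * norm (g x)" by (rule Cauchy_Schwarz_ineq2)
    moreover have "2 * (norm (f x) * norm (g x)) \<le> (norm (f x))\<^sup>2 + (norm (g x))\<^sup>2"
      using sum_squares_bound[of "norm (f x)" "norm (g x)"] by (simp add: mult.assoc)
    moreover have "0 \<le> norm (f x) * norm (g x)" by simp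
    ultimately show "norm (f x \<bullet> g x) \<le> norm ((norm (f x))\<^sup>2 + (norm (g x))\<^sup>2)"
      by simp
  qed
qed

definition L2_rel :: "('a::euclidean_space \<Rightarrow> 'b::euclidean_space) \<Rightarrow> ('a \<Rightarrow> 'b) \<Rightarrow> bool" where
  "L2_rel f g \<longleftrightarrow> square_integrable f \<and> square_integrable g \<and> (AE x in lebesgue. f x = g x)"

lemma L2_rel_refl: "L2_rel f f \<longleftrightarrow> square_integrable f"
  by (simp add: L2_rel_def)

quotient_type (overloaded) ('a, 'b) L2 = "'a::euclidean_space \<Rightarrow> 'b::euclidean_space" / partial: L2_rel
proof (rule part_equivpI)
  show "\<exists>x. L2_rel x x"
    using square_integrable_zero L2_rel_refl by blast
  show "symp L2_rel"
    by (auto simp: symp_def L2_rel_def)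
  show "transp L2_rel"
    by (auto simp: transp_def L2_rel_def)
qed

lemma square_integrable_rep: "square_integrable (rep_L2 v)"
  using L2_rel_refl Quotient_rep_reflp[OF Quotient_L2] by blast

lemma abs_rep_L2: "abs_L2 (rep_L2 v) = v"
  using Quotient_abs_rep[OF Quotient_L2] by blast

lemma rep_abs_L2: "square_integrable f \<Longrightarrow> AE x in lebesgue. rep_L2 (abs_L2 f) x = f x"
  using Quotient_rep_abs[OF Quotient_L2, of f] L2_rel_refl[of f] by (simp add: L2_rel_def)

instantiation L2 :: (euclidean_space, euclidean_space) real_inner
begin

lift_definition zero_L2 :: "('a, 'b) L2" is "\<lambda>x. 0"
  by (simp add: L2_rel_refl square_integrable_zero)

lift_definition plus_L2 :: "('a, 'b) L2 \<Rightarrow> ('a, 'b) L2 \<Rightarrow> ('a, 'b) L2" is "\<lambda>f g x. f x + g x"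
  by (auto simp: L2_rel_def intro!: square_integrable_add)

lift_definition minus_L2 :: "('a, 'b) L2 \<Rightarrow> ('a, 'b) L2 \<Rightarrow> ('a, 'b) L2" is "\<lambda>f g x. f x - g x"
  by (auto simp: L2_rel_def intro!: square_integrable_diff)

lift_definition uminus_L2 :: "('a, 'b) L2 \<Rightarrow> ('a, 'b) L2" is "\<lambda>f x. - f x"
  by (auto simp: L2_rel_def intro!: square_integrable_minus)

lift_definition scaleR_L2 :: "real \<Rightarrow> ('a, 'b) L2 \<Rightarrow> ('a, 'b) L2" is "\<lambda>c f x. c *\<^sub>R f x"
  by (auto simp: L2_rel_def intro!: square_integrable_scaleR)

lift_definition inner_L2 :: "('a, 'b) L2 \<Rightarrow> ('a, 'b) L2 \<Rightarrow> real" is "\<lambda>f g. \<integral>x. f x \<bullet> g x \<partial>lebesgue"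
proof -
  fix f f' g g' :: "'a \<Rightarrow> 'b"
  assume "L2_rel f f'" "L2_rel g g'"
  then show "(\<integral>x. f x \<bullet> g x \<partial>lebesgue) = (\<integral>x. f' x \<bullet> g' x \<partial>lebesgue)"
    by (intro integral_cong_AE)
       (auto simp: L2_rel_def square_integrable_def intro!: borel_measurable_inner)
qed

definition norm_L2 :: "('a, 'b) L2 \<Rightarrow> real" where
  "norm_L2 v = sqrt (inner v v)"

definition sgn_L2 :: "('a, 'b) L2 \<Rightarrow> ('a, 'b) L2" where
  "sgn_L2 v = scaleR (inverse (norm v)) v"

definition dist_L2 :: "('a, 'b) L2 \<Rightarrow> ('a, 'b) L2 \<Rightarrow> real" where
  "dist_L2 v w = norm (v - w)"

definition uniformity_L2 :: "(('a, 'b) L2 \<times> ('a, 'b) L2) filter" where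
  "uniformity_L2 = (INF e\<in>{0 <..}. principal {(x, y). dist x y < e})"

definition open_L2 :: "('a, 'b) L2 set \<Rightarrow> bool" where
  "open_L2 S = (\<forall>x\<in>S. \<forall>\<^sub>F (x', y) in uniformity. x' = x \<longrightarrow> y \<in> S)"

instance
proof
  fix u v w :: "('a, 'b) L2" and a b :: real
  show "u + v + w = u + (v + w)"
    by transfer (auto simp: L2_rel_def add.assoc intro!: square_integrable_add)
  show "u + v = v + u"
    by transfer (auto simp: L2_rel_def add.commute intro!: square_integrable_add)
  show "0 + u = u"
    by transfer (auto simp: L2_rel_def)
  show "- u + u = 0"
    by transfer (auto simp: L2_rel_def square_integrable_zero)
  show "u - v = u + - v"
    by transfer (auto simp: L2_rel_def intro!: square_integrable_diff)
  show "a *\<^sub>R (u + v) = a *\<^sub>R u + a *\<^sub>R v"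
    by transfer (auto simp: L2_rel_def scaleR_add_right
        intro!: square_integrable_add square_integrable_scaleR)
  show "(a + b) *\<^sub>R u = a *\<^sub>R u + b *\<^sub>R u"
    by transfer (auto simp: L2_rel_def scaleR_add_left
        intro!: square_integrable_add square_integrable_scaleR)
  show "a *\<^sub>R b *\<^sub>R u = (a * b) *\<^sub>R u"
    by transfer (auto simp: L2_rel_def intro!: square_integrable_scaleR)
  show "1 *\<^sub>R u = u"
    by transfer (auto simp: L2_rel_def)
  show "inner u v = inner v u"
    by transfer (simp add: inner_commute)
  show "inner (u + v) w = inner u w + inner v w"
    by transfer (simp add: L2_rel_refl inner_add_left square_integrable_inner)
  show "inner (a *\<^sub>R u) v = a * inner u v"
    by transfer simp
  show "0 \<le> inner u u"
    by transfer simp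
  show "inner u u = 0 \<longleftrightarrow> u = 0"
  proof transfer
    fix f :: "'a \<Rightarrow> 'b" assume "L2_rel f f"
    then have f: "square_integrable f" by (simp add: L2_rel_refl)
    have "(\<integral>x. f x \<bullet> f x \<partial>lebesgue) = 0 \<longleftrightarrow> (AE x in lebesgue. f x \<bullet> f x = 0)"
      using square_integrable_inner[OF f f] by (rule integral_nonneg_eq_0_iff_AE) simp
    then show "(\<integral>x. f x \<bullet> f x \<partial>lebesgue) = 0 \<longleftrightarrow> L2_rel f (\<lambda>x. 0)"
      using f by (simp add: L2_rel_def square_integrable_zero)
  qed
qed (simp_all add: norm_L2_def sgn_L2_def dist_L2_def uniformity_L2_def open_L2_def)

end

lemma norm_L2_sq: "(norm v)\<^sup>2 = (\<integral>x. (norm (rep_L2 v x))\<^sup>2 \<partial>lebesgue)"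
proof -
  have "(norm v)\<^sup>2 = inner v v"
    by (simp add: power2_norm_eq_inner)
  also have "\<dots> = (\<integral>x. rep_L2 v x \<bullet> rep_L2 v x \<partial>lebesgue)"
    by (simp add: inner_L2_def)
  finally show ?thesis
    by (simp add: power2_norm_eq_inner)
qed

lemma abs_L2_add:
  "square_integrable f \<Longrightarrow> square_integrable g \<Longrightarrow> abs_L2 f + abs_L2 g = abs_L2 (\<lambda>x. f x + g x)"
  by (rule plus_L2.abs_eq) (simp_all add: L2_rel_refl)

lemma abs_L2_diff:
  "square_integrable f \<Longrightarrow> square_integrable g \<Longrightarrow> abs_L2 f - abs_L2 g = abs_L2 (\<lambda>x. f x - g x)"
  by (rule minus_L2.abs_eq) (simp_all add: L2_rel_refl)

lemma abs_L2_scaleR: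
  "square_integrable f \<Longrightarrow> c *\<^sub>R abs_L2 f = abs_L2 (\<lambda>x. c *\<^sub>R f x)"
  by (rule scaleR_L2.abs_eq) (simp_all add: L2_rel_refl)

lemma norm_abs_L2_sq:
  assumes "square_integrable f"
  shows "(norm (abs_L2 f))\<^sup>2 = (\<integral>x. (norm (f x))\<^sup>2 \<partial>lebesgue)"
  using assms
  by (simp add: power2_norm_eq_inner inner_L2.abs_eq L2_rel_refl)

lemma dist_abs_L2_sq:
  assumes "square_integrable f" "square_integrable g"
  shows "(dist (abs_L2 f) (abs_L2 g))\<^sup>2 = (\<integral>x. (norm (f x - g x))\<^sup>2 \<partial>lebesgue)"
  using assms by (simp add: dist_norm abs_L2_diff norm_abs_L2_sq square_integrable_diff)

lemma dist_L2_nn_integral: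
  assumes "square_integrable f" "square_integrable g"
  shows "(\<integral>\<^sup>+x. ennreal ((norm (f x - g x))\<^sup>2) \<partial>lebesgue) = ennreal ((dist (abs_L2 f) (abs_L2 g))\<^sup>2)"
  unfolding dist_abs_L2_sq[OF assms]
  using square_integrable_diff[OF assms]
  by (intro nn_integral_eq_integral) (auto simp: square_integrable_def)

text \<open>
  Completeness and separability are what the library's Bochner integral asks of the type of values.
\<close>

instance L2 :: (euclidean_space, euclidean_space) banach
proof
  fix X :: "nat \<Rightarrow> ('a, 'b) L2"
  assume X: "Cauchy X"
  define F where "F = (\<lambda>n. rep_L2 (X n))"
  have F: "square_integrable (F n)" "abs_L2 (F n) = X n" for n
    by (simp_all add: F_def square_integrable_rep abs_rep_L2)
  have F_meas[measurable]: "F n \<in> borel_measurable lebesgue" for n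
    using F(1)[of n] by (simp add: square_integrable_def)
  have "\<exists>M. \<forall>m\<ge>M. \<forall>n\<ge>M. dist (X m) (X n) < (1/2) ^ k" for k :: nat
    using metric_CauchyD[OF X, of "(1/2) ^ k"] by simp
  then obtain N where N: "\<And>k m n. m \<ge> N k \<Longrightarrow> n \<ge> N k \<Longrightarrow> dist (X m) (X n) < (1/2) ^ k"
    by metis
  define r where "r k = (\<Sum>j\<le>k. N j)" for k
  have r_ge: "N k \<le> r k" for k
    unfolding r_def by (rule member_le_sum) auto
  have r_mono: "r k \<le> r (Suc k)" for k
    by (simp add: r_def)
  have r_dist: "dist (X (r (Suc k))) (X (r k)) < (1/2) ^ k" for k
    using r_ge[of k] r_mono[of k] by (intro N) auto
  define d where "d k x = (norm (F (r (Suc k)) x - F (r k) x))\<^sup>2" for k x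
  have d_meas[measurable]: "d k \<in> borel_measurable lebesgue" for k
    unfolding d_def by measurable
  have "(\<integral>\<^sup>+x. (\<Sum>k. ennreal (2 ^ k * d k x)) \<partial>lebesgue) = (\<Sum>k. \<integral>\<^sup>+x. ennreal (2 ^ k * d k x) \<partial>lebesgue)"
    by (rule nn_integral_suminf) measurable
  also have "\<dots> \<le> (\<Sum>k. ennreal ((1/2) ^ k))"
  proof (rule suminf_le)
    fix k
    have "(\<integral>\<^sup>+x. ennreal (2 ^ k * d k x) \<partial>lebesgue) = ennreal (2 ^ k) * (\<integral>\<^sup>+x. ennreal (d k x) \<partial>lebesgue)"
      by (simp add: ennreal_mult' nn_integral_cmult)
    also have "\<dots> = ennreal (2 ^ k * (dist (X (r (Suc k))) (X (r k)))\<^sup>2)"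
      unfolding d_def by (subst dist_L2_nn_integral) (simp_all add: F ennreal_mult')
    also have "\<dots> \<le> ennreal (2 ^ k * ((1/2) ^ k)\<^sup>2)"
      using r_dist[of k] by (intro ennreal_leI mult_left_mono power_mono) auto
    also have "\<dots> = ennreal ((1/2) ^ k)"
      by (simp add: power2_eq_square power_one_over)
    finally show "(\<integral>\<^sup>+x. ennreal (2 ^ k * d k x) \<partial>lebesgue) \<le> ennreal ((1/2) ^ k)" .
  qed auto
  also have "\<dots> = ennreal (\<Sum>k. (1/2) ^ k)"
    by (rule suminf_ennreal2) auto
  also have "\<dots> < \<infinity>" by simp
  finally have fin: "(\<integral>\<^sup>+x. (\<Sum>k. ennreal (2 ^ k * d k x)) \<partial>lebesgue) < \<infinity>" .
  have "AE x in lebesgue. (\<Sum>k. ennreal (2 ^ k * d k x)) \<noteq> \<infinity>"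
    using fin by (intro nn_integral_PInf_AE) auto
  then have conv: "AE x in lebesgue. convergent (\<lambda>k. F (r k) x)"
  proof eventually_elim
    fix x assume *: "(\<Sum>k. ennreal (2 ^ k * d k x)) \<noteq> \<infinity>"
    then have sm: "summable (\<lambda>k. 2 ^ k * d k x)"
      by (intro summable_suminf_not_top) (auto simp: d_def)
    then obtain B where B: "\<And>k. norm (2 ^ k * d k x) \<le> B"
      using summable_imp_Bseq[OF sm] unfolding Bseq_def by blast
    have B0: "0 \<le> B" using B[of 0] norm_ge_zero order_trans by blast
    have bnd: "norm (F (r (Suc k)) x - F (r k) x) \<le> sqrt B * (1 / sqrt 2) ^ k" for k
    proof (rule power2_le_imp_le)
      have "2 ^ k * d k x \<le> B" using B[of k] by simp
      then have "d k x \<le> B / 2 ^ k" by (simp add: field_simps)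
      also have "\<dots> = (sqrt B * (1 / sqrt 2) ^ k)\<^sup>2"
      proof -
        have "((1 / sqrt 2) ^ k)\<^sup>2 = ((1 / sqrt 2)\<^sup>2) ^ k"
          by (simp only: power_mult[symmetric] mult.commute)
        then show ?thesis
          using B0 by (simp add: power_mult_distrib power_divide)
      qed
      finally show "(norm (F (r (Suc k)) x - F (r k) x))\<^sup>2 \<le> (sqrt B * (1 / sqrt 2) ^ k)\<^sup>2"
        by (simp add: d_def)
    qed (use B0 in simp)
    have "summable (\<lambda>k. F (r (Suc k)) x - F (r k) x)"
      by (rule summable_comparison_test'[where N=0, OF _ bnd])
         (intro summable_mult summable_geometric, simp)
    then have "convergent (\<lambda>n. \<Sum>k<n. F (r (Suc k)) x - F (r k) x)"
      by (simp add: summable_iff_convergent)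
    then have "convergent (\<lambda>n. F (r n) x - F (r 0) x)"
      by (simp add: sum_lessThan_telescope[of "\<lambda>k. F (r k) x"])
    then show "convergent (\<lambda>k. F (r k) x)"
      using convergent_add[OF _ convergent_const[of "F (r 0) x"]] by fastforce
  qed
  define G where "G x = lim (\<lambda>k. F (r k) x)" for x
  have G_meas[measurable]: "G \<in> borel_measurable lebesgue"
    unfolding G_def by (rule borel_measurable_lim_metric) measurable
  have G_lim: "AE x in lebesgue. (\<lambda>k. F (r k) x) \<longlonglongrightarrow> G x"
    using conv by eventually_elim (simp add: G_def convergent_LIMSEQ_iff)
  have r_incr: "r k \<le> r m" if "k \<le> m" for k m
    using lift_Suc_mono_le[of r, OF r_mono that] .
  have est: "(\<integral>\<^sup>+x. ennreal ((norm (F n x - G x))\<^sup>2) \<partial>lebesgue) \<le> ennreal (((1/2) ^ k)\<^sup>2)"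
    if n: "n \<ge> N k" for n k
  proof -
    have "(\<integral>\<^sup>+x. ennreal ((norm (F n x - G x))\<^sup>2) \<partial>lebesgue)
        = (\<integral>\<^sup>+x. liminf (\<lambda>m. ennreal ((norm (F n x - F (r m) x))\<^sup>2)) \<partial>lebesgue)"
    proof (rule nn_integral_cong_AE, use G_lim in eventually_elim)
      fix x assume "(\<lambda>k. F (r k) x) \<longlonglongrightarrow> G x"
      then have "(\<lambda>m. ennreal ((norm (F n x - F (r m) x))\<^sup>2)) \<longlonglongrightarrow> ennreal ((norm (F n x - G x))\<^sup>2)"
        by (intro tendsto_ennrealI tendsto_intros)
      then show "ennreal ((norm (F n x - G x))\<^sup>2) = liminf (\<lambda>m. ennreal ((norm (F n x - F (r m) x))\<^sup>2))"
        by (rule lim_imp_Liminf[OF sequentially_bot, symmetric])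
    qed
    also have "\<dots> \<le> liminf (\<lambda>m. \<integral>\<^sup>+x. ennreal ((norm (F n x - F (r m) x))\<^sup>2) \<partial>lebesgue)"
      by (rule nn_integral_liminf) measurable
    also have "\<dots> \<le> limsup (\<lambda>m. \<integral>\<^sup>+x. ennreal ((norm (F n x - F (r m) x))\<^sup>2) \<partial>lebesgue)"
      by (rule Liminf_le_Limsup) simp
    also have "\<dots> \<le> ennreal (((1/2) ^ k)\<^sup>2)"
    proof (rule Limsup_bounded, rule eventually_sequentiallyI)
      fix m assume "k \<le> m"
      then have "N k \<le> r m" using r_ge[of k] r_incr[of k m] by simp
      then have "dist (X n) (X (r m)) < (1/2) ^ k" using n by (intro N)
      then show "(\<integral>\<^sup>+x. ennreal ((norm (F n x - F (r m) x))\<^sup>2) \<partial>lebesgue) \<le> ennreal (((1/2) ^ k)\<^sup>2)"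
        by (subst dist_L2_nn_integral) (auto simp: F intro!: ennreal_leI power_mono)
    qed
    finally show ?thesis .
  qed
  have sqd: "square_integrable (\<lambda>x. F (N 0) x - G x)"
    unfolding square_integrable_def
  proof (intro conjI integrableI_nonneg)
    show "(\<integral>\<^sup>+x. ennreal ((norm (F (N 0) x - G x))\<^sup>2) \<partial>lebesgue) < \<infinity>"
      using est[of 0 "N 0"] by (auto intro: le_less_trans)
  qed auto
  have G: "square_integrable G"
    using square_integrable_diff[OF F(1)[of "N 0"] sqd] by simp
  have "X \<longlonglongrightarrow> abs_L2 G"
  proof (rule metric_LIMSEQ_I)
    fix e :: real assume "e > 0"
    then obtain k where k: "(1/2) ^ k < e"
      using real_arch_pow_inv[of e "1/2"] by auto
    have "dist (X n) (abs_L2 G) < e" if "n \<ge> N k" for n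
    proof -
      have "ennreal ((dist (X n) (abs_L2 G))\<^sup>2) \<le> ennreal (((1/2) ^ k)\<^sup>2)"
        using est[OF that] by (subst (asm) dist_L2_nn_integral) (simp_all add: F G)
      then have "dist (X n) (abs_L2 G) \<le> (1/2) ^ k"
        by (subst (asm) ennreal_le_iff) (auto dest: power2_le_imp_le)
      with k show ?thesis by simp
    qed
    then show "\<exists>no. \<forall>n\<ge>no. dist (X n) (abs_L2 G) < e" by blast
  qed
  then show "convergent X" by (rule convergentI)
qed

lemma second_countable_of_dense:
  fixes R :: "'c::metric_space set"
  assumes "countable R" "closure R = UNIV"
  shows "\<exists>B::'c set set. countable B \<and> open = generate_topology B"
proof -
  define B where "B = (\<lambda>(x, n). ball x (1 / real (Suc n))) ` (R \<times> (UNIV :: nat set))"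
  have "countable B"
    unfolding B_def using assms(1) by (intro countable_image countable_SIGMA) auto
  moreover have "topological_basis B"
  proof (rule topological_basisI)
    fix A assume "A \<in> B"
    then show "open A" by (auto simp: B_def)
  next
    fix S :: "'c set" and x assume "open S" "x \<in> S"
    then obtain e where e: "e > 0" "ball x e \<subseteq> S" by (meson openE)
    obtain n where n: "1 / real (Suc n) < e / 2"
      using e(1) reals_Archimedean[of "e / 2"] by (auto simp: inverse_eq_divide)
    have "x \<in> closure R" using assms(2) by simp
    then obtain y where y: "y \<in> R" "dist y x < 1 / real (Suc n)"
      unfolding closure_approachable by (metis of_nat_0_less_iff zero_less_Suc zero_less_divide_1_iff)
    have "ball y (1 / real (Suc n)) \<subseteq> S"
    proof
      fix z assume "z \<in> ball y (1 / real (Suc n))"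
      then have "dist x z < e"
        using y(2) n dist_triangle[of x z y] by (simp add: dist_commute)
      then show "z \<in> S" using e(2) by auto
    qed
    moreover have "ball y (1 / real (Suc n)) \<in> B"
      unfolding B_def using y(1) by force
    moreover have "x \<in> ball y (1 / real (Suc n))"
      using y(2) by simp
    ultimately show "\<exists>A\<in>B. x \<in> A \<and> A \<subseteq> S" by blast
  qed
  ultimately show ?thesis
    using topological_basis_imp_subbasis by blast
qed

lemma subspace_closure_span: "subspace (closure (span S))"
  for S :: "'c::real_normed_vector set"
  unfolding subspace_def
proof (intro conjI ballI allI)
  show "0 \<in> closure (span S)"
    using closure_subset span_zero by blast
next
  fix x y assume "x \<in> closure (span S)" "y \<in> closure (span S)"
  then obtain f g where f: "\<And>n. f n \<in> span S" "f \<longlonglongrightarrow> x" and g: "\<And>n. g n \<in> span S" "g \<longlonglongrightarrow> y"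
    unfolding closure_sequential by blast
  then have "(\<forall>n. f n + g n \<in> span S) \<and> (\<lambda>n. f n + g n) \<longlonglongrightarrow> x + y"
    by (auto intro: tendsto_add span_add)
  then show "x + y \<in> closure (span S)"
    unfolding closure_sequential by fast
next
  fix c x assume "x \<in> closure (span S)"
  then obtain f where f: "\<And>n. f n \<in> span S" "f \<longlonglongrightarrow> x"
    unfolding closure_sequential by blast
  then have "(\<forall>n. c *\<^sub>R f n \<in> span S) \<and> (\<lambda>n. c *\<^sub>R f n) \<longlonglongrightarrow> c *\<^sub>R x"
    by (auto intro: tendsto_intros span_mul)
  then show "c *\<^sub>R x \<in> closure (span S)"
    unfolding closure_sequential by fast
qed

lemma countable_dense_of_span:
  fixes C :: "'c::real_normed_vector set"
  assumes "countable C" "closure (span C) = UNIV"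
  obtains R :: "'c set" where "countable R" "closure R = UNIV"
proof -
  define S :: "(real \<times> 'c) list \<Rightarrow> 'c" where "S = (\<lambda>xs. \<Sum>(q, c)\<leftarrow>xs. q *\<^sub>R c)"
  define R where "R = S ` lists ((\<rat>::real set) \<times> C)"
  have S_app: "S (xs @ ys) = S xs + S ys" for xs ys
    by (simp add: S_def)
  have "countable R"
    unfolding R_def using assms(1)
    by (intro countable_image countable_lists countable_SIGMA countable_rat)
  moreover have "span C \<subseteq> closure R"
  proof
    fix x assume "x \<in> span C"
    then show "x \<in> closure R"
    proof (induction rule: span_induct_alt)
      case base
      have "S [] \<in> R" unfolding R_def by (intro imageI) simp
      then show ?case using closure_subset by (auto simp: S_def)
    next
      case (step c x y)
      from step.IH obtain f where f: "\<And>n. f n \<in> R" "f \<longlonglongrightarrow> y"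
        unfolding closure_sequential by blast
      have "c \<in> closure (\<rat> :: real set)"
        by (simp add: Rats_closure_real)
      then obtain q where q: "\<And>n. q n \<in> \<rat>" "q \<longlonglongrightarrow> c"
        unfolding closure_sequential by blast
      have "q n *\<^sub>R x + f n \<in> R" for n
      proof -
        obtain xs where xs: "xs \<in> lists (\<rat> \<times> C)" "f n = S xs"
          using f(1)[of n] unfolding R_def by blast
        have "q n *\<^sub>R x + f n = S ((q n, x) # xs)"
          using xs(2) by (simp add: S_def)
        moreover have "(q n, x) # xs \<in> lists (\<rat> \<times> C)"
          using xs(1) q(1)[of n] step.hyps by auto
        ultimately show ?thesis unfolding R_def by blast
      qed
      moreover have "(\<lambda>n. q n *\<^sub>R x + f n) \<longlonglongrightarrow> c *\<^sub>R x + y"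
        by (intro tendsto_intros q f)
      ultimately have "(\<forall>n. q n *\<^sub>R x + f n \<in> R) \<and> (\<lambda>n. q n *\<^sub>R x + f n) \<longlonglongrightarrow> c *\<^sub>R x + y"
        by blast
      then show ?case
        unfolding closure_sequential by fast
    qed
  qed
  then have "closure (span C) \<subseteq> closure R"
    by (simp add: closure_minimal)
  with assms(2) have "closure R = UNIV" by auto
  ultimately show ?thesis using that by blast
qed

lemma square_integrable_indicator:
  "A \<in> lmeasurable \<Longrightarrow> square_integrable (\<lambda>x. indicat_real A x *\<^sub>R y)"
proof -
  assume A: "A \<in> lmeasurable"
  have "(norm (indicat_real A x *\<^sub>R y))\<^sup>2 = indicat_real A x * (norm y)\<^sup>2" for x
    by (simp add: indicator_def)
  moreover have "integrable lebesgue (\<lambda>x. indicat_real A x * (norm y)\<^sup>2)"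
    using A by (auto simp: fmeasurable_def intro!: integrable_real_indicator)
  ultimately show ?thesis
    using A by (auto simp: square_integrable_def fmeasurable_def intro!: borel_measurable_scaleR)
qed

lemma dist_L2_indicator:
  assumes "A \<in> lmeasurable" "U \<in> lmeasurable" "A \<subseteq> U" "norm y = 1"
  shows "(dist (abs_L2 (\<lambda>x. indicat_real U x *\<^sub>R y)) (abs_L2 (\<lambda>x. indicat_real A x *\<^sub>R y)))\<^sup>2
    = measure lebesgue (U - A)"
proof -
  have "(norm (indicat_real U x *\<^sub>R y - indicat_real A x *\<^sub>R y))\<^sup>2 = indicat_real (U - A) x" for x
    using assms(3,4) by (auto simp: indicator_def)
  then show ?thesis
    using assms(1,2) by (simp add: dist_abs_L2_sq square_integrable_indicator)
qed

instance L2 :: (euclidean_space, euclidean_space) second_countable_topology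
proof
  obtain \<B> :: "'a set set" where \<B>: "countable \<B>" "topological_basis \<B>"
    using ex_countable_basis by blast
  define \<U> where "\<U> = {\<Union>F |F. finite F \<and> F \<subseteq> \<B>} \<inter> lmeasurable"
  define C :: "('a, 'b) L2 set" where
    "C = (\<lambda>(U, b). abs_L2 (\<lambda>x. indicat_real U x *\<^sub>R b)) ` (\<U> \<times> Basis)"
  define W where "W = closure (span C)"
  have W: "subspace W"
    unfolding W_def by (rule subspace_closure_span)
  have W_closed: "closed W" by (simp add: W_def)
  have "countable \<U>"
  proof -
    have "{\<Union>F |F. finite F \<and> F \<subseteq> \<B>} = Union ` {F. finite F \<and> F \<subseteq> \<B>}" by blast
    then show ?thesis
      unfolding \<U>_def using countable_Collect_finite_subset[OF \<B>(1)] by (metis countable_Int1 countable_image)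
  qed
  then have "countable C"
    unfolding C_def by (intro countable_image countable_SIGMA) (auto intro: countable_finite)
  have W1: "abs_L2 (\<lambda>x. indicat_real U x *\<^sub>R b) \<in> W" if "open U" "U \<in> lmeasurable" "b \<in> Basis" for U b
  proof -
    obtain B' where B': "B' \<subseteq> \<B>" "\<Union>B' = U"
      using \<B>(2) \<open>open U\<close> unfolding topological_basis_def by blast
    have cB': "countable B'" using B'(1) \<B>(1) countable_subset by blast
    obtain G :: "nat \<Rightarrow> 'a set" where G: "B' \<union> {{}} = range G"
      using cB' uncountable_def[of "B' \<union> {{}}"] by auto
    define V where "V n = (\<Union>k<n. G k) " for n
    have Gopen: "open (G k)" for k
    proof -
      have "G k \<in> B' \<union> {{}}" using G by blast
      then show ?thesis using B'(1) \<B>(2) topological_basis_open by auto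
    qed
    have Vopen: "open (V n)" for n unfolding V_def using Gopen by blast
    have VU: "(\<Union>n. V n) = U"
    proof -
      have "(\<Union>n. V n) = (\<Union>k. G k)" unfolding V_def by blast
      also have "\<dots> = \<Union>(B' \<union> {{}})" unfolding G by blast
      also have "\<dots> = U" using B'(2) by auto
      finally show ?thesis .
    qed
    have V_sub: "V n \<subseteq> U" for n using VU by blast
    have V_sets: "V n \<in> sets lebesgue" for n
      using borel_open[OF Vopen] by (rule sets_completionI_sets[of _ lborel, unfolded sets_lborel])
    have V_lm: "V n \<in> lmeasurable" for n
      by (rule fmeasurableI2[OF \<open>U \<in> lmeasurable\<close> V_sub V_sets])
    have V_U: "V n \<in> \<U>" for n
    proof -
      have "V n = \<Union>((G ` {..<n}) - {{}})" unfolding V_def by auto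
      moreover have "(G ` {..<n}) - {{}} \<subseteq> \<B>" using G B'(1) by auto
      ultimately show ?thesis unfolding \<U>_def using V_lm by blast
    qed
    have V_inc: "incseq V" unfolding V_def incseq_def by (auto intro: less_le_trans)
    have VC: "abs_L2 (\<lambda>x. indicat_real (V n) x *\<^sub>R b) \<in> span C" for n
      using V_U[of n] \<open>b \<in> Basis\<close> unfolding C_def by (intro span_base) force
    have "(\<lambda>n. measure lebesgue (V n)) \<longlonglongrightarrow> measure lebesgue (\<Union>n. V n)"
    proof (rule Lim_measure_incseq[OF _ V_inc])
      show "range V \<subseteq> sets lebesgue" using V_sets by blast
      show "emeasure lebesgue (\<Union>n. V n) \<noteq> \<infinity>"
        unfolding VU using \<open>U \<in> lmeasurable\<close> by (auto simp: fmeasurable_def)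
    qed
    then have "(\<lambda>n. measure lebesgue U - measure lebesgue (V n)) \<longlonglongrightarrow> 0"
      unfolding VU by (auto intro: tendsto_eq_intros)
    moreover have "measure lebesgue (U - V n) = measure lebesgue U - measure lebesgue (V n)" for n
      by (rule measurable_measure_Diff[OF \<open>U \<in> lmeasurable\<close> V_sets V_sub])
    ultimately have "(\<lambda>n. measure lebesgue (U - V n)) \<longlonglongrightarrow> 0" by simp
    moreover have "measure lebesgue (U - V n) =
        (dist (abs_L2 (\<lambda>x. indicat_real U x *\<^sub>R b)) (abs_L2 (\<lambda>x. indicat_real (V n) x *\<^sub>R b)))\<^sup>2" for n
      by (rule dist_L2_indicator[OF V_lm \<open>U \<in> lmeasurable\<close> V_sub norm_Basis[OF \<open>b \<in> Basis\<close>], symmetric])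
    ultimately have "(\<lambda>n. (dist (abs_L2 (\<lambda>x. indicat_real U x *\<^sub>R b)) (abs_L2 (\<lambda>x. indicat_real (V n) x *\<^sub>R b)))\<^sup>2) \<longlonglongrightarrow> 0"
      by simp
    from tendsto_real_sqrt[OF this]
    have "(\<lambda>n. dist (abs_L2 (\<lambda>x. indicat_real (V n) x *\<^sub>R b)) (abs_L2 (\<lambda>x. indicat_real U x *\<^sub>R b))) \<longlonglongrightarrow> 0"
      by (simp add: dist_commute)
    then have "(\<lambda>n. abs_L2 (\<lambda>x. indicat_real (V n) x *\<^sub>R b)) \<longlonglongrightarrow> abs_L2 (\<lambda>x. indicat_real U x *\<^sub>R b)"
      by (rule iffD2[OF tendsto_dist_iff])
    with VC have "(\<forall>n. abs_L2 (\<lambda>x. indicat_real (V n) x *\<^sub>R b) \<in> span C) \<and>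
        (\<lambda>n. abs_L2 (\<lambda>x. indicat_real (V n) x *\<^sub>R b)) \<longlonglongrightarrow> abs_L2 (\<lambda>x. indicat_real U x *\<^sub>R b)"
      by blast
    then show ?thesis
      unfolding W_def closure_sequential by fast
  qed
  have W2: "abs_L2 (\<lambda>x. indicat_real A x *\<^sub>R b) \<in> W" if "A \<in> lmeasurable" "b \<in> Basis" for A b
  proof -
    have "\<exists>w\<in>W. dist w (abs_L2 (\<lambda>x. indicat_real A x *\<^sub>R b)) < e" if "e > 0" for e :: real
    proof -
      have A: "A \<in> sets lebesgue" using \<open>A \<in> lmeasurable\<close> by (simp add: fmeasurableD)
      obtain T where T: "open T" "A \<subseteq> T" "T - A \<in> lmeasurable" "emeasure lebesgue (T - A) < ennreal (e\<^sup>2)"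
        using sets_lebesgue_outer_open[OF A, of "e\<^sup>2"] \<open>e > 0\<close> by auto
      have "T = A \<union> (T - A)" using T(2) by blast
      then have Tl: "T \<in> lmeasurable"
        using fmeasurable.Un[OF \<open>A \<in> lmeasurable\<close> T(3)] by simp
      have "measure lebesgue (T - A) < e\<^sup>2"
        using T(3,4) by (simp add: emeasure_eq_measure2 ennreal_less_iff)
      then have "(dist (abs_L2 (\<lambda>x. indicat_real T x *\<^sub>R b)) (abs_L2 (\<lambda>x. indicat_real A x *\<^sub>R b)))\<^sup>2 < e\<^sup>2"
        using T(2) Tl \<open>A \<in> lmeasurable\<close> \<open>b \<in> Basis\<close> by (subst dist_L2_indicator) auto
      then have "dist (abs_L2 (\<lambda>x. indicat_real T x *\<^sub>R b)) (abs_L2 (\<lambda>x. indicat_real A x *\<^sub>R b)) < e"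
        using \<open>e > 0\<close> by (intro power2_less_imp_less[of _ e]) auto
      with W1[OF T(1) Tl \<open>b \<in> Basis\<close>] show ?thesis by blast
    qed
    then have "abs_L2 (\<lambda>x. indicat_real A x *\<^sub>R b) \<in> closure W"
      by (simp add: closure_approachable)
    then show ?thesis using W_closed by simp
  qed
  have W3: "abs_L2 (\<lambda>x. indicat_real A x *\<^sub>R y) \<in> W" if A: "A \<in> lmeasurable" for A y
  proof -
    have fin: "square_integrable (\<lambda>x. \<Sum>b\<in>F. indicat_real A x *\<^sub>R ((y \<bullet> b) *\<^sub>R b)) \<and>
        abs_L2 (\<lambda>x. \<Sum>b\<in>F. indicat_real A x *\<^sub>R ((y \<bullet> b) *\<^sub>R b)) \<in> W"
      if "finite F" "F \<subseteq> Basis" for F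
      using that
    proof (induction F rule: finite_induct)
      case empty
      have "abs_L2 (\<lambda>x. 0) = (0 :: ('a, 'b) L2)" by (simp add: zero_L2_def)
      then show ?case using W by (simp add: square_integrable_zero subspace_0)
    next
      case (insert b F)
      have sq: "square_integrable (\<lambda>x. indicat_real A x *\<^sub>R b)"
        using A by (rule square_integrable_indicator)
      have "(y \<bullet> b) *\<^sub>R abs_L2 (\<lambda>x. indicat_real A x *\<^sub>R b) \<in> W"
        using W W2[OF A, of b] insert.prems by (intro subspace_scale) auto
      then have 1: "abs_L2 (\<lambda>x. indicat_real A x *\<^sub>R ((y \<bullet> b) *\<^sub>R b)) \<in> W"
        by (simp add: abs_L2_scaleR[OF sq] mult.commute)
      have 2: "square_integrable (\<lambda>x. indicat_real A x *\<^sub>R ((y \<bullet> b) *\<^sub>R b))"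
        using A by (rule square_integrable_indicator)
      have 3: "square_integrable (\<lambda>x. \<Sum>b\<in>F. indicat_real A x *\<^sub>R ((y \<bullet> b) *\<^sub>R b))"
        "abs_L2 (\<lambda>x. \<Sum>b\<in>F. indicat_real A x *\<^sub>R ((y \<bullet> b) *\<^sub>R b)) \<in> W"
        using insert by auto
      show ?case
        using square_integrable_add[OF 2 3(1)] subspace_add[OF W 1 3(2)] insert.hyps
        by (simp only: abs_L2_add[OF 2 3(1)] sum.insert not_False_eq_True simp_thms)
    qed
    have "(\<Sum>b\<in>Basis. indicat_real A x *\<^sub>R ((y \<bullet> b) *\<^sub>R b)) = indicat_real A x *\<^sub>R y" for x
      by (simp only: scaleR_sum_right[symmetric] euclidean_representation)
    then show ?thesis using fin[of Basis] by simp
  qed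
  have W4: "square_integrable f \<and> abs_L2 f \<in> W"
    if "simple_function lebesgue f" "emeasure lebesgue {y \<in> space lebesgue. f y \<noteq> 0} \<noteq> \<infinity>" for f :: "'a \<Rightarrow> 'b"
    using that
  proof (induction rule: integrable_simple_function_induct)
    case (cong f g)
    then have "f = g" by auto
    with cong show ?case by simp
  next
    case (indicator A y)
    then have "A \<in> lmeasurable" by (simp add: fmeasurable_def)
    then show ?case using W3 square_integrable_indicator by blast
  next
    case (add f g)
    then show ?case
      using square_integrable_add[of f g] subspace_add[OF W, of "abs_L2 f" "abs_L2 g"]
      by (simp add: abs_L2_add)
  qed
  have W5: "v \<in> W" for v
  proof -
    define f where "f = rep_L2 v"
    have f: "square_integrable f" "v = abs_L2 f"
      by (simp_all add: f_def square_integrable_rep abs_rep_L2)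
    then have f_meas[measurable]: "f \<in> borel_measurable lebesgue" by (simp add: square_integrable_def)
    obtain s where s: "\<And>i. simple_function lebesgue (s i)" "\<And>x. (\<lambda>i. s i x) \<longlonglongrightarrow> f x"
      "\<And>i x. norm (s i x) \<le> 2 * norm (f x)"
      using borel_measurable_implies_sequence_metric[OF f_meas, of 0] by auto
    have s_meas[measurable]: "s i \<in> borel_measurable lebesgue" for i
      using s(1) by (rule borel_measurable_simple_function)
    have s_sq: "integrable lebesgue (\<lambda>x. (norm (s i x))\<^sup>2)" for i
    proof (rule Bochner_Integration.integrable_bound)
      show "integrable lebesgue (\<lambda>x. 4 * (norm (f x))\<^sup>2)"
        using f(1) by (simp add: square_integrable_def)
      show "AE x in lebesgue. norm ((norm (s i x))\<^sup>2) \<le> norm (4 * (norm (f x))\<^sup>2)"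
        using power_mono[OF s(3), of _ _ 2] by (simp add: power_mult_distrib)
    qed measurable
    have s_sup: "emeasure lebesgue {y \<in> space lebesgue. s i y \<noteq> 0} \<noteq> \<infinity>" for i
    proof -
      have "emeasure lebesgue {y \<in> space lebesgue. ennreal ((norm (s i y))\<^sup>2) \<noteq> 0} \<noteq> \<infinity>"
      proof (rule simple_function_finite_support)
        show "simple_function lebesgue (\<lambda>x. ennreal ((norm (s i x))\<^sup>2))"
          using simple_function_compose1[OF s(1), of "\<lambda>z. ennreal ((norm z)\<^sup>2)"] .
        show "(\<integral>\<^sup>+x. ennreal ((norm (s i x))\<^sup>2) \<partial>lebesgue) < \<infinity>"
          using s_sq[of i] by (simp add: integrable_iff_bounded)
      qed simp
      then show ?thesis by simp
    qed
    have sW: "square_integrable (s i)" "abs_L2 (s i) \<in> W" for i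
      using W4[OF s(1) s_sup] by auto
    have "(\<lambda>i. \<integral>x. (norm (s i x - f x))\<^sup>2 \<partial>lebesgue) \<longlonglongrightarrow> (\<integral>x. (0::real) \<partial>(lebesgue :: 'a measure))"
    proof (rule integral_dominated_convergence)
      show "integrable lebesgue (\<lambda>x. 9 * (norm (f x))\<^sup>2)"
        using f(1) by (simp add: square_integrable_def)
      have "(\<lambda>i. (norm (s i x - f x))\<^sup>2) \<longlonglongrightarrow> (norm (f x - f x))\<^sup>2" for x
        by (intro tendsto_intros s(2))
      then show "AE x in lebesgue. (\<lambda>i. (norm (s i x - f x))\<^sup>2) \<longlonglongrightarrow> 0"
        by simp
      have "norm (s i x - f x) \<le> 3 * norm (f x)" for i x
        using norm_triangle_ineq4[of "s i x" "f x"] s(3)[of i x] by linarith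
      then have "(norm (s i x - f x))\<^sup>2 \<le> (3 * norm (f x))\<^sup>2" for i x
        by (rule power_mono) simp
      then show "AE x in lebesgue. norm ((norm (s i x - f x))\<^sup>2) \<le> 9 * (norm (f x))\<^sup>2" for i
        by (simp add: power_mult_distrib)
    qed measurable
    then have "(\<lambda>i. (dist (abs_L2 (s i)) v)\<^sup>2) \<longlonglongrightarrow> 0"
      using f sW(1) by (simp add: dist_abs_L2_sq)
    from tendsto_real_sqrt[OF this] have "(\<lambda>i. dist (abs_L2 (s i)) v) \<longlonglongrightarrow> 0"
      by simp
    then have "(\<lambda>i. abs_L2 (s i)) \<longlonglongrightarrow> v"
      by (rule iffD2[OF tendsto_dist_iff])
    then show ?thesis
      by (rule closed_sequentially[OF W_closed sW(2)])
  qed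
  then have "closure (span C) = UNIV" unfolding W_def by blast
  then obtain R :: "('a, 'b) L2 set" where "countable R" "closure R = UNIV"
    using countable_dense_of_span[OF \<open>countable C\<close>] by blast
  then show "\<exists>B::('a, 'b) L2 set set. countable B \<and> open = generate_topology B"
    by (rule second_countable_of_dense)
qed

instance L2 :: (euclidean_space, euclidean_space) polish_space ..

section \<open>Domains and function spaces\<close>

text \<open>
  Near every boundary point, and for a suitable direction \<^term>\<open>e\<close> playing the role of the
  vertical axis, \<^term>\<open>D\<close> is the part above the graph of a Lipschitz function of the
  remaining coordinates, which are represented by the orthogonal projection to the
  hyperplane \<open>e\<^sup>\<bottom>\<close>.
\<close>

definition bounded_Lipschitz_domain :: "'a::euclidean_space set \<Rightarrow> bool" where
  "bounded_Lipschitz_domain D \<longleftrightarrow>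
    D \<noteq> {} \<and> open D \<and> connected D \<and> bounded D \<and>
    (\<forall>x0\<in>frontier D. \<exists>r>0. \<exists>e. \<exists>L. \<exists>g :: 'a \<Rightarrow> real.
       norm e = 1 \<and> L-lipschitz_on {z. z \<bullet> e = 0} g \<and>
       D \<inter> ball x0 r = {x \<in> ball x0 r. g (x - (x \<bullet> e) *\<^sub>R e) < x \<bullet> e})"

definition Linf :: "'a::euclidean_space set \<Rightarrow> ('a \<Rightarrow> real) set" where
  "Linf D = {g \<in> borel_measurable (lebesgue_on D). esssup (lebesgue_on D) (\<lambda>x. ennreal \<bar>g x\<bar>) < \<infinity>}"

definition Linf_norm :: "'a::euclidean_space set \<Rightarrow> ('a \<Rightarrow> real) \<Rightarrow> real" where
  "Linf_norm D g = enn2real (esssup (lebesgue_on D) (\<lambda>x. ennreal \<bar>g x\<bar>))"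

definition Linf_sums :: "'a::euclidean_space set \<Rightarrow> (nat \<Rightarrow> 'a \<Rightarrow> real) \<Rightarrow> ('a \<Rightarrow> real) \<Rightarrow> bool" where
  "Linf_sums D g b \<longleftrightarrow> b \<in> Linf D \<and> (\<lambda>n. Linf_norm D (\<lambda>x. b x - (\<Sum>j<n. g j x))) \<longlonglongrightarrow> 0"

primrec Ck :: "nat \<Rightarrow> ('a::euclidean_space \<Rightarrow> real) \<Rightarrow> bool" where
  "Ck 0 \<phi> \<longleftrightarrow> continuous_on UNIV \<phi>"
| "Ck (Suc k) \<phi> \<longleftrightarrow>
    (\<forall>x. \<phi> differentiable (at x)) \<and> (\<forall>i\<in>Basis. Ck k (\<lambda>x. frechet_derivative \<phi> (at x) i))"

definition grad :: "('a::euclidean_space \<Rightarrow> real) \<Rightarrow> 'a \<Rightarrow> 'a" where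
  "grad \<phi> x = (\<Sum>i\<in>Basis. frechet_derivative \<phi> (at x) i *\<^sub>R i)"

text \<open>\<open>C\<^sub>c\<^sup>\<infinity>(D)\<close>, extended by zero to the whole space.\<close>

definition test_functions :: "'a::euclidean_space set \<Rightarrow> ('a \<Rightarrow> real) set" where
  "test_functions D = {\<phi>. (\<forall>k. Ck k \<phi>) \<and>
     compact (closure {x. \<phi> x \<noteq> 0}) \<and> closure {x. \<phi> x \<noteq> 0} \<subseteq> D}"

text \<open>
  An element of \<open>H\<^sup>1\<close> is represented by the pair \<open>(v, \<nabla>v)\<close> of \<open>L\<^sup>2\<close> functions, extended by zero
  outside \<^term>\<open>D\<close>.  The norm of the product type is then the full \<open>H\<^sup>1\<close> norm, and \<open>H\<^sup>1\<^sub>0(D)\<close> is the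
  closure of the test functions in it.  \<open>V_norm\<close> is the gradient norm, equivalent to the product
  norm on \<open>H10 D\<close> for bounded \<^term>\<open>D\<close> by the Poincare inequality; hence
  measurability and Bochner integrals of \<open>V\<close>-valued maps can be taken in the product type.
\<close>

type_synonym 'a H1 = "('a, real) L2 \<times> ('a, 'a) L2"

definition H10 :: "'a::euclidean_space set \<Rightarrow> 'a H1 set" where
  "H10 D = closure ((\<lambda>\<phi>. (abs_L2 \<phi>, abs_L2 (grad \<phi>))) ` test_functions D)"

definition weak_grad :: "'a::euclidean_space H1 \<Rightarrow> 'a \<Rightarrow> 'a" where
  "weak_grad v = rep_L2 (snd v)"

definition V_norm :: "'a::euclidean_space H1 \<Rightarrow> real" where
  "V_norm v = norm (snd v)"

definition Hminus1 :: "'a::euclidean_space set \<Rightarrow> ('a H1 \<Rightarrow> real) set" where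
  "Hminus1 D = {f.
     (\<forall>v\<in>H10 D. \<forall>w\<in>H10 D. f (v + w) = f v + f w) \<and>
     (\<forall>c. \<forall>v\<in>H10 D. f (c *\<^sub>R v) = c * f v) \<and>
     (\<exists>K. \<forall>v\<in>H10 D. \<bar>f v\<bar> \<le> K * V_norm v)}"

section \<open>The parametric elliptic problem\<close>

definition weak_solution ::
    "'a::euclidean_space set \<Rightarrow> ('a \<Rightarrow> real) \<Rightarrow> ('a H1 \<Rightarrow> real) \<Rightarrow> 'a H1 \<Rightarrow> bool" where
  "weak_solution D a f u \<longleftrightarrow> u \<in> H10 D \<and>
    (\<forall>v\<in>H10 D. (\<integral>x. a x * (weak_grad u x \<bullet> weak_grad v x) \<partial>lebesgue_on D) = f v)"

text \<open>The parameter sequences are indexed from 0.\<close>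

definition coeff_converges :: "'a::euclidean_space set \<Rightarrow> (nat \<Rightarrow> 'a \<Rightarrow> real) \<Rightarrow> (nat \<Rightarrow> real) \<Rightarrow> bool" where
  "coeff_converges D \<psi> y \<longleftrightarrow> (\<exists>b. Linf_sums D (\<lambda>j x. y j * \<psi> j x) b)"

text \<open>The \<open>L\<^sup>\<infinity>\<close> limit is determined up to null sets; \<open>log_coeff\<close> picks a representative.\<close>

definition log_coeff :: "'a::euclidean_space set \<Rightarrow> (nat \<Rightarrow> 'a \<Rightarrow> real) \<Rightarrow> (nat \<Rightarrow> real) \<Rightarrow> 'a \<Rightarrow> real" where
  "log_coeff D \<psi> y = (SOME b. Linf_sums D (\<lambda>j x. y j * \<psi> j x) b)"

definition diffusion_coeff :: "'a::euclidean_space set \<Rightarrow> (nat \<Rightarrow> 'a \<Rightarrow> real) \<Rightarrow> (nat \<Rightarrow> real) \<Rightarrow> 'a \<Rightarrow> real" where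
  "diffusion_coeff D \<psi> y x = exp (log_coeff D \<psi> y x)"

definition solution ::
    "'a::euclidean_space set \<Rightarrow> (nat \<Rightarrow> 'a \<Rightarrow> real) \<Rightarrow> ('a H1 \<Rightarrow> real) \<Rightarrow> (nat \<Rightarrow> real) \<Rightarrow> 'a H1" where
  "solution D \<psi> f y =
    (if coeff_converges D \<psi> y then THE u. weak_solution D (diffusion_coeff D \<psi> y) f u else 0)"

section \<open>Hermite expansions\<close>

definition gauss :: "(nat \<Rightarrow> real) measure" where
  "gauss = (\<Pi>\<^sub>M j\<in>UNIV. density lborel (\<lambda>t. ennreal (std_normal_density t)))"

definition hermite :: "nat \<Rightarrow> real \<Rightarrow> real" where
  "hermite k t = (-1) ^ k / sqrt (fact k) * ((deriv ^^ k) std_normal_density t / std_normal_density t)"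

definition multi_indices :: "(nat \<Rightarrow> nat) set" where
  "multi_indices = {\<nu>. finite {j. \<nu> j \<noteq> 0}}"

text \<open>All factors with \<open>\<nu> j = 0\<close> equal 1.\<close>

definition hermite_prod :: "(nat \<Rightarrow> nat) \<Rightarrow> (nat \<Rightarrow> real) \<Rightarrow> real" where
  "hermite_prod \<nu> y = (\<Prod>j | \<nu> j \<noteq> 0. hermite (\<nu> j) (y j))"

definition hermite_coeff ::
    "'a::euclidean_space set \<Rightarrow> (nat \<Rightarrow> 'a \<Rightarrow> real) \<Rightarrow> ('a H1 \<Rightarrow> real) \<Rightarrow> (nat \<Rightarrow> nat) \<Rightarrow> 'a H1" where
  "hermite_coeff D \<psi> f \<nu> = (\<integral>y. hermite_prod \<nu> y *\<^sub>R solution D \<psi> f y \<partial>gauss)"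

definition hermite_partial_sum ::
    "'a::euclidean_space set \<Rightarrow> (nat \<Rightarrow> 'a \<Rightarrow> real) \<Rightarrow> ('a H1 \<Rightarrow> real) \<Rightarrow>
     (nat \<Rightarrow> nat) set \<Rightarrow> (nat \<Rightarrow> real) \<Rightarrow> 'a H1" where
  "hermite_partial_sum D \<psi> f \<Lambda> y = (\<Sum>\<nu>\<in>\<Lambda>. hermite_prod \<nu> y *\<^sub>R hermite_coeff D \<psi> f \<nu>)"

definition L2_V :: "'a::euclidean_space set \<Rightarrow> ((nat \<Rightarrow> real) \<Rightarrow> 'a H1) set" where
  "L2_V D = {g \<in> borel_measurable gauss.
     (AE y in gauss. g y \<in> H10 D) \<and> integrable gauss (\<lambda>y. (V_norm (g y))\<^sup>2)}"

definition L2_V_norm :: "((nat \<Rightarrow> real) \<Rightarrow> 'a::euclidean_space H1) \<Rightarrow> real" where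
  "L2_V_norm g = sqrt (\<integral>y. (V_norm (g y))\<^sup>2 \<partial>gauss)"

definition n_largest :: "'i set \<Rightarrow> ('i \<Rightarrow> real) \<Rightarrow> nat \<Rightarrow> 'i set \<Rightarrow> bool" where
  "n_largest I c n \<Lambda> \<longleftrightarrow> \<Lambda> \<subseteq> I \<and> finite \<Lambda> \<and> card \<Lambda> = n \<and> (\<forall>\<nu>\<in>\<Lambda>. \<forall>\<mu>\<in>I - \<Lambda>. c \<mu> \<le> c \<nu>)"

end

theory Submission
  imports Defs
begin

text \<open>
  Shifting the Gaussian measure turns finite differences of \<open>u\<close> in the parameters into adjoint
  differences of Hermite polynomials. As the step size tends to \<open>0\<close> the latter converge to
  \<open>\<surd>(\<nu>!/\<kappa>!) H\<^sub>\<nu>\<close>, where \<open>\<mu> = \<nu> - \<kappa>\<close> is the order of the difference, so no derivative of \<open>u\<close> is ever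
  needed. In the energy norm the mixed differences of \<open>u\<close> satisfy a discrete Leibniz recursion that
  bounds them by \<open>|\<mu>|! 2\<^bsup>|\<mu>|\<^esup> \<beta>\<^sup>\<mu>\<close> with \<open>\<beta>\<^sub>j = \<parallel>\<psi>\<^sub>j\<parallel>\<close>. Choosing \<open>\<mu> = min \<nu> r\<close> for a large fixed \<open>r\<close> and
  splitting \<open>\<beta>\<^sub>j = \<beta>\<^sub>j\<^bsup>q\<^esup> \<beta>\<^sub>j\<^bsup>1 - q\<^esup>\<close>, the resulting bound for \<open>u\<^sub>\<nu>\<close> is a product of a multinomial term, which
  lies in \<open>\<ell>\<^sup>2\<close>, and a product weight, which lies in \<open>\<ell>\<^bsup>2p/(2-p)\<^esup>\<close>. Hence \<open>u\<^sub>\<nu>\<close> is in \<open>\<ell>\<^sup>p\<close>, and the rate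
  follows from completeness of the Hermite basis and Stechkin's lemma.
\<close>

text \<open>With the full order \<open>\<mu> = \<nu>\<close> the bound for \<open>u_\<nu>\<close>
  would be \<open>|\<nu>|! / sqrt (\<nu>!)\<close> times powers of \<open>2 \<beta>\<close>, which
  blows up already along multiples of one unit vector. Cutting the order at \<open>r\<close> keeps
  single-coordinate factorials bounded, while a large entry \<open>n\<close> still gains
  \<open>sqrt (\<kappa>!/\<nu>!)\<close>, about \<open>n powr (- r/2)\<close>. The factor
  \<open>|\<mu>|!\<close> couples all coordinates and has no product form; this forces the
  splitting. Its exponents are those of Hoelder: \<open>1/p = 1/2 + 1/t\<close> with
  \<open>t = 2p/(2-p)\<close>, and \<open>1/q = 1/p + 1/2\<close> says exactly that
  \<open>(1 - q) t = q\<close>, so \<open>\<beta> powr (1 - q)\<close> lies in l^t. The multinomial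
  part needs a small l^1 norm of \<open>\<beta> powr q\<close>; a scalar \<open>\<epsilon>\<close>
  provides it and is divided out of the other factor. The parameters are unbounded, so ellipticity
  is not uniform. Energy norms keep the constants of the recursion independent of \<open>y\<close>:
  only the increments must be small, and a small step ensures that. What remains of \<open>y\<close>
  is one factor \<open>exp (Bnd y)\<close>, square integrable by independence of the
  coordinates.\<close>

section \<open>Integrals of directional derivatives\<close>

text \<open>The difference quotients along \<open>e\<close> integrate to \<open>0\<close> by
  translation invariance, and the mean value theorem bounds them by \<open>w\<close>, so dominated
  convergence applies. Serves both Gaussian integration by parts and the Poincare
  inequality.\<close>

lemma integral_directional_derivative_eq_0:
  fixes F F' w :: "'a::euclidean_space \<Rightarrow> real"
  assumes der: "\<And>x t. ((\<lambda>t. F (x + t *\<^sub>R e)) has_real_derivative F' (x + t *\<^sub>R e)) (at t)"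
    and F: "integrable lborel F" and w: "integrable lborel w"
    and bound: "\<And>x t. 0 \<le> t \<Longrightarrow> t \<le> 1 \<Longrightarrow> \<bar>F' (x + t *\<^sub>R e)\<bar> \<le> w x"
  shows "(\<integral>x. F' x \<partial>lborel) = 0"
proof -
  define h where "h n = 1 / real (Suc n)" for n
  have h: "0 < h n" "h n \<le> 1" for n
    by (auto simp: h_def field_simps)
  have h0: "h \<longlonglongrightarrow> 0"
    unfolding h_def by (rule LIMSEQ_Suc[OF lim_1_over_n])
  define s where "s n x = (F (x + h n *\<^sub>R e) - F x) / h n" for n x
  have [measurable]: "F \<in> borel_measurable borel" "w \<in> borel_measurable borel"
    using F w by (auto dest: borel_measurable_integrable)
  have tr: "distr lborel borel ((+) c) = lborel" for c :: 'a
    by (rule lborel_distr_plus)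
  have int_tr: "integrable lborel (\<lambda>x. F (c + x))" "(\<integral>x. F (c + x) \<partial>lborel) = (\<integral>x. F x \<partial>lborel)" for c
  proof -
    show "integrable lborel (\<lambda>x. F (c + x))"
      using F tr[of c] integrable_distr_eq[of "(+) c" lborel borel F] by simp
    show "(\<integral>x. F (c + x) \<partial>lborel) = (\<integral>x. F x \<partial>lborel)"
      using integral_distr[of "(+) c" lborel borel F] tr[of c] by simp
  qed
  have s0: "(\<integral>x. s n x \<partial>lborel) = 0" for n
    using int_tr[of "h n *\<^sub>R e"] F by (simp add: s_def add.commute)
  have s_lim: "(\<lambda>n. s n x) \<longlonglongrightarrow> F' x" for x
  proof -
    have "((\<lambda>t. (F (x + t *\<^sub>R e) - F x) / t) \<longlongrightarrow> F' x) (at 0)"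
      using der[of x 0] by (simp add: has_field_derivative_iff)
    moreover have "filterlim h (at 0) sequentially"
      using h0 h by (auto simp: filterlim_at intro!: always_eventually) (metis less_irrefl)
    ultimately show ?thesis
      unfolding s_def by (rule filterlim_compose)
  qed
  have s_meas: "s n \<in> borel_measurable lborel" for n
    unfolding s_def by measurable
  have F'_meas: "F' \<in> borel_measurable lborel"
    by (rule borel_measurable_LIMSEQ_metric[OF s_meas]) (rule s_lim)
  have "(\<lambda>n. \<integral>x. s n x \<partial>lborel) \<longlonglongrightarrow> (\<integral>x. F' x \<partial>lborel)"
  proof (rule integral_dominated_convergence[where w=w])
    show "AE x in lborel. norm (s n x) \<le> w x" for n
    proof (rule AE_I2)
      fix x
      have "\<exists>t>0. t < h n \<and> F (x + h n *\<^sub>R e) - F (x + 0 *\<^sub>R e) = (h n - 0) * F' (x + t *\<^sub>R e)"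
        by (rule MVT2) (use h der in auto)
      then obtain t where t: "0 < t" "t < h n" "F (x + h n *\<^sub>R e) - F x = h n * F' (x + t *\<^sub>R e)"
        by auto
      then have "s n x = F' (x + t *\<^sub>R e)"
        using h(1)[of n] by (simp add: s_def)
      with bound[of t x] t h(2)[of n] show "norm (s n x) \<le> w x" by simp
    qed
  qed (use s_lim w F'_meas s_meas in auto)
  with s0 show ?thesis by (simp add: LIMSEQ_const_iff)
qed

section \<open>Hermite polynomials in one variable\<close>

text \<open>Probabilists' Hermite polynomials, generated by the raising operator
  \<open>x - d/dx\<close>. Up to sign this is the factor that appears when \<open>He n\<close> times
  the Gaussian density is differentiated.\<close>

primrec He :: "nat \<Rightarrow> real poly" where
  "He 0 = 1"
| "He (Suc n) = [:0, 1:] * He n - pderiv (He n)"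

lemma std_normal_density_deriv:
  "(std_normal_density has_real_derivative - x * std_normal_density x) (at x)"
proof -
  have "((\<lambda>x::real. 1 / sqrt (2 * pi) * exp (- x\<^sup>2 / 2)) has_real_derivative
      - x * (1 / sqrt (2 * pi) * exp (- x\<^sup>2 / 2))) (at x)"
    by (auto intro!: derivative_eq_intros simp: field_simps)
  then show ?thesis
    by (simp only: std_normal_density_def[abs_def])
qed

lemma He_density_deriv:
  "((\<lambda>x. (-1) ^ k * poly (He k) x * std_normal_density x) has_real_derivative
    (-1) ^ Suc k * poly (He (Suc k)) x * std_normal_density x) (at x)"
proof -
  have "((\<lambda>x. (-1) ^ k * poly (He k) x * std_normal_density x) has_real_derivative
      (-1) ^ k * poly (pderiv (He k)) x * std_normal_density x
      + (- x * std_normal_density x) * ((-1) ^ k * poly (He k) x)) (at x)"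
    by (rule DERIV_mult[OF DERIV_cmult[OF poly_DERIV] std_normal_density_deriv])
  then show ?thesis by (simp add: algebra_simps)
qed

lemma deriv_std_normal_density:
  "(deriv ^^ k) std_normal_density = (\<lambda>x. (-1) ^ k * poly (He k) x * std_normal_density x)"
proof (induction k)
  case (Suc k)
  then show ?case
    using He_density_deriv[of k] by (auto intro!: ext DERIV_imp_deriv)
qed auto

lemma std_normal_density_pos: "0 < std_normal_density x"
  by (rule normal_density_pos) simp

lemma hermite_eq_poly: "hermite k x = poly (He k) x / sqrt (fact k)"
proof -
  have "std_normal_density x \<noteq> 0" "(-1::real) ^ k * (-1) ^ k = 1"
    using std_normal_density_pos[of x] by (auto simp: power_mult_distrib[symmetric])
  then show ?thesis
    by (simp add: hermite_def deriv_std_normal_density mult.assoc[symmetric])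
qed

lemma hermite_0 [simp]: "hermite 0 x = 1"
  by (simp add: hermite_eq_poly)

lemma hermite_measurable [measurable]: "hermite k \<in> borel_measurable borel"
proof -
  have "continuous_on UNIV (\<lambda>x. poly (He k) x / sqrt (fact k))"
    by (intro continuous_intros) auto
  then show ?thesis
    by (simp add: hermite_eq_poly[abs_def] borel_measurable_continuous_onI)
qed

text \<open>The lowering relation. Together with \<open>integral_He_Suc\<close> it drives the
  induction for orthogonality.\<close>

lemma pderiv_He: "pderiv (He (Suc n)) = smult (real (Suc n)) (He n)"
proof (induction n)
  case (Suc n)
  have "pderiv (He (Suc (Suc n))) = He (Suc n) + ([:0, 1:] * pderiv (He (Suc n)) - pderiv (pderiv (He (Suc n))))"
    unfolding He.simps(2)[of "Suc n"]
    by (simp add: pderiv_diff pderiv_mult pderiv_pCons algebra_simps del: He.simps)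
  also have "\<dots> = He (Suc n) + smult (real (Suc n)) (He (Suc n))"
    unfolding Suc by (simp add: pderiv_smult smult_diff_right)
  also have "\<dots> = smult (real (Suc (Suc n))) (He (Suc n))"
    by (intro poly_eqI) (simp add: algebra_simps del: He.simps)
  finally show ?case .
qed (simp add: pderiv_pCons one_pCons)

text \<open>\<open>He n\<close> is monic of degree \<open>n\<close>, so the change of basis is
  triangular. Needed to turn orthogonality to Hermite polynomials into vanishing moments.\<close>

lemma monom_eq_He_sum: "\<exists>c. \<forall>x. x ^ n = (\<Sum>k\<le>n. c k * poly (He k) x)"
proof -
  have "degree (He n) \<le> n \<and> coeff (He n) n = 1" for n
  proof (induction n)
    case (Suc n)
    have "degree (He (Suc n)) \<le> Suc n"
      using Suc degree_pderiv[of "He n"]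
      by (auto intro!: degree_diff_le order_trans[OF degree_mult_le])
    moreover have "coeff (pderiv (He n)) (Suc n) = 0"
      using Suc degree_pderiv[of "He n"] by (intro coeff_eq_0) auto
    then have "coeff (He (Suc n)) (Suc n) = 1"
      using Suc by (simp add: coeff_pCons)
    ultimately show ?case by simp
  qed auto
  then have deg: "degree (He n) \<le> n" "coeff (He n) n = 1" for n by auto
  have "degree p \<le> n \<Longrightarrow> \<exists>c. \<forall>x. poly p x = (\<Sum>k\<le>n. c k * poly (He k) x)" for p n
  proof (induction n arbitrary: p)
    case 0
    then show ?case
      by (auto intro!: exI[of _ "\<lambda>_. coeff p 0"] elim!: degree_eq_zeroE)
  next
    case (Suc n)
    define p' where "p' = p - smult (coeff p (Suc n)) (He (Suc n))"
    have "degree p' \<le> Suc n"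
      unfolding p'_def using Suc.prems deg(1)[of "Suc n"]
      by (intro degree_diff_le order_trans[OF degree_smult_le]) auto
    moreover have "coeff p' (Suc n) = 0"
      using deg(2)[of "Suc n"] by (simp add: p'_def del: He.simps)
    ultimately have "degree p' \<le> n"
      by (metis Suc_leI coeff_0 degree_0 le_SucE le_zero_eq leading_coeff_0_iff zero_le)
    then obtain c where c: "\<And>x. poly p' x = (\<Sum>k\<le>n. c k * poly (He k) x)"
      using Suc.IH by blast
    have "poly p x = (\<Sum>k\<le>Suc n. (c(Suc n := coeff p (Suc n))) k * poly (He k) x)" for x
    proof -
      have "poly p x = poly p' x + coeff p (Suc n) * poly (He (Suc n)) x"
        by (simp add: p'_def del: He.simps)
      then show ?thesis by (simp add: c del: He.simps)
    qed
    then show ?case by blast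
  qed
  from this[of "monom 1 n" n] show ?thesis
    by (simp add: degree_monom_le poly_monom)
qed

subsection \<open>Functions of exponential growth\<close>

text \<open>The class of one-variable weights. It contains Hermite polynomials and indicators, its
  members are integrable for the Gaussian, and unlike polynomial growth it is stable under
  \<open>adjoint_shift\<close>, which multiplies by an exponential.\<close>

definition exp_growth :: "(real \<Rightarrow> real) \<Rightarrow> bool" where
  "exp_growth G \<longleftrightarrow> G \<in> borel_measurable borel \<and> (\<exists>C c. 0 \<le> C \<and> 0 \<le> c \<and> (\<forall>x. \<bar>G x\<bar> \<le> C * exp (c * \<bar>x\<bar>)))"

text \<open>Horner induction: each step spends half of the rate \<open>c\<close> on the factor
  \<open>x\<close> and leaves the other half for the remaining polynomial. Hence \<open>c\<close> is
  arbitrary in the induction.\<close>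

lemma poly_exp_bound:
  fixes p :: "real poly"
  assumes "0 < c"
  shows "\<exists>C\<ge>0. \<forall>x. \<bar>poly p x\<bar> \<le> C * exp (c * \<bar>x\<bar>)"
  using assms
proof (induction p arbitrary: c)
  case 0
  then show ?case by (auto intro!: exI[of _ 0])
next
  case (pCons a p)
  then obtain C where C: "0 \<le> C" "\<And>x. \<bar>poly p x\<bar> \<le> C * exp (c / 2 * \<bar>x\<bar>)"
    by (metis half_gt_zero)
  have "\<bar>poly (pCons a p) x\<bar> \<le> (\<bar>a\<bar> + 2 / c * C) * exp (c * \<bar>x\<bar>)" for x
  proof -
    have "c / 2 * \<bar>x\<bar> \<le> exp (c / 2 * \<bar>x\<bar>)"
      using exp_ge_add_one_self[of "c / 2 * \<bar>x\<bar>"] by linarith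
    then have x: "\<bar>x\<bar> \<le> 2 / c * exp (c / 2 * \<bar>x\<bar>)"
      using \<open>0 < c\<close> by (simp add: field_simps)
    have "\<bar>x * poly p x\<bar> \<le> (2 / c * exp (c / 2 * \<bar>x\<bar>)) * (C * exp (c / 2 * \<bar>x\<bar>))"
      unfolding abs_mult by (intro mult_mono x C) (use \<open>0 < c\<close> in auto)
    also have "\<dots> = 2 / c * C * exp (c * \<bar>x\<bar>)"
      by (simp add: exp_add[symmetric])
    finally have 1: "\<bar>x * poly p x\<bar> \<le> 2 / c * C * exp (c * \<bar>x\<bar>)" .
    have "\<bar>a\<bar> * 1 \<le> \<bar>a\<bar> * exp (c * \<bar>x\<bar>)"
      using \<open>0 < c\<close> by (intro mult_left_mono) auto
    then have "\<bar>a\<bar> + \<bar>x * poly p x\<bar> \<le> (\<bar>a\<bar> + 2 / c * C) * exp (c * \<bar>x\<bar>)"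
      using 1 by (simp add: algebra_simps)
    then show ?thesis
      using abs_triangle_ineq[of a "x * poly p x"] by simp
  qed
  moreover have "0 \<le> \<bar>a\<bar> + 2 / c * C" using C \<open>0 < c\<close> by simp
  ultimately show ?case by blast
qed

lemma exp_growth_hermite: "exp_growth (hermite k)"
proof -
  obtain C where C: "0 \<le> C" "\<And>x. \<bar>poly (He k) x\<bar> \<le> C * exp (1 * \<bar>x\<bar>)"
    using poly_exp_bound[of 1 "He k"] by auto
  have "\<bar>hermite k x\<bar> \<le> C / sqrt (fact k) * exp (1 * \<bar>x\<bar>)" for x
    using divide_right_mono[OF C(2)[of x], of "sqrt (fact k)"] by (simp add: hermite_eq_poly abs_divide)
  moreover have "0 \<le> C / sqrt (fact k)" using C by simp
  ultimately show ?thesis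
    unfolding exp_growth_def using hermite_measurable by (metis zero_le_one)
qed

lemma exp_growth_diff:
  assumes "exp_growth G" "exp_growth H" shows "exp_growth (\<lambda>x. G x - H x)"
proof -
  obtain C c C' c' where *: "0 \<le> C" "0 \<le> c" "\<And>x. \<bar>G x\<bar> \<le> C * exp (c * \<bar>x\<bar>)"
    "0 \<le> C'" "0 \<le> c'" "\<And>x. \<bar>H x\<bar> \<le> C' * exp (c' * \<bar>x\<bar>)"
    using assms unfolding exp_growth_def by metis
  have "\<bar>G x - H x\<bar> \<le> (C + C') * exp ((c + c') * \<bar>x\<bar>)" for x
  proof -
    have "C * exp (c * \<bar>x\<bar>) \<le> C * exp ((c + c') * \<bar>x\<bar>)" "C' * exp (c' * \<bar>x\<bar>) \<le> C' * exp ((c + c') * \<bar>x\<bar>)"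
      using * by (auto intro!: mult_left_mono mult_right_mono)
    moreover have "(C + C') * exp ((c + c') * \<bar>x\<bar>) = C * exp ((c + c') * \<bar>x\<bar>) + C' * exp ((c + c') * \<bar>x\<bar>)"
      by (rule distrib_right)
    ultimately show ?thesis using *(3)[of x] *(6)[of x] by linarith
  qed
  moreover have "0 \<le> C + C'" "0 \<le> c + c'" using * by auto
  moreover have "(\<lambda>x. G x - H x) \<in> borel_measurable borel"
    using assms unfolding exp_growth_def by (intro borel_measurable_diff) auto
  ultimately show ?thesis
    unfolding exp_growth_def by blast
qed

section \<open>Differences adjoint to translations under the Gaussian weight\<close>

text \<open>The adjoint of \<open>f \<mapsto> f (x + h)\<close> in L^2 of the standard Gaussian; the
  exponential is the quotient of the shifted and the unshifted density.\<close>

definition adjoint_shift :: "real \<Rightarrow> (real \<Rightarrow> real) \<Rightarrow> real \<Rightarrow> real" where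
  "adjoint_shift h G x = G (x - h) * exp (h * x - h\<^sup>2 / 2)"

definition adjoint_diff :: "real \<Rightarrow> (real \<Rightarrow> real) \<Rightarrow> real \<Rightarrow> real" where
  "adjoint_diff h G x = adjoint_shift h G x - G x"

lemma exp_growth_adjoint_shift:
  assumes "exp_growth G" shows "exp_growth (adjoint_shift h G)"
proof -
  obtain C c where *: "0 \<le> C" "0 \<le> c" "\<And>x. \<bar>G x\<bar> \<le> C * exp (c * \<bar>x\<bar>)" and [measurable]: "G \<in> borel_measurable borel"
    using assms unfolding exp_growth_def by metis
  have "\<bar>adjoint_shift h G x\<bar> \<le> C * exp (c * \<bar>h\<bar>) * exp ((c + \<bar>h\<bar>) * \<bar>x\<bar>)" for x
  proof -
    have 1: "c * \<bar>x - h\<bar> \<le> c * \<bar>x\<bar> + c * \<bar>h\<bar>"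
      using *(2) mult_left_mono[of "\<bar>x - h\<bar>" "\<bar>x\<bar> + \<bar>h\<bar>" c] by (simp add: algebra_simps)
    have 2: "h * x \<le> \<bar>h\<bar> * \<bar>x\<bar>"
      by (metis abs_ge_self abs_mult)
    have "\<bar>adjoint_shift h G x\<bar> \<le> (C * exp (c * \<bar>x - h\<bar>)) * exp (h * x - h\<^sup>2 / 2)"
      unfolding adjoint_shift_def abs_mult by (auto intro!: mult_right_mono *)
    also have "\<dots> = C * exp (c * \<bar>x - h\<bar> + (h * x - h\<^sup>2 / 2))"
      by (simp only: exp_add mult.assoc)
    also have "\<dots> \<le> C * exp (c * \<bar>h\<bar> + (c + \<bar>h\<bar>) * \<bar>x\<bar>)"
    proof -
      have "c * \<bar>x - h\<bar> + (h * x - h\<^sup>2 / 2) \<le> c * \<bar>h\<bar> + (c + \<bar>h\<bar>) * \<bar>x\<bar>"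
        using 1 2 zero_le_power2[of h] unfolding distrib_right by linarith
      then show ?thesis using *(1) by (intro mult_left_mono) auto
    qed
    finally show ?thesis by (simp add: exp_add mult.assoc)
  qed
  moreover have "adjoint_shift h G \<in> borel_measurable borel"
    unfolding adjoint_shift_def by measurable
  moreover have "0 \<le> C * exp (c * \<bar>h\<bar>)" "0 \<le> c + \<bar>h\<bar>"
    using * by auto
  ultimately show ?thesis
    unfolding exp_growth_def by blast
qed

lemma exp_growth_adjoint_diff: "exp_growth G \<Longrightarrow> exp_growth (adjoint_diff h G)"
  unfolding adjoint_diff_def by (intro exp_growth_diff exp_growth_adjoint_shift)

lemma exp_growth_adjoint_diff_pow: "exp_growth G \<Longrightarrow> exp_growth ((adjoint_diff h ^^ m) G)"
  by (induction m) (auto intro: exp_growth_adjoint_diff)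

definition backward_diff :: "real \<Rightarrow> (real \<Rightarrow> real) \<Rightarrow> real \<Rightarrow> real" where
  "backward_diff h f x = f (x - h) - f x"

text \<open>Iterated mean value theorem for a tower \<open>d\<close> of successive derivatives. The
  induction hypothesis is applied to the differenced tower \<open>d'\<close>, and one more mean
  value step removes the remaining difference.\<close>

lemma backward_diff_pow_mean_value:
  fixes d :: "nat \<Rightarrow> real \<Rightarrow> real"
  assumes "\<And>k x. (d k has_real_derivative d (Suc k) x) (at x)" "0 < h"
  shows "\<exists>\<xi>. x - real m * h \<le> \<xi> \<and> \<xi> \<le> x \<and> (backward_diff h ^^ m) (d 0) x = (- h) ^ m * d m \<xi>"
  using assms(1)
proof (induction m arbitrary: d)
  case 0
  then show ?case by auto
next
  case (Suc m)
  define d' where "d' k = backward_diff h (d k)" for k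
  have "(d' k has_real_derivative d' (Suc k) x) (at x)" for k x
    unfolding d'_def backward_diff_def
    using DERIV_diff[OF DERIV_shift[THEN iffD1, of "d k" "d (Suc k) (x - h)" x "- h"] Suc.prems(1)[of k x]]
      Suc.prems(1)[of k "x - h"] by simp
  from Suc.IH[of d', OF this] obtain \<xi> where \<xi>: "x - real m * h \<le> \<xi>" "\<xi> \<le> x"
    "(backward_diff h ^^ m) (d' 0) x = (- h) ^ m * d' m \<xi>" by blast
  have "\<exists>z>\<xi> - h. z < \<xi> \<and> d m \<xi> - d m (\<xi> - h) = (\<xi> - (\<xi> - h)) * d (Suc m) z"
    by (rule MVT2) (use Suc.prems \<open>0 < h\<close> in auto)
  then obtain z where z: "\<xi> - h < z" "z < \<xi>" "d m \<xi> - d m (\<xi> - h) = h * d (Suc m) z" by auto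
  have "(backward_diff h ^^ Suc m) (d 0) x = (- h) ^ m * (- (h * d (Suc m) z))"
    using \<xi>(3) unfolding z(3)[symmetric]
    by (simp add: funpow_Suc_right d'_def backward_diff_def algebra_simps del: funpow.simps)
  then show ?case
    using \<xi> z by (intro exI[of _ z]) (auto simp: algebra_simps)
qed

lemma std_normal_density_shift:
  "std_normal_density (x - h) = std_normal_density x * exp (h * x - h\<^sup>2 / 2)"
  by (simp add: std_normal_density_def exp_add[symmetric] power2_eq_square field_simps)

text \<open>Dividing by the density conjugates the adjoint difference to a plain backward
  difference, because the exponential factor is exactly the quotient of densities at
  \<open>x - h\<close> and \<open>x\<close>.\<close>

lemma adjoint_diff_pow_quotient:
  "(adjoint_diff h ^^ m) (\<lambda>x. \<phi> x / std_normal_density x) =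
    (\<lambda>x. (backward_diff h ^^ m) \<phi> x / std_normal_density x)"
proof (induction m)
  case (Suc m)
  have "adjoint_diff h (\<lambda>x. \<phi> x / std_normal_density x) x = backward_diff h \<phi> x / std_normal_density x"
    for \<phi> x
    using std_normal_density_pos[of x]
    by (simp add: adjoint_diff_def adjoint_shift_def backward_diff_def std_normal_density_shift diff_divide_distrib)
  then show ?case using Suc by auto
qed simp

text \<open>\<open>hermite k\<close> is a multiple of the \<open>k\<close>-th derivative of the
  density divided by the density. Its adjoint differences are thus backward differences of that
  derivative, and the mean value theorem turns them into a derivative of order
  \<open>k + m\<close>.\<close>

lemma adjoint_diff_pow_hermite:
  assumes "0 < h"
  shows "\<exists>\<xi>. x - real m * h \<le> \<xi> \<and> \<xi> \<le> x \<and> (adjoint_diff h ^^ m) (hermite k) x / h ^ m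
    = poly (He (k + m)) \<xi> / sqrt (fact k) * (std_normal_density \<xi> / std_normal_density x)"
proof -
  \<comment> \<open>\<open>d i\<close> is the derivative of order \<open>k + i\<close> of the
    density, normalized so that \<open>d 0\<close> belongs to \<open>hermite k\<close>.\<close>
  define d where "d i x = (-1) ^ k / sqrt (fact k) * ((-1) ^ (k + i) * poly (He (k + i)) x * std_normal_density x)" for i x
  have d: "(d i has_real_derivative d (Suc i) x) (at x)" for i x
    unfolding d_def using DERIV_cmult[OF He_density_deriv[of "k + i" x], of "(-1) ^ k / sqrt (fact k)"]
    by simp
  have sgn: "(-1::real) ^ k * (-1) ^ k = 1" for k :: nat
    by (auto simp: power_mult_distrib[symmetric])
  have H: "hermite k = (\<lambda>x. d 0 x / std_normal_density x)"
    using sgn[of k] std_normal_density_pos by (intro ext) (simp add: hermite_eq_poly d_def less_imp_neq[symmetric])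
  obtain \<xi> where \<xi>: "x - real m * h \<le> \<xi>" "\<xi> \<le> x" "(backward_diff h ^^ m) (d 0) x = (- h) ^ m * d m \<xi>"
    using backward_diff_pow_mean_value[of d, OF d assms] by blast
  have "(- h) ^ m * ((-1) ^ k * (-1) ^ (k + m)) = h ^ m"
    using sgn[of k] sgn[of m] by (simp add: power_add power_minus[of h])
  then have "(- h) ^ m * d m \<xi> = h ^ m * (poly (He (k + m)) \<xi> / sqrt (fact k) * std_normal_density \<xi>)"
    unfolding d_def by (simp add: field_simps)
  then have "(adjoint_diff h ^^ m) (hermite k) x / h ^ m
    = poly (He (k + m)) \<xi> / sqrt (fact k) * (std_normal_density \<xi> / std_normal_density x)"
    using \<open>0 < h\<close> unfolding H adjoint_diff_pow_quotient \<xi>(3) by simp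
  with \<xi> show ?thesis by blast
qed

text \<open>Uniformity in \<open>h\<close> is the point: it supplies the dominating function for the
  passage to step size \<open>0\<close> in \<open>hc_bound_aux\<close>. The intermediate point is
  within \<open>m\<close> of \<open>x\<close>, so the quotient of densities costs at most
  \<open>exp (m * |x|)\<close>.\<close>

lemma adjoint_diff_pow_hermite_bound:
  "\<exists>C c. 0 \<le> C \<and> 0 \<le> c \<and> (\<forall>h x. 0 < h \<longrightarrow> h \<le> 1 \<longrightarrow>
    \<bar>(adjoint_diff h ^^ m) (hermite k) x / h ^ m\<bar> \<le> C * exp (c * \<bar>x\<bar>))"
proof -
  obtain C where C: "0 \<le> C" "\<And>x. \<bar>poly (He (k + m)) x\<bar> \<le> C * exp (1 * \<bar>x\<bar>)"
    using poly_exp_bound[of 1 "He (k + m)"] by auto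
  have "\<bar>(adjoint_diff h ^^ m) (hermite k) x / h ^ m\<bar> \<le> (C * exp m) * exp ((1 + real m) * \<bar>x\<bar>)"
    if h: "0 < h" "h \<le> 1" for h x
  proof -
    obtain \<xi> where \<xi>: "x - real m * h \<le> \<xi>" "\<xi> \<le> x" and eq: "(adjoint_diff h ^^ m) (hermite k) x / h ^ m
      = poly (He (k + m)) \<xi> / sqrt (fact k) * (std_normal_density \<xi> / std_normal_density x)"
      using adjoint_diff_pow_hermite[OF h(1)] by blast
    define t where "t = x - \<xi>"
    have "real m * h \<le> real m * 1" using h by (intro mult_left_mono) auto
    then have t: "0 \<le> t" "t \<le> m" using \<xi> by (auto simp: t_def)
    have "std_normal_density \<xi> / std_normal_density x = exp (t * x - t\<^sup>2 / 2)"
      using std_normal_density_shift[of x t] std_normal_density_pos[of x] by (simp add: t_def)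
    also have "\<dots> \<le> exp (real m * \<bar>x\<bar>)"
    proof -
      have "t * x \<le> t * \<bar>x\<bar>" "t * \<bar>x\<bar> \<le> real m * \<bar>x\<bar>"
        using t by (auto intro!: mult_left_mono mult_right_mono)
      then have "t * x - t\<^sup>2 / 2 \<le> real m * \<bar>x\<bar>" using zero_le_power2[of t] by linarith
      then show ?thesis by simp
    qed
    finally have 1: "std_normal_density \<xi> / std_normal_density x \<le> exp (real m * \<bar>x\<bar>)" .
    have "\<bar>\<xi>\<bar> \<le> \<bar>x\<bar> + real m" using t by (simp add: t_def)
    then have "C * exp (1 * \<bar>\<xi>\<bar>) \<le> C * exp (\<bar>x\<bar> + real m)" using C by (intro mult_left_mono) auto
    then have 2: "\<bar>poly (He (k + m)) \<xi>\<bar> \<le> C * exp (\<bar>x\<bar> + real m)" using C(2)[of \<xi>] by simp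
    have "\<bar>poly (He (k + m)) \<xi> / sqrt (fact k)\<bar> \<le> \<bar>poly (He (k + m)) \<xi>\<bar> / 1"
      unfolding abs_divide by (intro divide_left_mono) (auto simp: real_le_rsqrt fact_ge_1)
    with 2 have 3: "\<bar>poly (He (k + m)) \<xi> / sqrt (fact k)\<bar> \<le> C * exp (\<bar>x\<bar> + real m)" by simp
    have "0 \<le> std_normal_density \<xi> / std_normal_density x"
      using std_normal_density_pos[of \<xi>] std_normal_density_pos[of x] by simp
    then have "\<bar>(adjoint_diff h ^^ m) (hermite k) x / h ^ m\<bar> \<le> (C * exp (\<bar>x\<bar> + real m)) * exp (real m * \<bar>x\<bar>)"
      unfolding eq abs_mult using 1 3 C(1) by (intro mult_mono) auto
    also have "\<dots> = (C * exp m) * exp ((1 + real m) * \<bar>x\<bar>)"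
      by (simp add: algebra_simps exp_add)
    finally show ?thesis .
  qed
  moreover have "0 \<le> C * exp (real m)" "0 \<le> 1 + real m" using C by auto
  ultimately show ?thesis by blast
qed

text \<open>The intermediate points are squeezed to \<open>x\<close>. The square root arises because
  the limit \<open>He (k + m)\<close> still carries the normalization of \<open>hermite k\<close>;
  it grows with \<open>k\<close> and is the source of all decay of the coefficients.\<close>

lemma adjoint_diff_pow_hermite_limit:
  assumes h: "\<And>n. 0 < h n" and h0: "h \<longlonglongrightarrow> 0"
  shows "(\<lambda>n. (adjoint_diff (h n) ^^ m) (hermite k) x / h n ^ m)
    \<longlonglongrightarrow> sqrt (fact (k + m) / fact k) * hermite (k + m) x"
proof -
  define \<Phi> where "\<Phi> \<xi> = poly (He (k + m)) \<xi> / sqrt (fact k) * (std_normal_density \<xi> / std_normal_density x)" for \<xi>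
  have "\<exists>\<xi>. x - real m * h n \<le> \<xi> \<and> \<xi> \<le> x \<and> (adjoint_diff (h n) ^^ m) (hermite k) x / h n ^ m = \<Phi> \<xi>" for n
    unfolding \<Phi>_def by (rule adjoint_diff_pow_hermite[OF h])
  then obtain \<xi> where \<xi>: "\<And>n. x - real m * h n \<le> \<xi> n" "\<And>n. \<xi> n \<le> x"
    "\<And>n. (adjoint_diff (h n) ^^ m) (hermite k) x / h n ^ m = \<Phi> (\<xi> n)" by metis
  have "(\<lambda>n. x - real m * h n) \<longlonglongrightarrow> x - real m * 0"
    by (intro tendsto_intros h0)
  then have lim: "(\<lambda>n. x - real m * h n) \<longlonglongrightarrow> x" by simp
  have "\<xi> \<longlonglongrightarrow> x"
  proof (rule tendsto_sandwich[OF _ _ lim tendsto_const[of x]])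
    show "\<forall>\<^sub>F n in sequentially. x - real m * h n \<le> \<xi> n" "\<forall>\<^sub>F n in sequentially. \<xi> n \<le> x"
      using \<xi>(1,2) by (auto intro!: always_eventually)
  qed
  moreover have "isCont \<Phi> x"
    unfolding \<Phi>_def std_normal_density_def by (intro continuous_intros) auto
  ultimately have "(\<lambda>n. \<Phi> (\<xi> n)) \<longlonglongrightarrow> \<Phi> x"
    by (simp add: isCont_tendsto_compose)
  moreover have "\<Phi> x = sqrt (fact (k + m) / fact k) * hermite (k + m) x"
    using std_normal_density_pos[of x] by (simp add: \<Phi>_def hermite_eq_poly real_sqrt_divide)
  ultimately show ?thesis by (simp add: \<xi>(3))
qed

subsection \<open>Gaussian integrals\<close>

abbreviation normal1 :: "real measure" where
  "normal1 \<equiv> density lborel (\<lambda>t. ennreal (std_normal_density t))"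

lemma prob_space_normal1: "prob_space normal1"
  by (rule prob_space_normal_density) simp

lemma integrable_exp_abs_normal1: "integrable normal1 (\<lambda>x. exp (c * \<bar>x\<bar>))"
proof -
  have "integrable lborel (\<lambda>x. exp (c\<^sup>2 / 2) * normal_density c 1 x)" for c
    using integrable_normal_density[of 1 c] by simp
  \<comment> \<open>Completing the square: an exponential weight moves the mean of the density to
    \<open>c\<close>.\<close>
  moreover have "exp (c\<^sup>2 / 2) * normal_density c 1 x = std_normal_density x * exp (c * x)" for c x
    using std_normal_density_shift[of x c]
    by (simp add: normal_density_def std_normal_density_def exp_add[symmetric] power2_eq_square field_simps)
  ultimately have *: "integrable lborel (\<lambda>x. std_normal_density x * exp (c * x))" for c by simp
  have "integrable lborel (\<lambda>x. std_normal_density x * exp (c * \<bar>x\<bar>))"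
  proof (rule Bochner_Integration.integrable_bound)
    show "integrable lborel (\<lambda>x. std_normal_density x * exp (c * x) + std_normal_density x * exp ((- c) * x))"
      using *[of c] *[of "- c"] by simp
    show "AE x in lborel. norm (std_normal_density x * exp (c * \<bar>x\<bar>))
      \<le> norm (std_normal_density x * exp (c * x) + std_normal_density x * exp ((- c) * x))"
    proof (rule AE_I2)
      fix x
      have "0 \<le> std_normal_density x * exp (c * x)" "0 \<le> std_normal_density x * exp (- c * x)"
        using std_normal_density_pos[of x] by auto
      then show "norm (std_normal_density x * exp (c * \<bar>x\<bar>))
          \<le> norm (std_normal_density x * exp (c * x) + std_normal_density x * exp ((- c) * x))"
        by (cases "0 \<le> x") (auto simp del: mult_minus_left)
    qed
  qed measurable
  then show ?thesis
    by (subst integrable_density) auto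
qed

lemma exp_growth_integrable: "exp_growth G \<Longrightarrow> integrable normal1 G"
proof -
  assume "exp_growth G"
  then obtain C c where *: "\<And>x. \<bar>G x\<bar> \<le> C * exp (c * \<bar>x\<bar>)" and [measurable]: "G \<in> borel_measurable borel"
    unfolding exp_growth_def by metis
  show ?thesis
  proof (rule Bochner_Integration.integrable_bound)
    show "integrable normal1 (\<lambda>x. C * exp (c * \<bar>x\<bar>))"
      using integrable_exp_abs_normal1[of c] by simp
    show "AE x in normal1. norm (G x) \<le> norm (C * exp (c * \<bar>x\<bar>))"
    proof (rule AE_I2)
      fix x
      show "norm (G x) \<le> norm (C * exp (c * \<bar>x\<bar>))"
        using *[of x] abs_ge_self[of "C * exp (c * \<bar>x\<bar>)"] by (simp del: abs_mult abs_exp_cancel)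
    qed
  qed simp
qed

lemma exp_growth_poly: "exp_growth (poly p)"
proof -
  have "continuous_on UNIV (poly p)" by (intro continuous_intros)
  then have "poly p \<in> borel_measurable borel" by (rule borel_measurable_continuous_onI)
  then show ?thesis
    using poly_exp_bound[of 1 p] unfolding exp_growth_def by (metis zero_le_one zero_less_one)
qed

lemma integrable_poly_normal1: "integrable normal1 (poly p)"
  by (intro exp_growth_integrable exp_growth_poly)

text \<open>Gaussian integration by parts: the derivative of \<open>p\<close> times the density is
  \<open>p' - x p\<close> times the density, and it has integral zero.\<close>

lemma integral_poly_deriv_normal1:
  "(\<integral>x. poly (pderiv p) x \<partial>normal1) = (\<integral>x. poly ([:0, 1:] * p) x \<partial>normal1)"
proof -
  define F where "F x = poly p x * std_normal_density x" for x
  define F' where "F' x = poly (pderiv p - [:0, 1:] * p) x * std_normal_density x" for x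
  obtain C where C: "0 \<le> C" "\<And>x. \<bar>poly (pderiv p - [:0, 1:] * p) x\<bar> \<le> C * exp (1 * \<bar>x\<bar>)"
    using poly_exp_bound[of 1 "pderiv p - [:0, 1:] * p"] by auto
  have dens: "integrable lborel (\<lambda>x. G x * std_normal_density x) \<and>
     (\<integral>x. G x \<partial>normal1) = (\<integral>x. G x * std_normal_density x \<partial>lborel)" if "exp_growth G" for G
  proof -
    have "G \<in> borel_measurable lborel" using that by (simp add: exp_growth_def)
    then show ?thesis
      using exp_growth_integrable[OF that] integrable_density[of G lborel std_normal_density]
        integral_density[of G lborel std_normal_density]
      by (simp add: mult.commute)
  qed
  \<comment> \<open>In the dominating function one factor \<open>exp |x|\<close> pays for the
    polynomial at \<open>x + t\<close> and the other for the density at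
    \<open>x + t\<close>.\<close>
  have "(\<integral>x. F' x \<partial>lborel) = 0"
  proof (rule integral_directional_derivative_eq_0[where F=F and e=1 and w="\<lambda>x. C * exp 1 * (exp (2 * \<bar>x\<bar>) * std_normal_density x)"])
    fix x t :: real
    have "(F has_real_derivative F' y) (at y)" for y
      unfolding F_def F'_def using DERIV_mult[OF poly_DERIV[of p y] std_normal_density_deriv[of y]]
      by (simp add: algebra_simps)
    then show "((\<lambda>t. F (x + t *\<^sub>R 1)) has_real_derivative F' (x + t *\<^sub>R 1)) (at t)"
      using DERIV_shift[of F "F' (x + t)" t x] by (simp add: add.commute)
    show "integrable lborel F"
      unfolding F_def using dens[OF exp_growth_poly] by blast
    have "exp_growth (\<lambda>x. exp (2 * \<bar>x\<bar>))"
      unfolding exp_growth_def by (auto intro!: exI[of _ 1] exI[of _ 2])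
    from dens[OF this] show "integrable lborel (\<lambda>x. C * exp 1 * (exp (2 * \<bar>x\<bar>) * std_normal_density x))"
      by simp
    assume t: "0 \<le> t" "t \<le> 1"
    have "std_normal_density (x + t) = std_normal_density x * exp (- t * x - t\<^sup>2 / 2)"
      using std_normal_density_shift[of x "- t"] by simp
    also have "\<dots> \<le> std_normal_density x * exp \<bar>x\<bar>"
    proof -
      have "- t * x \<le> t * \<bar>x\<bar>" using t mult_left_mono[of "- x" "\<bar>x\<bar>" t] by simp
      moreover have "t * \<bar>x\<bar> \<le> 1 * \<bar>x\<bar>" using t by (intro mult_right_mono) auto
      ultimately show ?thesis
      proof -
        have "- t * x - t\<^sup>2 / 2 \<le> \<bar>x\<bar>"
          using \<open>- t * x \<le> t * \<bar>x\<bar>\<close> \<open>t * \<bar>x\<bar> \<le> 1 * \<bar>x\<bar>\<close> zero_le_power2[of t] by linarith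
        then show ?thesis using std_normal_density_pos[of x] by simp
      qed
    qed
    finally have 1: "std_normal_density (x + t) \<le> std_normal_density x * exp \<bar>x\<bar>" .
    have "C * exp (1 * \<bar>x + t\<bar>) \<le> C * exp (\<bar>x\<bar> + 1)" using C t by (intro mult_left_mono) auto
    then have 2: "\<bar>poly (pderiv p - [:0, 1:] * p) (x + t)\<bar> \<le> C * exp (\<bar>x\<bar> + 1)" using C(2)[of "x + t"] by linarith
    have "\<bar>F' (x + t)\<bar> \<le> (C * exp (\<bar>x\<bar> + 1)) * (std_normal_density x * exp \<bar>x\<bar>)"
      unfolding F'_def abs_mult using 1 2 C(1) std_normal_density_pos[of "x + t"]
      by (intro mult_mono) auto
    also have "\<dots> = C * exp 1 * (exp (2 * \<bar>x\<bar>) * std_normal_density x)"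
    proof -
      have "exp (\<bar>x\<bar> + 1) * exp \<bar>x\<bar> = exp 1 * exp (2 * \<bar>x\<bar>)"
        by (simp add: exp_add[symmetric])
      then show ?thesis by (metis (no_types, opaque_lifting) mult.assoc mult.commute)
    qed
    finally show "\<bar>F' (x + t *\<^sub>R 1)\<bar> \<le> C * exp 1 * (exp (2 * \<bar>x\<bar>) * std_normal_density x)" by simp
  qed
  then have "(\<integral>x. poly (pderiv p - [:0, 1:] * p) x \<partial>normal1) = 0"
    unfolding F'_def conjunct2[OF dens[OF exp_growth_poly]] .
  then show ?thesis
    using integrable_poly_normal1[of "pderiv p"] integrable_poly_normal1[of "[:0, 1:] * p"]
    by (simp only: poly_diff Bochner_Integration.integral_diff right_minus_eq)
qed

text \<open>In L^2 of the Gaussian the raising operator is the adjoint of differentiation, so one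
  index of \<open>He\<close> is traded for one derivative of \<open>p\<close>.\<close>

lemma integral_He_Suc:
  "(\<integral>x. poly p x * poly (He (Suc n)) x \<partial>normal1) = (\<integral>x. poly (pderiv p) x * poly (He n) x \<partial>normal1)"
proof -
  have "(\<integral>x. poly (pderiv (p * He n)) x \<partial>normal1) = (\<integral>x. poly ([:0, 1:] * (p * He n)) x \<partial>normal1)"
    by (rule integral_poly_deriv_normal1)
  moreover have "(\<integral>x. poly (pderiv (p * He n)) x \<partial>normal1) =
      (\<integral>x. poly (p * pderiv (He n)) x \<partial>normal1) + (\<integral>x. poly (pderiv p * He n) x \<partial>normal1)"
    using integrable_poly_normal1[of "p * pderiv (He n)"] integrable_poly_normal1[of "pderiv p * He n"]
    unfolding pderiv_mult poly_add by (subst Bochner_Integration.integral_add[symmetric]) (simp_all only: mult.commute)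
  moreover have "(\<integral>x. poly (p * He (Suc n)) x \<partial>normal1) =
      (\<integral>x. poly ([:0, 1:] * (p * He n)) x \<partial>normal1) - (\<integral>x. poly (p * pderiv (He n)) x \<partial>normal1)"
  proof -
    have e: "p * He (Suc n) = [:0, 1:] * (p * He n) - p * pderiv (He n)"
      by (simp add: algebra_simps)
    show ?thesis
      unfolding e poly_diff by (intro Bochner_Integration.integral_diff integrable_poly_normal1)
  qed
  ultimately show ?thesis by simp
qed

lemma integral_He_He:
  "(\<integral>x. poly (He m) x * poly (He n) x \<partial>normal1) = (if m = n then fact n else 0)"
proof (induction m arbitrary: n)
  case 0
  interpret prob_space normal1 by (rule prob_space_normal1)
  show ?case
  proof (cases n)
    case (Suc k)
    then show ?thesis using integral_He_Suc[of 1 k] by simp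
  qed (use prob_space in simp)
next
  case (Suc m)
  show ?case
  proof (cases n)
    case 0
    then show ?thesis using integral_He_Suc[of 1 m] by simp
  next
    case (Suc k)
    then show ?thesis
      unfolding Suc integral_He_Suc pderiv_He using Suc.IH[of k] by (simp add: mult.assoc)
  qed
qed

lemma integral_hermite_hermite:
  "(\<integral>x. hermite m x * hermite n x \<partial>normal1) = (if m = n then 1 else 0)"
  using integral_He_He[of m n] by (simp add: hermite_eq_poly)

section \<open>The Gaussian measure on sequences\<close>

lemma sets_gauss [measurable_cong]: "sets gauss = sets (\<Pi>\<^sub>M j\<in>UNIV. borel)"
  unfolding gauss_def by (intro sets_PiM_cong) auto

lemma space_gauss [simp]: "space gauss = UNIV"
  by (simp add: gauss_def space_PiM)

lemma sets_gauss_borel: "sets gauss = sets (borel :: (nat \<Rightarrow> real) measure)"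
  unfolding sets_gauss by (rule sets_PiM_equal_borel)

lemma coordinate_measurable: "(\<lambda>y. y j) \<in> borel_measurable gauss"
  by measurable

lemma fun_upd_measurable_gauss [measurable]: "(\<lambda>y. y(j := y j + h)) \<in> measurable gauss gauss"
  by (subst measurable_cong_sets[OF sets_gauss sets_gauss]) (rule measurable_PiM_single', auto)

interpretation gauss: product_prob_space "\<lambda>_. normal1" "UNIV :: nat set"
  by (rule product_prob_spaceI) (rule prob_space_normal1)

lemma prob_space_gauss: "prob_space gauss"
  unfolding gauss_def by (rule gauss.P.prob_space_axioms)

interpretation gs: prob_space gauss
  by (rule prob_space_gauss)

lemma distr_gauss_component: "distr gauss borel (\<lambda>y. y j) = normal1"
proof -
  have "distr gauss normal1 (\<lambda>y. y j) = normal1"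
    unfolding gauss_def by (rule distr_PiM_component) (auto intro: prob_space_normal1)
  moreover have "distr gauss normal1 (\<lambda>y. y j) = distr gauss borel (\<lambda>y. y j)"
    by (rule distr_cong) auto
  ultimately show ?thesis by simp
qed

lemma indep_coordinates: "gs.indep_vars (\<lambda>_. borel) (\<lambda>j y. y j) UNIV"
proof -
  have "distr gauss (\<Pi>\<^sub>M i\<in>UNIV. borel) (\<lambda>x. \<lambda>i\<in>UNIV. x i) = (\<Pi>\<^sub>M i\<in>UNIV. distr gauss borel (\<lambda>x. x i))"
  proof -
    have "distr gauss (\<Pi>\<^sub>M i\<in>UNIV. borel) (\<lambda>x. \<lambda>i\<in>UNIV. x i) = distr gauss gauss (\<lambda>x. x)"
      by (rule distr_cong) (auto simp: sets_gauss)
    also have "\<dots> = gauss" by (rule distr_id2) simp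
    also have "\<dots> = (\<Pi>\<^sub>M i\<in>UNIV. distr gauss borel (\<lambda>x. x i))"
      by (simp add: distr_gauss_component) (simp add: gauss_def)
    finally show ?thesis .
  qed
  then show ?thesis
    by (subst gs.indep_vars_iff_distr_eq_PiM) (auto intro: coordinate_measurable)
qed

lemma nn_integral_gauss_component:
  assumes "g \<in> borel_measurable borel"
  shows "(\<integral>\<^sup>+y. g (y j) \<partial>gauss) = (\<integral>\<^sup>+x. g x \<partial>normal1)"
  using nn_integral_distr[of "\<lambda>y. y j" gauss borel g] assms
  by (simp add: distr_gauss_component coordinate_measurable)

lemma nn_integral_gauss_prod:
  fixes g :: "nat \<Rightarrow> real \<Rightarrow> real"
  assumes J: "finite J" and g: "\<And>j. j \<in> J \<Longrightarrow> g j \<in> borel_measurable borel" "\<And>j x. j \<in> J \<Longrightarrow> 0 \<le> g j x"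
  shows "(\<integral>\<^sup>+y. ennreal (\<Prod>j\<in>J. g j (y j)) \<partial>gauss) = (\<Prod>j\<in>J. \<integral>\<^sup>+x. ennreal (g j x) \<partial>normal1)"
proof -
  have "gs.indep_vars (\<lambda>_. borel) (\<lambda>j y. ennreal (g j (y j))) J"
    by (rule gs.indep_vars_compose2[OF gs.indep_vars_subset[OF indep_coordinates]])
      (use g(1) in auto)
  then have "(\<integral>\<^sup>+y. (\<Prod>j\<in>J. ennreal (g j (y j))) \<partial>gauss) = (\<Prod>j\<in>J. \<integral>\<^sup>+y. ennreal (g j (y j)) \<partial>gauss)"
    by (rule gs.indep_vars_nn_integral[OF J]) simp
  also have "\<dots> = (\<Prod>j\<in>J. \<integral>\<^sup>+x. ennreal (g j x) \<partial>normal1)"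
    using g(1) by (intro prod.cong refl nn_integral_gauss_component[of "\<lambda>x. ennreal (g _ x)"]) auto
  finally show ?thesis
    using g(2) by (simp add: prod_ennreal)
qed

lemma integral_gauss_prod:
  fixes g :: "nat \<Rightarrow> real \<Rightarrow> real"
  assumes J: "finite J" and g: "\<And>j. j \<in> J \<Longrightarrow> integrable normal1 (g j)"
  shows "integrable gauss (\<lambda>y. \<Prod>j\<in>J. g j (y j))"
    and "(\<integral>y. (\<Prod>j\<in>J. g j (y j)) \<partial>gauss) = (\<Prod>j\<in>J. \<integral>x. g j x \<partial>normal1)"
proof -
  have gm: "g j \<in> borel_measurable borel" if "j \<in> J" for j
    using borel_measurable_integrable[OF g[OF that]] by simp
  have gi: "integrable gauss (\<lambda>y. g j (y j))" "(\<integral>y. g j (y j) \<partial>gauss) = (\<integral>x. g j x \<partial>normal1)" if "j \<in> J" for j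
    using integrable_distr_eq[OF coordinate_measurable gm[OF that], of j] g[OF that]
      integral_distr[OF coordinate_measurable gm[OF that], of j]
    by (auto simp: distr_gauss_component)
  have ind: "gs.indep_vars (\<lambda>_. borel) (\<lambda>j y. g j (y j)) J"
    by (rule gs.indep_vars_compose2[OF gs.indep_vars_subset[OF indep_coordinates]])
      (use gm in auto)
  show "integrable gauss (\<lambda>y. \<Prod>j\<in>J. g j (y j))"
    by (rule gs.indep_vars_integrable[OF J ind]) (rule gi)
  have "(\<integral>y. (\<Prod>j\<in>J. g j (y j)) \<partial>gauss) = (\<Prod>j\<in>J. \<integral>y. g j (y j) \<partial>gauss)"
    by (rule gs.indep_vars_lebesgue_integral[OF J ind]) (rule gi)
  then show "(\<integral>y. (\<Prod>j\<in>J. g j (y j)) \<partial>gauss) = (\<Prod>j\<in>J. \<integral>x. g j x \<partial>normal1)"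
    using gi by simp
qed

subsection \<open>Shifts of a coordinate\<close>

lemma emeasure_normal1_shift:
  assumes [measurable]: "A \<in> sets borel"
  shows "emeasure normal1 {x. x + h \<in> A} = (\<integral>\<^sup>+x. ennreal (exp (h * x - h\<^sup>2 / 2) * indicator A x) \<partial>normal1)"
proof -
  have "emeasure normal1 {x. x + h \<in> A} = (\<integral>\<^sup>+x. ennreal (std_normal_density x) * indicator A (x + h) \<partial>lborel)"
    by (subst emeasure_density) (auto intro!: nn_integral_cong split: split_indicator)
  also have "\<dots> = (\<integral>\<^sup>+x. ennreal (std_normal_density (x - h)) * indicator A x \<partial>lborel)"
    using nn_integral_real_affine[of "\<lambda>x. ennreal (std_normal_density (x - h)) * indicator A x" 1 h]
    by (simp add: add.commute)
  also have "\<dots> = (\<integral>\<^sup>+x. ennreal (std_normal_density x) * ennreal (exp (h * x - h\<^sup>2 / 2) * indicator A x) \<partial>lborel)"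
    by (intro nn_integral_cong)
      (auto simp: std_normal_density_shift ennreal_mult'' split: split_indicator)
  also have "\<dots> = (\<integral>\<^sup>+x. ennreal (exp (h * x - h\<^sup>2 / 2) * indicator A x) \<partial>normal1)"
    by (subst nn_integral_density) auto
  finally show ?thesis .
qed

text \<open>The Cameron-Martin formula for a shift along one coordinate. Finite measures on the
  product are determined by cylinder sets, where both sides factorize and only the factor of
  coordinate \<open>j\<close> differs.\<close>

lemma distr_gauss_shift:
  "distr gauss gauss (\<lambda>y. y(j := y j + h)) = density gauss (\<lambda>y. ennreal (exp (h * y j - h\<^sup>2 / 2)))"
proof (rule measure_eqI_PiM_infinite[where I=UNIV and M="\<lambda>_. borel"])
  fix A :: "nat \<Rightarrow> real set" and J :: "nat set"
  assume J: "finite J" "\<And>i. i \<in> J \<Longrightarrow> A i \<in> sets borel"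
  define X where "X = prod_emb UNIV (\<lambda>_. borel) J (Pi\<^sub>E J A)"
  \<comment> \<open>The base is enlarged by \<open>j\<close> so that the density depends on
    coordinates in \<open>K\<close> only; \<open>B\<close> leaves the added coordinate
    unconstrained.\<close>
  define K where "K = insert j J"
  define B where "B i = (if i \<in> J then A i else UNIV)" for i
  have K: "finite K" "j \<in> K" using J by (auto simp: K_def)
  have B: "B i \<in> sets borel" for i using J by (auto simp: B_def)
  have X: "y \<in> X \<longleftrightarrow> (\<forall>i\<in>K. y i \<in> B i)" for y :: "nat \<Rightarrow> real"
    by (auto simp: X_def prod_emb_def B_def K_def space_PiM)
  have "X \<in> sets (\<Pi>\<^sub>M i\<in>UNIV. borel)"
    unfolding X_def using J by (intro sets_PiM_I) auto
  then have Xs: "X \<in> sets gauss" by (simp add: sets_gauss)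
  have ind: "indicator {y. \<forall>i\<in>K. y i \<in> C i} y = (\<Prod>i\<in>K. indicator (C i) (y i) :: real)" for y :: "nat \<Rightarrow> real" and C
    using K(1) by (auto simp: indicator_def prod_zero_iff)
  define C where "C i = (if i = j then {x. x + h \<in> B j} else B i)" for i
  have Cs: "C i \<in> sets borel" for i
  proof -
    have "(\<lambda>x. x + h) -` B j \<inter> space borel \<in> sets borel"
      using B[of j] by (intro measurable_sets[of _ borel borel]) auto
    then show ?thesis using B by (auto simp: C_def vimage_def)
  qed
  have pre: "(\<lambda>y. y(j := y j + h)) -` X \<inter> space gauss = {y. \<forall>i\<in>K. y i \<in> C i}"
  proof -
    have "(\<forall>i\<in>K. (y(j := y j + h)) i \<in> B i) \<longleftrightarrow> (\<forall>i\<in>K. y i \<in> C i)" for y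
      by (intro ball_cong refl) (simp add: C_def)
    then show ?thesis by (auto simp: X)
  qed
  have "emeasure (distr gauss gauss (\<lambda>y. y(j := y j + h))) X = emeasure gauss {y. \<forall>i\<in>K. y i \<in> C i}"
    using emeasure_distr[OF fun_upd_measurable_gauss Xs, of j h] unfolding pre .
  also have "\<dots> = (\<integral>\<^sup>+y. ennreal (indicator {y. \<forall>i\<in>K. y i \<in> C i} y) \<partial>gauss)"
    using measurable_sets[OF fun_upd_measurable_gauss Xs, of j h] unfolding pre
    by (subst ennreal_indicator) (rule nn_integral_indicator[symmetric])
  also have "\<dots> = (\<Prod>i\<in>K. \<integral>\<^sup>+x. ennreal (indicator (C i) x) \<partial>normal1)"
    unfolding ind using Cs by (intro nn_integral_gauss_prod K) auto
  also have "\<dots> = (\<Prod>i\<in>K. \<integral>\<^sup>+x. ennreal ((if i = j then exp (h * x - h\<^sup>2 / 2) else 1) * indicator (B i) x) \<partial>normal1)"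
  proof (intro prod.cong refl)
    fix i
    show "(\<integral>\<^sup>+x. ennreal (indicator (C i) x) \<partial>normal1) =
        (\<integral>\<^sup>+x. ennreal ((if i = j then exp (h * x - h\<^sup>2 / 2) else 1) * indicator (B i) x) \<partial>normal1)"
    proof (cases "i = j")
      case True
      have "(\<integral>\<^sup>+x. ennreal (indicator (C j) x) \<partial>normal1) = emeasure normal1 (C j)"
        using Cs[of j] by (simp add: ennreal_indicator)
      also have "\<dots> = emeasure normal1 {x. x + h \<in> B j}" by (simp add: C_def)
      also have "\<dots> = (\<integral>\<^sup>+x. ennreal (exp (h * x - h\<^sup>2 / 2) * indicator (B j) x) \<partial>normal1)"
        by (rule emeasure_normal1_shift[OF B])
      finally show ?thesis using True by simp
    qed (simp add: C_def)
  qed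
  also have "\<dots> = (\<integral>\<^sup>+y. ennreal (\<Prod>i\<in>K. (if i = j then exp (h * y i - h\<^sup>2 / 2) else 1) * indicator (B i) (y i)) \<partial>gauss)"
    by (rule nn_integral_gauss_prod[OF K(1), symmetric]) (use B in \<open>auto intro!: borel_measurable_times\<close>)
  also have "\<dots> = (\<integral>\<^sup>+y. ennreal (exp (h * y j - h\<^sup>2 / 2)) * indicator X y \<partial>gauss)"
  proof (rule nn_integral_cong)
    fix y :: "nat \<Rightarrow> real"
    have Xeq: "X = {y. \<forall>i\<in>K. y i \<in> B i}" using X by blast
    have "(\<Prod>i\<in>K. (if i = j then exp (h * y i - h\<^sup>2 / 2) else 1) * indicator (B i) (y i))
        = exp (h * y j - h\<^sup>2 / 2) * (indicator X y :: real)"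
      unfolding prod.distrib Xeq ind using K by (simp add: prod.delta)
    then show "ennreal (\<Prod>i\<in>K. (if i = j then exp (h * y i - h\<^sup>2 / 2) else 1) * indicator (B i) (y i))
        = ennreal (exp (h * y j - h\<^sup>2 / 2)) * indicator X y"
      by (simp add: ennreal_mult'' ennreal_indicator)
  qed
  also have "\<dots> = emeasure (density gauss (\<lambda>y. ennreal (exp (h * y j - h\<^sup>2 / 2)))) X"
    using Xs by (subst emeasure_density) (auto intro!: measurable_compose[OF coordinate_measurable])
  finally show "emeasure (distr gauss gauss (\<lambda>y. y(j := y j + h))) (prod_emb UNIV (\<lambda>_. borel) J (Pi\<^sub>E J A))
      = emeasure (density gauss (\<lambda>y. ennreal (exp (h * y j - h\<^sup>2 / 2)))) (prod_emb UNIV (\<lambda>_. borel) J (Pi\<^sub>E J A))"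
    by (simp add: X_def)
next
  interpret D: prob_space "distr gauss gauss (\<lambda>y. y(j := y j + h))"
    by (rule gs.prob_space_distr) simp
  show "finite_measure (distr gauss gauss (\<lambda>y. y(j := y j + h)))"
    using D.prob_space_axioms by (simp add: prob_space_def)
qed (simp_all add: sets_gauss)

lemma gauss_shift:
  fixes F :: "(nat \<Rightarrow> real) \<Rightarrow> 'b::{banach, second_countable_topology}"
  assumes F [measurable]: "F \<in> borel_measurable gauss"
  shows integrable_gauss_shift: "integrable gauss (\<lambda>y. F (y(j := y j + h))) \<longleftrightarrow>
      integrable gauss (\<lambda>y. exp (h * y j - h\<^sup>2 / 2) *\<^sub>R F y)"
    and integral_gauss_shift: "(\<integral>y. F (y(j := y j + h)) \<partial>gauss) = (\<integral>y. exp (h * y j - h\<^sup>2 / 2) *\<^sub>R F y \<partial>gauss)"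
proof -
  have [measurable]: "(\<lambda>y. exp (h * y j - h\<^sup>2 / 2)) \<in> borel_measurable gauss"
    by (intro measurable_compose[OF coordinate_measurable]) auto
  show "integrable gauss (\<lambda>y. F (y(j := y j + h))) \<longleftrightarrow>
      integrable gauss (\<lambda>y. exp (h * y j - h\<^sup>2 / 2) *\<^sub>R F y)"
    using integrable_distr_eq[of "\<lambda>y. y(j := y j + h)" gauss gauss F]
      integrable_density[of F gauss "\<lambda>y. exp (h * y j - h\<^sup>2 / 2)"]
    unfolding distr_gauss_shift by simp
  show "(\<integral>y. F (y(j := y j + h)) \<partial>gauss) = (\<integral>y. exp (h * y j - h\<^sup>2 / 2) *\<^sub>R F y \<partial>gauss)"
    using integral_distr[of "\<lambda>y. y(j := y j + h)" gauss gauss F]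
      integral_density[of F gauss "\<lambda>y. exp (h * y j - h\<^sup>2 / 2)"]
    unfolding distr_gauss_shift by simp
qed

subsection \<open>Integrability against all exponentials of finitely many coordinates\<close>

text \<open>A shift of one coordinate changes the density by an exponential of that coordinate, so
  neither integrability nor square integrability survives it in general. Demanding all exponential
  weights makes the class stable.\<close>

definition exp_integrable :: "((nat \<Rightarrow> real) \<Rightarrow> 'b::{banach, second_countable_topology}) \<Rightarrow> bool" where
  "exp_integrable F \<longleftrightarrow> F \<in> borel_measurable gauss \<and>
    (\<forall>c J. finite J \<longrightarrow> integrable gauss (\<lambda>y. exp (c * (\<Sum>j\<in>J. \<bar>y j\<bar>)) *\<^sub>R F y))"

lemma measurable_exp_sum_gauss [measurable]:
  "(\<lambda>y. exp (c * (\<Sum>j\<in>J. \<bar>y j\<bar>))) \<in> borel_measurable gauss"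
  by measurable

lemma exp_integrable_bound:
  fixes F :: "(nat \<Rightarrow> real) \<Rightarrow> 'b::{banach, second_countable_topology}"
    and G :: "(nat \<Rightarrow> real) \<Rightarrow> 'c::{banach, second_countable_topology}"
  assumes "exp_integrable F" and [measurable]: "G \<in> borel_measurable gauss"
    and J: "finite J" and le: "\<And>y. norm (G y) \<le> C * exp (c * (\<Sum>j\<in>J. \<bar>y j\<bar>)) * norm (F y)"
  shows "integrable gauss G"
proof (rule Bochner_Integration.integrable_bound)
  show "integrable gauss (\<lambda>y. C *\<^sub>R (exp (c * (\<Sum>j\<in>J. \<bar>y j\<bar>)) *\<^sub>R F y))"
    using assms by (intro integrable_scaleR_right) (auto simp: exp_integrable_def)
  show "AE y in gauss. norm (G y) \<le> norm (C *\<^sub>R (exp (c * (\<Sum>j\<in>J. \<bar>y j\<bar>)) *\<^sub>R F y))"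
  proof (rule AE_I2)
    fix y
    have "C * exp (c * (\<Sum>j\<in>J. \<bar>y j\<bar>)) * norm (F y) \<le> \<bar>C\<bar> * exp (c * (\<Sum>j\<in>J. \<bar>y j\<bar>)) * norm (F y)"
      by (intro mult_right_mono) auto
    then show "norm (G y) \<le> norm (C *\<^sub>R (exp (c * (\<Sum>j\<in>J. \<bar>y j\<bar>)) *\<^sub>R F y))"
      using le[of y] by (auto simp only: norm_scaleR abs_exp_cancel mult.assoc)
  qed
qed simp

lemma exp_growth_prod_bound:
  assumes "finite J" "\<And>j. j \<in> J \<Longrightarrow> exp_growth (g j)"
  shows "\<exists>C c. 0 \<le> C \<and> 0 \<le> c \<and> (\<forall>y. \<bar>\<Prod>j\<in>J. g j (y j)\<bar> \<le> C * exp (c * (\<Sum>j\<in>J. \<bar>y j\<bar>)))"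
proof -
  have "\<exists>C c. \<forall>j\<in>J. 0 \<le> C j \<and> 0 \<le> c j \<and> (\<forall>x. \<bar>g j x\<bar> \<le> C j * exp (c j * \<bar>x\<bar>))"
    using assms(2) unfolding exp_growth_def by metis
  then obtain C c where *: "\<And>j. j \<in> J \<Longrightarrow> 0 \<le> C j \<and> 0 \<le> c j \<and> (\<forall>x. \<bar>g j x\<bar> \<le> C j * exp (c j * \<bar>x\<bar>))"
    by blast
  define c' where "c' = (\<Sum>j\<in>J. c j)"
  have c': "c j \<le> c'" if "j \<in> J" for j
    unfolding c'_def using assms(1) that * by (intro member_le_sum) auto
  have "\<bar>\<Prod>j\<in>J. g j (y j)\<bar> \<le> (\<Prod>j\<in>J. C j) * exp (c' * (\<Sum>j\<in>J. \<bar>y j\<bar>))" for y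
  proof -
    have "\<bar>\<Prod>j\<in>J. g j (y j)\<bar> \<le> (\<Prod>j\<in>J. C j * exp (c' * \<bar>y j\<bar>))"
      unfolding abs_prod
    proof (rule prod_mono)
      fix j assume j: "j \<in> J"
      have "C j * exp (c j * \<bar>y j\<bar>) \<le> C j * exp (c' * \<bar>y j\<bar>)"
        using *[OF j] c'[OF j] by (intro mult_left_mono) (auto intro: mult_right_mono)
      then show "0 \<le> \<bar>g j (y j)\<bar> \<and> \<bar>g j (y j)\<bar> \<le> C j * exp (c' * \<bar>y j\<bar>)"
        using *[OF j] by (meson abs_ge_zero order_trans)
    qed
    also have "\<dots> = (\<Prod>j\<in>J. C j) * exp (c' * (\<Sum>j\<in>J. \<bar>y j\<bar>))"
      using assms(1) by (simp add: prod.distrib exp_sum sum_distrib_left)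
    finally show ?thesis .
  qed
  moreover have "0 \<le> (\<Prod>j\<in>J. C j)" "0 \<le> c'"
    unfolding c'_def using * by (auto intro!: prod_nonneg sum_nonneg)
  ultimately show ?thesis by blast
qed

lemma measurable_gauss_prod:
  assumes "\<And>j. j \<in> J \<Longrightarrow> g j \<in> borel_measurable borel"
  shows "(\<lambda>y. \<Prod>j\<in>J. g j (y j) :: real) \<in> borel_measurable gauss"
  using assms by (intro borel_measurable_prod measurable_compose[OF coordinate_measurable])

lemma exp_integrable_prod:
  assumes F: "exp_integrable F" and J: "finite J" and g: "\<And>j. j \<in> J \<Longrightarrow> exp_growth (g j)"
  shows "integrable gauss (\<lambda>y. (\<Prod>j\<in>J. g j (y j)) *\<^sub>R F y)"
proof -
  obtain C c where *: "\<And>y. \<bar>\<Prod>j\<in>J. g j (y j)\<bar> \<le> C * exp (c * (\<Sum>j\<in>J. \<bar>y j\<bar>))"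
    using exp_growth_prod_bound[of J g] J g by blast
  have "(\<lambda>y. \<Prod>j\<in>J. g j (y j)) \<in> borel_measurable gauss"
    using g by (intro measurable_gauss_prod) (auto simp: exp_growth_def)
  moreover have "F \<in> borel_measurable gauss" using F by (simp add: exp_integrable_def)
  ultimately show ?thesis
    using * by (intro exp_integrable_bound[OF F _ J, where C=C and c=c]) (auto intro!: mult_right_mono)
qed

section \<open>Discrete integration by parts against product weights\<close>

definition forward_diff :: "nat \<Rightarrow> real \<Rightarrow> ((nat \<Rightarrow> real) \<Rightarrow> 'b::ab_group_add) \<Rightarrow> (nat \<Rightarrow> real) \<Rightarrow> 'b" where
  "forward_diff j h F y = F (y(j := y j + h)) - F y"

lemma exp_integrable_shift:
  assumes F: "exp_integrable F" shows "exp_integrable (\<lambda>y. F (y(j := y j + h)))"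
proof -
  have [measurable]: "F \<in> borel_measurable gauss" using F by (simp add: exp_integrable_def)
  have "integrable gauss (\<lambda>y. exp (c * (\<Sum>i\<in>J. \<bar>y i\<bar>)) *\<^sub>R F (y(j := y j + h)))" if J: "finite J" for c J
  proof -
    \<comment> \<open>The weight is composed with the inverse shift, so that \<open>G\<close> at the
      shifted point is the integrand of interest and the change of variables applies to
      \<open>G\<close>.\<close>
    define G where "G y = exp (c * (\<Sum>i\<in>J. \<bar>(y(j := y j + (- h))) i\<bar>)) *\<^sub>R F y" for y
    have fu [measurable]: "(\<lambda>y. y(j := y j + (- h))) \<in> measurable gauss gauss"
      by (rule fun_upd_measurable_gauss)
    have Gm [measurable]: "G \<in> borel_measurable gauss"
      unfolding G_def by (intro borel_measurable_scaleR measurable_compose[OF fu measurable_exp_sum_gauss]) simp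
    have "integrable gauss (\<lambda>y. exp (h * y j - h\<^sup>2 / 2) *\<^sub>R G y)"
    proof (rule exp_integrable_bound[OF F])
      show "finite (insert j J)" using J by simp
      fix y :: "nat \<Rightarrow> real"
      have 1: "(\<Sum>i\<in>J. \<bar>(y(j := y j + (- h))) i\<bar>) \<le> (\<Sum>i\<in>insert j J. \<bar>y i\<bar>) + \<bar>h\<bar>"
      proof -
        have "(\<Sum>i\<in>J. \<bar>(y(j := y j + (- h))) i\<bar>) \<le> (\<Sum>i\<in>J. \<bar>y i\<bar> + (if i = j then \<bar>h\<bar> else 0))"
          by (intro sum_mono) auto
        also have "\<dots> \<le> (\<Sum>i\<in>J. \<bar>y i\<bar>) + \<bar>h\<bar>"
          using J by (simp add: sum.distrib)
        also have "(\<Sum>i\<in>J. \<bar>y i\<bar>) \<le> (\<Sum>i\<in>insert j J. \<bar>y i\<bar>)"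
          using J by (intro sum_mono2) auto
        finally show ?thesis by simp
      qed
      have 2: "c * (\<Sum>i\<in>J. \<bar>(y(j := y j + (- h))) i\<bar>) \<le> \<bar>c\<bar> * ((\<Sum>i\<in>insert j J. \<bar>y i\<bar>) + \<bar>h\<bar>)"
        using 1 by (intro mult_mono sum_nonneg) auto
      have "h * y j \<le> \<bar>h\<bar> * \<bar>y j\<bar>" by (metis abs_ge_self abs_mult)
      also have "\<dots> \<le> \<bar>h\<bar> * (\<Sum>i\<in>insert j J. \<bar>y i\<bar>)"
        using J by (intro mult_left_mono member_le_sum) auto
      finally have 3: "h * y j - h\<^sup>2 / 2 \<le> \<bar>h\<bar> * (\<Sum>i\<in>insert j J. \<bar>y i\<bar>)"
        using zero_le_power2[of h] by linarith
      have "exp (h * y j - h\<^sup>2 / 2) * exp (c * (\<Sum>i\<in>J. \<bar>(y(j := y j + (- h))) i\<bar>))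
        \<le> exp (\<bar>h\<bar> * (\<Sum>i\<in>insert j J. \<bar>y i\<bar>)) * exp (\<bar>c\<bar> * ((\<Sum>i\<in>insert j J. \<bar>y i\<bar>) + \<bar>h\<bar>))"
        using 2 3 by (intro mult_mono) auto
      also have "\<dots> = exp (\<bar>c\<bar> * \<bar>h\<bar>) * exp ((\<bar>h\<bar> + \<bar>c\<bar>) * (\<Sum>i\<in>insert j J. \<bar>y i\<bar>))"
        by (simp add: exp_add[symmetric] algebra_simps)
      finally have "(exp (h * y j - h\<^sup>2 / 2) * exp (c * (\<Sum>i\<in>J. \<bar>(y(j := y j + (- h))) i\<bar>))) * norm (F y)
        \<le> (exp (\<bar>c\<bar> * \<bar>h\<bar>) * exp ((\<bar>h\<bar> + \<bar>c\<bar>) * (\<Sum>i\<in>insert j J. \<bar>y i\<bar>))) * norm (F y)"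
        by (rule mult_right_mono) simp
      then show "norm (exp (h * y j - h\<^sup>2 / 2) *\<^sub>R G y)
        \<le> exp (\<bar>c\<bar> * \<bar>h\<bar>) * exp ((\<bar>h\<bar> + \<bar>c\<bar>) * (\<Sum>i\<in>insert j J. \<bar>y i\<bar>)) * norm (F y)"
        by (simp add: G_def mult.assoc)
    qed (auto intro!: borel_measurable_scaleR measurable_compose[OF coordinate_measurable])
    then have "integrable gauss (\<lambda>y. G (y(j := y j + h)))"
      using integrable_gauss_shift[OF Gm, of j h] by simp
    then show ?thesis by (simp add: G_def)
  qed
  then show ?thesis by (simp add: exp_integrable_def)
qed

lemma exp_integrable_diff:
  "exp_integrable F \<Longrightarrow> exp_integrable G \<Longrightarrow> exp_integrable (\<lambda>y. F y - G y)"
  by (auto simp: exp_integrable_def scaleR_diff_right)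

lemma exp_integrable_forward_diff: "exp_integrable F \<Longrightarrow> exp_integrable (forward_diff j h F)"
  unfolding forward_diff_def[abs_def] by (intro exp_integrable_diff exp_integrable_shift)

lemma integral_prod_shift:
  assumes F: "exp_integrable F" and J: "finite J" "j \<in> J" and g: "\<And>j. exp_growth (g j)"
  shows "(\<integral>y. (\<Prod>i\<in>J. g i (y i)) *\<^sub>R F (y(j := y j + h)) \<partial>gauss) =
    (\<integral>y. (\<Prod>i\<in>J. (g(j := adjoint_shift h (g j))) i (y i)) *\<^sub>R F y \<partial>gauss)"
proof -
  define g' where "g' = g(j := (\<lambda>x. g j (x - h)))"
  have [measurable]: "F \<in> borel_measurable gauss" using F by (simp add: exp_integrable_def)
  have "g i \<in> borel_measurable borel" for i using g by (simp add: exp_growth_def)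
  then have g': "g' i \<in> borel_measurable borel" for i
    by (auto simp: g'_def)

  have "(\<integral>y. (\<Prod>i\<in>J. g i (y i)) *\<^sub>R F (y(j := y j + h)) \<partial>gauss) =
    (\<integral>y. (\<Prod>i\<in>J. g' i ((y(j := y j + h)) i)) *\<^sub>R F (y(j := y j + h)) \<partial>gauss)"
    by (intro Bochner_Integration.integral_cong refl arg_cong2[where f="(*\<^sub>R)"] prod.cong) (auto simp: g'_def)
  also have "\<dots> = (\<integral>y. exp (h * y j - h\<^sup>2 / 2) *\<^sub>R ((\<Prod>i\<in>J. g' i (y i)) *\<^sub>R F y) \<partial>gauss)"
    by (rule integral_gauss_shift[of "\<lambda>y. (\<Prod>i\<in>J. g' i (y i)) *\<^sub>R F y"])
      (auto intro!: borel_measurable_scaleR measurable_gauss_prod g')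
  also have "\<dots> = (\<integral>y. (\<Prod>i\<in>J. (g(j := adjoint_shift h (g j))) i (y i)) *\<^sub>R F y \<partial>gauss)"
  proof (intro Bochner_Integration.integral_cong refl)
    fix y
    have s: "(\<Prod>i\<in>J. (g(j := k)) i (y i)) = k (y j) * (\<Prod>i\<in>J - {j}. g i (y i))" for k
      using J by (subst prod.remove[of _ j]) (auto intro!: prod.cong)
    show "exp (h * y j - h\<^sup>2 / 2) *\<^sub>R ((\<Prod>i\<in>J. g' i (y i)) *\<^sub>R F y) =
        (\<Prod>i\<in>J. (g(j := adjoint_shift h (g j))) i (y i)) *\<^sub>R F y"
      unfolding g'_def s adjoint_shift_def by (simp add: mult_ac)
  qed
  finally show ?thesis .
qed

lemma integral_prod_forward_diff:
  assumes F: "exp_integrable F" and J: "finite J" "j \<in> J" and g: "\<And>j. exp_growth (g j)"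
  shows "(\<integral>y. (\<Prod>i\<in>J. g i (y i)) *\<^sub>R forward_diff j h F y \<partial>gauss) =
    (\<integral>y. (\<Prod>i\<in>J. (g(j := adjoint_diff h (g j))) i (y i)) *\<^sub>R F y \<partial>gauss)"
proof -
  have 1: "integrable gauss (\<lambda>y. (\<Prod>i\<in>J. g i (y i)) *\<^sub>R F (y(j := y j + h)))"
    "integrable gauss (\<lambda>y. (\<Prod>i\<in>J. g i (y i)) *\<^sub>R F y)"
    using g by (auto intro!: exp_integrable_prod exp_integrable_shift F J)
  have "exp_growth ((g(j := adjoint_shift h (g j))) i)" for i
    using g exp_growth_adjoint_shift by simp
  then have 2: "integrable gauss (\<lambda>y. (\<Prod>i\<in>J. (g(j := adjoint_shift h (g j))) i (y i)) *\<^sub>R F y)"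
    by (intro exp_integrable_prod F J)
  have split: "(\<Prod>i\<in>J. (g(j := k)) i (y i)) = k (y j) * (\<Prod>i\<in>J - {j}. g i (y i))" for k and y :: "nat \<Rightarrow> real"
    using J by (subst prod.remove[of _ j]) (auto intro!: prod.cong)
  have "(\<integral>y. (\<Prod>i\<in>J. g i (y i)) *\<^sub>R forward_diff j h F y \<partial>gauss) =
    (\<integral>y. (\<Prod>i\<in>J. g i (y i)) *\<^sub>R F (y(j := y j + h)) \<partial>gauss) - (\<integral>y. (\<Prod>i\<in>J. g i (y i)) *\<^sub>R F y \<partial>gauss)"
    using 1 by (simp add: forward_diff_def scaleR_diff_right)
  also have "\<dots> = (\<integral>y. (\<Prod>i\<in>J. (g(j := adjoint_shift h (g j))) i (y i)) *\<^sub>R F y - (\<Prod>i\<in>J. g i (y i)) *\<^sub>R F y \<partial>gauss)"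
    unfolding integral_prod_shift[OF F J g] using 1 2 by (intro Bochner_Integration.integral_diff[symmetric])
  also have "\<dots> = (\<integral>y. (\<Prod>i\<in>J. (g(j := adjoint_diff h (g j))) i (y i)) *\<^sub>R F y \<partial>gauss)"
  proof (intro Bochner_Integration.integral_cong refl)
    fix y
    have "(\<Prod>i\<in>J. g i (y i)) = g j (y j) * (\<Prod>i\<in>J - {j}. g i (y i))"
      using J by (rule prod.remove)
    then show "(\<Prod>i\<in>J. (g(j := adjoint_shift h (g j))) i (y i)) *\<^sub>R F y - (\<Prod>i\<in>J. g i (y i)) *\<^sub>R F y
        = (\<Prod>i\<in>J. (g(j := adjoint_diff h (g j))) i (y i)) *\<^sub>R F y"
      unfolding split adjoint_diff_def by (simp add: scaleR_diff_left[symmetric] left_diff_distrib)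
  qed
  finally show ?thesis .
qed

primrec forward_diffs :: "real \<Rightarrow> nat list \<Rightarrow> ((nat \<Rightarrow> real) \<Rightarrow> 'b::ab_group_add) \<Rightarrow> (nat \<Rightarrow> real) \<Rightarrow> 'b" where
  "forward_diffs h [] F = F"
| "forward_diffs h (j # js) F = forward_diff j h (forward_diffs h js F)"

lemma exp_integrable_forward_diffs: "exp_integrable F \<Longrightarrow> exp_integrable (forward_diffs h js F)"
  by (induction js) (auto intro: exp_integrable_forward_diff)

text \<open>Discrete integration by parts: every difference moves from \<open>F\<close> to the
  weight of its own coordinate. Adjoint differences in distinct coordinates act on distinct factors,
  so only the multiplicities in \<open>js\<close> remain.\<close>

lemma integral_prod_forward_diffs:
  assumes F: "exp_integrable F" and J: "finite J" "set js \<subseteq> J" and g: "\<And>j. exp_growth (g j)"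
  shows "(\<integral>y. (\<Prod>i\<in>J. g i (y i)) *\<^sub>R forward_diffs h js F y \<partial>gauss) =
    (\<integral>y. (\<Prod>i\<in>J. (adjoint_diff h ^^ count_list js i) (g i) (y i)) *\<^sub>R F y \<partial>gauss)"
  using J(2) g
proof (induction js arbitrary: g)
  case (Cons j js)
  have "(\<integral>y. (\<Prod>i\<in>J. g i (y i)) *\<^sub>R forward_diffs h (j # js) F y \<partial>gauss) =
    (\<integral>y. (\<Prod>i\<in>J. (g(j := adjoint_diff h (g j))) i (y i)) *\<^sub>R forward_diffs h js F y \<partial>gauss)"
    using Cons.prems J(1) by (simp add: integral_prod_forward_diff exp_integrable_forward_diffs F)
  also have "\<dots> = (\<integral>y. (\<Prod>i\<in>J. (adjoint_diff h ^^ count_list js i) ((g(j := adjoint_diff h (g j))) i) (y i)) *\<^sub>R F y \<partial>gauss)"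
    using Cons.prems exp_growth_adjoint_diff by (intro Cons.IH) auto
  also have "\<dots> = (\<integral>y. (\<Prod>i\<in>J. (adjoint_diff h ^^ count_list (j # js) i) (g i) (y i)) *\<^sub>R F y \<partial>gauss)"
    by (intro Bochner_Integration.integral_cong prod.cong refl arg_cong2[where f="(*\<^sub>R)"])
      (auto simp: funpow_swap1)
  finally show ?case .
qed simp

subsection \<open>Exponentials of infinitely many coordinates\<close>

text \<open>The bound has no constant in front and an exponent linear in \<open>c\<close>, so a
  product over coordinates stays bounded when the weights are summable. It comes from convexity: on
  \<open>[0, M]\<close> the exponential lies below its chord.\<close>

lemma expectation_exp_abs_normal1_le:
  assumes "0 < M"
  shows "\<exists>K\<ge>0. \<forall>c. 0 \<le> c \<longrightarrow> c \<le> M \<longrightarrow> (\<integral>x. exp (c * \<bar>x\<bar>) \<partial>normal1) \<le> exp (K * c)"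
proof -
  note N_prob = prob_space.prob_space[OF prob_space_normal1]
  define E where "E = (\<integral>x. exp (M * \<bar>x\<bar>) \<partial>normal1)"
  have "1 \<le> E"
  proof -
    have "(\<integral>x. 1 \<partial>normal1) \<le> (\<integral>x. exp (M * \<bar>x\<bar>) \<partial>normal1)"
      using \<open>0 < M\<close> by (intro integral_mono integrable_exp_abs_normal1) auto
    then show ?thesis using N_prob by (simp add: E_def)
  qed
  have "(\<integral>x. exp (c * \<bar>x\<bar>) \<partial>normal1) \<le> exp ((E - 1) / M * c)" if c: "0 \<le> c" "c \<le> M" for c
  proof -
    have "(\<integral>x. exp (c * \<bar>x\<bar>) \<partial>normal1) \<le> (\<integral>x. (1 - c / M) + c / M * exp (M * \<bar>x\<bar>) \<partial>normal1)"
    proof (intro integral_mono Bochner_Integration.integrable_add integrable_exp_abs_normal1)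
      fix x :: real
      have "exp ((1 - c / M) *\<^sub>R 0 + (c / M) *\<^sub>R (M * \<bar>x\<bar>)) \<le> (1 - c / M) * exp 0 + c / M * exp (M * \<bar>x\<bar>)"
        using exp_convex by (rule convex_onD) (use c \<open>0 < M\<close> in \<open>auto simp: field_simps\<close>)
      then show "exp (c * \<bar>x\<bar>) \<le> (1 - c / M) + c / M * exp (M * \<bar>x\<bar>)"
        using \<open>0 < M\<close> by simp
    qed (auto intro!: integrable_exp_abs_normal1 Bochner_Integration.integrable_divide integrable_mult_right)
    also have "\<dots> = 1 + (E - 1) / M * c"
      using integrable_exp_abs_normal1[of M] N_prob
      by (simp add: E_def add_divide_distrib diff_divide_distrib algebra_simps)
    also have "\<dots> \<le> exp ((E - 1) / M * c)"
      by (rule exp_ge_add_one_self)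
    finally show ?thesis .
  qed
  moreover have "0 \<le> (E - 1) / M" using \<open>1 \<le> E\<close> \<open>0 < M\<close> by simp
  ultimately show ?thesis by blast
qed

text \<open>Partial sums have exponential moments that factorize by independence and are bounded by
  \<open>exp (K * suminf c)\<close>. Monotone convergence gives a finite moment for the supremum,
  and its finiteness almost everywhere gives summability.\<close>

lemma exp_suminf_gauss:
  fixes c :: "nat \<Rightarrow> real"
  assumes c: "\<And>j. 0 \<le> c j" "summable c"
  shows AE_summable_gauss: "AE y in gauss. summable (\<lambda>j. c j * \<bar>y j\<bar>)"
    and integrable_exp_suminf_gauss: "integrable gauss (\<lambda>y. exp (\<Sum>j. c j * \<bar>y j\<bar>))"
proof -
  \<comment> \<open>A common bound of all \<open>c j\<close>; the summand \<open>1\<close> keeps it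
    positive when \<open>c\<close> vanishes.\<close>
  define M where "M = suminf c + 1"
  have "0 < M" using suminf_nonneg[OF c(2,1)] by (simp add: M_def)
  have cM: "c j \<le> M" for j
    using sum_le_suminf[OF c(2), of "{j}"] c(1) by (simp add: M_def)
  obtain K where K: "0 \<le> K" "\<And>c. 0 \<le> c \<Longrightarrow> c \<le> M \<Longrightarrow> (\<integral>x. exp (c * \<bar>x\<bar>) \<partial>normal1) \<le> exp (K * c)"
    using expectation_exp_abs_normal1_le[OF \<open>0 < M\<close>] by blast
  define S where "S n y = (\<Sum>j<n. c j * \<bar>y j\<bar>)" for n and y :: "nat \<Rightarrow> real"
  have S_mono: "S m y \<le> S n y" if "m \<le> n" for m n y
    unfolding S_def using that c(1) by (intro sum_mono2) auto
  have [measurable]: "S n \<in> borel_measurable gauss" for n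
    unfolding S_def by measurable
  have S_int: "(\<integral>\<^sup>+y. ennreal (exp (S n y)) \<partial>gauss) \<le> ennreal (exp (K * suminf c))" for n
  proof -
    have "(\<integral>\<^sup>+y. ennreal (exp (S n y)) \<partial>gauss) = (\<integral>\<^sup>+y. ennreal (\<Prod>j<n. exp (c j * \<bar>y j\<bar>)) \<partial>gauss)"
      by (simp add: S_def exp_sum)
    also have "\<dots> = (\<Prod>j<n. \<integral>\<^sup>+x. ennreal (exp (c j * \<bar>x\<bar>)) \<partial>normal1)"
      by (rule nn_integral_gauss_prod) auto
    also have "\<dots> = (\<Prod>j<n. ennreal (\<integral>x. exp (c j * \<bar>x\<bar>) \<partial>normal1))"
      by (intro prod.cong refl nn_integral_eq_integral integrable_exp_abs_normal1) auto
    also have "\<dots> \<le> (\<Prod>j<n. ennreal (exp (K * c j)))"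
      by (intro prod_mono_ennreal ennreal_leI K c cM)
    also have "\<dots> = ennreal (exp (K * (\<Sum>j<n. c j)))"
      by (simp add: prod_ennreal exp_sum sum_distrib_left)
    also have "\<dots> \<le> ennreal (exp (K * suminf c))"
      using sum_le_suminf[OF c(2), of "{..<n}"] c(1) K(1) by (auto intro!: ennreal_leI mult_left_mono)
    finally show ?thesis .
  qed
  have sup_int: "(\<integral>\<^sup>+y. (SUP n. ennreal (exp (S n y))) \<partial>gauss) \<le> ennreal (exp (K * suminf c))"
  proof -
    have "(\<integral>\<^sup>+y. (SUP n. ennreal (exp (S n y))) \<partial>gauss) = (SUP n. \<integral>\<^sup>+y. ennreal (exp (S n y)) \<partial>gauss)"
      by (rule nn_integral_monotone_convergence_SUP)
        (auto simp: incseq_def le_fun_def intro!: ennreal_leI S_mono)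
    also have "\<dots> \<le> ennreal (exp (K * suminf c))"
      using S_int by (rule SUP_least)
    finally show ?thesis .
  qed
  have "AE y in gauss. (SUP n. ennreal (exp (S n y))) \<noteq> \<infinity>"
    using sup_int by (intro nn_integral_PInf_AE) (auto simp: top_unique)
  then show AE: "AE y in gauss. summable (\<lambda>j. c j * \<bar>y j\<bar>)"
  proof eventually_elim
    fix y assume fin: "(SUP n. ennreal (exp (S n y))) \<noteq> \<infinity>"
    then obtain B where B: "(SUP n. ennreal (exp (S n y))) = ennreal B" "0 \<le> B"
      by (metis ennreal_cases infinity_ennreal_def)
    have "S n y \<le> B" for n
    proof -
      have "ennreal (exp (S n y)) \<le> ennreal B" unfolding B(1)[symmetric] by (rule SUP_upper) simp
      then have "exp (S n y) \<le> B" using B(2) by (simp add: ennreal_le_iff)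
      then show ?thesis using exp_ge_add_one_self[of "S n y"] by linarith
    qed
    then show "summable (\<lambda>j. c j * \<bar>y j\<bar>)"
      using c(1) by (intro summableI_nonneg_bounded[where x=B]) (auto simp: S_def)
  qed
  show "integrable gauss (\<lambda>y. exp (\<Sum>j. c j * \<bar>y j\<bar>))"
  proof (rule integrableI_nonneg)
    have "(\<integral>\<^sup>+y. ennreal (exp (\<Sum>j. c j * \<bar>y j\<bar>)) \<partial>gauss) \<le> (\<integral>\<^sup>+y. (SUP n. ennreal (exp (S n y))) \<partial>gauss)"
    proof (rule nn_integral_mono_AE, use AE in eventually_elim)
      fix y :: "nat \<Rightarrow> real" assume "summable (\<lambda>j. c j * \<bar>y j\<bar>)"
      then have "(\<lambda>n. S n y) \<longlonglongrightarrow> (\<Sum>j. c j * \<bar>y j\<bar>)"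
        unfolding S_def by (rule summable_LIMSEQ)
      then have "(\<lambda>n. ennreal (exp (S n y))) \<longlonglongrightarrow> ennreal (exp (\<Sum>j. c j * \<bar>y j\<bar>))"
        by (intro tendsto_ennrealI tendsto_exp)
      then show "ennreal (exp (\<Sum>j. c j * \<bar>y j\<bar>)) \<le> (SUP n. ennreal (exp (S n y)))"
        by (rule LIMSEQ_le_const2) (auto intro!: SUP_upper)
    qed
    also have "\<dots> < \<infinity>" using sup_int by (auto intro: le_less_trans)
    finally show "(\<integral>\<^sup>+y. ennreal (exp (\<Sum>j. c j * \<bar>y j\<bar>)) \<partial>gauss) < \<infinity>" .
  qed (auto intro!: borel_measurable_exp borel_measurable_suminf)
qed

subsection \<open>Orthonormality of the Hermite polynomials\<close>

lemma hermite_prod_eq: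
  assumes "finite J" "{j. \<nu> j \<noteq> 0} \<subseteq> J"
  shows "hermite_prod \<nu> y = (\<Prod>j\<in>J. hermite (\<nu> j) (y j))"
  unfolding hermite_prod_def using assms by (intro prod.mono_neutral_left) auto

lemma hermite_prod_measurable [measurable]: "hermite_prod \<nu> \<in> borel_measurable gauss"
  unfolding hermite_prod_def[abs_def] by (intro measurable_gauss_prod) simp

lemma exp_growth_mult: "exp_growth G \<Longrightarrow> exp_growth H \<Longrightarrow> exp_growth (\<lambda>x. G x * H x)"
proof -
  assume "exp_growth G" "exp_growth H"
  then obtain C c C' c' where *: "0 \<le> C" "0 \<le> c" "\<And>x. \<bar>G x\<bar> \<le> C * exp (c * \<bar>x\<bar>)"
    "0 \<le> C'" "0 \<le> c'" "\<And>x. \<bar>H x\<bar> \<le> C' * exp (c' * \<bar>x\<bar>)"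
    and [measurable]: "G \<in> borel_measurable borel" "H \<in> borel_measurable borel"
    unfolding exp_growth_def by metis
  have "\<bar>G x * H x\<bar> \<le> (C * C') * exp ((c + c') * \<bar>x\<bar>)" for x
  proof -
    have "\<bar>G x * H x\<bar> \<le> (C * exp (c * \<bar>x\<bar>)) * (C' * exp (c' * \<bar>x\<bar>))"
      unfolding abs_mult using * by (intro mult_mono) auto
    also have "\<dots> = (C * C') * exp ((c + c') * \<bar>x\<bar>)"
      by (simp add: exp_add distrib_right)
    finally show ?thesis .
  qed
  moreover have "0 \<le> C * C'" "0 \<le> c + c'" "(\<lambda>x. G x * H x) \<in> borel_measurable borel" using * by auto
  ultimately show ?thesis unfolding exp_growth_def by blast
qed

lemma hermite_prod_orthonormal:
  assumes "\<nu> \<in> multi_indices" "\<mu> \<in> multi_indices"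
  shows integrable_hermite_prod_mult: "integrable gauss (\<lambda>y. hermite_prod \<nu> y * hermite_prod \<mu> y)"
    and integral_hermite_prod_mult: "(\<integral>y. hermite_prod \<nu> y * hermite_prod \<mu> y \<partial>gauss) = (if \<nu> = \<mu> then 1 else 0)"
proof -
  define J where "J = {j. \<nu> j \<noteq> 0} \<union> {j. \<mu> j \<noteq> 0}"
  have J: "finite J" using assms by (auto simp: J_def multi_indices_def)
  have eq: "hermite_prod \<nu> y * hermite_prod \<mu> y = (\<Prod>j\<in>J. hermite (\<nu> j) (y j) * hermite (\<mu> j) (y j))" for y
    using hermite_prod_eq[OF J, of \<nu> y] hermite_prod_eq[OF J, of \<mu> y] by (auto simp: J_def prod.distrib)
  have int: "integrable normal1 (\<lambda>x. hermite (\<nu> j) x * hermite (\<mu> j) x)" for j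
    by (intro exp_growth_integrable exp_growth_mult exp_growth_hermite)
  show "integrable gauss (\<lambda>y. hermite_prod \<nu> y * hermite_prod \<mu> y)"
    unfolding eq by (rule integral_gauss_prod(1)[OF J int])
  have "(\<integral>y. hermite_prod \<nu> y * hermite_prod \<mu> y \<partial>gauss) =
      (\<Prod>j\<in>J. \<integral>x. hermite (\<nu> j) x * hermite (\<mu> j) x \<partial>normal1)"
    unfolding eq by (rule integral_gauss_prod(2)[OF J int])
  also have "\<dots> = (\<Prod>j\<in>J. if \<nu> j = \<mu> j then 1 else 0)"
    by (simp add: integral_hermite_hermite)
  also have "\<dots> = (if \<nu> = \<mu> then 1 else 0)"
  proof (cases "\<nu> = \<mu>")
    case False
    then obtain j where j: "\<nu> j \<noteq> \<mu> j" by blast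
    then have "j \<in> J" by (auto simp: J_def)
    then show ?thesis using False j J by (auto simp: prod_zero_iff)
  qed simp
  finally show "(\<integral>y. hermite_prod \<nu> y * hermite_prod \<mu> y \<partial>gauss) = (if \<nu> = \<mu> then 1 else 0)" .
qed

section \<open>Completeness of the Hermite polynomials\<close>

text \<open>The exponential series, integrated termwise, is a sum of moments. The exponential
  moments of \<open>Y\<close> against \<open>G\<close> dominate all partial sums.\<close>

lemma moments_zero_imp_char_zero:
  fixes Y G :: "'a \<Rightarrow> real"
  assumes [measurable]: "Y \<in> borel_measurable M" "G \<in> borel_measurable M"
    and exp: "\<And>c. integrable M (\<lambda>x. exp (c * \<bar>Y x\<bar>) * G x)"
    and mom: "\<And>n. (\<integral>x. Y x ^ n * G x \<partial>M) = 0"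
  shows "(\<integral>x. iexp (t * Y x) * complex_of_real (G x) \<partial>M) = 0"
proof -
  define s where "s N x = (\<Sum>n<N. (\<i> * complex_of_real (t * Y x)) ^ n /\<^sub>R fact n) * complex_of_real (G x)" for N x
  have absexp: "integrable M (\<lambda>x. exp (\<bar>t\<bar> * \<bar>Y x\<bar>) * \<bar>G x\<bar>)"
    using integrable_norm[OF exp[of "\<bar>t\<bar>"]] by (simp add: abs_mult)
  have pow_bound: "\<bar>t * Y x\<bar> ^ n / fact n \<le> exp (\<bar>t\<bar> * \<bar>Y x\<bar>)" for n x
  proof -
    have "(\<Sum>k<Suc n. \<bar>t * Y x\<bar> ^ k /\<^sub>R fact k) \<le> (\<Sum>k. \<bar>t * Y x\<bar> ^ k /\<^sub>R fact k)"
      by (rule sum_le_suminf[OF summable_exp_generic]) auto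
    moreover have "\<bar>t * Y x\<bar> ^ n /\<^sub>R fact n \<le> (\<Sum>k<Suc n. \<bar>t * Y x\<bar> ^ k /\<^sub>R fact k)"
      by (rule member_le_sum) auto
    ultimately show ?thesis by (simp add: exp_def abs_mult divide_inverse mult.commute)
  qed
  have term_int: "integrable M (\<lambda>x. (\<i> * complex_of_real (t * Y x)) ^ n /\<^sub>R fact n * complex_of_real (G x))" for n
  proof (rule Bochner_Integration.integrable_bound[OF absexp])
    show "AE x in M. norm ((\<i> * complex_of_real (t * Y x)) ^ n /\<^sub>R fact n * complex_of_real (G x))
        \<le> norm (exp (\<bar>t\<bar> * \<bar>Y x\<bar>) * \<bar>G x\<bar>)"
    proof (rule AE_I2)
      fix x
      have "norm ((\<i> * complex_of_real (t * Y x)) ^ n /\<^sub>R fact n * complex_of_real (G x)) = \<bar>t * Y x\<bar> ^ n / fact n * \<bar>G x\<bar>"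
        by (simp add: norm_mult norm_power divide_inverse mult_ac abs_mult)
      also have "\<dots> \<le> exp (\<bar>t\<bar> * \<bar>Y x\<bar>) * \<bar>G x\<bar>"
        using pow_bound by (intro mult_right_mono) auto
      finally show "norm ((\<i> * complex_of_real (t * Y x)) ^ n /\<^sub>R fact n * complex_of_real (G x))
        \<le> norm (exp (\<bar>t\<bar> * \<bar>Y x\<bar>) * \<bar>G x\<bar>)" by simp
    qed
  qed measurable
  have term_0: "(\<integral>x. (\<i> * complex_of_real (t * Y x)) ^ n /\<^sub>R fact n * complex_of_real (G x) \<partial>M) = 0" for n
  proof -
    have "(\<i> * complex_of_real (t * Y x)) ^ n /\<^sub>R fact n * complex_of_real (G x)
        = ((\<i> * complex_of_real t) ^ n /\<^sub>R fact n) * complex_of_real (Y x ^ n * G x)" for x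
      by (simp add: power_mult_distrib scaleR_conv_of_real mult_ac)
    then show ?thesis by (simp only: integral_mult_right_zero integral_complex_of_real mom) simp
  qed
  have s0: "(\<integral>x. s N x \<partial>M) = 0" for N
    unfolding s_def sum_distrib_right using term_int term_0 by (subst Bochner_Integration.integral_sum) auto
  have "(\<lambda>N. \<integral>x. s N x \<partial>M) \<longlonglongrightarrow> (\<integral>x. iexp (t * Y x) * complex_of_real (G x) \<partial>M)"
  proof (rule integral_dominated_convergence[OF _ _ absexp])
    show "(\<lambda>x. iexp (t * Y x) * complex_of_real (G x)) \<in> borel_measurable M" "\<And>i. s i \<in> borel_measurable M"
      unfolding s_def by measurable
    show "AE x in M. (\<lambda>N. s N x) \<longlonglongrightarrow> iexp (t * Y x) * complex_of_real (G x)"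
    proof (rule AE_I2)
      fix x
      have "(\<lambda>N. \<Sum>n<N. (\<i> * complex_of_real (t * Y x)) ^ n /\<^sub>R fact n) \<longlonglongrightarrow> iexp (t * Y x)"
        using exp_converges[of "\<i> * complex_of_real (t * Y x)"] by (simp add: sums_def)
      then show "(\<lambda>N. s N x) \<longlonglongrightarrow> iexp (t * Y x) * complex_of_real (G x)"
        unfolding s_def by (intro tendsto_intros)
    qed
    show "AE x in M. norm (s N x) \<le> exp (\<bar>t\<bar> * \<bar>Y x\<bar>) * \<bar>G x\<bar>" for N
    proof (rule AE_I2)
      fix x
      have "norm (\<Sum>n<N. (\<i> * complex_of_real (t * Y x)) ^ n /\<^sub>R fact n) \<le> (\<Sum>n<N. \<bar>t * Y x\<bar> ^ n /\<^sub>R fact n)"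
        by (rule sum_norm_le) (simp add: norm_mult norm_power abs_mult)
      also have "\<dots> \<le> (\<Sum>n. \<bar>t * Y x\<bar> ^ n /\<^sub>R fact n)"
        by (rule sum_le_suminf[OF summable_exp_generic]) auto
      also have "\<dots> = exp (\<bar>t\<bar> * \<bar>Y x\<bar>)" by (simp add: exp_def abs_mult)
      finally show "norm (s N x) \<le> exp (\<bar>t\<bar> * \<bar>Y x\<bar>) * \<bar>G x\<bar>"
        unfolding s_def norm_mult by (intro mult_mono) auto
    qed
  qed
  then show ?thesis unfolding s0 by (simp add: LIMSEQ_const_iff)
qed

text \<open>Levy's uniqueness theorem concerns probability distributions, so \<open>G\<close> is
  split into positive and negative parts. They have the same mass \<open>m\<close> because the
  moment of order zero vanishes; after division by \<open>m\<close> they induce distributions of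
  \<open>Y\<close> with equal characteristic functions. Mass zero is a separate case.\<close>

lemma (in finite_measure) moments_zero_imp_indicator_zero:
  fixes Y G :: "'a \<Rightarrow> real"
  assumes Y [measurable]: "Y \<in> borel_measurable M" and G [measurable]: "G \<in> borel_measurable M"
    and exp: "\<And>c. integrable M (\<lambda>x. exp (c * \<bar>Y x\<bar>) * G x)"
    and mom: "\<And>n. (\<integral>x. Y x ^ n * G x \<partial>M) = 0"
    and A [measurable]: "A \<in> sets borel"
  shows "(\<integral>x. indicator A (Y x) * G x \<partial>M) = 0"
proof -
  have Gi: "integrable M G" using exp[of 0] by simp
  define P where "P x = max 0 (G x)" for x
  define Q where "Q x = max 0 (- G x)" for x
  have PQ: "G x = P x - Q x" "0 \<le> P x" "0 \<le> Q x" for x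
    by (auto simp: P_def Q_def max_def)
  have PQi: "integrable M P" "integrable M Q"
    unfolding P_def Q_def using Gi by (auto intro!: integrable_max)
  have [measurable]: "P \<in> borel_measurable M" "Q \<in> borel_measurable M"
    unfolding P_def Q_def by measurable
  define m where "m = (\<integral>x. P x \<partial>M)"
  have mQ: "(\<integral>x. Q x \<partial>M) = m"
  proof -
    have "(\<integral>x. G x \<partial>M) = 0" using mom[of 0] by simp
    then have "(\<integral>x. P x - Q x \<partial>M) = 0" by (simp only: PQ(1)[symmetric])
    then show ?thesis using PQi by (simp add: m_def)
  qed
  have "0 \<le> m" unfolding m_def using PQ by (intro integral_nonneg_AE) auto
  have ind: "integrable M (\<lambda>x. indicator A (Y x) * R x)" if "integrable M R" for R :: "'a \<Rightarrow> real"
  proof (rule Bochner_Integration.integrable_bound[OF that])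
    show "(\<lambda>x. indicator A (Y x) * R x) \<in> borel_measurable M"
      using borel_measurable_integrable[OF that] by measurable
  qed (auto split: split_indicator)
  have split: "(\<integral>x. indicator A (Y x) * G x \<partial>M) = (\<integral>x. indicator A (Y x) * P x \<partial>M) - (\<integral>x. indicator A (Y x) * Q x \<partial>M)"
    unfolding PQ(1) right_diff_distrib by (intro Bochner_Integration.integral_diff ind PQi)
  show ?thesis
  proof (cases "m = 0")
    case True
    then have "AE x in M. P x = 0" "AE x in M. Q x = 0"
      using integral_nonneg_eq_0_iff_AE[OF PQi(1)] integral_nonneg_eq_0_iff_AE[OF PQi(2)] PQ mQ
      by (auto simp: m_def)
    then have "AE x in M. indicator A (Y x) * G x = 0"
      by eventually_elim (simp add: PQ(1))
    then show ?thesis using integral_cong_AE[of "\<lambda>x. indicator A (Y x) * G x" M "\<lambda>x. 0"] by simp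
  next
    case False
    with \<open>0 \<le> m\<close> have "0 < m" by simp
    define D where "D R = distr (density M (\<lambda>x. ennreal (R x / m))) borel Y" for R :: "'a \<Rightarrow> real"
    have D: "real_distribution (D R)" "char (D R) t = (\<integral>x. iexp (t * Y x) * complex_of_real (R x) \<partial>M) / m"
      "measure (D R) A = (\<integral>x. indicator A (Y x) * R x \<partial>M) / m"
      if R: "integrable M R" "\<And>x. 0 \<le> R x" "(\<integral>x. R x \<partial>M) = m" for R t
    proof -
      have [measurable]: "R \<in> borel_measurable M" using R(1) by simp
      have "(\<integral>\<^sup>+x. ennreal (R x / m) \<partial>M) = ennreal (\<integral>x. R x / m \<partial>M)"
        using R \<open>0 < m\<close> by (intro nn_integral_eq_integral) auto
      then have "emeasure (density M (\<lambda>x. ennreal (R x / m))) (space M) = 1"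
        using R(3) \<open>0 < m\<close> by (subst emeasure_density) (auto simp: mult_indicator_subset cong: nn_integral_cong)
      then interpret d: prob_space "density M (\<lambda>x. ennreal (R x / m))"
        by (intro prob_spaceI) simp
      interpret DR: prob_space "D R"
        unfolding D_def by (rule d.prob_space_distr) simp
      show rd: "real_distribution (D R)"
        unfolding real_distribution_def real_distribution_axioms_def
        using DR.prob_space_axioms by (simp add: D_def)
      have "char (D R) t = (\<integral>x. iexp (t * Y x) \<partial>density M (\<lambda>x. ennreal (R x / m)))"
        unfolding char_def D_def by (subst integral_distr) auto
      also have "\<dots> = (\<integral>x. (R x / m) *\<^sub>R iexp (t * Y x) \<partial>M)"
        using R(2) \<open>0 < m\<close> by (subst integral_density) auto
      also have "\<dots> = (\<integral>x. (iexp (t * Y x) * complex_of_real (R x)) / m \<partial>M)"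
        by (intro Bochner_Integration.integral_cong refl) (simp add: scaleR_conv_of_real)
      finally show "char (D R) t = (\<integral>x. iexp (t * Y x) * complex_of_real (R x) \<partial>M) / m"
        by simp
      have "measure (D R) A = (\<integral>x. indicator A x \<partial>D R)"
        by (simp add: D_def)
      also have "\<dots> = (\<integral>x. indicator A (Y x) \<partial>density M (\<lambda>x. ennreal (R x / m)))"
        unfolding D_def by (subst integral_distr) auto
      also have "\<dots> = (\<integral>x. (R x / m) *\<^sub>R indicator A (Y x) \<partial>M)"
        using R(2) \<open>0 < m\<close> by (subst integral_density) auto
      also have "\<dots> = (\<integral>x. (indicator A (Y x) * R x) / m \<partial>M)"
        by (intro Bochner_Integration.integral_cong refl) simp
      finally show "measure (D R) A = (\<integral>x. indicator A (Y x) * R x \<partial>M) / m"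
        by simp
    qed
    have cint: "integrable M (\<lambda>x. iexp (t * Y x) * complex_of_real (R x))" if "integrable M R" for R :: "'a \<Rightarrow> real" and t
    proof (rule Bochner_Integration.integrable_bound[OF that])
      show "(\<lambda>x. iexp (t * Y x) * complex_of_real (R x)) \<in> borel_measurable M"
        using borel_measurable_integrable[OF that] by measurable
    qed (auto simp: norm_mult)
    have "char (D P) t = char (D Q) t" for t
    proof -
      have "(\<integral>x. iexp (t * Y x) * complex_of_real (P x) - iexp (t * Y x) * complex_of_real (Q x) \<partial>M) = 0"
        using moments_zero_imp_char_zero[OF Y G exp mom, of t] by (simp add: PQ(1) algebra_simps)
      then show ?thesis
        using cint[OF PQi(1), of t] cint[OF PQi(2), of t] by (simp add: D PQ PQi mQ m_def[symmetric])
    qed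
    then have "D P = D Q"
      using D(1)[of P] D(1)[of Q] PQ PQi mQ m_def by (intro Levy_uniqueness) auto
    then have "measure (D P) A = measure (D Q) A" by simp
    then show ?thesis
      using \<open>0 < m\<close> split by (simp add: D PQ PQi mQ m_def[symmetric])
  qed
qed

text \<open>Young's inequality: the square of the exponential weight is integrable because it
  factorizes over \<open>J\<close>.\<close>

lemma exp_integrable_square:
  fixes F :: "(nat \<Rightarrow> real) \<Rightarrow> 'b::{banach, second_countable_topology}"
  assumes [measurable]: "F \<in> borel_measurable gauss" and F2: "integrable gauss (\<lambda>y. (norm (F y))\<^sup>2)"
  shows "exp_integrable F"
  unfolding exp_integrable_def
proof (intro conjI allI impI)
  fix c and J :: "nat set" assume J: "finite J"
  have "integrable gauss (\<lambda>y. \<Prod>j\<in>J. exp (2 * c * \<bar>y j\<bar>))"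
    by (rule integral_gauss_prod(1)[OF J integrable_exp_abs_normal1])
  moreover have "(exp (c * (\<Sum>j\<in>J. \<bar>y j\<bar>)))\<^sup>2 = (\<Prod>j\<in>J. exp (2 * c * \<bar>y j\<bar>))" for y :: "nat \<Rightarrow> real"
    using J by (simp add: exp_sum[symmetric] exp_of_nat_mult[symmetric] sum_distrib_left mult.assoc)
  ultimately have "integrable gauss (\<lambda>y. (exp (c * (\<Sum>j\<in>J. \<bar>y j\<bar>)))\<^sup>2 + (norm (F y))\<^sup>2)"
    using F2 by simp
  then show "integrable gauss (\<lambda>y. exp (c * (\<Sum>j\<in>J. \<bar>y j\<bar>)) *\<^sub>R F y)"
  proof (rule Bochner_Integration.integrable_bound)
    show "AE y in gauss. norm (exp (c * (\<Sum>j\<in>J. \<bar>y j\<bar>)) *\<^sub>R F y) \<le> norm ((exp (c * (\<Sum>j\<in>J. \<bar>y j\<bar>)))\<^sup>2 + (norm (F y))\<^sup>2)"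
    proof (rule AE_I2)
      fix y
      define a where "a = exp (c * (\<Sum>j\<in>J. \<bar>y j\<bar>))"
      have "2 * a * norm (F y) \<le> a\<^sup>2 + (norm (F y))\<^sup>2" by (rule sum_squares_bound)
      moreover have "0 \<le> a * norm (F y)" by (simp add: a_def)
      ultimately have "a * norm (F y) \<le> a\<^sup>2 + (norm (F y))\<^sup>2"
        unfolding mult.assoc by linarith
      then have "\<bar>a\<bar> * norm (F y) \<le> \<bar>a\<^sup>2 + (norm (F y))\<^sup>2\<bar>"
        by (simp add: a_def)
      then show "norm (exp (c * (\<Sum>j\<in>J. \<bar>y j\<bar>)) *\<^sub>R F y) \<le> norm ((exp (c * (\<Sum>j\<in>J. \<bar>y j\<bar>)))\<^sup>2 + (norm (F y))\<^sup>2)"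
        unfolding a_def[symmetric] norm_scaleR real_norm_def .
    qed
  qed measurable
qed (rule assms)

lemma exp_growth_indicator: "A \<in> sets borel \<Longrightarrow> exp_growth (indicator A)"
  unfolding exp_growth_def
  by (intro conjI exI[of _ "1::real"] exI[of _ "0::real"]) (auto split: split_indicator)

lemma exp_growth_exp_abs: "0 \<le> c \<Longrightarrow> exp_growth (\<lambda>x. exp (c * \<bar>x\<bar>))"
  unfolding exp_growth_def
  by (intro conjI exI[of _ "1::real"] exI[of _ c]) auto

text \<open>Hermite factors are exchanged for indicators one coordinate at a time; \<open>I\<close>
  holds the coordinates already exchanged. With all other factors frozen in
  \<open>P y * F y\<close>, orthogonality says that the moments in coordinate \<open>i\<close>
  vanish.\<close>

lemma orthogonal_hermite_imp_indicators:
  fixes F :: "(nat \<Rightarrow> real) \<Rightarrow> real"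
  assumes F: "exp_integrable F" and orth: "\<And>\<nu>. \<nu> \<in> multi_indices \<Longrightarrow> (\<integral>y. hermite_prod \<nu> y * F y \<partial>gauss) = 0"
    and I: "finite I" "finite K" "I \<subseteq> K" and A: "\<And>j. j \<in> I \<Longrightarrow> A j \<in> sets borel \<and> g j = indicator (A j)"
    and H: "\<And>j. j \<in> K - I \<Longrightarrow> g j = hermite (\<nu> j)"
  shows "(\<integral>y. (\<Prod>j\<in>K. g j (y j)) * F y \<partial>gauss) = 0"
  using I(1,3) A H
proof (induction I arbitrary: g \<nu> rule: finite_induct)
  case empty
  define \<nu>' where "\<nu>' j = (if j \<in> K then \<nu> j else 0)" for j
  have "\<nu>' \<in> multi_indices"
    using I(2) by (auto simp: multi_indices_def \<nu>'_def)
  moreover have "hermite_prod \<nu>' y = (\<Prod>j\<in>K. g j (y j))" for y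
    using empty I(2) by (subst hermite_prod_eq[of K]) (auto simp: \<nu>'_def)
  ultimately show ?case using orth[of \<nu>'] by simp
next
  case (insert i I)
  have [measurable]: "F \<in> borel_measurable gauss" using F by (simp add: exp_integrable_def)
  define P where "P y = (\<Prod>j\<in>K - {i}. g j (y j))" for y
  have iK: "i \<in> K" using insert by auto
  have gr: "exp_growth (g j)" if "j \<in> K" for j
  proof (cases "j \<in> insert i I")
    case True
    then show ?thesis using insert.prems(2)[of j] by (auto intro: exp_growth_indicator)
  next
    case False
    then show ?thesis using insert.prems(3)[of j] that exp_growth_hermite by auto
  qed
  have upd: "(\<Prod>j\<in>K. (g(i := k)) j (y j)) = k (y i) * P y" for k y
    unfolding P_def using I(2) iK by (subst prod.remove[of _ i]) (auto intro!: prod.cong)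
  have int: "integrable gauss (\<lambda>y. k (y i) * (P y * F y))" if "exp_growth k" for k
  proof -
    have "integrable gauss (\<lambda>y. (\<Prod>j\<in>K. (g(i := k)) j (y j)) *\<^sub>R F y)"
      using gr that by (intro exp_integrable_prod F I) auto
    then show ?thesis unfolding upd real_scaleR_def mult.assoc .
  qed
  have "(\<integral>y. indicator (A i) (y i) * (P y * F y) \<partial>gauss) = 0"
  proof (rule gs.moments_zero_imp_indicator_zero)
    show "(\<lambda>y. P y * F y) \<in> borel_measurable gauss"
      unfolding P_def using gr by (intro borel_measurable_times measurable_gauss_prod) (auto simp: exp_growth_def)
    show "integrable gauss (\<lambda>y. exp (c * \<bar>y i\<bar>) * (P y * F y))" for c
    proof (rule Bochner_Integration.integrable_bound)
      show "integrable gauss (\<lambda>y. exp (\<bar>c\<bar> * \<bar>y i\<bar>) * (P y * F y))"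
        by (rule int[OF exp_growth_exp_abs]) simp
      show "(\<lambda>y. exp (c * \<bar>y i\<bar>) * (P y * F y)) \<in> borel_measurable gauss"
        using \<open>(\<lambda>y. P y * F y) \<in> borel_measurable gauss\<close> by measurable
      show "AE y in gauss. norm (exp (c * \<bar>y i\<bar>) * (P y * F y)) \<le> norm (exp (\<bar>c\<bar> * \<bar>y i\<bar>) * (P y * F y))"
        unfolding norm_mult by (intro AE_I2 mult_right_mono) (auto intro: mult_right_mono)
    qed
    fix n
    obtain c where c: "\<And>x. x ^ n = (\<Sum>k\<le>n. c k * poly (He k) x)" using monom_eq_He_sum[of n] by blast
    have c': "x ^ n = (\<Sum>k\<le>n. (c k * sqrt (fact k)) * hermite k x)" for x
      unfolding c by (intro sum.cong refl) (simp add: hermite_eq_poly)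
    have "(\<integral>y. y i ^ n * (P y * F y) \<partial>gauss) = (\<integral>y. (\<Sum>k\<le>n. (c k * sqrt (fact k)) * (hermite k (y i) * (P y * F y))) \<partial>gauss)"
      unfolding c' by (simp add: sum_distrib_right mult.assoc)
    also have "\<dots> = (\<Sum>k\<le>n. (c k * sqrt (fact k)) * (\<integral>y. hermite k (y i) * (P y * F y) \<partial>gauss))"
      by (subst Bochner_Integration.integral_sum) (auto intro!: int exp_growth_hermite)
    also have "\<dots> = 0"
    proof (intro sum.neutral ballI)
      fix k
      \<comment> \<open>Putting a Hermite polynomial back in coordinate \<open>i\<close> leaves one
        indicator fewer, which is the situation of the induction hypothesis.\<close>
      have "(\<integral>y. (\<Prod>j\<in>K. (g(i := hermite k)) j (y j)) * F y \<partial>gauss) = 0"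
        by (rule insert.IH[of "g(i := hermite k)" "\<nu>(i := k)"]) (use insert in auto)
      then show "(c k * sqrt (fact k)) * (\<integral>y. hermite k (y i) * (P y * F y) \<partial>gauss) = 0"
        unfolding upd mult.assoc by simp
    qed
    finally show "(\<integral>y. y i ^ n * (P y * F y) \<partial>gauss) = 0" .
  qed (use insert.prems(2)[of i] in \<open>auto intro: coordinate_measurable\<close>)
  moreover have "(\<Prod>j\<in>K. g j (y j)) = indicator (A i) (y i) * P y" for y
    using upd[of "g i" y] insert.prems(2)[of i] unfolding fun_upd_triv by simp
  ultimately show ?case by (simp add: mult.assoc)
qed

text \<open>The positive and negative parts of \<open>F\<close> define finite measures that agree on
  cylinder sets by the preceding lemma, hence everywhere; so their densities agree.\<close>

theorem hermite_complete:
  fixes F :: "(nat \<Rightarrow> real) \<Rightarrow> real"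
  assumes F: "exp_integrable F" and orth: "\<And>\<nu>. \<nu> \<in> multi_indices \<Longrightarrow> (\<integral>y. hermite_prod \<nu> y * F y \<partial>gauss) = 0"
  shows "AE y in gauss. F y = 0"
proof -
  have [measurable]: "F \<in> borel_measurable gauss" using F by (simp add: exp_integrable_def)
  have Fi: "integrable gauss F"
    using F unfolding exp_integrable_def by (auto dest!: spec[of _ 0] spec[of _ "{}"])
  define P where "P y = max 0 (F y)" for y
  define Q where "Q y = max 0 (- F y)" for y
  have PQ: "F y = P y - Q y" "0 \<le> P y" "0 \<le> Q y" for y
    by (auto simp: P_def Q_def max_def)
  have PQi: "integrable gauss P" "integrable gauss Q"
    unfolding P_def Q_def using Fi by (auto intro!: integrable_max)
  have [measurable]: "P \<in> borel_measurable gauss" "Q \<in> borel_measurable gauss"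
    unfolding P_def Q_def by measurable
  have "density gauss P = density gauss Q"
  proof (rule measure_eqI_PiM_infinite[where I=UNIV and M="\<lambda>_. borel"])
    fix A :: "nat \<Rightarrow> real set" and J :: "nat set"
    assume J: "finite J" "\<And>i. i \<in> J \<Longrightarrow> A i \<in> sets borel"
    define X where "X = prod_emb UNIV (\<lambda>_. borel) J (Pi\<^sub>E J A)"
    have "X \<in> sets (\<Pi>\<^sub>M i\<in>UNIV. borel)"
      unfolding X_def using J by (intro sets_PiM_I) auto
    then have Xs [measurable]: "X \<in> sets gauss" by (simp add: sets_gauss)
    have X: "indicator X y = (\<Prod>j\<in>J. indicator (A j) (y j) :: real)" for y
    proof (cases "\<forall>j\<in>J. y j \<in> A j")
      case True
      then have "(\<Prod>j\<in>J. indicator (A j) (y j) :: real) = 1" by (intro prod.neutral) simp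
      then show ?thesis using True by (auto simp: X_def prod_emb_def space_PiM)
    next
      case False
      then obtain j where "j \<in> J" "y j \<notin> A j" by blast
      then have "(\<Prod>j\<in>J. indicator (A j) (y j) :: real) = 0"
        using J(1) by (intro prod_zero bexI[of _ j]) auto
      then show ?thesis using False by (auto simp: X_def prod_emb_def space_PiM PiE_iff)
    qed
    have "(\<integral>y. indicator X y * F y \<partial>gauss) = 0"
      unfolding X by (rule orthogonal_hermite_imp_indicators[OF F orth J(1) J(1), of A]) (use J in auto)
    then have "(\<integral>y. indicator X y * P y \<partial>gauss) - (\<integral>y. indicator X y * Q y \<partial>gauss) = 0"
      using PQi by (subst Bochner_Integration.integral_diff[symmetric])
        (auto simp: PQ(1) right_diff_distrib intro!: integrable_real_mult_indicator[unfolded mult.commute[of _ "indicator _ _"]])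
    then have eq: "(\<integral>y. indicator X y * P y \<partial>gauss) = (\<integral>y. indicator X y * Q y \<partial>gauss)" by simp
    have dens: "emeasure (density gauss (\<lambda>y. ennreal (R y))) X = ennreal (\<integral>y. indicator X y * R y \<partial>gauss)"
      if R: "integrable gauss R" "\<And>y. 0 \<le> R y" for R :: "(nat \<Rightarrow> real) \<Rightarrow> real"
    proof -
      have "emeasure (density gauss (\<lambda>y. ennreal (R y))) X = (\<integral>\<^sup>+y. ennreal (indicator X y * R y) \<partial>gauss)"
        using R Xs by (subst emeasure_density) (auto intro!: nn_integral_cong split: split_indicator)
      also have "\<dots> = ennreal (\<integral>y. indicator X y * R y \<partial>gauss)"
        using R by (intro nn_integral_eq_integral)
          (auto intro!: integrable_real_mult_indicator[unfolded mult.commute[of _ "indicator _ _"]])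
      finally show ?thesis .
    qed
    show "emeasure (density gauss (\<lambda>y. ennreal (P y))) (prod_emb UNIV (\<lambda>_. borel) J (Pi\<^sub>E J A))
      = emeasure (density gauss (\<lambda>y. ennreal (Q y))) (prod_emb UNIV (\<lambda>_. borel) J (Pi\<^sub>E J A))"
      unfolding X_def[symmetric] using eq by (simp add: dens PQ PQi)
  next
    show "finite_measure (density gauss (\<lambda>y. ennreal (P y)))"
    proof (rule finite_measureI)
      have "emeasure (density gauss (\<lambda>y. ennreal (P y))) UNIV = (\<integral>\<^sup>+y. ennreal (P y) \<partial>gauss)"
        by (subst emeasure_density) (auto simp: sets.top[of gauss, simplified])
      also have "\<dots> < \<infinity>" using PQi(1) PQ(2) by (simp add: integrable_iff_bounded)
      finally show "emeasure (density gauss (\<lambda>y. ennreal (P y))) (space (density gauss (\<lambda>y. ennreal (P y)))) \<noteq> \<infinity>"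
        by simp
    qed
  qed (simp_all add: sets_gauss)
  then have "AE y in gauss. ennreal (P y) = ennreal (Q y)"
    by (intro gs.density_unique) auto
  then show ?thesis
    by eventually_elim (use PQ in auto)
qed

subsection \<open>Hermite expansions of Hilbert space valued functions\<close>

lemma square_integrable_gauss_mult:
  fixes F :: "(nat \<Rightarrow> real) \<Rightarrow> 'b::{banach, second_countable_topology}" and h :: "(nat \<Rightarrow> real) \<Rightarrow> real"
  assumes [measurable]: "F \<in> borel_measurable gauss" "h \<in> borel_measurable gauss"
    and F: "integrable gauss (\<lambda>y. (norm (F y))\<^sup>2)" and h: "integrable gauss (\<lambda>y. (h y)\<^sup>2)"
  shows "integrable gauss (\<lambda>y. h y *\<^sub>R F y)"
proof (rule Bochner_Integration.integrable_bound)
  show "integrable gauss (\<lambda>y. (h y)\<^sup>2 + (norm (F y))\<^sup>2)"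
    using F h by simp
  show "AE y in gauss. norm (h y *\<^sub>R F y) \<le> norm ((h y)\<^sup>2 + (norm (F y))\<^sup>2)"
  proof (rule AE_I2)
    fix y
    have "2 * \<bar>h y\<bar> * norm (F y) \<le> \<bar>h y\<bar>\<^sup>2 + (norm (F y))\<^sup>2" by (rule sum_squares_bound)
    moreover have "0 \<le> \<bar>h y\<bar> * norm (F y)" by simp
    ultimately have "\<bar>h y\<bar> * norm (F y) \<le> \<bar>h y\<bar>\<^sup>2 + (norm (F y))\<^sup>2"
      unfolding mult.assoc by linarith
    then show "norm (h y *\<^sub>R F y) \<le> norm ((h y)\<^sup>2 + (norm (F y))\<^sup>2)" by simp
  qed
qed measurable

lemma square_integrable_gauss_diff:
  fixes F G :: "(nat \<Rightarrow> real) \<Rightarrow> 'b::{banach, second_countable_topology}"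
  assumes [measurable]: "F \<in> borel_measurable gauss" "G \<in> borel_measurable gauss"
    and F: "integrable gauss (\<lambda>y. (norm (F y))\<^sup>2)" and G: "integrable gauss (\<lambda>y. (norm (G y))\<^sup>2)"
  shows "integrable gauss (\<lambda>y. (norm (F y - G y))\<^sup>2)"
proof (rule Bochner_Integration.integrable_bound)
  show "integrable gauss (\<lambda>y. 2 * (norm (F y))\<^sup>2 + 2 * (norm (G y))\<^sup>2)"
    using F G by simp
  show "AE y in gauss. norm ((norm (F y - G y))\<^sup>2) \<le> norm (2 * (norm (F y))\<^sup>2 + 2 * (norm (G y))\<^sup>2)"
  proof (rule AE_I2)
    fix y
    have "(norm (F y - G y))\<^sup>2 \<le> (norm (F y) + norm (G y))\<^sup>2"
      by (intro power_mono norm_triangle_ineq4) simp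
    also have "\<dots> \<le> 2 * (norm (F y))\<^sup>2 + 2 * (norm (G y))\<^sup>2"
      using sum_squares_bound[of "norm (F y)" "norm (G y)"] by (simp add: power2_sum)
    finally show "norm ((norm (F y - G y))\<^sup>2) \<le> norm (2 * (norm (F y))\<^sup>2 + 2 * (norm (G y))\<^sup>2)"
      by simp
  qed
qed measurable

text \<open>Eventually instantiated with the gradient \<open>snd (u y)\<close>, whose Hilbert norm
  is the V norm; the expansion theorem also instantiates it with remainders of
  \<open>U\<close>.\<close>

locale gauss_L2 =
  fixes U :: "(nat \<Rightarrow> real) \<Rightarrow> 'b::{real_inner, banach, second_countable_topology}"
  assumes U_meas [measurable]: "U \<in> borel_measurable gauss"
    and U_sq: "integrable gauss (\<lambda>y. (norm (U y))\<^sup>2)"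
begin

definition coef :: "(nat \<Rightarrow> nat) \<Rightarrow> 'b" where
  "coef \<nu> = (\<integral>y. hermite_prod \<nu> y *\<^sub>R U y \<partial>gauss)"

definition psum :: "(nat \<Rightarrow> nat) set \<Rightarrow> (nat \<Rightarrow> real) \<Rightarrow> 'b" where
  "psum \<Lambda> y = (\<Sum>\<nu>\<in>\<Lambda>. hermite_prod \<nu> y *\<^sub>R coef \<nu>)"

lemma psum_measurable [measurable]: "psum \<Lambda> \<in> borel_measurable gauss"
  unfolding psum_def[abs_def] by measurable

lemma integrable_hermite_prod_sq: "\<nu> \<in> multi_indices \<Longrightarrow> integrable gauss (\<lambda>y. (hermite_prod \<nu> y)\<^sup>2)"
  using integrable_hermite_prod_mult[of \<nu> \<nu>] by (simp add: power2_eq_square)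

lemma integrable_hermite_prod_U: "\<nu> \<in> multi_indices \<Longrightarrow> integrable gauss (\<lambda>y. hermite_prod \<nu> y *\<^sub>R U y)"
  by (intro square_integrable_gauss_mult U_sq integrable_hermite_prod_sq) simp_all

lemma psum_inner:
  "psum \<Lambda> y \<bullet> psum \<Lambda>' y = (\<Sum>\<nu>\<in>\<Lambda>. \<Sum>\<mu>\<in>\<Lambda>'. (hermite_prod \<nu> y * hermite_prod \<mu> y) * (coef \<nu> \<bullet> coef \<mu>))"
  unfolding psum_def inner_sum_left inner_sum_right by (subst sum.swap) (simp add: mult_ac)

lemma psum_norm_sq:
  assumes "finite \<Lambda>" "\<Lambda> \<subseteq> multi_indices"
  shows "integrable gauss (\<lambda>y. (norm (psum \<Lambda> y))\<^sup>2)"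
    and "(\<integral>y. (norm (psum \<Lambda> y))\<^sup>2 \<partial>gauss) = (\<Sum>\<nu>\<in>\<Lambda>. (norm (coef \<nu>))\<^sup>2)"
proof -
  have int: "integrable gauss (\<lambda>y. (hermite_prod \<nu> y * hermite_prod \<mu> y) * (coef \<nu> \<bullet> coef \<mu>))"
    if "\<nu> \<in> \<Lambda>" "\<mu> \<in> \<Lambda>" for \<nu> \<mu>
    using that assms by (intro integrable_mult_left integrable_hermite_prod_mult) auto
  show "integrable gauss (\<lambda>y. (norm (psum \<Lambda> y))\<^sup>2)"
    unfolding power2_norm_eq_inner psum_inner using int by (intro Bochner_Integration.integrable_sum)
  have "(\<integral>y. (norm (psum \<Lambda> y))\<^sup>2 \<partial>gauss)
      = (\<Sum>\<nu>\<in>\<Lambda>. \<Sum>\<mu>\<in>\<Lambda>. (\<integral>y. hermite_prod \<nu> y * hermite_prod \<mu> y \<partial>gauss) * (coef \<nu> \<bullet> coef \<mu>))"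
    unfolding power2_norm_eq_inner psum_inner using int
    by (subst Bochner_Integration.integral_sum; (intro Bochner_Integration.integrable_sum; assumption)?)
      (auto intro!: sum.cong simp: Bochner_Integration.integral_sum)
  also have "\<dots> = (\<Sum>\<nu>\<in>\<Lambda>. \<Sum>\<mu>\<in>\<Lambda>. if \<nu> = \<mu> then coef \<nu> \<bullet> coef \<mu> else 0)"
    using assms by (intro sum.cong refl) (subst integral_hermite_prod_mult, auto)
  also have "\<dots> = (\<Sum>\<nu>\<in>\<Lambda>. (norm (coef \<nu>))\<^sup>2)"
    using assms by (intro sum.cong refl) (simp add: power2_norm_eq_inner)
  finally show "(\<integral>y. (norm (psum \<Lambda> y))\<^sup>2 \<partial>gauss) = (\<Sum>\<nu>\<in>\<Lambda>. (norm (coef \<nu>))\<^sup>2)" .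
qed

lemma psum_error:
  assumes \<Lambda>: "finite \<Lambda>" "\<Lambda> \<subseteq> multi_indices"
  shows psum_error_integrable: "integrable gauss (\<lambda>y. (norm (U y - psum \<Lambda> y))\<^sup>2)"
    and psum_error_eq: "(\<integral>y. (norm (U y - psum \<Lambda> y))\<^sup>2 \<partial>gauss)
      = (\<integral>y. (norm (U y))\<^sup>2 \<partial>gauss) - (\<Sum>\<nu>\<in>\<Lambda>. (norm (coef \<nu>))\<^sup>2)"
proof -
  show "integrable gauss (\<lambda>y. (norm (U y - psum \<Lambda> y))\<^sup>2)"
    by (intro square_integrable_gauss_diff U_sq psum_norm_sq \<Lambda>) simp_all
  have U\<nu>: "integrable gauss (\<lambda>y. (hermite_prod \<nu> y *\<^sub>R U y) \<bullet> coef \<nu>)"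
    "(\<integral>y. (hermite_prod \<nu> y *\<^sub>R U y) \<bullet> coef \<nu> \<partial>gauss) = (norm (coef \<nu>))\<^sup>2" if "\<nu> \<in> \<Lambda>" for \<nu>
  proof -
    have "integrable gauss (\<lambda>y. hermite_prod \<nu> y *\<^sub>R U y)"
      using that \<Lambda> by (intro integrable_hermite_prod_U) auto
    then show "integrable gauss (\<lambda>y. (hermite_prod \<nu> y *\<^sub>R U y) \<bullet> coef \<nu>)"
      "(\<integral>y. (hermite_prod \<nu> y *\<^sub>R U y) \<bullet> coef \<nu> \<partial>gauss) = (norm (coef \<nu>))\<^sup>2"
      by (simp_all only: integrable_inner_left integral_inner_left coef_def[symmetric] power2_norm_eq_inner)
  qed
  have cross: "U y \<bullet> psum \<Lambda> y = (\<Sum>\<nu>\<in>\<Lambda>. (hermite_prod \<nu> y *\<^sub>R U y) \<bullet> coef \<nu>)" for y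
    by (simp add: psum_def inner_sum_right)
  have ci: "integrable gauss (\<lambda>y. U y \<bullet> psum \<Lambda> y)"
    unfolding cross using U\<nu> by (intro Bochner_Integration.integrable_sum)
  have cI: "(\<integral>y. U y \<bullet> psum \<Lambda> y \<partial>gauss) = (\<Sum>\<nu>\<in>\<Lambda>. (norm (coef \<nu>))\<^sup>2)"
    unfolding cross using U\<nu> by (subst Bochner_Integration.integral_sum) auto
  have "(norm (U y - psum \<Lambda> y))\<^sup>2 = (norm (U y))\<^sup>2 + (norm (psum \<Lambda> y))\<^sup>2 - 2 * (U y \<bullet> psum \<Lambda> y)" for y
    by (simp add: power2_norm_eq_inner inner_diff inner_commute)
  then have "(\<integral>y. (norm (U y - psum \<Lambda> y))\<^sup>2 \<partial>gauss)
      = (\<integral>y. (norm (U y))\<^sup>2 \<partial>gauss) + (\<integral>y. (norm (psum \<Lambda> y))\<^sup>2 \<partial>gauss) - 2 * (\<integral>y. U y \<bullet> psum \<Lambda> y \<partial>gauss)"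
    using ci U_sq psum_norm_sq(1)[OF \<Lambda>] by simp
  then show "(\<integral>y. (norm (U y - psum \<Lambda> y))\<^sup>2 \<partial>gauss)
      = (\<integral>y. (norm (U y))\<^sup>2 \<partial>gauss) - (\<Sum>\<nu>\<in>\<Lambda>. (norm (coef \<nu>))\<^sup>2)"
    using psum_norm_sq(2)[OF \<Lambda>] cI by simp
qed

lemma bessel:
  assumes "finite \<Lambda>" "\<Lambda> \<subseteq> multi_indices"
  shows "(\<Sum>\<nu>\<in>\<Lambda>. (norm (coef \<nu>))\<^sup>2) \<le> (\<integral>y. (norm (U y))\<^sup>2 \<partial>gauss)"
proof -
  have "0 \<le> (\<integral>y. (norm (U y - psum \<Lambda> y))\<^sup>2 \<partial>gauss)" by simp
  then show ?thesis unfolding psum_error_eq[OF assms] by simp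
qed

lemma norm_coef_le:
  assumes "\<nu> \<in> multi_indices"
  shows "(norm (coef \<nu>))\<^sup>2 \<le> (\<integral>y. (norm (U y))\<^sup>2 \<partial>gauss)"
  using bessel[of "{\<nu>}"] assms by simp

text \<open>Reduction to the scalar case by testing with a countable dense set \<open>D\<close>, so
  that the exceptional null sets can be united. A nonzero value would have positive inner product
  with an open, nonempty set of vectors.\<close>

lemma coef_eq_0_imp_AE_0:
  assumes 0: "\<And>\<nu>. \<nu> \<in> multi_indices \<Longrightarrow> coef \<nu> = 0"
  shows "AE y in gauss. U y = 0"
proof -
  obtain D :: "'b set" where D: "countable D" "\<And>X. open X \<Longrightarrow> X \<noteq> {} \<Longrightarrow> \<exists>d\<in>D. d \<in> X"
    using countable_dense_setE by blast
  have "AE y in gauss. U y \<bullet> d = 0" for d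
  proof (rule hermite_complete)
    show "exp_integrable (\<lambda>y. U y \<bullet> d)"
    proof (rule exp_integrable_square)
      show "integrable gauss (\<lambda>y. (norm (U y \<bullet> d))\<^sup>2)"
      proof (rule Bochner_Integration.integrable_bound)
        show "integrable gauss (\<lambda>y. (norm d)\<^sup>2 * (norm (U y))\<^sup>2)" using U_sq by simp
        show "AE y in gauss. norm ((norm (U y \<bullet> d))\<^sup>2) \<le> norm ((norm d)\<^sup>2 * (norm (U y))\<^sup>2)"
        proof (rule AE_I2)
          fix y
          have "(norm (U y \<bullet> d))\<^sup>2 \<le> (norm (U y) * norm d)\<^sup>2"
            by (intro power_mono) (auto intro: Cauchy_Schwarz_ineq2)
          then show "norm ((norm (U y \<bullet> d))\<^sup>2) \<le> norm ((norm d)\<^sup>2 * (norm (U y))\<^sup>2)"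
            by (simp add: power_mult_distrib mult.commute)
        qed
      qed measurable
    qed measurable
    fix \<nu> assume \<nu>: "\<nu> \<in> multi_indices"
    have "(\<integral>y. hermite_prod \<nu> y * (U y \<bullet> d) \<partial>gauss) = (\<integral>y. (hermite_prod \<nu> y *\<^sub>R U y) \<bullet> d \<partial>gauss)"
      by simp
    also have "\<dots> = coef \<nu> \<bullet> d"
      unfolding coef_def using integrable_hermite_prod_U[OF \<nu>] by (intro integral_inner_left)
    finally show "(\<integral>y. hermite_prod \<nu> y * (U y \<bullet> d) \<partial>gauss) = 0"
      using 0[OF \<nu>] by simp
  qed
  then have "AE y in gauss. \<forall>d\<in>D. U y \<bullet> d = 0"
    using D(1) by (subst AE_ball_countable) auto
  then show ?thesis
  proof eventually_elim
    fix y assume *: "\<forall>d\<in>D. U y \<bullet> d = 0"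
    show "U y = 0"
    proof (rule ccontr)
      assume "U y \<noteq> 0"
      then have "U y \<in> {z. 0 < U y \<bullet> z}" by simp
      moreover have "open {z. 0 < U y \<bullet> z}"
        by (intro open_Collect_less continuous_intros)
      ultimately show False using D(2)[of "{z. 0 < U y \<bullet> z}"] * by fastforce
    qed
  qed
qed

text \<open>A Riesz-Fischer argument: index sets that nearly exhaust the supremum \<open>s\<close>
  of the coefficient sums give partial sums converging fast to some \<open>W\<close>, and
  \<open>U - W\<close> vanishes because all its coefficients do.\<close>

theorem hermite_expansion_dense:
  assumes "0 < \<epsilon>"
  shows "\<exists>\<Lambda>. finite \<Lambda> \<and> \<Lambda> \<subseteq> multi_indices \<and> (\<integral>y. (norm (U y - psum \<Lambda> y))\<^sup>2 \<partial>gauss) < \<epsilon>"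
proof -
  define \<F> where "\<F> = {\<Lambda>. finite \<Lambda> \<and> \<Lambda> \<subseteq> (multi_indices :: (nat \<Rightarrow> nat) set)}"
  define q where "q \<Lambda> = (\<Sum>\<nu>\<in>\<Lambda>. (norm (coef \<nu>))\<^sup>2)" for \<Lambda>
  define s where "s = (SUP \<Lambda>\<in>\<F>. q \<Lambda>)"
  have bdd: "bdd_above (q ` \<F>)"
    using bessel by (intro bdd_aboveI[of _ "\<integral>y. (norm (U y))\<^sup>2 \<partial>gauss"]) (auto simp: q_def \<F>_def)
  have q_le: "q \<Lambda> \<le> s" if "\<Lambda> \<in> \<F>" for \<Lambda>
    unfolding s_def by (rule cSUP_upper[OF that bdd])
  have ne: "{} \<in> \<F>" by (simp add: \<F>_def)
  have q_mono: "q \<Lambda> \<le> q \<Lambda>'" if "\<Lambda> \<subseteq> \<Lambda>'" "\<Lambda>' \<in> \<F>" for \<Lambda> \<Lambda>'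
    unfolding q_def using that by (intro sum_mono2) (auto simp: \<F>_def)
  \<comment> \<open>A defect \<open>(1/4) ^ n\<close> in the sum of squares becomes an L^2 distance
    \<open>(1/2) ^ n\<close>, which is summable.\<close>
  have "\<exists>\<Lambda>\<in>\<F>. s - (1/4) ^ n < q \<Lambda>" for n
  proof -
    have "s - (1/4) ^ n < s" by simp
    then show ?thesis unfolding s_def using less_cSUP_iff[OF _ bdd] ne by blast
  qed
  then obtain L where L: "\<And>n. L n \<in> \<F>" "\<And>n. s - (1/4) ^ n < q (L n)" by metis
  define \<Lambda> where "\<Lambda> n = (\<Union>k\<le>n. L k)" for n
  have \<Lambda>F: "\<Lambda> n \<in> \<F>" for n using L(1) by (auto simp: \<Lambda>_def \<F>_def)
  have \<Lambda>: "finite (\<Lambda> n)" "\<Lambda> n \<subseteq> multi_indices" for n using \<Lambda>F by (auto simp: \<F>_def)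
  have \<Lambda>_mono: "\<Lambda> m \<subseteq> \<Lambda> n" if "m \<le> n" for m n
    unfolding \<Lambda>_def using that by (intro UN_mono) auto
  have \<Lambda>q: "s - (1/4) ^ n < q (\<Lambda> n)" for n
  proof -
    have "L n \<subseteq> \<Lambda> n" by (auto simp: \<Lambda>_def)
    then show ?thesis using L(2)[of n] q_mono[OF _ \<Lambda>F, of "L n" n] by linarith
  qed
  have q_diff: "q (\<Lambda>' - \<Lambda> n) \<le> (1/4) ^ n" if "\<Lambda>' \<in> \<F>" for n \<Lambda>'
  proof -
    have "q (\<Lambda>' \<union> \<Lambda> n) = q (\<Lambda>' - \<Lambda> n) + q (\<Lambda> n)"
      unfolding q_def using that \<Lambda> by (subst sum.union_disjoint[symmetric]) (auto simp: \<F>_def intro!: sum.cong)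
    moreover have "q (\<Lambda>' \<union> \<Lambda> n) \<le> s"
      using that \<Lambda>F by (intro q_le) (auto simp: \<F>_def)
    ultimately show ?thesis using \<Lambda>q[of n] by linarith
  qed
  define S where "S n = psum (\<Lambda> n)" for n
  have [measurable]: "S n \<in> borel_measurable gauss" for n by (simp add: S_def)
  have S_diff: "S m y - S n y = psum (\<Lambda> m - \<Lambda> n) y" if "n \<le> m" for m n y
    unfolding S_def psum_def using \<Lambda>_mono[OF that] \<Lambda> by (simp add: sum_diff)
  have S_dist: "integrable gauss (\<lambda>y. (norm (S m y - S n y))\<^sup>2)"
    "(\<integral>y. (norm (S m y - S n y))\<^sup>2 \<partial>gauss) \<le> (1/4) ^ n" if "n \<le> m" for m n
  proof -
    have *: "finite (\<Lambda> m - \<Lambda> n)" "\<Lambda> m - \<Lambda> n \<subseteq> multi_indices" using \<Lambda> by auto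
    show "integrable gauss (\<lambda>y. (norm (S m y - S n y))\<^sup>2)"
      unfolding S_diff[OF that] by (rule psum_norm_sq(1)[OF *])
    show "(\<integral>y. (norm (S m y - S n y))\<^sup>2 \<partial>gauss) \<le> (1/4) ^ n"
      unfolding S_diff[OF that] psum_norm_sq(2)[OF *] using q_diff[OF \<Lambda>F] by (simp add: q_def)
  qed
  define d where "d n y = norm (S (Suc n) y - S n y)" for n y
  have [measurable]: "d n \<in> borel_measurable gauss" for n unfolding d_def by measurable
  have "(\<integral>\<^sup>+y. (\<Sum>n. ennreal (d n y)) \<partial>gauss) = (\<Sum>n. \<integral>\<^sup>+y. ennreal (d n y) \<partial>gauss)"
    by (rule nn_integral_suminf) measurable
  also have "\<dots> \<le> (\<Sum>n. ennreal ((1/2) ^ n))"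
  proof (rule suminf_le)
    fix n
    have sq: "integrable gauss (\<lambda>y. (d n y)\<^sup>2)" "(\<integral>y. (d n y)\<^sup>2 \<partial>gauss) \<le> ((1/2) ^ n)\<^sup>2"
      using S_dist[of n "Suc n"] by (auto simp: d_def power_mult[symmetric] mult.commute power2_eq_square power_mult_distrib[symmetric])
    \<comment> \<open>Young's inequality with weight \<open>2 ^ n\<close> balances the two terms:
      each integrates to at most half of \<open>(1/2) ^ n\<close>.\<close>
    have "(\<integral>\<^sup>+y. ennreal (d n y) \<partial>gauss) \<le> (\<integral>\<^sup>+y. ennreal (2 ^ n / 2 * (d n y)\<^sup>2 + (1/2) ^ n / 2) \<partial>gauss)"
    proof (intro nn_integral_mono ennreal_leI)
      fix y
      have "2 * (2 ^ n * d n y) * 1 \<le> (2 ^ n * d n y)\<^sup>2 + 1\<^sup>2" by (rule sum_squares_bound)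
      then show "d n y \<le> 2 ^ n / 2 * (d n y)\<^sup>2 + (1/2) ^ n / 2"
        by (simp add: field_simps power2_eq_square)
    qed
    also have "\<dots> = ennreal (\<integral>y. 2 ^ n / 2 * (d n y)\<^sup>2 + (1/2) ^ n / 2 \<partial>gauss)"
      using sq by (intro nn_integral_eq_integral) auto
    also have "(\<integral>y. 2 ^ n / 2 * (d n y)\<^sup>2 + (1/2) ^ n / 2 \<partial>gauss) = 2 ^ n / 2 * (\<integral>y. (d n y)\<^sup>2 \<partial>gauss) + (1/2) ^ n / 2"
      using sq gs.prob_space by simp
    also have "\<dots> \<le> 2 ^ n / 2 * ((1/2) ^ n)\<^sup>2 + (1/2) ^ n / 2"
      using sq by (intro add_right_mono mult_left_mono) auto
    also have "\<dots> = (1/2) ^ n"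
      by (simp add: power2_eq_square power_one_over)
    finally show "(\<integral>\<^sup>+y. ennreal (d n y) \<partial>gauss) \<le> ennreal ((1/2) ^ n)"
      by (simp add: ennreal_leI)
  qed auto
  also have "\<dots> = ennreal (\<Sum>n. (1/2) ^ n)" by (rule suminf_ennreal2) auto
  also have "\<dots> < \<infinity>" by simp
  finally have "AE y in gauss. (\<Sum>n. ennreal (d n y)) \<noteq> \<infinity>"
    by (intro nn_integral_PInf_AE) auto
  then have conv: "AE y in gauss. convergent (\<lambda>n. S n y)"
  proof eventually_elim
    fix y assume "(\<Sum>n. ennreal (d n y)) \<noteq> \<infinity>"
    then have "summable (\<lambda>n. d n y)"
      by (intro summable_suminf_not_top) (auto simp: d_def)
    then have "summable (\<lambda>n. S (Suc n) y - S n y)"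
      unfolding d_def by (rule summable_norm_cancel)
    then have "convergent (\<lambda>n. \<Sum>k<n. S (Suc k) y - S k y)" by (simp add: summable_iff_convergent)
    then have "convergent (\<lambda>n. S n y - S 0 y)" by (simp add: sum_lessThan_telescope[of "\<lambda>n. S n y"])
    then show "convergent (\<lambda>n. S n y)"
      using convergent_add[OF _ convergent_const[of "S 0 y"]] by fastforce
  qed
  define W where "W y = lim (\<lambda>n. S n y)" for y
  have [measurable]: "W \<in> borel_measurable gauss"
    unfolding W_def by (rule borel_measurable_lim_metric) measurable
  have W_lim: "AE y in gauss. (\<lambda>n. S n y) \<longlonglongrightarrow> W y"
    using conv by eventually_elim (simp add: W_def convergent_LIMSEQ_iff)
  have W_dist_nn: "(\<integral>\<^sup>+y. ennreal ((norm (W y - S n y))\<^sup>2) \<partial>gauss) \<le> ennreal ((1/4) ^ n)" for n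
  proof -
    have "(\<integral>\<^sup>+y. ennreal ((norm (W y - S n y))\<^sup>2) \<partial>gauss)
        = (\<integral>\<^sup>+y. liminf (\<lambda>m. ennreal ((norm (S m y - S n y))\<^sup>2)) \<partial>gauss)"
    proof (rule nn_integral_cong_AE, use W_lim in eventually_elim)
      fix y assume "(\<lambda>m. S m y) \<longlonglongrightarrow> W y"
      then have "(\<lambda>m. ennreal ((norm (S m y - S n y))\<^sup>2)) \<longlonglongrightarrow> ennreal ((norm (W y - S n y))\<^sup>2)"
        by (intro tendsto_ennrealI tendsto_intros)
      then show "ennreal ((norm (W y - S n y))\<^sup>2) = liminf (\<lambda>m. ennreal ((norm (S m y - S n y))\<^sup>2))"
        by (rule lim_imp_Liminf[OF sequentially_bot, symmetric])
    qed
    also have "\<dots> \<le> liminf (\<lambda>m. \<integral>\<^sup>+y. ennreal ((norm (S m y - S n y))\<^sup>2) \<partial>gauss)"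
      by (rule nn_integral_liminf) measurable
    also have "\<dots> \<le> limsup (\<lambda>m. \<integral>\<^sup>+y. ennreal ((norm (S m y - S n y))\<^sup>2) \<partial>gauss)"
      by (rule Liminf_le_Limsup) simp
    also have "\<dots> \<le> ennreal ((1/4) ^ n)"
    proof (rule Limsup_bounded, rule eventually_sequentiallyI)
      fix m assume "n \<le> m"
      then show "(\<integral>\<^sup>+y. ennreal ((norm (S m y - S n y))\<^sup>2) \<partial>gauss) \<le> ennreal ((1/4) ^ n)"
        using S_dist[of n m] by (subst nn_integral_eq_integral) (auto intro: ennreal_leI)
    qed
    finally show ?thesis .
  qed
  have W_dist: "integrable gauss (\<lambda>y. (norm (W y - S n y))\<^sup>2)" "(\<integral>y. (norm (W y - S n y))\<^sup>2 \<partial>gauss) \<le> (1/4) ^ n" for n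
  proof -
    show i: "integrable gauss (\<lambda>y. (norm (W y - S n y))\<^sup>2)"
      using W_dist_nn[of n] by (intro integrableI_nonneg) (auto intro: le_less_trans)
    show "(\<integral>y. (norm (W y - S n y))\<^sup>2 \<partial>gauss) \<le> (1/4) ^ n"
      using W_dist_nn[of n] nn_integral_eq_integral[OF i] by (simp add: ennreal_le_iff)
  qed
  have US: "integrable gauss (\<lambda>y. (norm (U y - S n y))\<^sup>2)" for n
    unfolding S_def by (rule psum_error_integrable[OF \<Lambda>])
  define R where "R y = U y - W y" for y
  have R_sq: "integrable gauss (\<lambda>y. (norm (R y))\<^sup>2)"
    using square_integrable_gauss_diff[OF _ _ US[of 0] W_dist(1)[of 0]] by (simp add: R_def)
  have "R \<in> borel_measurable gauss" unfolding R_def[abs_def] by measurable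
  with R_sq interpret R: gauss_L2 R by unfold_locales
  \<comment> \<open>The coefficient of \<open>U - S n\<close> is zero inside
    \<open>\<Lambda> n\<close> and \<open>coef \<nu>\<close> outside, where the defect bounds it by
    \<open>(1/2) ^ n\<close>; Bessel bounds the coefficient of \<open>W - S n\<close> alike. Their
    difference is the coefficient of \<open>R\<close> for every \<open>n\<close>.\<close>
  have "R.coef \<nu> = 0" if \<nu>: "\<nu> \<in> multi_indices" for \<nu>
  proof -
    have bound: "norm (R.coef \<nu>) \<le> 2 * (1/2) ^ n" for n
    proof -
      interpret A: gauss_L2 "\<lambda>y. U y - S n y"
        by standard (use US in simp_all)
      interpret B: gauss_L2 "\<lambda>y. W y - S n y"
        by standard (use W_dist in simp_all)
      have half: "((1/2) ^ n)\<^sup>2 = ((1/4) ^ n :: real)"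
        by (simp add: power2_eq_square power_mult_distrib[symmetric])
      have split: "R.coef \<nu> = A.coef \<nu> - B.coef \<nu>"
        unfolding R.coef_def A.coef_def B.coef_def
        using A.integrable_hermite_prod_U[OF \<nu>] B.integrable_hermite_prod_U[OF \<nu>]
        by (subst Bochner_Integration.integral_diff[symmetric]) (auto simp: R_def scaleR_diff_right)
      have "(norm (B.coef \<nu>))\<^sup>2 \<le> ((1/2) ^ n)\<^sup>2"
        using B.norm_coef_le[OF \<nu>] W_dist(2)[of n] unfolding half by linarith
      then have B: "norm (B.coef \<nu>) \<le> (1/2) ^ n" by (rule power2_le_imp_le) simp
      have "A.coef \<nu> = (if \<nu> \<in> \<Lambda> n then 0 else coef \<nu>)"
      proof -
        have int: "integrable gauss (\<lambda>y. hermite_prod \<nu> y *\<^sub>R (hermite_prod \<mu> y *\<^sub>R coef \<mu>))" if "\<mu> \<in> \<Lambda> n" for \<mu>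
        proof -
          have "\<mu> \<in> multi_indices" using that \<Lambda> by blast
          then show ?thesis
            using \<nu> integrable_hermite_prod_mult[of \<nu> \<mu>] integrable_scaleR_left[of "coef \<mu>" gauss "\<lambda>y. hermite_prod \<nu> y * hermite_prod \<mu> y"]
            by (simp add: scaleR_scaleR)
        qed
        have "(\<integral>y. hermite_prod \<nu> y *\<^sub>R S n y \<partial>gauss) = (\<Sum>\<mu>\<in>\<Lambda> n. \<integral>y. hermite_prod \<nu> y *\<^sub>R (hermite_prod \<mu> y *\<^sub>R coef \<mu>) \<partial>gauss)"
          unfolding S_def psum_def scaleR_sum_right using int by (rule Bochner_Integration.integral_sum)
        also have "\<dots> = (\<Sum>\<mu>\<in>\<Lambda> n. if \<nu> = \<mu> then coef \<mu> else 0)"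
        proof (intro sum.cong refl)
          fix \<mu> assume "\<mu> \<in> \<Lambda> n"
          then have \<mu>: "\<mu> \<in> multi_indices" using \<Lambda> by blast
          show "(\<integral>y. hermite_prod \<nu> y *\<^sub>R (hermite_prod \<mu> y *\<^sub>R coef \<mu>) \<partial>gauss) = (if \<nu> = \<mu> then coef \<mu> else 0)"
            using integral_hermite_prod_mult[OF \<nu> \<mu>] integrable_hermite_prod_mult[OF \<nu> \<mu>] by simp
        qed
        also have "\<dots> = (if \<nu> \<in> \<Lambda> n then coef \<nu> else 0)"
          using \<Lambda> by simp
        finally have Sn: "(\<integral>y. hermite_prod \<nu> y *\<^sub>R S n y \<partial>gauss) = (if \<nu> \<in> \<Lambda> n then coef \<nu> else 0)" .
        have "integrable gauss (\<lambda>y. hermite_prod \<nu> y *\<^sub>R S n y)"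
          unfolding S_def psum_def scaleR_sum_right using int by (intro Bochner_Integration.integrable_sum)
        then have "A.coef \<nu> = coef \<nu> - (\<integral>y. hermite_prod \<nu> y *\<^sub>R S n y \<partial>gauss)"
          unfolding A.coef_def coef_def using integrable_hermite_prod_U[OF \<nu>]
          by (subst Bochner_Integration.integral_diff[symmetric]) (auto simp: scaleR_diff_right)
        then show ?thesis unfolding Sn by simp
      qed
      moreover have "(norm (coef \<nu>))\<^sup>2 \<le> ((1/2) ^ n)\<^sup>2" if "\<nu> \<notin> \<Lambda> n"
      proof -
        have "{\<nu>} - \<Lambda> n = {\<nu>}" using that by blast
        then show ?thesis
          using q_diff[of "{\<nu>}" n] \<nu> unfolding half by (simp add: q_def \<F>_def)
      qed
      then have "norm (coef \<nu>) \<le> (1/2) ^ n" if "\<nu> \<notin> \<Lambda> n"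
        using that by (intro power2_le_imp_le[of "norm (coef \<nu>)"]) auto
      ultimately have "norm (A.coef \<nu>) \<le> (1/2) ^ n" by auto
      then show ?thesis
        unfolding split using B norm_triangle_ineq4[of "A.coef \<nu>" "B.coef \<nu>"] by linarith
    qed
    have "(\<lambda>n. 2 * (1/2::real) ^ n) \<longlonglongrightarrow> 2 * 0"
      by (intro tendsto_intros LIMSEQ_power_zero) auto
    then have "norm (R.coef \<nu>) \<le> 2 * 0"
      by (rule LIMSEQ_le_const) (use bound in blast)
    then show ?thesis by simp
  qed
  then have "AE y in gauss. R y = 0" by (rule R.coef_eq_0_imp_AE_0)
  then have UW: "AE y in gauss. U y = W y" by eventually_elim (simp add: R_def)
  obtain n where n: "(1/4) ^ n < \<epsilon>"
    using real_arch_pow_inv[OF \<open>0 < \<epsilon>\<close>, of "1/4"] by auto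
  have "(\<integral>y. (norm (U y - S n y))\<^sup>2 \<partial>gauss) = (\<integral>y. (norm (W y - S n y))\<^sup>2 \<partial>gauss)"
    by (rule integral_cong_AE) (use UW in \<open>auto elim!: eventually_mono\<close>)
  also have "\<dots> < \<epsilon>" using W_dist(2)[of n] n by linarith
  finally show ?thesis using \<Lambda>[of n] unfolding S_def by blast
qed

text \<open>A finite set \<open>L\<close> of small error contributes beyond \<open>\<Lambda>\<close>
  only through \<open>L - \<Lambda>\<close>, so bounds for finite tails control the whole
  error.\<close>

corollary psum_error_le:
  assumes \<Lambda>: "finite \<Lambda>" "\<Lambda> \<subseteq> multi_indices"
    and B: "\<And>\<Lambda>'. finite \<Lambda>' \<Longrightarrow> \<Lambda>' \<subseteq> multi_indices - \<Lambda> \<Longrightarrow> (\<Sum>\<nu>\<in>\<Lambda>'. (norm (coef \<nu>))\<^sup>2) \<le> B"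
  shows "(\<integral>y. (norm (U y - psum \<Lambda> y))\<^sup>2 \<partial>gauss) \<le> B"
proof (rule field_le_epsilon)
  fix \<epsilon> :: real assume "0 < \<epsilon>"
  then obtain L where L: "finite L" "L \<subseteq> multi_indices" "(\<integral>y. (norm (U y - psum L y))\<^sup>2 \<partial>gauss) < \<epsilon>"
    using hermite_expansion_dense by blast
  have "(\<Sum>\<nu>\<in>L. (norm (coef \<nu>))\<^sup>2) \<le> (\<Sum>\<nu>\<in>\<Lambda> \<union> (L - \<Lambda>). (norm (coef \<nu>))\<^sup>2)"
    using \<Lambda> L by (intro sum_mono2) auto
  also have "\<dots> = (\<Sum>\<nu>\<in>\<Lambda>. (norm (coef \<nu>))\<^sup>2) + (\<Sum>\<nu>\<in>L - \<Lambda>. (norm (coef \<nu>))\<^sup>2)"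
    using \<Lambda> L by (intro sum.union_disjoint) auto
  also have "(\<Sum>\<nu>\<in>L - \<Lambda>. (norm (coef \<nu>))\<^sup>2) \<le> B" using L by (intro B) auto
  finally show "(\<integral>y. (norm (U y - psum \<Lambda> y))\<^sup>2 \<partial>gauss) \<le> B + \<epsilon>"
    using L(3) unfolding psum_error_eq[OF \<Lambda>] psum_error_eq[OF L(1,2)] by linarith
qed

end

section \<open>Symmetric variational problems on closed subspaces\<close>

text \<open>Direct method: the solution minimizes the quadratic energy \<open>J\<close> on
  \<open>H\<close>. The hypotheses are relative to \<open>H\<close> because the elliptic form, which
  sees only gradients, degenerates on the ambient product space.\<close>

lemma variational_solution_exists:
  fixes B :: "'h::{real_inner, banach} \<Rightarrow> 'h \<Rightarrow> real" and H :: "'h set"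
  assumes H: "subspace H" "closed H"
    and add: "\<And>u v w. u \<in> H \<Longrightarrow> v \<in> H \<Longrightarrow> w \<in> H \<Longrightarrow> B (u + v) w = B u w + B v w"
    and scale: "\<And>c u w. u \<in> H \<Longrightarrow> w \<in> H \<Longrightarrow> B (c *\<^sub>R u) w = c * B u w"
    and sym: "\<And>u w. u \<in> H \<Longrightarrow> w \<in> H \<Longrightarrow> B u w = B w u"
    and bound: "\<And>u w. u \<in> H \<Longrightarrow> w \<in> H \<Longrightarrow> \<bar>B u w\<bar> \<le> C * norm u * norm w"
    and coercive: "\<And>u. u \<in> H \<Longrightarrow> \<alpha> * (norm u)\<^sup>2 \<le> B u u" and "0 < \<alpha>"
    and f_add: "\<And>u v. u \<in> H \<Longrightarrow> v \<in> H \<Longrightarrow> f (u + v) = f u + f v"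
    and f_scale: "\<And>c u. u \<in> H \<Longrightarrow> f (c *\<^sub>R u) = c * f u"
    and f_bound: "\<And>u. u \<in> H \<Longrightarrow> \<bar>f u\<bar> \<le> K * norm u"
  shows "\<exists>u\<in>H. \<forall>v\<in>H. B u v = f v"
proof -
  define J where "J u = B u u - 2 * f u" for u
  have mem: "u + v \<in> H" "c *\<^sub>R u \<in> H" "u - v \<in> H" "0 \<in> H" if "u \<in> H" "v \<in> H" for u v c
    using that H(1) by (auto intro: subspace_add subspace_scale subspace_diff subspace_0)
  have diff: "B (u - v) w = B u w - B v w" "f (u - v) = f u - f v" if "u \<in> H" "v \<in> H" "w \<in> H" for u v w
  proof -
    have "(-1) *\<^sub>R v \<in> H" by (rule mem(2)[OF that(2,2)])
    then show "B (u - v) w = B u w - B v w" "f (u - v) = f u - f v"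
      using add[of u "(-1) *\<^sub>R v" w] scale[of v w "-1"] f_add[of u "(-1) *\<^sub>R v"] f_scale[of v "-1"] that by simp_all
  qed
  have addr: "B w (u + v) = B w u + B w v" "B w (c *\<^sub>R u) = c * B w u" "B w (u - v) = B w u - B w v"
    if "u \<in> H" "v \<in> H" "w \<in> H" for u v w c
    using that add[of u v w] scale[of u w c] diff[of u v w] mem by (simp_all add: sym[of w])
  have J_bdd: "- (K\<^sup>2 / \<alpha>) \<le> J u" if "u \<in> H" for u
  proof -
    have "2 * K * norm u \<le> K\<^sup>2 / \<alpha> + \<alpha> * (norm u)\<^sup>2"
    proof -
      have "2 * K * (\<alpha> * norm u) \<le> K\<^sup>2 + (\<alpha> * norm u)\<^sup>2" by (rule sum_squares_bound)
      moreover have "K\<^sup>2 + (\<alpha> * norm u)\<^sup>2 = (K\<^sup>2 / \<alpha> + \<alpha> * (norm u)\<^sup>2) * \<alpha>"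
        using \<open>0 < \<alpha>\<close> by (simp add: field_simps power2_eq_square)
      ultimately have "(2 * K * norm u) * \<alpha> \<le> (K\<^sup>2 / \<alpha> + \<alpha> * (norm u)\<^sup>2) * \<alpha>"
        by (simp only: mult_ac)
      then show ?thesis using mult_right_le_imp_le[OF _ \<open>0 < \<alpha>\<close>] by blast
    qed
    then show ?thesis using f_bound[OF that] coercive[OF that] by (simp add: J_def abs_le_iff)
  qed
  define m where "m = (INF u\<in>H. J u)"
  have bdd: "bdd_below (J ` H)" using J_bdd by (intro bdd_belowI) auto
  have ne: "H \<noteq> {}" using subspace_0[OF H(1)] by auto
  have m_le: "m \<le> J u" if "u \<in> H" for u unfolding m_def by (rule cINF_lower[OF bdd that])
  have "\<exists>u\<in>H. J u < m + 1 / real (Suc n)" for n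
  proof -
    have "m < m + 1 / real (Suc n)" by simp
    then show ?thesis unfolding m_def using cINF_less_iff[OF ne bdd] by blast
  qed
  then obtain x where x: "\<And>n. x n \<in> H" "\<And>n. J (x n) < m + 1 / real (Suc n)" by metis
  \<comment> \<open>Parallelogram identity: the midpoint has energy at least \<open>m\<close>, so
    the distance of two points is controlled by their excess energies and minimizing sequences are
    Cauchy.\<close>
  have par: "\<alpha> * (norm (u - v))\<^sup>2 \<le> 2 * J u + 2 * J v - 4 * m" if uv: "u \<in> H" "v \<in> H" for u v
  proof -
    define w where "w = (1/2) *\<^sub>R (u + v)"
    have wH: "w \<in> H" unfolding w_def using uv mem by blast
    have Bw: "B w w = (1/4) * (B u u + 2 * B u v + B v v)"
      unfolding w_def using uv mem by (simp add: scale add addr sym[of v u] del: distrib_left_numeral) (simp add: field_simps)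
    have fw: "f w = (1/2) * (f u + f v)"
      unfolding w_def using uv mem by (simp add: f_scale f_add)
    have "B (u - v) (u - v) = B u u - 2 * B u v + B v v"
      using uv mem by (simp add: diff addr sym[of v u])
    also have "\<dots> = 2 * J u + 2 * J v - 4 * J w"
      unfolding J_def Bw fw by (simp add: field_simps)
    finally have "B (u - v) (u - v) \<le> 2 * J u + 2 * J v - 4 * m"
      using m_le[OF wH] by simp
    then show ?thesis using coercive[of "u - v"] uv mem by (meson order_trans)
  qed
  have "Cauchy x"
  proof (rule CauchyI)
    fix e :: real assume "0 < e"
    obtain N where N: "1 / real (Suc N) < \<alpha> * e\<^sup>2 / 4"
      using reals_Archimedean[of "\<alpha> * e\<^sup>2 / 4"] \<open>0 < \<alpha>\<close> \<open>0 < e\<close> by (auto simp: inverse_eq_divide)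
    have "norm (x i - x j) < e" if "N \<le> i" "N \<le> j" for i j
    proof -
      have "1 / real (Suc i) \<le> 1 / real (Suc N)" "1 / real (Suc j) \<le> 1 / real (Suc N)"
        using that by (auto intro!: divide_left_mono)
      then have "\<alpha> * (norm (x i - x j))\<^sup>2 < \<alpha> * e\<^sup>2"
        using par[OF x(1) x(1), of i j] x(2)[of i] x(2)[of j] N by linarith
      then have "(norm (x i - x j))\<^sup>2 < e\<^sup>2" using \<open>0 < \<alpha>\<close> by simp
      then show ?thesis using \<open>0 < e\<close> by (intro power2_less_imp_less[of _ e]) auto
    qed
    then show "\<exists>M. \<forall>m\<ge>M. \<forall>n\<ge>M. norm (x m - x n) < e" by blast
  qed
  then obtain u where u: "x \<longlonglongrightarrow> u" using Cauchy_convergent convergent_def by blast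
  have uH: "u \<in> H" by (rule closed_sequentially[OF H(2) x(1) u])
  have J_lim: "(\<lambda>n. J (x n)) \<longlonglongrightarrow> J u"
  proof -
    have "(\<lambda>n. B (x n) (x n)) \<longlonglongrightarrow> B u u"
    proof (rule Lim_null_comparison[of "\<lambda>n. B (x n) (x n) - B u u" "\<lambda>n. C * (norm (x n) + norm u) * norm (x n - u)", THEN LIM_zero_cancel])
      have "norm (B (x n) (x n) - B u u) \<le> C * (norm (x n) + norm u) * norm (x n - u)" for n
      proof -
        have "B (x n) (x n) - B u u = B (x n - u) (x n) + B (x n - u) u"
          using x(1)[of n] uH mem by (simp add: diff sym[of u "x n"])
        then have "\<bar>B (x n) (x n) - B u u\<bar> \<le> C * norm (x n - u) * norm (x n) + C * norm (x n - u) * norm u"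
          using bound[of "x n - u" "x n"] bound[of "x n - u" u] x(1)[of n] uH mem[of "x n" u] by linarith
        then show ?thesis by (simp add: algebra_simps)
      qed
      then show "\<forall>\<^sub>F n in sequentially. norm (B (x n) (x n) - B u u) \<le> C * (norm (x n) + norm u) * norm (x n - u)"
        by (intro always_eventually allI)
      have "(\<lambda>n. C * (norm (x n) + norm u) * norm (x n - u)) \<longlonglongrightarrow> C * (norm u + norm u) * norm (u - u)"
        by (intro tendsto_intros u)
      then show "(\<lambda>n. C * (norm (x n) + norm u) * norm (x n - u)) \<longlonglongrightarrow> 0" by simp
    qed
    moreover have "(\<lambda>n. f (x n)) \<longlonglongrightarrow> f u"
    proof (rule Lim_null_comparison[of "\<lambda>n. f (x n) - f u" "\<lambda>n. K * norm (x n - u)", THEN LIM_zero_cancel])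
      have "norm (f (x n) - f u) \<le> K * norm (x n - u)" for n
        using diff(2)[of "x n" u u] f_bound[of "x n - u"] x(1)[of n] uH mem[of "x n" u] by simp
      then show "\<forall>\<^sub>F n in sequentially. norm (f (x n) - f u) \<le> K * norm (x n - u)"
        by (intro always_eventually allI)
      have "(\<lambda>n. K * norm (x n - u)) \<longlonglongrightarrow> K * norm (u - u)"
        by (intro tendsto_intros u)
      then show "(\<lambda>n. K * norm (x n - u)) \<longlonglongrightarrow> 0" by simp
    qed
    ultimately show ?thesis unfolding J_def by (intro tendsto_intros)
  qed
  have "(\<lambda>n. m + 1 / real (Suc n)) \<longlonglongrightarrow> m + 0"
    by (intro tendsto_intros LIMSEQ_Suc[OF lim_1_over_n])
  then have "J u \<le> m + 0"
    using x(2) by (intro LIMSEQ_le[OF J_lim]) (auto intro: less_imp_le)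
  then have Ju: "J u \<le> J v" if "v \<in> H" for v using m_le[OF that] by simp
  have "B u v = f v" if v: "v \<in> H" for v
  proof -
    define b where "b = B u v - f v"
    have quad: "0 \<le> 2 * t * b + t\<^sup>2 * B v v" for t
    proof -
      have tv: "t *\<^sub>R v \<in> H" "u + t *\<^sub>R v \<in> H" using mem v uH by blast+
      have "J (u + t *\<^sub>R v) = J u + 2 * t * b + t\<^sup>2 * B v v"
        unfolding J_def b_def using v uH tv
        by (simp add: add addr scale f_add f_scale sym[of v u] power2_eq_square algebra_simps)
      then show ?thesis using Ju[OF tv(2)] by simp
    qed
    \<comment> \<open>\<open>c\<close> is positive and exceeds \<open>B v v\<close>; the choice
      \<open>t = - b / c\<close> in the quadratic inequality then forces
      \<open>b = 0\<close>.\<close>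
    define c where "c = \<bar>B v v\<bar> + 1"
    have "0 < c" by (simp add: c_def)
    have "0 \<le> 2 * (- (b / c)) * b + (- (b / c))\<^sup>2 * B v v" by (rule quad)
    also have "\<dots> \<le> 2 * (- (b / c)) * b + (- (b / c))\<^sup>2 * c"
      by (intro add_left_mono mult_left_mono) (auto simp: c_def)
    also have "\<dots> = - (b\<^sup>2 / c)" using \<open>0 < c\<close> by (simp add: power2_eq_square field_simps)
    finally have "b\<^sup>2 / c \<le> 0" by simp
    then have "b\<^sup>2 \<le> 0" using \<open>0 < c\<close> by (simp add: divide_le_0_iff)
    then show ?thesis by (simp add: b_def)
  qed
  then show ?thesis using uH by blast
qed

text \<open>With the inner product as form, the variational lemma yields the orthogonal projection
  \<open>u\<close> of the integral \<open>I\<close>. The residual \<open>I - u\<close> is orthogonal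
  to almost every value of \<open>F\<close>, hence to \<open>I\<close>, and so vanishes.\<close>

lemma integral_in_closed_subspace:
  fixes F :: "'x \<Rightarrow> 'h::{real_inner, banach, second_countable_topology}"
  assumes H: "subspace H" "closed H" and F: "integrable M F" and mem: "AE x in M. F x \<in> H"
  shows "(\<integral>x. F x \<partial>M) \<in> H"
proof -
  define I where "I = (\<integral>x. F x \<partial>M)"
  have "\<exists>u\<in>H. \<forall>v\<in>H. u \<bullet> v = I \<bullet> v"
    by (rule variational_solution_exists[OF H, where C=1 and \<alpha>=1 and K="norm I"])
      (use Cauchy_Schwarz_ineq2[of I] in \<open>auto simp: inner_add power2_norm_eq_inner Cauchy_Schwarz_ineq2 inner_commute\<close>)
  then obtain u where u: "u \<in> H" "\<And>v. v \<in> H \<Longrightarrow> u \<bullet> v = I \<bullet> v" by blast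
  define z where "z = I - u"
  have z: "v \<bullet> z = 0" if "v \<in> H" for v
    using u(2)[OF that] by (simp add: z_def inner_diff inner_commute)
  have "I \<bullet> z = (\<integral>x. F x \<bullet> z \<partial>M)"
    unfolding I_def using F by (intro integral_inner_left[symmetric])
  also have "\<dots> = (\<integral>x. 0 \<partial>M)"
    by (rule integral_cong_AE) (use F mem z in \<open>auto intro!: borel_measurable_inner elim!: eventually_mono dest: borel_measurable_integrable\<close>)
  finally have "I \<bullet> z = 0" by simp
  moreover have "u \<bullet> z = 0" by (rule z[OF u(1)])
  ultimately have "z \<bullet> z = 0" by (simp add: z_def inner_diff)
  then have "I = u" by (simp add: z_def)
  then show ?thesis using u(1) by (simp add: I_def)
qed

section \<open>The space \<open>H\<^sup>1\<^sub>0(D)\<close>\<close>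

lemma test_functions_differentiable: "\<phi> \<in> test_functions D \<Longrightarrow> \<phi> differentiable (at x)"
  by (auto simp: test_functions_def dest: spec[of _ "Suc 0"])

lemma test_functions_continuous: "\<phi> \<in> test_functions D \<Longrightarrow> continuous_on UNIV \<phi>"
  by (auto simp: test_functions_def dest: spec[of _ 0])

lemma test_functions_partial_continuous:
  "\<phi> \<in> test_functions D \<Longrightarrow> i \<in> Basis \<Longrightarrow> continuous_on UNIV (\<lambda>x. frechet_derivative \<phi> (at x) i)"
  by (auto simp: test_functions_def dest: spec[of _ "Suc 0"])

lemma vanishes_outside_closure_support:
  fixes \<phi> :: "'a::euclidean_space \<Rightarrow> real"
  assumes x: "x \<notin> closure {x. \<phi> x \<noteq> 0}"
  shows "\<phi> x = 0" and "frechet_derivative \<phi> (at x) i = 0"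
proof -
  define S where "S = - closure {x. \<phi> x \<noteq> 0}"
  have op: "open S" unfolding S_def by (rule open_Compl) (rule closed_closure)
  have z: "\<phi> y = 0" if "y \<in> S" for y
    using that closure_subset[of "{x. \<phi> x \<noteq> 0}"] by (auto simp: S_def)
  have xS: "x \<in> S" using x by (simp add: S_def)
  have "((\<lambda>x. 0) has_derivative (\<lambda>x. 0)) (at x)" by simp
  then have "(\<phi> has_derivative (\<lambda>x. 0)) (at x)"
    by (rule has_derivative_transform_within_open[OF _ op xS]) (simp add: z)
  then have "frechet_derivative \<phi> (at x) = (\<lambda>x. 0)"
    using frechet_derivative_at by metis
  then show "\<phi> x = 0" "frechet_derivative \<phi> (at x) i = 0" using xS z by simp_all
qed

lemma continuous_compact_support_integrable:
  fixes f :: "'a::euclidean_space \<Rightarrow> 'b::euclidean_space"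
  assumes f: "continuous_on UNIV f" and K: "compact K" "\<And>x. x \<notin> K \<Longrightarrow> f x = 0"
  shows "integrable lborel f"
proof -
  have "integrable lborel (\<lambda>x. indicator K x *\<^sub>R f x)"
    by (rule borel_integrable_compact[OF K(1)]) (use f continuous_on_subset in blast)
  moreover have "(\<lambda>x. indicator K x *\<^sub>R f x) = f" using K(2) by (auto simp: indicator_def)
  ultimately show ?thesis by simp
qed

lemma continuous_compact_support_square_integrable:
  fixes f :: "'a::euclidean_space \<Rightarrow> 'b::euclidean_space"
  assumes f: "continuous_on UNIV f" and K: "compact K" "\<And>x. x \<notin> K \<Longrightarrow> f x = 0"
  shows "square_integrable f"
proof -
  have "integrable lborel (\<lambda>x. (norm (f x))\<^sup>2)"
    by (rule continuous_compact_support_integrable[OF _ K(1)]) (use f K in \<open>auto intro!: continuous_intros\<close>)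
  moreover have "f \<in> borel_measurable borel" using f by (rule borel_measurable_continuous_onI)
  ultimately show ?thesis
    by (simp add: square_integrable_def integrable_completion measurable_completion)
qed

lemma test_functions_grad:
  assumes "\<phi> \<in> test_functions D"
  shows grad_test_function_continuous: "continuous_on UNIV (grad \<phi>)"
    and grad_test_function_outside: "x \<notin> closure {x. \<phi> x \<noteq> 0} \<Longrightarrow> grad \<phi> x = 0"
    and square_integrable_test_function: "square_integrable \<phi>"
    and square_integrable_grad: "square_integrable (grad \<phi>)"
proof -
  have K: "compact (closure {x. \<phi> x \<noteq> 0})" using assms by (simp add: test_functions_def)
  show c: "continuous_on UNIV (grad \<phi>)"
    unfolding grad_def[abs_def] using test_functions_partial_continuous[OF assms] by (intro continuous_intros)
  show o: "grad \<phi> x = 0" if "x \<notin> closure {x. \<phi> x \<noteq> 0}" for x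
    unfolding grad_def using vanishes_outside_closure_support(2)[OF that] by simp
  show "square_integrable \<phi>"
    by (rule continuous_compact_support_square_integrable[OF test_functions_continuous[OF assms] K])
      (rule vanishes_outside_closure_support(1))
  show "square_integrable (grad \<phi>)"
    by (rule continuous_compact_support_square_integrable[OF c K o])
qed

lemma grad_inner_Basis: "i \<in> Basis \<Longrightarrow> grad \<phi> x \<bullet> i = frechet_derivative \<phi> (at x) i"
  unfolding grad_def by (simp add: inner_sum_left_Basis)

lemma frechet_derivative_add:
  fixes \<phi> \<psi> :: "'a::euclidean_space \<Rightarrow> real"
  assumes "\<phi> differentiable (at x)" "\<psi> differentiable (at x)"
  shows "frechet_derivative (\<lambda>x. \<phi> x + \<psi> x) (at x) = (\<lambda>i. frechet_derivative \<phi> (at x) i + frechet_derivative \<psi> (at x) i)"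
proof -
  have "((\<lambda>x. \<phi> x + \<psi> x) has_derivative (\<lambda>i. frechet_derivative \<phi> (at x) i + frechet_derivative \<psi> (at x) i)) (at x)"
    using assms unfolding frechet_derivative_works by (rule has_derivative_add)
  then show ?thesis using frechet_derivative_at by metis
qed

lemma Ck_add: "Ck k \<phi> \<Longrightarrow> Ck k \<psi> \<Longrightarrow> Ck k (\<lambda>x. \<phi> x + \<psi> x)"
proof (induction k arbitrary: \<phi> \<psi>)
  case (Suc k)
  then have "frechet_derivative (\<lambda>x. \<phi> x + \<psi> x) (at x) i = frechet_derivative \<phi> (at x) i + frechet_derivative \<psi> (at x) i" for x i
    by (subst frechet_derivative_add) auto
  with Suc show ?case by auto
qed (auto intro: continuous_intros)

lemma frechet_derivative_cmult:
  fixes \<phi> :: "'a::euclidean_space \<Rightarrow> real"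
  assumes "\<phi> differentiable (at x)"
  shows "frechet_derivative (\<lambda>x. c * \<phi> x) (at x) = (\<lambda>i. c * frechet_derivative \<phi> (at x) i)"
proof -
  have "((\<lambda>x. c * \<phi> x) has_derivative (\<lambda>i. c * frechet_derivative \<phi> (at x) i)) (at x)"
    using assms unfolding frechet_derivative_works by (rule has_derivative_mult_right)
  then show ?thesis using frechet_derivative_at by metis
qed

lemma Ck_cmult: "Ck k \<phi> \<Longrightarrow> Ck k (\<lambda>x. c * \<phi> x)"
proof (induction k arbitrary: \<phi>)
  case (Suc k)
  then show ?case by (auto simp: frechet_derivative_cmult)
qed (auto intro: continuous_intros)

lemma compact_if_closed_subset:
  fixes K C :: "'x::t2_space set"
  assumes "compact K" "closed C" "C \<subseteq> K"
  shows "compact C"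
  using compact_Int_closed[OF assms(1,2)] assms(3) by (simp add: inf.absorb2)

lemma test_functions_add:
  assumes "\<phi> \<in> test_functions D" "\<psi> \<in> test_functions D"
  shows "(\<lambda>x. \<phi> x + \<psi> x) \<in> test_functions D"
proof -
  have "{x. \<phi> x + \<psi> x \<noteq> 0} \<subseteq> {x. \<phi> x \<noteq> 0} \<union> {x. \<psi> x \<noteq> 0}" by auto
  then have sub: "closure {x. \<phi> x + \<psi> x \<noteq> 0} \<subseteq> closure {x. \<phi> x \<noteq> 0} \<union> closure {x. \<psi> x \<noteq> 0}"
    by (metis closure_Un closure_mono)
  have "compact (closure {x. \<phi> x \<noteq> 0} \<union> closure {x. \<psi> x \<noteq> 0})"
    using assms by (intro compact_Un) (auto simp: test_functions_def)
  then have "compact (closure {x. \<phi> x + \<psi> x \<noteq> 0})"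
    by (rule compact_if_closed_subset[OF _ closed_closure sub])
  moreover have "closure {x. \<phi> x + \<psi> x \<noteq> 0} \<subseteq> D"
    using sub assms unfolding test_functions_def by blast
  ultimately show ?thesis using assms by (simp add: test_functions_def Ck_add)
qed

lemma test_functions_cmult:
  assumes "\<phi> \<in> test_functions D"
  shows "(\<lambda>x. c * \<phi> x) \<in> test_functions D"
proof -
  have "{x. c * \<phi> x \<noteq> 0} \<subseteq> {x. \<phi> x \<noteq> 0}" by auto
  then have sub: "closure {x. c * \<phi> x \<noteq> 0} \<subseteq> closure {x. \<phi> x \<noteq> 0}"
    by (rule closure_mono)
  have "compact (closure {x. \<phi> x \<noteq> 0})"
    using assms by (auto simp: test_functions_def)
  then have "compact (closure {x. c * \<phi> x \<noteq> 0})"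
    by (rule compact_if_closed_subset[OF _ closed_closure sub])
  moreover have "closure {x. c * \<phi> x \<noteq> 0} \<subseteq> D"
    using sub assms unfolding test_functions_def by blast
  ultimately show ?thesis using assms unfolding test_functions_def by (auto intro: Ck_cmult)
qed

lemma Ck_zero: "Ck k (\<lambda>x. 0)"
  by (induction k) (auto simp: frechet_derivative_const)

lemma test_functions_zero: "(\<lambda>x. 0) \<in> test_functions D"
  by (simp add: test_functions_def Ck_zero)

definition embed_H1 :: "('a::euclidean_space \<Rightarrow> real) \<Rightarrow> 'a H1" where
  "embed_H1 \<phi> = (abs_L2 \<phi>, abs_L2 (grad \<phi>))"

lemma subspace_test_functions: "subspace (embed_H1 ` test_functions D)"
  unfolding subspace_def
proof (intro conjI ballI allI)
  have "grad (\<lambda>x. 0 :: real) = (\<lambda>x :: 'a. 0)"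
    by (auto simp: grad_def frechet_derivative_const)
  then have "embed_H1 (\<lambda>x :: 'a. 0) = 0"
    by (simp add: embed_H1_def zero_L2_def zero_prod_def)
  then show "(0 :: 'a H1) \<in> embed_H1 ` test_functions D"
    using test_functions_zero by force
next
  fix u v :: "'a H1" assume "u \<in> embed_H1 ` test_functions D" "v \<in> embed_H1 ` test_functions D"
  then obtain \<phi> \<psi> where *: "\<phi> \<in> test_functions D" "u = embed_H1 \<phi>" "\<psi> \<in> test_functions D" "v = embed_H1 \<psi>" by blast
  have "grad (\<lambda>x. \<phi> x + \<psi> x) = (\<lambda>x. grad \<phi> x + grad \<psi> x)"
    using test_functions_differentiable[OF *(1)] test_functions_differentiable[OF *(3)]
    by (auto simp: grad_def frechet_derivative_add scaleR_add_left sum.distrib)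
  then have "u + v = embed_H1 (\<lambda>x. \<phi> x + \<psi> x)"
    unfolding *(2,4) embed_H1_def
    by (simp add: abs_L2_add square_integrable_test_function[OF *(1)] square_integrable_test_function[OF *(3)]
        square_integrable_grad[OF *(1)] square_integrable_grad[OF *(3)])
  then show "u + v \<in> embed_H1 ` test_functions D"
    using test_functions_add[OF *(1,3)] by blast
next
  fix c and u :: "'a H1" assume "u \<in> embed_H1 ` test_functions D"
  then obtain \<phi> where *: "\<phi> \<in> test_functions D" "u = embed_H1 \<phi>" by blast
  have "grad (\<lambda>x. c * \<phi> x) = (\<lambda>x. c *\<^sub>R grad \<phi> x)"
    using test_functions_differentiable[OF *(1)]
    by (auto simp: grad_def frechet_derivative_cmult scaleR_sum_right)
  then have "c *\<^sub>R u = embed_H1 (\<lambda>x. c * \<phi> x)"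
    unfolding *(2) embed_H1_def
    by (simp add: abs_L2_scaleR square_integrable_test_function[OF *(1)] square_integrable_grad[OF *(1)])
  then show "c *\<^sub>R u \<in> embed_H1 ` test_functions D"
    using test_functions_cmult[OF *(1)] by blast
qed

lemma H10_eq: "H10 D = closure (embed_H1 ` test_functions D)"
  by (simp add: H10_def embed_H1_def)

lemma closed_H10: "closed (H10 D)"
  by (simp add: H10_eq)

lemma subspace_H10: "subspace (H10 D)"
proof -
  have "span (embed_H1 ` test_functions D) = embed_H1 ` test_functions D"
    using subspace_test_functions span_eq_iff by blast
  then show ?thesis
    unfolding H10_eq using subspace_closure_span[of "embed_H1 ` test_functions D"] by metis
qed

subsection \<open>The Poincare inequality\<close>

lemma closed_segment_shift_subset:
  fixes x e :: "'a::real_vector"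
  assumes "0 \<le> t" "t \<le> 1" shows "- (t *\<^sub>R e) \<in> closed_segment 0 (- e)"
  using assms by (auto simp: closed_segment_def intro!: exI[of _ t])

lemma integral_directional_derivative_compact_support:
  fixes F F' :: "'a::euclidean_space \<Rightarrow> real"
  assumes der: "\<And>x t. ((\<lambda>t. F (x + t *\<^sub>R e)) has_real_derivative F' (x + t *\<^sub>R e)) (at t)"
    and F: "continuous_on UNIV F" and F': "continuous_on UNIV F'"
    and K: "compact K" "\<And>x. x \<notin> K \<Longrightarrow> F x = 0" "\<And>x. x \<notin> K \<Longrightarrow> F' x = 0"
  shows "(\<integral>x. F' x \<partial>lborel) = 0"
proof -
  \<comment> \<open>\<open>K\<close> swept along \<open>- e\<close>: a point outside
    \<open>L\<close> stays outside \<open>K\<close> when moved by \<open>t *\<^sub>R e\<close> with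
    \<open>t\<close> between \<open>0\<close> and \<open>1\<close>.\<close>
  define L where "L = {x + y |x y. x \<in> K \<and> y \<in> closed_segment 0 (- e)}"
  have L: "compact L" unfolding L_def by (rule compact_sums[OF K(1)]) simp
  have "bounded (F' ` K)"
    using F' K(1) by (intro compact_imp_bounded compact_continuous_image) (auto intro: continuous_on_subset)
  then obtain M where M: "0 < M" "\<And>x. x \<in> K \<Longrightarrow> \<bar>F' x\<bar> \<le> M"
    unfolding bounded_pos by auto
  show ?thesis
  proof (rule integral_directional_derivative_eq_0[where F=F and e=e and w="\<lambda>x. M * indicator L x"])
    show "integrable lborel F"
      by (rule continuous_compact_support_integrable[OF F K(1,2)])
    show "integrable lborel (\<lambda>x. M * indicator L x)"
      using L emeasure_bounded_finite[OF compact_imp_bounded[OF L]]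
      by (intro integrable_mult_right integrable_real_indicator) (auto simp: compact_imp_closed borel_closed)
    fix x and t :: real assume t: "0 \<le> t" "t \<le> 1"
    show "\<bar>F' (x + t *\<^sub>R e)\<bar> \<le> M * indicator L x"
    proof (cases "x + t *\<^sub>R e \<in> K")
      case True
      then have "x \<in> L"
        unfolding L_def using closed_segment_shift_subset[OF t, of e]
        by (intro CollectI exI[of _ "x + t *\<^sub>R e"] exI[of _ "- (t *\<^sub>R e)"]) auto
      then show ?thesis using M(2)[OF True] by simp
    qed (use K(3) M(1) in auto)
  qed (rule der)
qed

text \<open>The derivative of \<open>(x \<bullet> e) * (\<phi> x)\<^sup>2\<close> along
  \<open>e\<close> integrates to zero, which expresses the integral of the square of
  \<open>\<phi>\<close> by the mixed term with \<open>d\<close>. Since \<open>x \<bullet> e\<close>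
  is bounded by \<open>R\<close>, Young's inequality absorbs half of it.\<close>

lemma poincare_test_function:
  fixes \<phi> :: "'a::euclidean_space \<Rightarrow> real"
  assumes \<phi>: "\<phi> \<in> test_functions D" and R: "\<And>x. x \<in> D \<Longrightarrow> norm x \<le> R"
  shows "norm (abs_L2 \<phi>) \<le> 2 * R * norm (abs_L2 (grad \<phi>))"
proof -
  obtain e :: 'a where e: "e \<in> Basis" using nonempty_Basis by blast
  define K where "K = closure {x. \<phi> x \<noteq> 0}"
  have K: "compact K" "K \<subseteq> D" using \<phi> by (auto simp: K_def test_functions_def)
  define d where "d x = frechet_derivative \<phi> (at x) e" for x
  have out: "\<phi> x = 0" "d x = 0" "grad \<phi> x = 0" if "x \<notin> K" for x
    using vanishes_outside_closure_support[of x \<phi>] grad_test_function_outside[OF \<phi>, of x] that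
    by (auto simp: K_def d_def)
  have cont: "continuous_on UNIV \<phi>" "continuous_on UNIV d" "continuous_on UNIV (grad \<phi>)"
    using test_functions_continuous[OF \<phi>] test_functions_partial_continuous[OF \<phi> e] grad_test_function_continuous[OF \<phi>]
    by (auto simp: d_def[abs_def])
  show ?thesis
  proof (cases "K = {}")
    \<comment> \<open>An empty support is separate: \<open>R\<close> is known to be nonnegative only
      if \<open>D\<close> has a point. Here both norms vanish.\<close>
    case True
    then have "\<phi> = (\<lambda>x. 0)" using out by auto
    then have "abs_L2 \<phi> = (0 :: ('a, real) L2)" by (simp add: zero_L2_def)
    moreover have "grad \<phi> = (\<lambda>x. 0)" using out True by auto
    then have "abs_L2 (grad \<phi>) = (0 :: ('a, 'a) L2)" by (simp add: zero_L2_def)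
    ultimately show ?thesis by simp
  next
    case False
    then have R0: "0 \<le> R" using R K(2) norm_ge_zero order_trans by blast
    define F where "F x = (x \<bullet> e) * (\<phi> x)\<^sup>2" for x
    define F' where "F' x = (\<phi> x)\<^sup>2 + 2 * (x \<bullet> e) * \<phi> x * d x" for x
    have "(\<integral>x. F' x \<partial>lborel) = 0"
    proof (rule integral_directional_derivative_compact_support[of F e F' K])
      fix x t
      have fr: "(\<phi> has_derivative frechet_derivative \<phi> (at z)) (at z)" for z
        using test_functions_differentiable[OF \<phi>] frechet_derivative_works by blast
      have lin: "((\<lambda>t. x + t *\<^sub>R e) has_derivative (\<lambda>t. t *\<^sub>R e)) (at t)"
        by (auto intro!: derivative_eq_intros)
      have "((\<lambda>t. \<phi> (x + t *\<^sub>R e)) has_derivative (\<lambda>s. frechet_derivative \<phi> (at (x + t *\<^sub>R e)) (s *\<^sub>R e))) (at t)"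
        using has_derivative_compose[OF lin fr] .
      moreover have "frechet_derivative \<phi> (at z) (s *\<^sub>R e) = s * d z" for s z
        using linear_frechet_derivative[OF test_functions_differentiable[OF \<phi>]] by (simp add: d_def linear_cmul)
      ultimately have a: "((\<lambda>t. \<phi> (x + t *\<^sub>R e)) has_real_derivative d (x + t *\<^sub>R e)) (at t)"
        by (simp add: has_field_derivative_def mult.commute[of _ "d _"])
      have b: "((\<lambda>t. (x + t *\<^sub>R e) \<bullet> e) has_real_derivative 1) (at t)"
        using e by (auto intro!: derivative_eq_intros simp: inner_add_left)
      show "((\<lambda>t. F (x + t *\<^sub>R e)) has_real_derivative F' (x + t *\<^sub>R e)) (at t)"
        unfolding F_def F'_def by (rule DERIV_cong[OF DERIV_mult[OF b DERIV_power[OF a, of 2]]]) simp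
    qed (use cont out K in \<open>auto simp: F_def[abs_def] F'_def[abs_def] intro!: continuous_intros\<close>)
    moreover have int: "integrable lborel (\<lambda>x. (\<phi> x)\<^sup>2)" "integrable lborel (\<lambda>x. (norm (grad \<phi> x))\<^sup>2)" "integrable lborel F'"
      using cont out K
      by (auto intro!: continuous_compact_support_integrable[of _ K] continuous_intros simp: F'_def[abs_def])
    moreover have "(\<integral>x. F' x \<partial>lborel) \<ge> (\<integral>x. (\<phi> x)\<^sup>2 / 2 - 2 * R\<^sup>2 * (norm (grad \<phi> x))\<^sup>2 \<partial>lborel)"
    proof (rule integral_mono)
      fix x
      show "(\<phi> x)\<^sup>2 / 2 - 2 * R\<^sup>2 * (norm (grad \<phi> x))\<^sup>2 \<le> F' x"
      proof (cases "x \<in> K")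
        case True
        have "\<bar>x \<bullet> e\<bar> \<le> norm x * norm e" by (rule Cauchy_Schwarz_ineq2)
        then have "\<bar>x \<bullet> e\<bar> \<le> R" using R[of x] True K(2) e by auto
        moreover have "\<bar>d x\<bar> \<le> norm (grad \<phi> x)"
          using Basis_le_norm[OF e, of "grad \<phi> x"] e by (simp add: d_def grad_inner_Basis)
        ultimately have "\<bar>x \<bullet> e\<bar> * \<bar>d x\<bar> \<le> R * norm (grad \<phi> x)"
          using R0 by (intro mult_mono) auto
        then have "(\<bar>x \<bullet> e\<bar> * \<bar>d x\<bar>) * \<bar>\<phi> x\<bar> \<le> (R * norm (grad \<phi> x)) * \<bar>\<phi> x\<bar>" by (rule mult_right_mono) simp
        moreover have "4 * ((R * norm (grad \<phi> x)) * \<bar>\<phi> x\<bar>) \<le> 4 * (R\<^sup>2 * (norm (grad \<phi> x))\<^sup>2) + (\<phi> x)\<^sup>2"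
          using sum_squares_bound[of "2 * (R * norm (grad \<phi> x))" "\<bar>\<phi> x\<bar>"] by (simp add: power_mult_distrib mult.assoc)
        moreover have "- (2 * (x \<bullet> e) * \<phi> x * d x) \<le> 2 * ((\<bar>x \<bullet> e\<bar> * \<bar>d x\<bar>) * \<bar>\<phi> x\<bar>)"
          using abs_ge_minus_self[of "2 * (x \<bullet> e) * \<phi> x * d x"] by (simp add: abs_mult mult_ac)
        ultimately have "(\<phi> x)\<^sup>2 / 2 - 2 * (R\<^sup>2 * (norm (grad \<phi> x))\<^sup>2) \<le> (\<phi> x)\<^sup>2 + (2 * (x \<bullet> e) * \<phi> x * d x)"
          by linarith
        then show ?thesis unfolding F'_def mult.assoc .
      qed (use out in \<open>simp add: F'_def\<close>)
    qed (use int in simp_all)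
    ultimately have "(\<integral>x. (\<phi> x)\<^sup>2 \<partial>lborel) / 2 \<le> 2 * R\<^sup>2 * (\<integral>x. (norm (grad \<phi> x))\<^sup>2 \<partial>lborel)"
      by simp
    moreover have "(norm (abs_L2 \<phi>))\<^sup>2 = (\<integral>x. (\<phi> x)\<^sup>2 \<partial>lborel)"
      using int(1) by (simp add: norm_abs_L2_sq square_integrable_test_function[OF \<phi>] integral_completion)
    moreover have "(norm (abs_L2 (grad \<phi>)))\<^sup>2 = (\<integral>x. (norm (grad \<phi> x))\<^sup>2 \<partial>lborel)"
      using int(2) by (simp add: norm_abs_L2_sq square_integrable_grad[OF \<phi>] integral_completion)
    ultimately have "(norm (abs_L2 \<phi>))\<^sup>2 \<le> (2 * R * norm (abs_L2 (grad \<phi>)))\<^sup>2"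
      by (simp add: power_mult_distrib)
    then show ?thesis using R0 by (intro power2_le_imp_le[of "norm (abs_L2 \<phi>)"]) auto
  qed
qed

lemma H10_closure_induct:
  assumes "v \<in> H10 D" and "closed S" and "\<And>\<phi>. \<phi> \<in> test_functions D \<Longrightarrow> embed_H1 \<phi> \<in> S"
  shows "v \<in> S"
  using closure_minimal[of "embed_H1 ` test_functions D" S] assms unfolding H10_eq by blast

lemma poincare_H10:
  assumes "bounded (D :: 'a::euclidean_space set)"
  shows "\<exists>C>0. \<forall>v\<in>H10 D. norm v \<le> C * V_norm v"
proof -
  obtain R where R: "0 < R" "\<And>x. x \<in> D \<Longrightarrow> norm x \<le> R"
    using assms unfolding bounded_pos by blast
  have "norm v \<le> (2 * R + 1) * V_norm v" if "v \<in> H10 D" for v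
  proof -
    have "v \<in> {v. norm (fst v) \<le> 2 * R * norm (snd v)}"
    proof (rule H10_closure_induct[OF that])
      show "closed {v :: 'a H1. norm (fst v) \<le> 2 * R * norm (snd v)}"
        by (intro closed_Collect_le continuous_intros)
    qed (simp add: embed_H1_def poincare_test_function[OF _ R(2)])
    then have "norm (fst v) \<le> 2 * R * norm (snd v)" by simp
    moreover have "norm v \<le> norm (fst v) + norm (snd v)"
      using norm_Pair_le[of "fst v" "snd v"] by simp
    ultimately show ?thesis by (simp add: V_norm_def algebra_simps)
  qed
  then show ?thesis using R(1) by (intro exI[of _ "2 * R + 1"]) auto
qed

section \<open>Multiplication operators\<close>

lemma L2_eqI:
  assumes "AE x in lebesgue. rep_L2 u x = rep_L2 v x" shows "u = v"
proof -
  have "L2_rel (rep_L2 u) (rep_L2 v)"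
    using assms by (simp add: L2_rel_def square_integrable_rep)
  then have "abs_L2 (rep_L2 u) = abs_L2 (rep_L2 v)"
    using Quotient_rel_abs[OF Quotient_L2] by blast
  then show ?thesis by (simp add: abs_rep_L2)
qed

lemma rep_L2_add: "AE x in lebesgue. rep_L2 (u + v) x = rep_L2 u x + rep_L2 v x"
  using rep_abs_L2[OF square_integrable_add[OF square_integrable_rep[of u] square_integrable_rep[of v]]]
  by (simp add: abs_L2_add[OF square_integrable_rep square_integrable_rep, symmetric] abs_rep_L2)

lemma rep_L2_scaleR: "AE x in lebesgue. rep_L2 (c *\<^sub>R u) x = c *\<^sub>R rep_L2 u x"
  using rep_abs_L2[OF square_integrable_scaleR[OF square_integrable_rep[of u], of c]]
  by (simp add: abs_L2_scaleR[OF square_integrable_rep, symmetric] abs_rep_L2)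

lemma inner_L2_rep: "u \<bullet> v = (\<integral>x. rep_L2 u x \<bullet> rep_L2 v x \<partial>lebesgue)"
  by (simp add: inner_L2_def)

text \<open>A bound in place of the norm: bounds pass through sums, products and exponentials
  directly, while essential suprema would have to be computed each time.\<close>

definition Linf_bound :: "'a::euclidean_space set \<Rightarrow> ('a \<Rightarrow> real) \<Rightarrow> real \<Rightarrow> bool" where
  "Linf_bound D g c \<longleftrightarrow> g \<in> borel_measurable (lebesgue_on D) \<and> (AE x in lebesgue_on D. \<bar>g x\<bar> \<le> c)"

text \<open>The multiplier is cut off outside \<open>D\<close> since the elements of
  \<open>L2\<close> live on the whole space. Weak forms thereby become inner products, see
  \<open>form_eq_mult\<close>.\<close>

definition mult_L2 :: "'a::euclidean_space set \<Rightarrow> ('a \<Rightarrow> real) \<Rightarrow> ('a, 'b::euclidean_space) L2 \<Rightarrow> ('a, 'b) L2" where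
  "mult_L2 D g p = abs_L2 (\<lambda>x. (if x \<in> D then g x else 0) *\<^sub>R rep_L2 p x)"

locale domain =
  fixes D :: "'a::euclidean_space set"
  assumes D_sets: "D \<in> sets lebesgue"
begin

lemma AE_D: "(AE x in lebesgue_on D. P x) \<longleftrightarrow> (AE x in lebesgue. x \<in> D \<longrightarrow> P x)"
  using D_sets by (intro AE_restrict_space_iff) auto

lemma mult_square_integrable:
  assumes "Linf_bound D g c"
  shows "square_integrable (\<lambda>x. (if x \<in> D then g x else 0) *\<^sub>R rep_L2 p x)"
proof -
  have g: "(\<lambda>x. if x \<in> D then g x else 0) \<in> borel_measurable lebesgue"
    using assms D_sets by (intro borel_measurable_if_I) (auto simp: Linf_bound_def)
  have p: "rep_L2 p \<in> borel_measurable lebesgue" "integrable lebesgue (\<lambda>x. (norm (rep_L2 p x))\<^sup>2)"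
    using square_integrable_rep[of p] by (auto simp: square_integrable_def)
  have m: "(\<lambda>x. (if x \<in> D then g x else 0) *\<^sub>R rep_L2 p x) \<in> borel_measurable lebesgue"
    using g p by (intro borel_measurable_scaleR)
  have "integrable lebesgue (\<lambda>x. (norm ((if x \<in> D then g x else 0) *\<^sub>R rep_L2 p x))\<^sup>2)"
  proof (rule Bochner_Integration.integrable_bound)
    show "integrable lebesgue (\<lambda>x. c\<^sup>2 * (norm (rep_L2 p x))\<^sup>2)" using p by simp
    show "(\<lambda>x. (norm ((if x \<in> D then g x else 0) *\<^sub>R rep_L2 p x))\<^sup>2) \<in> borel_measurable lebesgue"
      using m by measurable
    show "AE x in lebesgue. norm ((norm ((if x \<in> D then g x else 0) *\<^sub>R rep_L2 p x))\<^sup>2) \<le> norm (c\<^sup>2 * (norm (rep_L2 p x))\<^sup>2)"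
      using assms[unfolded Linf_bound_def AE_D, THEN conjunct2]
    proof eventually_elim
      fix x assume gx: "x \<in> D \<longrightarrow> \<bar>g x\<bar> \<le> c"
      have "\<bar>if x \<in> D then g x else 0\<bar> \<le> \<bar>c\<bar>" using gx by auto
      then have "(if x \<in> D then g x else 0)\<^sup>2 \<le> c\<^sup>2" by (rule abs_le_square_iff[THEN iffD1])
      then have "(if x \<in> D then g x else 0)\<^sup>2 * (norm (rep_L2 p x))\<^sup>2 \<le> c\<^sup>2 * (norm (rep_L2 p x))\<^sup>2"
        by (rule mult_right_mono) simp
      then show "norm ((norm ((if x \<in> D then g x else 0) *\<^sub>R rep_L2 p x))\<^sup>2) \<le> norm (c\<^sup>2 * (norm (rep_L2 p x))\<^sup>2)"
        by (simp add: power_mult_distrib)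
    qed
  qed
  with m show ?thesis by (simp add: square_integrable_def)
qed

lemma rep_mult:
  assumes "Linf_bound D g c"
  shows "AE x in lebesgue. rep_L2 (mult_L2 D g p) x = (if x \<in> D then g x else 0) *\<^sub>R rep_L2 p x"
  unfolding mult_L2_def by (rule rep_abs_L2[OF mult_square_integrable[OF assms]])

lemma mult_norm_le:
  assumes g: "Linf_bound D g c" and "0 \<le> c"
  shows "norm (mult_L2 D g p) \<le> c * norm p"
proof -
  have sq: "integrable lebesgue (\<lambda>x. (norm (rep_L2 u x))\<^sup>2)" for u :: "('a, 'c::euclidean_space) L2"
    using square_integrable_rep[of u] by (simp add: square_integrable_def)
  have "(norm (mult_L2 D g p))\<^sup>2 \<le> c\<^sup>2 * (norm p)\<^sup>2"
    unfolding norm_L2_sq integral_mult_right_zero[symmetric]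
  proof (rule integral_mono_AE)
    show "AE x in lebesgue. (norm (rep_L2 (mult_L2 D g p) x))\<^sup>2 \<le> c\<^sup>2 * (norm (rep_L2 p x))\<^sup>2"
      using rep_mult[OF g, of p] g[unfolded Linf_bound_def AE_D, THEN conjunct2]
    proof eventually_elim
      fix x assume gx: "x \<in> D \<longrightarrow> \<bar>g x\<bar> \<le> c"
        and e: "rep_L2 (mult_L2 D g p) x = (if x \<in> D then g x else 0) *\<^sub>R rep_L2 p x"
      have "\<bar>if x \<in> D then g x else 0\<bar> \<le> \<bar>c\<bar>" using gx by auto
      then have "(if x \<in> D then g x else 0)\<^sup>2 \<le> c\<^sup>2" by (rule abs_le_square_iff[THEN iffD1])
      then have "(if x \<in> D then g x else 0)\<^sup>2 * (norm (rep_L2 p x))\<^sup>2 \<le> c\<^sup>2 * (norm (rep_L2 p x))\<^sup>2"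
        by (rule mult_right_mono) simp
      then show "(norm (rep_L2 (mult_L2 D g p) x))\<^sup>2 \<le> c\<^sup>2 * (norm (rep_L2 p x))\<^sup>2"
        unfolding e by (simp add: power_mult_distrib)
    qed
  qed (use sq in auto)
  then have "(norm (mult_L2 D g p))\<^sup>2 \<le> (c * norm p)\<^sup>2" by (simp add: power_mult_distrib)
  then show ?thesis using \<open>0 \<le> c\<close> by (intro power2_le_imp_le[of "norm (mult_L2 D g p)"]) auto
qed

lemma mult_add_right:
  assumes "Linf_bound D g c"
  shows "mult_L2 D g (p + q) = mult_L2 D g p + mult_L2 D g q"
proof (rule L2_eqI)
  show "AE x in lebesgue. rep_L2 (mult_L2 D g (p + q)) x = rep_L2 (mult_L2 D g p + mult_L2 D g q) x"
    using rep_mult[OF assms, of p] rep_mult[OF assms, of q] rep_mult[OF assms, of "p + q"]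
      rep_L2_add[of p q] rep_L2_add[of "mult_L2 D g p" "mult_L2 D g q"]
    by eventually_elim (simp add: scaleR_add_right)
qed

lemma mult_scaleR_right:
  assumes "Linf_bound D g c"
  shows "mult_L2 D g (r *\<^sub>R p) = r *\<^sub>R mult_L2 D g p"
proof (rule L2_eqI)
  show "AE x in lebesgue. rep_L2 (mult_L2 D g (r *\<^sub>R p)) x = rep_L2 (r *\<^sub>R mult_L2 D g p) x"
    using rep_mult[OF assms, of p] rep_mult[OF assms, of "r *\<^sub>R p"]
      rep_L2_scaleR[of r p] rep_L2_scaleR[of r "mult_L2 D g p"]
    by eventually_elim simp
qed

lemma mult_linear: "Linf_bound D g c \<Longrightarrow> linear (mult_L2 D g)"
  by (intro linearI mult_add_right mult_scaleR_right)

lemma mult_bounded_linear: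
  assumes g: "Linf_bound D g c" and "0 \<le> c" shows "bounded_linear (mult_L2 D g)"
  by (rule bounded_linear_intro[where K=c])
    (simp_all add: mult_add_right[OF g] mult_scaleR_right[OF g] mult_norm_le[OF g \<open>0 \<le> c\<close>] mult.commute[of _ c])

lemma mult_cong:
  assumes "Linf_bound D g c" "Linf_bound D h d" "AE x in lebesgue_on D. g x = h x"
  shows "mult_L2 D g p = mult_L2 D h p"
proof (rule L2_eqI)
  show "AE x in lebesgue. rep_L2 (mult_L2 D g p) x = rep_L2 (mult_L2 D h p) x"
    using rep_mult[OF assms(1), of p] rep_mult[OF assms(2), of p] assms(3)[unfolded AE_D]
    by eventually_elim auto
qed

lemma mult_add_left:
  assumes "Linf_bound D g c" "Linf_bound D h d" "Linf_bound D (\<lambda>x. g x + h x) e"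
  shows "mult_L2 D (\<lambda>x. g x + h x) p = mult_L2 D g p + mult_L2 D h p"
proof (rule L2_eqI)
  show "AE x in lebesgue. rep_L2 (mult_L2 D (\<lambda>x. g x + h x) p) x = rep_L2 (mult_L2 D g p + mult_L2 D h p) x"
    using rep_mult[OF assms(1), of p] rep_mult[OF assms(2), of p] rep_mult[OF assms(3), of p]
      rep_L2_add[of "mult_L2 D g p" "mult_L2 D h p"]
    by eventually_elim (auto simp: scaleR_add_left)
qed

lemma mult_mult:
  assumes "Linf_bound D g c" "Linf_bound D h d" "Linf_bound D (\<lambda>x. g x * h x) e"
  shows "mult_L2 D g (mult_L2 D h p) = mult_L2 D (\<lambda>x. g x * h x) p"
proof (rule L2_eqI)
  show "AE x in lebesgue. rep_L2 (mult_L2 D g (mult_L2 D h p)) x = rep_L2 (mult_L2 D (\<lambda>x. g x * h x) p) x"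
    using rep_mult[OF assms(1), of "mult_L2 D h p"] rep_mult[OF assms(2), of p] rep_mult[OF assms(3), of p]
    by eventually_elim auto
qed

lemma mult_self_adjoint:
  assumes "Linf_bound D g c"
  shows "mult_L2 D g p \<bullet> q = p \<bullet> mult_L2 D g q"
  unfolding inner_L2_rep
proof (rule integral_cong_AE)
  have m: "rep_L2 u \<in> borel_measurable lebesgue" for u :: "('a, 'c::euclidean_space) L2"
    using square_integrable_rep[of u] by (simp add: square_integrable_def)
  show "(\<lambda>x. rep_L2 (mult_L2 D g p) x \<bullet> rep_L2 q x) \<in> borel_measurable lebesgue"
    "(\<lambda>x. rep_L2 p x \<bullet> rep_L2 (mult_L2 D g q) x) \<in> borel_measurable lebesgue"
    using m by (auto intro!: borel_measurable_inner)
  show "AE x in lebesgue. rep_L2 (mult_L2 D g p) x \<bullet> rep_L2 q x = rep_L2 p x \<bullet> rep_L2 (mult_L2 D g q) x"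
    using rep_mult[OF assms, of p] rep_mult[OF assms, of q] by eventually_elim simp
qed

lemma form_eq_mult:
  assumes "Linf_bound D g c"
  shows "(\<integral>x. g x * (rep_L2 p x \<bullet> rep_L2 q x) \<partial>lebesgue_on D) = mult_L2 D g p \<bullet> q"
proof -
  have m: "rep_L2 u \<in> borel_measurable lebesgue" for u :: "('a, 'c::euclidean_space) L2"
    using square_integrable_rep[of u] by (simp add: square_integrable_def)
  have g: "(\<lambda>x. if x \<in> D then g x else 0) \<in> borel_measurable lebesgue"
    using assms D_sets by (intro borel_measurable_if_I) (auto simp: Linf_bound_def)
  have "(\<integral>x. g x * (rep_L2 p x \<bullet> rep_L2 q x) \<partial>lebesgue_on D) =
      (\<integral>x. (if x \<in> D then g x else 0) * (rep_L2 p x \<bullet> rep_L2 q x) \<partial>lebesgue)"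
    using D_sets by (subst integral_restrict_space) (auto intro!: Bochner_Integration.integral_cong)
  also have "\<dots> = mult_L2 D g p \<bullet> q"
    unfolding inner_L2_rep
  proof (rule integral_cong_AE)
    show "(\<lambda>x. (if x \<in> D then g x else 0) * (rep_L2 p x \<bullet> rep_L2 q x)) \<in> borel_measurable lebesgue"
      using g m by (intro borel_measurable_times borel_measurable_inner)
    show "(\<lambda>x. rep_L2 (mult_L2 D g p) x \<bullet> rep_L2 q x) \<in> borel_measurable lebesgue"
      using m by (auto intro!: borel_measurable_inner)
    show "AE x in lebesgue. (if x \<in> D then g x else 0) * (rep_L2 p x \<bullet> rep_L2 q x) = rep_L2 (mult_L2 D g p) x \<bullet> rep_L2 q x"
      using rep_mult[OF assms, of p] by eventually_elim simp
  qed
  finally show ?thesis .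
qed

lemma Linf_bound_const: "Linf_bound D (\<lambda>x. r) \<bar>r\<bar>"
  by (simp add: Linf_bound_def)

lemma Linf_bound_mono: "Linf_bound D g c \<Longrightarrow> c \<le> d \<Longrightarrow> Linf_bound D g d"
  unfolding Linf_bound_def by (auto elim: eventually_mono)

lemma Linf_bound_add: "Linf_bound D g c \<Longrightarrow> Linf_bound D h d \<Longrightarrow> Linf_bound D (\<lambda>x. g x + h x) (c + d)"
  unfolding Linf_bound_def
  by (auto elim!: eventually_elim2)

lemma Linf_bound_cmult: "Linf_bound D g c \<Longrightarrow> Linf_bound D (\<lambda>x. r * g x) (\<bar>r\<bar> * c)"
  unfolding Linf_bound_def by (auto simp: abs_mult elim!: eventually_mono intro!: mult_left_mono)

lemma Linf_bound_diff: "Linf_bound D g c \<Longrightarrow> Linf_bound D h d \<Longrightarrow> Linf_bound D (\<lambda>x. g x - h x) (c + d)"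
  using Linf_bound_add[of g c "\<lambda>x. -1 * h x" "\<bar>-1\<bar> * d"] Linf_bound_cmult[of h d "-1"] by simp

lemma Linf_bound_sum:
  "finite I \<Longrightarrow> (\<And>i. i \<in> I \<Longrightarrow> Linf_bound D (g i) (c i)) \<Longrightarrow> Linf_bound D (\<lambda>x. \<Sum>i\<in>I. g i x) (\<Sum>i\<in>I. c i)"
proof (induction I rule: finite_induct)
  case empty
  then show ?case using Linf_bound_const[of 0] by simp
next
  case (insert i I)
  then show ?case using Linf_bound_add[of "g i" "c i" "\<lambda>x. \<Sum>i\<in>I. g i x" "\<Sum>i\<in>I. c i"] by simp
qed

lemma Linf_bound_mult: "Linf_bound D g c \<Longrightarrow> Linf_bound D h d \<Longrightarrow> Linf_bound D (\<lambda>x. g x * h x) (c * d)"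
  unfolding Linf_bound_def
  by (auto simp: abs_mult elim!: eventually_elim2 intro!: mult_mono intro: order_trans[OF abs_ge_zero])

lemma Linf_bound_prod:
  "finite I \<Longrightarrow> (\<And>i. i \<in> I \<Longrightarrow> Linf_bound D (g i) (c i)) \<Longrightarrow> Linf_bound D (\<lambda>x. \<Prod>i\<in>I. g i x) (\<Prod>i\<in>I. c i)"
proof (induction I rule: finite_induct)
  case empty
  then show ?case using Linf_bound_const[of 1] by simp
next
  case (insert i I)
  then show ?case using Linf_bound_mult[of "g i" "c i" "\<lambda>x. \<Prod>i\<in>I. g i x" "\<Prod>i\<in>I. c i"] by simp
qed

lemma Linf_bound_exp: "Linf_bound D b c \<Longrightarrow> Linf_bound D (\<lambda>x. exp (b x)) (exp c)"
  unfolding Linf_bound_def by (auto elim!: eventually_mono simp: abs_le_iff)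

lemma Linf_bound_exp_minus_1: "Linf_bound D b c \<Longrightarrow> Linf_bound D (\<lambda>x. exp (b x) - 1) (exp c - 1)"
  unfolding Linf_bound_def
proof (elim conjE, intro conjI)
  assume "AE x in lebesgue_on D. \<bar>b x\<bar> \<le> c"
  then show "AE x in lebesgue_on D. \<bar>exp (b x) - 1\<bar> \<le> exp c - 1"
  proof eventually_elim
    fix x assume bx: "\<bar>b x\<bar> \<le> c"
    \<comment> \<open>For negative \<open>b x\<close> the claim amounts to
      \<open>1 - exp (- c) \<le> exp c - 1\<close>, which is the arithmetic-geometric mean
      inequality.\<close>
    have "1 + 1 \<le> exp c + exp (- c)"
    proof -
      have "0 \<le> (exp (c / 2) - exp (- c / 2))\<^sup>2" by simp
      also have "\<dots> = exp c + exp (- c) - 2"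
        by (simp add: power2_diff exp_of_nat_mult[symmetric] exp_add[symmetric] mult.assoc)
      finally show ?thesis by simp
    qed
    moreover have "exp (- c) \<le> exp (b x)" "exp (b x) \<le> exp c" using bx by auto
    ultimately show "\<bar>exp (b x) - 1\<bar> \<le> exp c - 1" by linarith
  qed
qed auto

lemma Linf_bound_exp_diff:
  assumes "Linf_bound D b B" "Linf_bound D b' B" "Linf_bound D (\<lambda>x. b x - b' x) \<delta>"
  shows "Linf_bound D (\<lambda>x. exp (b x) - exp (b' x)) (exp B * \<delta>)"
  unfolding Linf_bound_def
proof (intro conjI)
  have [measurable]: "b \<in> borel_measurable (lebesgue_on D)" "b' \<in> borel_measurable (lebesgue_on D)"
    using assms by (auto simp: Linf_bound_def)
  show "(\<lambda>x. exp (b x) - exp (b' x)) \<in> borel_measurable (lebesgue_on D)" by measurable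
  \<comment> \<open>A one-sided estimate suffices; exchanging \<open>s\<close> and \<open>t\<close>
    gives the other sign.\<close>
  have le: "exp s - exp t \<le> exp B * \<delta>" if "\<bar>s\<bar> \<le> B" "\<bar>s - t\<bar> \<le> \<delta>" for s t :: real
  proof -
    have "1 - exp (t - s) \<le> s - t" using exp_ge_add_one_self[of "t - s"] by linarith
    then have "exp s * (1 - exp (t - s)) \<le> exp s * (s - t)" by (intro mult_left_mono) auto
    also have "\<dots> \<le> exp B * \<delta>"
    proof (cases "0 \<le> s - t")
      case True
      then show ?thesis using that by (intro mult_mono) auto
    next
      case False
      then have "exp s * (s - t) \<le> 0" by (intro mult_nonneg_nonpos) auto
      also have "0 \<le> exp B * \<delta>" using that by (intro mult_nonneg_nonneg) auto
      finally show ?thesis .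
    qed
    finally show ?thesis by (simp add: algebra_simps exp_add[symmetric])
  qed
  have "AE x in lebesgue_on D. \<bar>b x\<bar> \<le> B" "AE x in lebesgue_on D. \<bar>b' x\<bar> \<le> B" "AE x in lebesgue_on D. \<bar>b x - b' x\<bar> \<le> \<delta>"
    using assms by (auto simp: Linf_bound_def)
  then show "AE x in lebesgue_on D. \<bar>exp (b x) - exp (b' x)\<bar> \<le> exp B * \<delta>"
  proof eventually_elim
    case (elim x)
    then show ?case using le[of "b x" "b' x"] le[of "b' x" "b x"] by (simp add: abs_le_iff abs_minus_commute)
  qed
qed

lemma Linf_bound_Linf_norm:
  assumes "g \<in> Linf D" shows "Linf_bound D g (Linf_norm D g)"
proof -
  have fin: "esssup (lebesgue_on D) (\<lambda>x. ennreal \<bar>g x\<bar>) < \<infinity>" and gm: "g \<in> borel_measurable (lebesgue_on D)"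
    using assms by (auto simp: Linf_def)
  have "AE x in lebesgue_on D. ennreal \<bar>g x\<bar> \<le> esssup (lebesgue_on D) (\<lambda>x. ennreal \<bar>g x\<bar>)" by (rule esssup_AE)
  moreover have "esssup (lebesgue_on D) (\<lambda>x. ennreal \<bar>g x\<bar>) = ennreal (Linf_norm D g)"
    using fin by (simp add: Linf_norm_def)
  ultimately have "AE x in lebesgue_on D. ennreal \<bar>g x\<bar> \<le> ennreal (Linf_norm D g)" by simp
  moreover have "0 \<le> Linf_norm D g" by (simp only: Linf_norm_def enn2real_nonneg)
  ultimately have "AE x in lebesgue_on D. \<bar>g x\<bar> \<le> Linf_norm D g"
    by (simp only: ennreal_le_iff)
  with gm show ?thesis by (simp add: Linf_bound_def)
qed

lemma Linf_bound_imp: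
  assumes "Linf_bound D g c" "0 \<le> c" shows "g \<in> Linf D" "Linf_norm D g \<le> c"
proof -
  have gm: "g \<in> borel_measurable (lebesgue_on D)" using assms by (simp add: Linf_bound_def)
  have "esssup (lebesgue_on D) (\<lambda>x. ennreal \<bar>g x\<bar>) \<le> ennreal c"
  proof (rule esssup_I)
    show "(\<lambda>x. ennreal \<bar>g x\<bar>) \<in> borel_measurable (lebesgue_on D)" using gm by measurable
    show "AE x in lebesgue_on D. ennreal \<bar>g x\<bar> \<le> ennreal c"
      using assms unfolding Linf_bound_def by (auto elim!: eventually_mono intro: ennreal_leI)
  qed
  note le = this
  show "g \<in> Linf D"
    using gm le_less_trans[OF le ennreal_less_top] by (simp add: Linf_def)
  show "Linf_norm D g \<le> c"
    unfolding Linf_norm_def by (rule enn2real_leI[OF assms(2) le])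
qed

lemma Linf_norm_nonneg: "0 \<le> Linf_norm D g"
  by (simp add: Linf_norm_def)

text \<open>Gradients of \<open>H10 D\<close> functions vanish outside \<open>D\<close>: true for
  test functions and preserved by limits. So the cutoff in \<open>mult_L2\<close> loses nothing on
  them, and multiplication by \<open>exp b\<close> can be inverted.\<close>

lemma mult_one_H10: "v \<in> H10 D \<Longrightarrow> mult_L2 D (\<lambda>x. 1) (snd v) = snd v"
proof -
  assume v: "v \<in> H10 D"
  have b1: "Linf_bound D (\<lambda>x. 1) 1" using Linf_bound_const[of 1] by simp
  have "v \<in> {v. mult_L2 D (\<lambda>x. 1) (snd v) = snd v}"
  proof (rule H10_closure_induct[OF v])
    have "continuous_on UNIV (\<lambda>v :: 'a H1. mult_L2 D (\<lambda>x. 1) (snd v))"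
      by (intro bounded_linear.continuous_on[OF mult_bounded_linear[OF b1]] continuous_intros) simp
    then show "closed {v :: 'a H1. mult_L2 D (\<lambda>x. 1) (snd v) = snd v}"
      by (intro closed_Collect_eq continuous_intros)
    fix \<phi> :: "'a \<Rightarrow> real" assume \<phi>: "\<phi> \<in> test_functions D"
    have out: "grad \<phi> x = 0" if "x \<notin> D" for x
      using grad_test_function_outside[OF \<phi>, of x] \<phi> that by (auto simp: test_functions_def)
    have "mult_L2 D (\<lambda>x. 1) (abs_L2 (grad \<phi>)) = abs_L2 (grad \<phi>)"
    proof (rule L2_eqI)
      show "AE x in lebesgue. rep_L2 (mult_L2 D (\<lambda>x. 1) (abs_L2 (grad \<phi>))) x = rep_L2 (abs_L2 (grad \<phi>)) x"
        using rep_mult[OF b1, of "abs_L2 (grad \<phi>)"] rep_abs_L2[OF square_integrable_grad[OF \<phi>]]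
        by eventually_elim (auto simp: out)
    qed
    then show "embed_H1 \<phi> \<in> {v. mult_L2 D (\<lambda>x. 1) (snd v) = snd v}" by (simp add: embed_H1_def)
  qed
  then show ?thesis by simp
qed

end

section \<open>Weak solutions\<close>

locale elliptic = domain D for D :: "'a::euclidean_space set" +
  fixes f :: "'a H1 \<Rightarrow> real" and Kf :: real and Cp :: real
  assumes poincare: "0 < Cp" "\<And>v. v \<in> H10 D \<Longrightarrow> norm v \<le> Cp * V_norm v"
    and f_add: "\<And>v w. v \<in> H10 D \<Longrightarrow> w \<in> H10 D \<Longrightarrow> f (v + w) = f v + f w"
    and f_scale: "\<And>c v. v \<in> H10 D \<Longrightarrow> f (c *\<^sub>R v) = c * f v"
    and f_bound: "0 \<le> Kf" "\<And>v. v \<in> H10 D \<Longrightarrow> \<bar>f v\<bar> \<le> Kf * V_norm v"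
begin

lemma H10_mem: "u \<in> H10 D \<Longrightarrow> v \<in> H10 D \<Longrightarrow> u + v \<in> H10 D" "u \<in> H10 D \<Longrightarrow> c *\<^sub>R u \<in> H10 D"
  "u \<in> H10 D \<Longrightarrow> v \<in> H10 D \<Longrightarrow> u - v \<in> H10 D" "0 \<in> H10 D"
  using subspace_H10[of D] by (auto intro: subspace_add subspace_scale subspace_diff subspace_0)

lemma H10_sum: "(\<And>i. i \<in> I \<Longrightarrow> u i \<in> H10 D) \<Longrightarrow> (\<Sum>i\<in>I. u i) \<in> H10 D"
  by (rule subspace_sum[OF subspace_H10])

text \<open>\<open>Exp b\<close> multiplies by \<open>exp b\<close>; the energy norm of a gradient \<open>p\<close> for the coefficient
  \<open>exp b\<close> is \<open>norm (Exp (b / 2) p)\<close>.\<close>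

definition Exp :: "('a \<Rightarrow> real) \<Rightarrow> ('a, 'a) L2 \<Rightarrow> ('a, 'a) L2" where
  "Exp b p = mult_L2 D (\<lambda>x. exp (b x)) p"

lemma weak_solution_iff:
  assumes "Linf_bound D b B"
  shows "weak_solution D (\<lambda>x. exp (b x)) f u \<longleftrightarrow> u \<in> H10 D \<and> (\<forall>v\<in>H10 D. Exp b (snd u) \<bullet> snd v = f v)"
  unfolding weak_solution_def weak_grad_def Exp_def form_eq_mult[OF Linf_bound_exp[OF assms]] ..

lemma Exp_norm_le: "Linf_bound D b B \<Longrightarrow> norm (Exp b p) \<le> exp B * norm p"
  unfolding Exp_def by (rule mult_norm_le[OF Linf_bound_exp]) auto

lemma Exp_linear: "Linf_bound D b B \<Longrightarrow> linear (Exp b)"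
  unfolding Exp_def[abs_def] by (rule mult_linear[OF Linf_bound_exp])

lemma Exp_Exp:
  assumes "Linf_bound D b B" "Linf_bound D b' B'"
  shows "Exp b (Exp b' p) = Exp (\<lambda>x. b x + b' x) p"
  unfolding Exp_def
  using mult_mult[OF Linf_bound_exp[OF assms(1)] Linf_bound_exp[OF assms(2)]
      Linf_bound_mult[OF Linf_bound_exp[OF assms(1)] Linf_bound_exp[OF assms(2)]]]
  by (simp add: exp_add)

lemma Exp_self_adjoint: "Linf_bound D b B \<Longrightarrow> Exp b p \<bullet> q = p \<bullet> Exp b q"
  unfolding Exp_def by (rule mult_self_adjoint[OF Linf_bound_exp])

lemma Linf_bound_half: "Linf_bound D b B \<Longrightarrow> Linf_bound D (\<lambda>x. b x / 2) (B / 2)"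
  using Linf_bound_cmult[of b B "1/2"] by simp

lemma Exp_inner:
  assumes "Linf_bound D b B"
  shows "Exp b p \<bullet> q = Exp (\<lambda>x. b x / 2) p \<bullet> Exp (\<lambda>x. b x / 2) q"
proof -
  have "Exp b p = Exp (\<lambda>x. b x / 2) (Exp (\<lambda>x. b x / 2) p)"
    using Exp_Exp[OF Linf_bound_half[OF assms] Linf_bound_half[OF assms]] by simp
  then show ?thesis using Exp_self_adjoint[OF Linf_bound_half[OF assms]] by simp
qed

lemma Exp_inverse_H10:
  assumes "Linf_bound D b B" "v \<in> H10 D"
  shows "Exp (\<lambda>x. - b x) (Exp b (snd v)) = snd v"
proof -
  have "Linf_bound D (\<lambda>x. - b x) B" using Linf_bound_cmult[OF assms(1), of "-1"] by simp
  then have "Exp (\<lambda>x. - b x) (Exp b (snd v)) = mult_L2 D (\<lambda>x. 1) (snd v)"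
    using Exp_Exp[OF _ assms(1)] by (simp add: Exp_def)
  then show ?thesis using mult_one_H10[OF assms(2)] by simp
qed

lemma V_norm_le_Exp:
  assumes "Linf_bound D b B" "v \<in> H10 D"
  shows "V_norm v \<le> exp B * norm (Exp b (snd v))"
proof -
  have "Linf_bound D (\<lambda>x. - b x) B" using Linf_bound_cmult[OF assms(1), of "-1"] by simp
  then show ?thesis
    using Exp_norm_le[of "\<lambda>x. - b x" B "Exp b (snd v)"] Exp_inverse_H10[OF assms] by (simp add: V_norm_def)
qed

lemma weak_solution_ex:
  assumes b: "Linf_bound D b B"
  shows "\<exists>u. weak_solution D (\<lambda>x. exp (b x)) f u"
proof -
  have lin: "Exp b (p + q) = Exp b p + Exp b q" "Exp b (c *\<^sub>R p) = c *\<^sub>R Exp b p" for p q c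
    using Exp_linear[OF b] by (auto simp: linear_add linear_scale)
  \<comment> \<open>Coercivity in the full product norm: \<open>exp (- B)\<close> is the lower bound
    of the coefficient, and the Poincare constant converts from the gradient norm.\<close>
  have coer: "(norm u)\<^sup>2 * (exp (- B) / Cp\<^sup>2) \<le> Exp b (snd u) \<bullet> snd u" if u: "u \<in> H10 D" for u
  proof -
    have "(norm u)\<^sup>2 \<le> (Cp * V_norm u)\<^sup>2" using poincare(2)[OF u] by (intro power_mono) auto
    also have "\<dots> \<le> Cp\<^sup>2 * (exp (B / 2) * norm (Exp (\<lambda>x. b x / 2) (snd u)))\<^sup>2"
      unfolding power_mult_distrib[of Cp] using V_norm_le_Exp[OF Linf_bound_half[OF b] u]
      by (intro mult_left_mono power_mono) (auto simp: V_norm_def)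
    also have "\<dots> = Cp\<^sup>2 * exp B * (Exp b (snd u) \<bullet> snd u)"
      by (simp add: power_mult_distrib exp_of_nat_mult[symmetric] Exp_inner[OF b] power2_norm_eq_inner)
    finally have "(norm u)\<^sup>2 \<le> Cp\<^sup>2 * exp B * (Exp b (snd u) \<bullet> snd u)" .
    then show ?thesis using poincare(1) by (simp add: exp_minus field_simps)
  qed
  have snd_le: "norm (snd u) \<le> norm u" for u :: "'a H1"
    using norm_snd_le[of "snd u" "fst u"] by simp
  have "\<exists>u\<in>H10 D. \<forall>v\<in>H10 D. Exp b (snd u) \<bullet> snd v = f v"
  proof (rule variational_solution_exists[OF subspace_H10 closed_H10, where C="exp B" and \<alpha>="exp (- B) / Cp\<^sup>2" and K=Kf])
    fix u w :: "'a H1"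
    have "\<bar>Exp b (snd u) \<bullet> snd w\<bar> \<le> norm (Exp b (snd u)) * norm (snd w)" by (rule Cauchy_Schwarz_ineq2)
    also have "\<dots> \<le> (exp B * norm u) * norm w"
      using Exp_norm_le[OF b, of "snd u"] snd_le[of u] snd_le[of w]
      by (intro mult_mono) (auto intro: order_trans mult_left_mono)
    finally show "\<bar>Exp b (snd u) \<bullet> snd w\<bar> \<le> exp B * norm u * norm w" .
    show "Exp b (snd u) \<bullet> snd w = Exp b (snd w) \<bullet> snd u"
      using Exp_self_adjoint[OF b] by (simp add: inner_commute)
    show "exp (- B) / Cp\<^sup>2 * (norm u)\<^sup>2 \<le> Exp b (snd u) \<bullet> snd u" if "u \<in> H10 D"
      using coer[OF that] by (simp add: mult.commute)
    show "\<bar>f u\<bar> \<le> Kf * norm u" if "u \<in> H10 D"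
    proof -
      have "Kf * V_norm u \<le> Kf * norm u" using f_bound(1) snd_le[of u] by (auto simp: V_norm_def intro: mult_left_mono)
      then show ?thesis using f_bound(2)[OF that] by linarith
    qed
  qed (use poincare(1) in \<open>auto simp: lin inner_add_left f_add f_scale\<close>)
  then show ?thesis using weak_solution_iff[OF b] by blast
qed

text \<open>Testing with \<open>u\<close> itself. In the energy norm only half of the exponent
  \<open>B\<close> is lost; the other half is paid on return to the V norm.\<close>

lemma energy_bound:
  assumes b: "Linf_bound D b B" and u: "weak_solution D (\<lambda>x. exp (b x)) f u"
  shows "norm (Exp (\<lambda>x. b x / 2) (snd u)) \<le> Kf * exp (B / 2)"
proof -
  define e where "e = norm (Exp (\<lambda>x. b x / 2) (snd u))"
  have uH: "u \<in> H10 D" and eq: "Exp b (snd u) \<bullet> snd u = f u"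
    using u weak_solution_iff[OF b] by auto
  have "e * e = f u"
    using eq unfolding Exp_inner[OF b] e_def by (simp add: power2_norm_eq_inner[symmetric] power2_eq_square)
  also have "\<dots> \<le> Kf * V_norm u" using f_bound(2)[OF uH] by simp
  also have "\<dots> \<le> Kf * (exp (B / 2) * e)"
    unfolding e_def using f_bound(1) by (intro mult_left_mono V_norm_le_Exp[OF Linf_bound_half[OF b] uH])
  finally have "e * e \<le> (Kf * exp (B / 2)) * e" by (simp add: mult.assoc)
  then show ?thesis
    unfolding e_def[symmetric] using f_bound(1) by (cases "e = 0") (auto simp: e_def)
qed

lemma weak_solution_V_norm:
  assumes b: "Linf_bound D b B" and u: "weak_solution D (\<lambda>x. exp (b x)) f u"
  shows "V_norm u \<le> Kf * exp B"
proof -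
  have uH: "u \<in> H10 D" using u by (simp add: weak_solution_def)
  have "V_norm u \<le> exp (B / 2) * (Kf * exp (B / 2))"
    using V_norm_le_Exp[OF Linf_bound_half[OF b] uH] energy_bound[OF assms]
    by (meson exp_ge_zero mult_left_mono order_trans)
  also have "\<dots> = Kf * exp B"
    by (simp add: exp_add[symmetric] mult.left_commute)
  finally show ?thesis .
qed

text \<open>Subtracting the two weak forms leaves the coefficient difference acting on
  \<open>u'\<close>. The three factors \<open>exp B\<close> come from that difference, from the
  bound for \<open>u'\<close> and from coercivity. The case \<open>\<delta> = 0\<close> is
  uniqueness; the general case gives measurability in the parameters.\<close>

lemma weak_solution_lipschitz:
  assumes b: "Linf_bound D b B" "weak_solution D (\<lambda>x. exp (b x)) f u"
    and b': "Linf_bound D b' B" "weak_solution D (\<lambda>x. exp (b' x)) f u'"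
    and d: "Linf_bound D (\<lambda>x. b x - b' x) \<delta>" "0 \<le> \<delta>"
  shows "V_norm (u - u') \<le> Kf * exp (3 * B) * \<delta>"
proof -
  define w where "w = u - u'"
  have uH: "u \<in> H10 D" "u' \<in> H10 D" using b b' by (auto simp: weak_solution_def)
  then have wH: "w \<in> H10 D" unfolding w_def by (rule H10_mem)
  have db: "Linf_bound D (\<lambda>x. exp (b x) - exp (b' x)) (exp B * \<delta>)"
    by (rule Linf_bound_exp_diff[OF b(1) b'(1) d(1)])
  have "Exp b (snd u') = mult_L2 D (\<lambda>x. (exp (b x) - exp (b' x)) + exp (b' x)) (snd u')"
    by (simp add: Exp_def)
  also have "\<dots> = mult_L2 D (\<lambda>x. exp (b x) - exp (b' x)) (snd u') + Exp b' (snd u')"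
    unfolding Exp_def
    by (rule mult_add_left[OF db Linf_bound_exp[OF b'(1)] Linf_bound_add[OF db Linf_bound_exp[OF b'(1)]]])
  finally have split: "Exp b (snd u') = mult_L2 D (\<lambda>x. exp (b x) - exp (b' x)) (snd u') + Exp b' (snd u')" .
  have "Exp b (snd u) \<bullet> snd w = Exp b' (snd u') \<bullet> snd w"
    using b b' wH weak_solution_iff[OF b(1)] weak_solution_iff[OF b'(1)] by simp
  moreover have "Exp b (snd w) = Exp b (snd u) - Exp b (snd u')"
    using Exp_linear[OF b(1)] by (simp add: w_def linear_diff)
  ultimately have "Exp b (snd w) \<bullet> snd w = - (mult_L2 D (\<lambda>x. exp (b x) - exp (b' x)) (snd u') \<bullet> snd w)"
    unfolding split by (simp add: inner_diff_left inner_add_left)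
  also have "\<dots> \<le> norm (mult_L2 D (\<lambda>x. exp (b x) - exp (b' x)) (snd u')) * norm (snd w)"
    using Cauchy_Schwarz_ineq2[of "mult_L2 D (\<lambda>x. exp (b x) - exp (b' x)) (snd u')" "snd w"] by linarith
  also have "\<dots> \<le> ((exp B * \<delta>) * (Kf * exp B)) * norm (snd w)"
  proof (intro mult_right_mono)
    have "norm (mult_L2 D (\<lambda>x. exp (b x) - exp (b' x)) (snd u')) \<le> (exp B * \<delta>) * V_norm u'"
      unfolding V_norm_def by (rule mult_norm_le[OF db]) (use d in auto)
    also have "\<dots> \<le> (exp B * \<delta>) * (Kf * exp B)"
      using weak_solution_V_norm[OF b'] d by (intro mult_left_mono) auto
    finally show "norm (mult_L2 D (\<lambda>x. exp (b x) - exp (b' x)) (snd u')) \<le> (exp B * \<delta>) * (Kf * exp B)" .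
  qed simp
  finally have 1: "Exp b (snd w) \<bullet> snd w \<le> ((exp B * \<delta>) * (Kf * exp B)) * V_norm w" by (simp add: V_norm_def)
  have "(V_norm w)\<^sup>2 \<le> (exp (B / 2) * norm (Exp (\<lambda>x. b x / 2) (snd w)))\<^sup>2"
    using V_norm_le_Exp[OF Linf_bound_half[OF b(1)] wH] by (intro power_mono) (auto simp: V_norm_def)
  also have "\<dots> = exp B * (Exp b (snd w) \<bullet> snd w)"
    by (simp add: power_mult_distrib exp_of_nat_mult[symmetric] Exp_inner[OF b(1)] power2_norm_eq_inner)
  also have "\<dots> \<le> exp B * (((exp B * \<delta>) * (Kf * exp B)) * V_norm w)"
    using 1 by (intro mult_left_mono) auto
  also have "\<dots> = (Kf * exp (3 * B) * \<delta>) * V_norm w"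
    by (simp add: exp_of_nat_mult[of 3, simplified] power3_eq_cube)
  finally have "V_norm w * V_norm w \<le> (Kf * exp (3 * B) * \<delta>) * V_norm w"
    by (simp add: power2_eq_square)
  then have "V_norm w \<le> Kf * exp (3 * B) * \<delta>"
    using f_bound(1) d(2) by (cases "V_norm w = 0") (auto simp: V_norm_def)
  then show ?thesis by (simp add: w_def)
qed

lemma weak_solution_unique:
  assumes b: "Linf_bound D b B" "weak_solution D (\<lambda>x. exp (b x)) f u" "weak_solution D (\<lambda>x. exp (b x)) f u'"
  shows "u = u'"
proof -
  have "Linf_bound D (\<lambda>x. b x - b x) 0" using Linf_bound_const[of 0] by simp
  then have "V_norm (u - u') \<le> 0"
    using weak_solution_lipschitz[OF b(1,2) b(1,3), of 0] by simp
  moreover have "u - u' \<in> H10 D" using b by (intro H10_mem) (auto simp: weak_solution_def)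
  ultimately have "norm (u - u') \<le> Cp * 0"
    using poincare by (meson mult_left_mono less_imp_le order_trans)
  then show ?thesis by simp
qed

definition sol :: "('a \<Rightarrow> real) \<Rightarrow> 'a H1" where
  "sol b = (THE u. weak_solution D (\<lambda>x. exp (b x)) f u)"

lemma sol_weak_solution: "Linf_bound D b B \<Longrightarrow> weak_solution D (\<lambda>x. exp (b x)) f (sol b)"
  unfolding sol_def using weak_solution_ex weak_solution_unique by (metis (mono_tags, lifting) the_equality)

lemma sol_mem: "Linf_bound D b B \<Longrightarrow> sol b \<in> H10 D"
  using sol_weak_solution by (auto simp: weak_solution_def)

lemma sol_cong:
  assumes "Linf_bound D b B" "Linf_bound D b' B'" "AE x in lebesgue_on D. b x = b' x"
  shows "sol b = sol b'"
proof (rule weak_solution_unique[OF assms(1) sol_weak_solution[OF assms(1)]])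
  have "Exp b p = Exp b' p" for p
    unfolding Exp_def by (rule mult_cong[OF Linf_bound_exp[OF assms(1)] Linf_bound_exp[OF assms(2)]])
      (use assms(3) in \<open>auto elim: eventually_mono\<close>)
  then show "weak_solution D (\<lambda>x. exp (b x)) f (sol b')"
    using sol_weak_solution[OF assms(2)] by (simp add: weak_solution_iff[OF assms(1)] weak_solution_iff[OF assms(2)])
qed

subsection \<open>Mixed differences\<close>

lemma sum_Pow_insert:
  fixes g :: "'i set \<Rightarrow> 'c::comm_monoid_add"
  assumes "finite P" "i \<notin> P"
  shows "(\<Sum>R\<in>Pow (insert i P). g R) = (\<Sum>R\<in>Pow P. g R) + (\<Sum>R\<in>Pow P. g (insert i R))"
proof -
  have inj: "inj_on (insert i) (Pow P)"
    using assms(2) by (intro inj_onI) (auto simp: insert_eq_iff)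
  have "(\<Sum>R\<in>Pow (insert i P). g R) = (\<Sum>R\<in>Pow P. g R) + (\<Sum>R\<in>insert i ` Pow P. g R)"
    unfolding Pow_insert using assms by (intro sum.union_disjoint) auto
  then show ?thesis by (simp add: sum.reindex[OF inj])
qed

end

text \<open>The iterated difference over the increments in \<open>P\<close>, by inclusion-exclusion,
  starting from the state where those in \<open>Q\<close> are switched on. Increments are labelled
  individually, so repeated differences in one coordinate need no multiplicities.\<close>

definition mixed_diff :: "('i set \<Rightarrow> 'c::real_vector) \<Rightarrow> 'i set \<Rightarrow> 'i set \<Rightarrow> 'c" where
  "mixed_diff U P Q = (\<Sum>S\<in>Pow P. (-1) ^ card (P - S) *\<^sub>R U (Q \<union> S))"

context elliptic
begin

lemma mixed_diff_empty [simp]: "mixed_diff U {} Q = U Q"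
  by (simp add: mixed_diff_def)

lemma mixed_diff_insert:
  fixes U :: "'i set \<Rightarrow> 'c::real_vector"
  assumes "finite P" "i \<notin> P"
  shows "mixed_diff U (insert i P) Q = mixed_diff U P (insert i Q) - mixed_diff U P Q"
proof -
  have "card (insert i P - S) = Suc (card (P - S))" if "S \<in> Pow P" for S
  proof -
    have "insert i P - S = insert i (P - S)" using that assms by auto
    then show ?thesis using assms by simp
  qed
  moreover have "insert i P - insert i S = P - S" if "S \<in> Pow P" for S using that assms by auto
  moreover have "Q \<union> insert i S = insert i Q \<union> S" for S by auto
  ultimately show ?thesis
    unfolding mixed_diff_def sum_Pow_insert[OF assms] by (simp add: sum_negf)
qed

lemma mixed_diff_H10: "(\<And>S. U S \<in> H10 D) \<Longrightarrow> mixed_diff U P Q \<in> H10 D"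
  unfolding mixed_diff_def by (intro H10_sum H10_mem)

end

section \<open>Combinatorial constants of the recursion for mixed differences\<close>

lemma sum_Pow_card:
  fixes g :: "nat \<Rightarrow> real"
  assumes "finite P"
  shows "(\<Sum>R\<in>Pow P. g (card R)) = (\<Sum>s\<le>card P. real (card P choose s) * g s)"
proof -
  have "(\<Sum>R\<in>Pow P. g (card R)) = (\<Sum>s\<in>{..card P}. \<Sum>R\<in>{R\<in>Pow P. card R = s}. g (card R))"
    using assms by (intro sum.group[symmetric]) (auto intro: card_mono)
  also have "\<dots> = (\<Sum>s\<le>card P. real (card P choose s) * g s)"
  proof (intro sum.cong refl)
    fix s
    have "card {R\<in>Pow P. card R = s} = card P choose s"
      using n_subsets[OF assms, of s] by (simp add: Pow_def)
    then show "(\<Sum>R\<in>{R\<in>Pow P. card R = s}. g (card R)) = real (card P choose s) * g s"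
      by simp
  qed
  finally show ?thesis .
qed

lemma exp_half_le: "exp (1 / 2 :: real) \<le> 5 / 3"
proof -
  have "exp (1/2 :: real) ^ 2 = exp 1" by (simp add: exp_of_nat_mult[symmetric])
  moreover have "exp 1 < (272 / 100 :: real)" using e_less_272 by simp
  ultimately have "exp (1/2 :: real) ^ 2 \<le> (5 / 3) ^ 2" by (simp add: power2_eq_square)
  then show ?thesis by (rule power2_le_imp_le) simp
qed

text \<open>Here the growth constant \<open>2\<close> pays off: divided by \<open>k! 2^k\<close> the
  sum is a partial sum of \<open>exp (1/2) - 1 \<le> 2/3\<close>, which absorbs the factor
  \<open>3/2\<close> lost when energy norms are compared.\<close>

lemma sum_fact_recursion:
  "(\<Sum>s\<in>{1..k}. real (k choose s) * (fact (k - s) * 2 ^ (k - s))) * (3 / 2) \<le> fact k * 2 ^ k"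
proof -
  have le: "(\<Sum>s\<in>{1..k}. (1/2) ^ s / fact s) \<le> (2 / 3 :: real)"
  proof -
    have "(\<Sum>s\<in>insert 0 {1..k}. (1/2) ^ s /\<^sub>R fact s) \<le> (\<Sum>s. (1/2 :: real) ^ s /\<^sub>R fact s)"
      by (rule sum_le_suminf[OF summable_exp_generic]) auto
    also have "\<dots> = exp (1/2)" by (simp add: exp_def)
    finally have "(\<Sum>s\<in>insert 0 {1..k}. (1/2 :: real) ^ s /\<^sub>R fact s) \<le> 5 / 3"
      using exp_half_le by linarith
    moreover have "(\<Sum>s\<in>insert 0 {1..k}. (1/2 :: real) ^ s /\<^sub>R fact s)
        = (1/2) ^ 0 /\<^sub>R fact 0 + (\<Sum>s\<in>{1..k}. (1/2) ^ s /\<^sub>R fact s)"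
      by (rule sum.insert) auto
    moreover have "(\<Sum>s\<in>{1..k}. (1/2 :: real) ^ s /\<^sub>R fact s) = (\<Sum>s\<in>{1..k}. (1/2) ^ s / fact s)"
      by (intro sum.cong refl) (simp only: real_scaleR_def divide_inverse mult.commute)
    ultimately show ?thesis by simp
  qed
  have "(\<Sum>s\<in>{1..k}. real (k choose s) * (fact (k - s) * 2 ^ (k - s))) = (\<Sum>s\<in>{1..k}. fact k * 2 ^ k * ((1/2) ^ s / fact s))"
  proof (intro sum.cong refl)
    fix s assume s: "s \<in> {1..k}"
    then have "real (k choose s) = fact k / (fact s * fact (k - s))" by (simp add: binomial_fact)
    moreover have "(2::real) ^ (k - s) = 2 ^ k * (1/2) ^ s"
      using s by (simp add: power_diff power_one_over)
    ultimately show "real (k choose s) * (fact (k - s) * 2 ^ (k - s)) = fact k * 2 ^ k * ((1/2) ^ s / fact s)"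
      by simp
  qed
  also have "\<dots> = fact k * 2 ^ k * (\<Sum>s\<in>{1..k}. (1/2) ^ s / fact s)"
    by (simp add: sum_distrib_left)
  also have "\<dots> \<le> fact k * 2 ^ k * (2 / 3 :: real)"
    using le by (rule mult_left_mono) simp
  finally show ?thesis by linarith
qed

context elliptic
begin

text \<open>\<open>u\<close> solves the problem with log-coefficient \<open>b0 + \<Sum>\<^sub>i\<in>\<^sub>Q \<xi> i\<close>.  Taking the mixed
  difference of the weak formulation and expanding it by a discrete Leibniz rule bounds the mixed
  difference of \<open>u\<close> in the energy norm by those of lower order.\<close>

lemma mixed_diff_bound:
  fixes I :: "'i set" and \<xi> :: "'i \<Rightarrow> 'a \<Rightarrow> real"
  assumes I: "finite I" and b0: "Linf_bound D b0 B" and chi: "\<And>i. i \<in> I \<Longrightarrow> Linf_bound D (\<xi> i) (c i)"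
    and c: "\<And>i. i \<in> I \<Longrightarrow> 0 \<le> c i" and csum: "(\<Sum>i\<in>I. c i) \<le> 4 / 5"
  defines "bQ \<equiv> \<lambda>Q x. b0 x + (\<Sum>i\<in>Q \<inter> I. \<xi> i x)"
  defines "U \<equiv> \<lambda>Q. sol (bQ Q)"
  assumes P: "P \<subseteq> I" "Q \<subseteq> I" "P \<inter> Q = {}"
  shows "norm (Exp (\<lambda>x. bQ Q x / 2) (snd (mixed_diff U P Q)))
    \<le> Kf * exp (B / 2 + 2 / 5) * (fact (card P) * 2 ^ card P) * (\<Prod>i\<in>P. exp (c i) - 1)"
proof -
  \<comment> \<open>The bound of order zero: \<open>energy_bound\<close> with
    \<open>B + 4 / 5\<close>, which bounds every log-coefficient \<open>bQ Q\<close>.\<close>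
  define M where "M = Kf * exp (B / 2 + 2 / 5)"
  have M0: "0 \<le> M" using f_bound(1) by (simp add: M_def)
  have csub: "(\<Sum>i\<in>Q. c i) \<le> 4 / 5" if "Q \<subseteq> I" for Q
    using sum_mono2[OF I that, of c] c csum by force
  have chi_sum: "Linf_bound D (\<lambda>x. \<Sum>i\<in>Q. \<xi> i x) (4 / 5)" if "Q \<subseteq> I" for Q
    by (rule Linf_bound_mono[OF Linf_bound_sum[of Q \<xi> c] csub[OF that]])
      (use that I finite_subset chi in auto)
  have bQ: "Linf_bound D (bQ Q) (B + 4 / 5)" for Q
    unfolding bQ_def by (intro Linf_bound_add b0 chi_sum) auto
  \<comment> \<open>\<open>exp (bQ Q x) * eta R x\<close> is the mixed difference of the coefficient
    over \<open>R\<close> from base \<open>Q\<close>, since switching on increment \<open>i\<close>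
    multiplies the coefficient by \<open>exp (\<xi> i x)\<close>.\<close>
  define eta where "eta R x = (\<Prod>i\<in>R. exp (\<xi> i x) - 1)" for R x
  define e where "e R = (\<Prod>i\<in>R. exp (c i) - 1)" for R
  have e0: "0 \<le> e R" if "R \<subseteq> I" for R
    unfolding e_def using that c by (intro prod_nonneg) auto
  have eta: "Linf_bound D (eta R) (e R)" if "R \<subseteq> I" for R
    unfolding eta_def e_def
    by (intro Linf_bound_prod Linf_bound_exp_minus_1 chi) (use that I finite_subset in auto)
  have UH: "U Q \<in> H10 D" for Q unfolding U_def by (rule sol_mem[OF bQ])
  have Usol: "Exp (bQ Q) (snd (U Q)) \<bullet> snd v = f v" if "v \<in> H10 D" for Q v
    using sol_weak_solution[OF bQ, of Q] that weak_solution_iff[OF bQ, of Q] by (simp add: U_def)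
  have coef: "Linf_bound D (\<lambda>x. exp (bQ Q x) * eta R x) (exp (B + 4 / 5) * e R)" if "R \<subseteq> I" for Q R
    by (intro Linf_bound_mult Linf_bound_exp bQ eta that)
  define T :: "'i set \<Rightarrow> 'i set \<Rightarrow> ('a, 'a) L2 \<Rightarrow> ('a, 'a) L2" where "T Q R p = mult_L2 D (\<lambda>x. exp (bQ Q x) * eta R x) p" for Q R p
  \<comment> \<open>The mixed difference of the left side of the weak formulation, expanded by a
    Leibniz rule: the coefficient is differenced over \<open>R\<close>, the solution over
    \<open>P - R\<close> from the base advanced by \<open>R\<close>.\<close>
  define Lb :: "'i set \<Rightarrow> 'i set \<Rightarrow> 'a H1 \<Rightarrow> real" where "Lb P Q v = (\<Sum>R\<in>Pow P. T Q R (snd (mixed_diff U (P - R) (Q \<union> R))) \<bullet> snd v)" for P Q v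
  \<comment> \<open>The subsets of \<open>insert i P\<close> pair up as \<open>R\<close> and
    \<open>insert i R\<close>; advancing the base by \<open>i\<close> adds the coefficient of
    \<open>insert i R\<close> to that of \<open>R\<close>.\<close>
  have leibniz: "Lb (insert i P) Q v = Lb P (insert i Q) v - Lb P Q v"
    if i: "i \<in> I" "i \<notin> P" "i \<notin> Q" and PQ: "P \<subseteq> I" "Q \<subseteq> I" for i P Q v
  proof -
    have fP: "finite P" using PQ(1) I finite_subset by blast
    have Tl: "linear (T Q R)" if "R \<subseteq> I" for Q R
      unfolding T_def[abs_def] by (rule mult_linear[OF coef[OF that]])
    have step: "T Q R (snd (mixed_diff U (insert i P - R) (Q \<union> R))) \<bullet> snd v
          + T Q (insert i R) (snd (mixed_diff U (insert i P - insert i R) (Q \<union> insert i R))) \<bullet> snd v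
        = T (insert i Q) R (snd (mixed_diff U (P - R) (insert i Q \<union> R))) \<bullet> snd v
          - T Q R (snd (mixed_diff U (P - R) (Q \<union> R))) \<bullet> snd v" if R: "R \<in> Pow P" for R
    proof -
      have RI: "R \<subseteq> I" "insert i R \<subseteq> I" "i \<notin> R" "finite R" using R PQ i fP finite_subset by auto
      have s1: "insert i P - R = insert i (P - R)" "insert i P - insert i R = P - R"
        "Q \<union> insert i R = insert i Q \<union> R" using R i by auto
      define w where "w = snd (mixed_diff U (P - R) (insert i Q \<union> R))"
      have "snd (mixed_diff U (insert i P - R) (Q \<union> R)) = w - snd (mixed_diff U (P - R) (Q \<union> R))"
        unfolding s1(1) using mixed_diff_insert[of "P - R" i U "Q \<union> R"] fP i by (simp add: w_def)
      then have a: "T Q R (snd (mixed_diff U (insert i P - R) (Q \<union> R)))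
          = T Q R w - T Q R (snd (mixed_diff U (P - R) (Q \<union> R)))"
        using linear_diff[OF Tl[OF RI(1)]] by simp
      have "bQ (insert i Q) x = bQ Q x + \<xi> i x" for x
      proof -
        have "insert i Q \<inter> I = insert i (Q \<inter> I)" using i by auto
        then show ?thesis using i I by (simp add: bQ_def)
      qed
      then have "(\<lambda>x. exp (bQ (insert i Q) x) * eta R x) = (\<lambda>x. exp (bQ Q x) * eta R x + exp (bQ Q x) * eta (insert i R) x)"
        using RI by (auto simp: eta_def exp_add algebra_simps)
      then have b: "T (insert i Q) R w = T Q R w + T Q (insert i R) w"
        unfolding T_def
        using mult_add_left[OF coef[OF RI(1)] coef[OF RI(2)] Linf_bound_add[OF coef[OF RI(1)] coef[OF RI(2)]]]
        by simp
      show ?thesis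
        unfolding a s1(2,3) w_def[symmetric] b by (simp add: inner_diff_left inner_add_left)
    qed
    show ?thesis
      unfolding Lb_def sum_Pow_insert[OF fP i(2)] sum.distrib[symmetric] sum_subtractf[symmetric]
      using step by (intro sum.cong) auto
  qed
  have T0: "T Q {} p = Exp (bQ Q) p" for Q p by (simp add: T_def eta_def Exp_def)
  have Lb0: "Lb {} Q v = f v" if "v \<in> H10 D" for Q v
    using Usol[OF that] by (simp add: Lb_def T0)
  \<comment> \<open>The right side \<open>f\<close> does not depend on the parameters, so every
    difference of order at least one vanishes.\<close>
  have Lb1: "Lb P Q v = 0" if "finite P" "P \<noteq> {}" "P \<subseteq> I" "Q \<subseteq> I" "P \<inter> Q = {}" and v: "v \<in> H10 D" for P Q v
    using that(1-5)
  proof (induction P arbitrary: Q rule: finite_induct)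
    case (insert i P)
    then have eq: "Lb (insert i P) Q v = Lb P (insert i Q) v - Lb P Q v"
      by (intro leibniz) auto
    show ?case
    proof (cases "P = {}")
      case True
      then show ?thesis using eq Lb0[OF v] by simp
    next
      case False
      then have "Lb P (insert i Q) v = 0" "Lb P Q v = 0"
        using insert by (auto intro!: insert.IH)
      then show ?thesis using eq by simp
    qed
  qed simp
  define En where "En Q p = norm (Exp (\<lambda>x. bQ Q x / 2) p)" for Q p
  \<comment> \<open>Changing the base changes the energy weight by the exponential of half the added
    increments; since these sum to at most \<open>4 / 5\<close>, the price is
    \<open>exp (2 / 5)\<close>, hence at most the \<open>3 / 2\<close> of
    \<open>sum_fact_recursion\<close>.\<close>
  have compare: "En Q p \<le> exp (2 / 5) * En (Q \<union> R) p" if "R \<subseteq> I" "Q \<subseteq> I" "R \<inter> Q = {}" for Q R p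
  proof -
    have h: "Linf_bound D (\<lambda>x. - (\<Sum>i\<in>R. \<xi> i x) / 2) (2 / 5)"
      using Linf_bound_cmult[OF chi_sum[OF that(1)], of "- 1 / 2"] by simp
    have "bQ (Q \<union> R) x = bQ Q x + (\<Sum>i\<in>R. \<xi> i x)" for x
    proof -
      have "(Q \<union> R) \<inter> I = (Q \<inter> I) \<union> R" "finite (Q \<inter> I)" "finite R" "(Q \<inter> I) \<inter> R = {}"
        using that I finite_subset by auto
      then show ?thesis by (simp add: bQ_def sum.union_disjoint)
    qed
    then have "(\<lambda>x. bQ Q x / 2) = (\<lambda>x. - (\<Sum>i\<in>R. \<xi> i x) / 2 + bQ (Q \<union> R) x / 2)"
      by (auto simp: field_simps)
    then have "Exp (\<lambda>x. bQ Q x / 2) p = Exp (\<lambda>x. - (\<Sum>i\<in>R. \<xi> i x) / 2) (Exp (\<lambda>x. bQ (Q \<union> R) x / 2) p)"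
      using Exp_Exp[OF h Linf_bound_half[OF bQ]] by simp
    then show ?thesis unfolding En_def using Exp_norm_le[OF h] by simp
  qed
  have E32: "exp (2 / 5 :: real) \<le> 3 / 2"
  proof -
    have "exp (2/5 :: real) ^ 5 = exp 1 ^ 2" by (simp add: exp_of_nat_mult[symmetric])
    also have "\<dots> \<le> (272 / 100) ^ 2" using e_less_272 by (intro power_mono) auto
    also have "\<dots> \<le> (3 / 2 :: real) ^ 5" by (simp add: power2_eq_square power_divide)
    finally show ?thesis by (rule power_le_imp_le_base[of _ 4, simplified]) simp
  qed
  have main: "En Q (snd (mixed_diff U P Q)) \<le> M * (fact (card P) * 2 ^ card P) * e P"
    if "P \<subseteq> I" "Q \<subseteq> I" "P \<inter> Q = {}" for P Q
    using that
  proof (induction "card P" arbitrary: P Q rule: less_induct)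
    case less
    have fP: "finite P" using less.prems I finite_subset by blast
    show ?case
    proof (cases "P = {}")
      case True
      have "En Q (snd (U Q)) \<le> Kf * exp ((B + 4 / 5) / 2)"
        unfolding En_def U_def by (rule energy_bound[OF bQ sol_weak_solution[OF bQ]])
      also have "\<dots> = M" by (simp add: M_def add_divide_distrib)
      finally show ?thesis using True by (simp add: e_def)
    next
      case False
      define w where "w = mixed_diff U P Q"
      define W where "W = En Q (snd w)"
      have wH: "w \<in> H10 D" unfolding w_def by (rule mixed_diff_H10[OF UH])
      define Ps where "Ps = Pow P - {{}}"
      have PsP: "Pow P = insert {} Ps" "{} \<notin> Ps" "finite Ps" using fP by (auto simp: Ps_def)
      \<comment> \<open>The vanishing difference is tested with \<open>w\<close> itself: the term
        \<open>R = {}\<close> is the squared energy norm of \<open>w\<close>, and all other terms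
        have lower order.\<close>
      have "0 = Lb P Q w" using Lb1[OF fP False less.prems wH] by simp
      also have "\<dots> = Exp (bQ Q) (snd w) \<bullet> snd w + (\<Sum>R\<in>Ps. T Q R (snd (mixed_diff U (P - R) (Q \<union> R))) \<bullet> snd w)"
        unfolding Lb_def PsP(1) sum.insert[OF PsP(3,2)] by (simp add: T0 w_def)
      also have "Exp (bQ Q) (snd w) \<bullet> snd w = W * W"
        unfolding Exp_inner[OF bQ] W_def En_def by (simp add: power2_norm_eq_inner[symmetric] power2_eq_square)
      finally have "W * W = - (\<Sum>R\<in>Ps. T Q R (snd (mixed_diff U (P - R) (Q \<union> R))) \<bullet> snd w)" by simp
      also have "\<dots> \<le> (\<Sum>R\<in>Ps. \<bar>T Q R (snd (mixed_diff U (P - R) (Q \<union> R))) \<bullet> snd w\<bar>)"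
        unfolding sum_negf[symmetric] by (intro sum_mono) simp
      also have "\<dots> \<le> (\<Sum>R\<in>Ps. (3 / 2 * M * e P * (fact (card P - card R) * 2 ^ (card P - card R))) * W)"
      proof (rule sum_mono)
        fix R assume "R \<in> Ps"
        then have R: "R \<subseteq> P" "R \<noteq> {}" by (auto simp: Ps_def)
        then have RI: "R \<subseteq> I" "finite R" using less.prems finite_subset[OF _ fP] by auto
        define q where "q = snd (mixed_diff U (P - R) (Q \<union> R))"
        have cardR: "card (P - R) = card P - card R" using R(1) RI(2) by (simp add: card_Diff_subset)
        have "card R \<le> card P" "0 < card R" using R RI fP by (auto intro: card_mono simp: card_gt_0_iff)
        then have lt: "card (P - R) < card P" unfolding cardR by simp
        \<comment> \<open>The weight \<open>exp (bQ Q)\<close> is divided evenly between the two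
          arguments, which leaves \<open>eta R\<close> as the only multiplier between
          energy-normalized gradients.\<close>
        have "T Q R q = mult_L2 D (\<lambda>x. exp (bQ Q x / 2)) (mult_L2 D (eta R) (Exp (\<lambda>x. bQ Q x / 2) q))"
        proof -
          note h = Linf_bound_exp[OF Linf_bound_half[OF bQ, of Q]]
          have 1: "mult_L2 D (eta R) (Exp (\<lambda>x. bQ Q x / 2) q) = mult_L2 D (\<lambda>x. eta R x * exp (bQ Q x / 2)) q"
            unfolding Exp_def by (rule mult_mult[OF eta[OF RI(1)] h Linf_bound_mult[OF eta[OF RI(1)] h]])
          have 2: "mult_L2 D (\<lambda>x. exp (bQ Q x / 2)) (mult_L2 D (\<lambda>x. eta R x * exp (bQ Q x / 2)) q)
              = mult_L2 D (\<lambda>x. exp (bQ Q x / 2) * (eta R x * exp (bQ Q x / 2))) q"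
            by (rule mult_mult[OF h Linf_bound_mult[OF eta[OF RI(1)] h] Linf_bound_mult[OF h Linf_bound_mult[OF eta[OF RI(1)] h]]])
          have "(\<lambda>x. exp (bQ Q x / 2) * (eta R x * exp (bQ Q x / 2))) = (\<lambda>x. exp (bQ Q x) * eta R x)"
          proof
            fix x
            have "exp (bQ Q x / 2) * exp (bQ Q x / 2) = exp (bQ Q x)" by (simp add: exp_add[symmetric])
            then show "exp (bQ Q x / 2) * (eta R x * exp (bQ Q x / 2)) = exp (bQ Q x) * eta R x"
              by (metis mult.assoc mult.commute)
          qed
          then show ?thesis unfolding 1 2 T_def by simp
        qed
        then have "T Q R q \<bullet> snd w = mult_L2 D (eta R) (Exp (\<lambda>x. bQ Q x / 2) q) \<bullet> Exp (\<lambda>x. bQ Q x / 2) (snd w)"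
          using mult_self_adjoint[OF Linf_bound_exp[OF Linf_bound_half[OF bQ, of Q]]] by (simp add: Exp_def)
        then have "\<bar>T Q R q \<bullet> snd w\<bar> \<le> norm (mult_L2 D (eta R) (Exp (\<lambda>x. bQ Q x / 2) q)) * W"
          unfolding W_def En_def by (simp add: Cauchy_Schwarz_ineq2)
        also have "\<dots> \<le> (e R * En Q q) * W"
          unfolding En_def W_def by (intro mult_right_mono mult_norm_le[OF eta[OF RI(1)] e0[OF RI(1)]]) auto
        also have "\<dots> \<le> (e R * (3 / 2 * (M * (fact (card (P - R)) * 2 ^ card (P - R)) * e (P - R)))) * W"
        proof (intro mult_right_mono mult_left_mono e0 RI)
          have "En Q q \<le> exp (2 / 5) * En (Q \<union> R) q"
            using R less.prems by (intro compare) auto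
          also have "\<dots> \<le> 3 / 2 * (M * (fact (card (P - R)) * 2 ^ card (P - R)) * e (P - R))"
            unfolding q_def using R less.prems by (intro mult_mono E32 less.hyps[OF lt]) (auto simp: En_def)
          finally show "En Q q \<le> 3 / 2 * (M * (fact (card (P - R)) * 2 ^ card (P - R)) * e (P - R))" .
        qed (auto simp: W_def En_def)
        also have "\<dots> = (3 / 2 * M * (e (P - R) * e R) * (fact (card P - card R) * 2 ^ (card P - card R))) * W"
          unfolding cardR by (simp add: mult_ac)
        also have "e (P - R) * e R = e P"
          unfolding e_def by (rule prod.subset_diff[OF R(1) fP, symmetric])
        finally show "\<bar>T Q R (snd (mixed_diff U (P - R) (Q \<union> R))) \<bullet> snd w\<bar>
            \<le> (3 / 2 * M * e P * (fact (card P - card R) * 2 ^ (card P - card R))) * W"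
          unfolding q_def .
      qed
      also have "\<dots> = ((\<Sum>R\<in>Ps. fact (card P - card R) * 2 ^ (card P - card R)) * (3 / 2)) * (M * e P) * W"
        by (simp add: sum_distrib_left sum_distrib_right mult_ac)
      also have "\<dots> \<le> (fact (card P) * 2 ^ card P) * (M * e P) * W"
      proof (intro mult_right_mono)
        \<comment> \<open>The value \<open>0\<close> at \<open>s = 0\<close> lets the sum range over
          all subsets of \<open>P\<close>, so that it can be grouped by cardinality.\<close>
        define g where "g s = (if s = 0 then 0 else fact (card P - s) * 2 ^ (card P - s) :: real)" for s
        have "(\<Sum>R\<in>Ps. fact (card P - card R) * 2 ^ (card P - card R)) = (\<Sum>R\<in>Ps. g (card R))"
          using fP finite_subset[OF _ fP] by (intro sum.cong refl) (auto simp: g_def Ps_def card_eq_0_iff)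
        also have "\<dots> = (\<Sum>R\<in>Pow P. g (card R))"
          unfolding PsP(1) sum.insert[OF PsP(3,2)] by (simp add: g_def)
        also have "\<dots> = (\<Sum>s\<le>card P. real (card P choose s) * g s)"
          by (rule sum_Pow_card[OF fP])
        also have "\<dots> = (\<Sum>s\<in>{1..card P}. real (card P choose s) * g s)"
          by (intro sum.mono_neutral_right) (auto simp: g_def)
        also have "\<dots> = (\<Sum>s\<in>{1..card P}. real (card P choose s) * (fact (card P - s) * 2 ^ (card P - s)))"
          by (intro sum.cong) (auto simp: g_def)
        finally show "(\<Sum>R\<in>Ps. fact (card P - card R) * 2 ^ (card P - card R)) * (3 / 2) \<le> fact (card P) * (2::real) ^ card P"
          using sum_fact_recursion[of "card P"] by simp
        show "0 \<le> M * e P" using M0 e0[OF less.prems(1)] by simp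
      qed (auto simp: W_def En_def)
      finally have "W * W \<le> (M * (fact (card P) * 2 ^ card P) * e P) * W" by (simp add: mult_ac)
      then have "W \<le> M * (fact (card P) * 2 ^ card P) * e P"
        using M0 e0[OF less.prems(1)] by (cases "W = 0") (auto simp: W_def En_def)
      then show ?thesis unfolding W_def w_def .
    qed
  qed
  show ?thesis using main[OF P] by (simp add: En_def M_def e_def)
qed

end

section \<open>The parametric problem\<close>

context domain
begin

lemma Linf_norm_bound_le: "Linf_bound D g c \<Longrightarrow> 0 \<le> c \<Longrightarrow> Linf_norm D g \<le> c"
  by (rule Linf_bound_imp(2))

lemma Linf_measurable: "g \<in> Linf D \<Longrightarrow> g \<in> borel_measurable (lebesgue_on D)"
  unfolding Linf_def by blast

lemma Linf_bound_diff_self: "g \<in> Linf D \<Longrightarrow> h \<in> Linf D \<Longrightarrow> Linf_bound D (\<lambda>x. g x - h x) (Linf_norm D (\<lambda>x. g x - h x))"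
proof -
  assume "g \<in> Linf D" "h \<in> Linf D"
  then have "Linf_bound D (\<lambda>x. g x - h x) (Linf_norm D g + Linf_norm D h)"
    by (intro Linf_bound_diff Linf_bound_Linf_norm)
  then have "(\<lambda>x. g x - h x) \<in> Linf D"
    by (rule Linf_bound_imp(1)) (simp add: Linf_norm_nonneg)
  then show ?thesis by (rule Linf_bound_Linf_norm)
qed

lemma Linf_bound_limit:
  assumes g: "g \<in> borel_measurable (lebesgue_on D)" and c: "c \<longlonglongrightarrow> C" and b: "\<And>n. Linf_bound D g (c n)"
  shows "Linf_bound D g C"
proof -
  have "AE x in lebesgue_on D. \<forall>n. \<bar>g x\<bar> \<le> c n"
    using b unfolding Linf_bound_def by (subst AE_all_countable) auto
  then have "AE x in lebesgue_on D. \<bar>g x\<bar> \<le> C"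
  proof eventually_elim
    fix x assume "\<forall>n. \<bar>g x\<bar> \<le> c n"
    then show "\<bar>g x\<bar> \<le> C" by (intro LIMSEQ_le_const[OF c]) auto
  qed
  with g show ?thesis by (simp add: Linf_bound_def)
qed

lemma Linf_sum: "(\<And>j. j \<in> I \<Longrightarrow> g j \<in> Linf D) \<Longrightarrow> finite I \<Longrightarrow> (\<lambda>x. \<Sum>j\<in>I. g j x) \<in> Linf D"
proof -
  assume "\<And>j. j \<in> I \<Longrightarrow> g j \<in> Linf D" "finite I"
  then have "Linf_bound D (\<lambda>x. \<Sum>j\<in>I. g j x) (\<Sum>j\<in>I. Linf_norm D (g j))"
    by (intro Linf_bound_sum Linf_bound_Linf_norm)
  then show ?thesis by (rule Linf_bound_imp(1)) (simp add: Linf_norm_nonneg sum_nonneg)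
qed

lemma Linf_sums_unique:
  assumes g: "\<And>j. g j \<in> Linf D" and b: "Linf_sums D g b" and b': "Linf_sums D g b'"
  shows "AE x in lebesgue_on D. b x = b' x"
proof -
  have bL: "b \<in> Linf D" "b' \<in> Linf D" using b b' by (auto simp: Linf_sums_def)
  have part: "(\<lambda>x. \<Sum>j<n. g j x) \<in> Linf D" for n using g by (intro Linf_sum) auto
  have "Linf_bound D (\<lambda>x. b x - b' x) (Linf_norm D (\<lambda>x. b x - (\<Sum>j<n. g j x)) + Linf_norm D (\<lambda>x. b' x - (\<Sum>j<n. g j x)))" for n
    using Linf_bound_diff[OF Linf_bound_diff_self[OF bL(1) part[of n]] Linf_bound_diff_self[OF bL(2) part[of n]]] by simp
  moreover have "(\<lambda>n. Linf_norm D (\<lambda>x. b x - (\<Sum>j<n. g j x)) + Linf_norm D (\<lambda>x. b' x - (\<Sum>j<n. g j x))) \<longlonglongrightarrow> 0 + 0"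
    using b b' by (intro tendsto_add) (auto simp: Linf_sums_def)
  ultimately have "Linf_bound D (\<lambda>x. b x - b' x) (0 + 0)"
    using Linf_bound_limit[OF borel_measurable_diff[OF bL[THEN Linf_measurable]]] by blast
  then show ?thesis by (auto simp: Linf_bound_def elim: eventually_mono)
qed

lemma Linf_sums_bound:
  assumes b: "Linf_sums D g b" and g: "\<And>j. Linf_bound D (g j) (c j)" "\<And>j. 0 \<le> c j" "summable c"
  shows "Linf_bound D b (suminf c)"
proof -
  have gL: "g j \<in> Linf D" for j using g by (intro Linf_bound_imp)
  have bL: "b \<in> Linf D" using b by (simp add: Linf_sums_def)
  have part: "(\<lambda>x. \<Sum>j<n. g j x) \<in> Linf D" for n using gL by (intro Linf_sum) auto
  have "Linf_bound D b (Linf_norm D (\<lambda>x. b x - (\<Sum>j<n. g j x)) + suminf c)" for n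
  proof -
    have "Linf_bound D (\<lambda>x. (b x - (\<Sum>j<n. g j x)) + (\<Sum>j<n. g j x)) (Linf_norm D (\<lambda>x. b x - (\<Sum>j<n. g j x)) + (\<Sum>j<n. c j))"
      by (intro Linf_bound_add Linf_bound_diff_self bL part Linf_bound_sum g) auto
    moreover have "(\<Sum>j<n. c j) \<le> suminf c" using g by (intro sum_le_suminf) auto
    ultimately show ?thesis by (auto intro: Linf_bound_mono)
  qed
  moreover have "(\<lambda>n. Linf_norm D (\<lambda>x. b x - (\<Sum>j<n. g j x)) + suminf c) \<longlonglongrightarrow> 0 + suminf c"
    using b by (intro tendsto_intros) (auto simp: Linf_sums_def)
  ultimately have "Linf_bound D b (0 + suminf c)"
    using Linf_bound_limit[OF Linf_measurable[OF bL]] by blast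
  then show ?thesis by simp
qed

lemma sum_diff_lessThan:
  fixes g :: "nat \<Rightarrow> 'c::ab_group_add"
  shows "n \<le> m \<Longrightarrow> (\<Sum>j<m. g j) - (\<Sum>j<n. g j) = (\<Sum>j\<in>{n..<m}. g j)"
  by (induction m rule: dec_induct) (auto simp: algebra_simps)

text \<open>Completeness of L^infty. The tolerance runs through \<open>1 / Suc k\<close> so that all
  quantifiers are countable; in this form the set of parameters with convergent series is
  measurable.\<close>

lemma Linf_sums_iff_Cauchy:
  assumes g: "\<And>j. g j \<in> Linf D"
  shows "(\<exists>b. Linf_sums D g b) \<longleftrightarrow>
    (\<forall>k. \<exists>N. \<forall>n\<ge>N. \<forall>m\<ge>n. Linf_norm D (\<lambda>x. \<Sum>j\<in>{n..<m}. g j x) \<le> 1 / real (Suc k))" (is "_ \<longleftrightarrow> ?C")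
proof
  assume "\<exists>b. Linf_sums D g b"
  then obtain b where b: "Linf_sums D g b" by blast
  have bL: "b \<in> Linf D" using b by (simp add: Linf_sums_def)
  have part: "(\<lambda>x. \<Sum>j<n. g j x) \<in> Linf D" for n using g by (intro Linf_sum) auto
  show ?C
  proof
    fix k
    define r where "r n = Linf_norm D (\<lambda>x. b x - (\<Sum>j<n. g j x))" for n
    have "r \<longlonglongrightarrow> 0" using b by (simp add: Linf_sums_def r_def[abs_def])
    then have "\<exists>N. \<forall>n\<ge>N. norm (r n - 0) < 1 / (2 * real (Suc k))"
      by (intro LIMSEQ_D) auto
    then obtain N where N: "\<And>n. n \<ge> N \<Longrightarrow> r n < 1 / (2 * real (Suc k))"
      by (auto simp: abs_less_iff)
    have "Linf_norm D (\<lambda>x. \<Sum>j\<in>{n..<m}. g j x) \<le> 1 / real (Suc k)" if "n \<ge> N" "m \<ge> n" for n m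
    proof -
      have "Linf_bound D (\<lambda>x. (b x - (\<Sum>j<n. g j x)) - (b x - (\<Sum>j<m. g j x))) (r n + r m)"
        unfolding r_def by (intro Linf_bound_diff Linf_bound_diff_self bL part)
      then have "Linf_bound D (\<lambda>x. \<Sum>j\<in>{n..<m}. g j x) (r n + r m)"
        by (simp add: sum_diff_lessThan[OF that(2), symmetric])
      then have "Linf_norm D (\<lambda>x. \<Sum>j\<in>{n..<m}. g j x) \<le> r n + r m"
        by (rule Linf_norm_bound_le) (simp add: r_def Linf_norm_nonneg)
      also have "\<dots> \<le> 1 / (2 * real (Suc k)) + 1 / (2 * real (Suc k))"
        using N[of n] N[of m] that by (intro add_mono) auto
      also have "\<dots> = 1 / real (Suc k)" by (simp add: field_simps)
      finally show ?thesis .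
    qed
    then show "\<exists>N. \<forall>n\<ge>N. \<forall>m\<ge>n. Linf_norm D (\<lambda>x. \<Sum>j\<in>{n..<m}. g j x) \<le> 1 / real (Suc k)" by blast
  qed
next
  assume ?C
  then obtain N where N: "\<And>k n m. n \<ge> N k \<Longrightarrow> m \<ge> n \<Longrightarrow> Linf_norm D (\<lambda>x. \<Sum>j\<in>{n..<m}. g j x) \<le> 1 / real (Suc k)"
    by metis
  define s where "s n x = (\<Sum>j<n. g j x)" for n x
  have s: "s n \<in> Linf D" for n unfolding s_def using g by (intro Linf_sum) auto
  have sm: "s n \<in> borel_measurable (lebesgue_on D)" for n using s by (simp add: Linf_def)
  have "AE x in lebesgue_on D. \<bar>s m x - s n x\<bar> \<le> 1 / real (Suc k)" if "n \<ge> N k" "m \<ge> n" for k n m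
  proof -
    have "(\<lambda>x. \<Sum>j\<in>{n..<m}. g j x) \<in> Linf D" using g by (intro Linf_sum) auto
    then have "AE x in lebesgue_on D. \<bar>\<Sum>j\<in>{n..<m}. g j x\<bar> \<le> Linf_norm D (\<lambda>x. \<Sum>j\<in>{n..<m}. g j x)"
      using Linf_bound_Linf_norm by (auto simp: Linf_bound_def)
    then show ?thesis
      using N[OF that] by (auto elim!: eventually_mono simp: s_def sum_diff_lessThan[OF that(2)])
  qed
  then have "AE x in lebesgue_on D. \<forall>k n m. n \<ge> N k \<longrightarrow> m \<ge> n \<longrightarrow> \<bar>s m x - s n x\<bar> \<le> 1 / real (Suc k)"
    by (intro AE_all_countable[THEN iffD2] allI AE_impI) auto
  then have unif: "AE x in lebesgue_on D. convergent (\<lambda>n. s n x) \<and>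
      (\<forall>k n. n \<ge> N k \<longrightarrow> \<bar>lim (\<lambda>n. s n x) - s n x\<bar> \<le> 1 / real (Suc k))"
  proof eventually_elim
    fix x assume *: "\<forall>k n m. n \<ge> N k \<longrightarrow> m \<ge> n \<longrightarrow> \<bar>s m x - s n x\<bar> \<le> 1 / real (Suc k)"
    have "Cauchy (\<lambda>n. s n x)"
    proof (rule CauchyI)
      fix e :: real assume "0 < e"
      then obtain k where k: "1 / real (Suc k) < e"
        using reals_Archimedean[of e] by (auto simp: inverse_eq_divide)
      have "norm (s m x - s n x) < e" if "m \<ge> N k" "n \<ge> N k" for m n
        using *[rule_format, of k n m] *[rule_format, of k m n] that k
        by (cases "n \<le> m") (auto simp: abs_minus_commute)
      then show "\<exists>M. \<forall>m\<ge>M. \<forall>n\<ge>M. norm (s m x - s n x) < e" by blast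
    qed
    then have c: "convergent (\<lambda>n. s n x)" by (simp add: Cauchy_convergent)
    then have L: "(\<lambda>n. s n x) \<longlonglongrightarrow> lim (\<lambda>n. s n x)" by (simp add: convergent_LIMSEQ_iff)
    have "\<bar>lim (\<lambda>n. s n x) - s n x\<bar> \<le> 1 / real (Suc k)" if n: "n \<ge> N k" for k n
    proof (rule LIMSEQ_le_const2)
      show "(\<lambda>m. \<bar>s m x - s n x\<bar>) \<longlonglongrightarrow> \<bar>lim (\<lambda>n. s n x) - s n x\<bar>"
        by (intro tendsto_intros L)
      show "\<exists>M. \<forall>m\<ge>M. \<bar>s m x - s n x\<bar> \<le> 1 / real (Suc k)" using * n by blast
    qed
    with c show "convergent (\<lambda>n. s n x) \<and> (\<forall>k n. n \<ge> N k \<longrightarrow> \<bar>lim (\<lambda>n. s n x) - s n x\<bar> \<le> 1 / real (Suc k))" by blast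
  qed
  define b where "b x = lim (\<lambda>n. s n x)" for x
  have bm: "b \<in> borel_measurable (lebesgue_on D)"
    unfolding b_def by (rule borel_measurable_lim_metric[OF sm])
  have bd: "Linf_bound D (\<lambda>x. b x - s n x) (1 / real (Suc k))" if "n \<ge> N k" for k n
    unfolding Linf_bound_def
  proof
    show "(\<lambda>x. b x - s n x) \<in> borel_measurable (lebesgue_on D)" using bm sm by measurable
    show "AE x in lebesgue_on D. \<bar>b x - s n x\<bar> \<le> 1 / real (Suc k)"
      using unif by eventually_elim (use that in \<open>simp add: b_def\<close>)
  qed
  have "Linf_bound D (\<lambda>x. (b x - s (N 0) x) + s (N 0) x) (1 / real (Suc 0) + Linf_norm D (s (N 0)))"
    by (intro Linf_bound_add bd Linf_bound_Linf_norm s) simp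
  then have "b \<in> Linf D"
    using Linf_bound_imp(1)[of b] by (simp add: Linf_norm_nonneg)
  moreover have "(\<lambda>n. Linf_norm D (\<lambda>x. b x - s n x)) \<longlonglongrightarrow> 0"
  proof (rule LIMSEQ_I)
    fix e :: real assume "0 < e"
    then obtain k where k: "1 / real (Suc k) < e"
      using reals_Archimedean[of e] by (auto simp: inverse_eq_divide)
    have "norm (Linf_norm D (\<lambda>x. b x - s n x) - 0) < e" if "n \<ge> N k" for n
      using Linf_norm_bound_le[OF bd[OF that]] k by (simp add: Linf_norm_nonneg)
    then show "\<exists>M. \<forall>n\<ge>M. norm (Linf_norm D (\<lambda>x. b x - s n x) - 0) < e" by blast
  qed
  ultimately show "\<exists>b. Linf_sums D g b" by (auto simp: Linf_sums_def s_def)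
qed

lemma Linf_sums_exists:
  assumes g: "\<And>j. Linf_bound D (g j) (c j)" "\<And>j. 0 \<le> c j" "summable c"
  shows "\<exists>b. Linf_sums D g b"
proof (subst Linf_sums_iff_Cauchy)
  show "g j \<in> Linf D" for j using g by (intro Linf_bound_imp)
  show "\<forall>k. \<exists>N. \<forall>n\<ge>N. \<forall>m\<ge>n. Linf_norm D (\<lambda>x. \<Sum>j\<in>{n..<m}. g j x) \<le> 1 / real (Suc k)"
  proof
    fix k
    obtain N where N: "\<And>n m. n \<ge> N \<Longrightarrow> norm (sum c {n..<m}) < 1 / real (Suc k)"
      using g(3) unfolding summable_Cauchy by (metis of_nat_0_less_iff zero_less_Suc zero_less_divide_1_iff)
    have "Linf_norm D (\<lambda>x. \<Sum>j\<in>{n..<m}. g j x) \<le> 1 / real (Suc k)" if "n \<ge> N" for n m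
    proof -
      have "Linf_norm D (\<lambda>x. \<Sum>j\<in>{n..<m}. g j x) \<le> sum c {n..<m}"
        by (intro Linf_norm_bound_le Linf_bound_sum g sum_nonneg) auto
      then show ?thesis using N[OF that, of m] by (simp add: abs_less_iff)
    qed
    then show "\<exists>N. \<forall>n\<ge>N. \<forall>m\<ge>n. Linf_norm D (\<lambda>x. \<Sum>j\<in>{n..<m}. g j x) \<le> 1 / real (Suc k)" by blast
  qed
qed

text \<open>From index \<open>i\<close> on, the shift changes limit and partial sums by the same
  function, so the remainders agree.\<close>

lemma Linf_sums_shift:
  fixes \<psi> :: "nat \<Rightarrow> 'a \<Rightarrow> real"
  assumes psi: "\<And>j. \<psi> j \<in> Linf D" and b: "Linf_sums D (\<lambda>j x. y j * \<psi> j x) b"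
  shows "Linf_sums D (\<lambda>j x. (y(i := y i + h)) j * \<psi> j x) (\<lambda>x. b x + h * \<psi> i x)"
  unfolding Linf_sums_def
proof
  have "Linf_bound D (\<lambda>x. b x + h * \<psi> i x) (Linf_norm D b + \<bar>h\<bar> * Linf_norm D (\<psi> i))"
    using b psi by (intro Linf_bound_add Linf_bound_cmult Linf_bound_Linf_norm) (auto simp: Linf_sums_def)
  then show "(\<lambda>x. b x + h * \<psi> i x) \<in> Linf D"
    by (rule Linf_bound_imp(1)) (simp add: Linf_norm_nonneg)
  have lim: "(\<lambda>n. Linf_norm D (\<lambda>x. b x - (\<Sum>j<n. y j * \<psi> j x))) \<longlonglongrightarrow> 0"
    using b by (simp add: Linf_sums_def)
  have eq: "(\<lambda>x. b x - (\<Sum>j<n. y j * \<psi> j x)) = (\<lambda>x. b x + h * \<psi> i x - (\<Sum>j<n. (y(i := y i + h)) j * \<psi> j x))" if "n > i" for n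
  proof
    fix x
    have "(\<Sum>j<n. (y(i := y i + h)) j * \<psi> j x) = (\<Sum>j<n. y j * \<psi> j x + (if j = i then h * \<psi> i x else 0))"
      by (intro sum.cong refl) (auto simp: distrib_right)
    also have "\<dots> = (\<Sum>j<n. y j * \<psi> j x) + h * \<psi> i x"
      using that by (simp add: sum.distrib)
    finally show "b x - (\<Sum>j<n. y j * \<psi> j x) = b x + h * \<psi> i x - (\<Sum>j<n. (y(i := y i + h)) j * \<psi> j x)" by simp
  qed
  have ev: "\<forall>\<^sub>F n in sequentially. Linf_norm D (\<lambda>x. b x - (\<Sum>j<n. y j * \<psi> j x))
      = Linf_norm D (\<lambda>x. b x + h * \<psi> i x - (\<Sum>j<n. (y(i := y i + h)) j * \<psi> j x))"
    by (intro eventually_sequentiallyI[of "Suc i"] arg_cong[where f="Linf_norm D"] eq) simp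
  show "(\<lambda>n. Linf_norm D (\<lambda>x. b x + h * \<psi> i x - (\<Sum>j<n. (y(i := y i + h)) j * \<psi> j x))) \<longlonglongrightarrow> 0"
    by (rule Lim_transform_eventually[OF lim ev])
qed

end

section \<open>The solution as a function of the parameters\<close>

locale parametric_elliptic = elliptic D f Kf Cp
  for D :: "'a::euclidean_space set" and f Kf Cp +
  fixes \<psi> :: "nat \<Rightarrow> 'a \<Rightarrow> real"
  assumes psi: "\<And>j. \<psi> j \<in> Linf D"
    and beta_summable: "summable (\<lambda>j. Linf_norm D (\<psi> j))"
begin

definition beta :: "nat \<Rightarrow> real" where "beta j = Linf_norm D (\<psi> j)"

lemma beta_nonneg: "0 \<le> beta j"
  by (simp add: beta_def Linf_norm_nonneg)

lemma summable_beta: "summable beta"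
  using beta_summable by (simp add: beta_def[abs_def])

lemma psi_bound: "Linf_bound D (\<psi> j) (beta j)"
  unfolding beta_def by (rule Linf_bound_Linf_norm[OF psi])

lemma term_bound: "Linf_bound D (\<lambda>x. r * \<psi> j x) (beta j * \<bar>r\<bar>)"
  using Linf_bound_cmult[OF psi_bound] by (simp add: mult.commute)

lemma term_Linf: "(\<lambda>x. r * \<psi> j x) \<in> Linf D"
  by (rule Linf_bound_imp(1)[OF term_bound]) (simp add: beta_nonneg)

text \<open>Parameters whose series converges absolutely in L^infty. They have full measure by
  \<open>AE_Omega\<close>, and on them \<open>Bnd\<close> bounds the log-coefficient
  explicitly.\<close>

definition Omega :: "(nat \<Rightarrow> real) set" where
  "Omega = {y. summable (\<lambda>j. beta j * \<bar>y j\<bar>)}"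

definition Bnd :: "(nat \<Rightarrow> real) \<Rightarrow> real" where
  "Bnd y = (\<Sum>j. beta j * \<bar>y j\<bar>)"

definition u :: "(nat \<Rightarrow> real) \<Rightarrow> 'a H1" where
  "u y = solution D \<psi> f y"

lemma AE_Omega: "AE y in gauss. y \<in> Omega"
  using AE_summable_gauss[OF beta_nonneg summable_beta] by (simp add: Omega_def)

lemma Linf_sums_Omega: "y \<in> Omega \<Longrightarrow> \<exists>b. Linf_sums D (\<lambda>j x. y j * \<psi> j x) b"
  by (rule Linf_sums_exists[OF term_bound]) (auto simp: Omega_def beta_nonneg)

text \<open>Two L^infty limits of the same series agree almost everywhere and \<open>sol\<close>
  sees only the almost-everywhere class, so the representative chosen by \<open>log_coeff\<close>
  does not matter.\<close>

lemma u_eq_sol: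
  assumes "Linf_sums D (\<lambda>j x. y j * \<psi> j x) b"
  shows "u y = sol b"
proof -
  have b': "Linf_sums D (\<lambda>j x. y j * \<psi> j x) (log_coeff D \<psi> y)"
    unfolding log_coeff_def using someI_ex[of "Linf_sums D (\<lambda>j x. y j * \<psi> j x)"] assms by blast
  have "u y = sol (log_coeff D \<psi> y)"
    using assms by (auto simp: u_def solution_def coeff_converges_def sol_def diffusion_coeff_def[abs_def])
  also have "\<dots> = sol b"
  proof (rule sol_cong)
    show "Linf_bound D (log_coeff D \<psi> y) (Linf_norm D (log_coeff D \<psi> y))" "Linf_bound D b (Linf_norm D b)"
      using assms b' by (auto intro!: Linf_bound_Linf_norm simp: Linf_sums_def)
    show "AE x in lebesgue_on D. log_coeff D \<psi> y x = b x"
      by (rule Linf_sums_unique[OF term_Linf b' assms])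
  qed
  finally show ?thesis .
qed

lemma u_in_H10: "u y \<in> H10 D"
proof (cases "\<exists>b. Linf_sums D (\<lambda>j x. y j * \<psi> j x) b")
  case True
  then obtain b where b: "Linf_sums D (\<lambda>j x. y j * \<psi> j x) b" by blast
  then have "Linf_bound D b (Linf_norm D b)" by (intro Linf_bound_Linf_norm) (simp add: Linf_sums_def)
  then show ?thesis unfolding u_eq_sol[OF b] by (rule sol_mem)
next
  \<comment> \<open>Where the series diverges \<open>solution\<close> has the default value
    \<open>0\<close>, so membership holds for every \<open>y\<close>.\<close>
  case False
  then show ?thesis using H10_mem(4) by (simp add: u_def solution_def coeff_converges_def)
qed

lemma u_V_norm:
  assumes "y \<in> Omega" shows "V_norm (u y) \<le> Kf * exp (Bnd y)"
proof -
  obtain b where b: "Linf_sums D (\<lambda>j x. y j * \<psi> j x) b" using Linf_sums_Omega[OF assms] by blast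
  have "Linf_bound D b (Bnd y)"
    unfolding Bnd_def by (rule Linf_sums_bound[OF b term_bound]) (use assms in \<open>auto simp: beta_nonneg Omega_def\<close>)
  then show ?thesis
    unfolding u_eq_sol[OF b] using weak_solution_V_norm sol_weak_solution by blast
qed

subsection \<open>Measurability\<close>

lemma measurable_gauss_continuous:
  "continuous_on UNIV F \<Longrightarrow> F \<in> borel_measurable gauss"
  using borel_measurable_continuous_onI measurable_cong_sets[OF sets_gauss_borel refl] by blast

lemma continuous_on_sum_coordinates:
  "continuous_on UNIV (\<lambda>y :: nat \<Rightarrow> real. \<Sum>j\<in>I. c j * \<bar>y j - z j\<bar>)"
  by (intro continuous_intros continuous_on_product_coordinates)

text \<open>The modulus \<open>G z\<close> may depend on the base point; this accommodates the
  Lipschitz constant of \<open>upart\<close>, whose bound grows with the parameters.\<close>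

lemma continuous_on_UNIV_comparison:
  fixes F :: "(nat \<Rightarrow> real) \<Rightarrow> 'c::real_normed_vector"
  assumes le: "\<And>y z. norm (F y - F z) \<le> G z y" and G: "\<And>z. continuous_on UNIV (G z)" "\<And>z. G z z = 0"
  shows "continuous_on UNIV F"
proof -
  have "(F \<longlongrightarrow> F z) (at z)" for z
  proof -
    have "(G z \<longlongrightarrow> G z z) (at z)"
      using G(1)[of z] by (simp add: continuous_on_def)
    then have "((\<lambda>y. F y - F z) \<longlongrightarrow> 0) (at z)"
      unfolding G(2) by (rule Lim_null_comparison[rotated]) (use le in auto)
    then show ?thesis by (rule LIM_zero_cancel)
  qed
  then show ?thesis by (simp add: continuous_on_def)
qed

lemma sum_term_bound: "finite I \<Longrightarrow> Linf_bound D (\<lambda>x. \<Sum>j\<in>I. y j * \<psi> j x) (\<Sum>j\<in>I. beta j * \<bar>y j\<bar>)"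
  by (rule Linf_bound_sum[OF _ term_bound])

lemma Linf_norm_sum_continuous:
  assumes I: "finite I"
  shows "continuous_on UNIV (\<lambda>y. Linf_norm D (\<lambda>x. \<Sum>j\<in>I. y j * \<psi> j x))"
proof (rule continuous_on_UNIV_comparison[where G="\<lambda>z y. \<Sum>j\<in>I. beta j * \<bar>y j - z j\<bar>"])
  have le: "Linf_norm D (\<lambda>x. \<Sum>j\<in>I. y j * \<psi> j x) \<le> Linf_norm D (\<lambda>x. \<Sum>j\<in>I. z j * \<psi> j x) + (\<Sum>j\<in>I. beta j * \<bar>y j - z j\<bar>)" for y z
  proof (rule Linf_norm_bound_le)
    have "(\<lambda>x. \<Sum>j\<in>I. z j * \<psi> j x) \<in> Linf D" using I term_Linf by (intro Linf_sum)
    then have "Linf_bound D (\<lambda>x. (\<Sum>j\<in>I. z j * \<psi> j x) + (\<Sum>j\<in>I. (y j - z j) * \<psi> j x))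
      (Linf_norm D (\<lambda>x. \<Sum>j\<in>I. z j * \<psi> j x) + (\<Sum>j\<in>I. beta j * \<bar>y j - z j\<bar>))"
      by (intro Linf_bound_add Linf_bound_Linf_norm sum_term_bound[where I=I and y="\<lambda>j. y j - z j"] I)
    then show "Linf_bound D (\<lambda>x. \<Sum>j\<in>I. y j * \<psi> j x)
      (Linf_norm D (\<lambda>x. \<Sum>j\<in>I. z j * \<psi> j x) + (\<Sum>j\<in>I. beta j * \<bar>y j - z j\<bar>))"
      by (simp add: sum.distrib[symmetric] left_diff_distrib)
  qed (simp add: Linf_norm_nonneg sum_nonneg beta_nonneg)
  fix y z
  show "norm (Linf_norm D (\<lambda>x. \<Sum>j\<in>I. y j * \<psi> j x) - Linf_norm D (\<lambda>x. \<Sum>j\<in>I. z j * \<psi> j x)) \<le> (\<Sum>j\<in>I. beta j * \<bar>y j - z j\<bar>)"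
    using le[of y z] le[of z y] by (simp add: abs_le_iff abs_minus_commute)
qed (auto intro: continuous_on_sum_coordinates)

text \<open>Truncation to finitely many coordinates gives continuity for the product topology, and
  measurability of \<open>u\<close> follows by a pointwise limit.\<close>

definition upart :: "nat \<Rightarrow> (nat \<Rightarrow> real) \<Rightarrow> 'a H1" where
  "upart n y = sol (\<lambda>x. \<Sum>j<n. y j * \<psi> j x)"

lemma upart_continuous: "continuous_on UNIV (upart n)"
proof -
  define S where "S y = (\<Sum>j<n. beta j * \<bar>y j\<bar>)" for y :: "nat \<Rightarrow> real"
  define d where "d z y = (\<Sum>j<n. beta j * \<bar>y j - z j\<bar>)" for y z :: "nat \<Rightarrow> real"
  have S0: "0 \<le> S y" for y by (simp add: S_def sum_nonneg beta_nonneg)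
  show ?thesis
  proof (rule continuous_on_UNIV_comparison[where G="\<lambda>z y. Cp * (Kf * exp (3 * (S y + S z)) * d z y)"])
    fix y z
    have b: "Linf_bound D (\<lambda>x. \<Sum>j<n. y j * \<psi> j x) (S y + S z)" "Linf_bound D (\<lambda>x. \<Sum>j<n. z j * \<psi> j x) (S y + S z)"
      using sum_term_bound[where I="{..<n}" and y=y] sum_term_bound[where I="{..<n}" and y=z] S0[of y] S0[of z]
      by (auto simp: S_def intro: Linf_bound_mono)
    have db: "Linf_bound D (\<lambda>x. (\<Sum>j<n. y j * \<psi> j x) - (\<Sum>j<n. z j * \<psi> j x)) (d z y)"
      using sum_term_bound[where I="{..<n}" and y="\<lambda>j. y j - z j"] by (simp add: d_def sum_subtractf left_diff_distrib)
    have "V_norm (upart n y - upart n z) \<le> Kf * exp (3 * (S y + S z)) * d z y"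
      unfolding upart_def
      by (rule weak_solution_lipschitz[OF b(1) sol_weak_solution[OF b(1)] b(2) sol_weak_solution[OF b(2)] db])
        (simp add: d_def sum_nonneg beta_nonneg)
    moreover have "upart n y - upart n z \<in> H10 D"
      unfolding upart_def using b by (intro H10_mem sol_mem)
    ultimately show "norm (upart n y - upart n z) \<le> Cp * (Kf * exp (3 * (S y + S z)) * d z y)"
      using poincare by (meson mult_left_mono less_imp_le order_trans)
  next
    fix z
    have "continuous_on UNIV S" "continuous_on UNIV (d z)"
      using continuous_on_sum_coordinates[where I="{..<n}" and c=beta and z="\<lambda>_. 0"]
        continuous_on_sum_coordinates[where I="{..<n}" and c=beta and z=z]
      by (auto simp: S_def[abs_def] d_def[abs_def])
    then show "continuous_on UNIV (\<lambda>y. Cp * (Kf * exp (3 * (S y + S z)) * d z y))"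
      by (intro continuous_intros)
  qed (simp add: d_def)
qed

lemma upart_converges:
  assumes b: "Linf_sums D (\<lambda>j x. y j * \<psi> j x) b"
  shows "(\<lambda>n. upart n y) \<longlonglongrightarrow> u y"
proof -
  define r where "r n = Linf_norm D (\<lambda>x. b x - (\<Sum>j<n. y j * \<psi> j x))" for n
  have r0: "r \<longlonglongrightarrow> 0" using b by (simp add: Linf_sums_def r_def[abs_def])
  have bL: "b \<in> Linf D" using b by (simp add: Linf_sums_def)
  have part: "(\<lambda>x. \<Sum>j<n. y j * \<psi> j x) \<in> Linf D" for n using term_Linf by (intro Linf_sum) auto
  have rb: "Linf_bound D (\<lambda>x. b x - (\<Sum>j<n. y j * \<psi> j x)) (r n)" for n
    unfolding r_def by (rule Linf_bound_diff_self[OF bL part])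
  define B where "B = Linf_norm D b"
  have bB: "Linf_bound D b B" unfolding B_def by (rule Linf_bound_Linf_norm[OF bL])
  have rn: "0 \<le> r n" for n by (simp add: r_def Linf_norm_nonneg)
  have le: "norm (upart n y - u y) \<le> Cp * (Kf * exp (3 * (B + r n)) * r n)" for n
  proof -
    have b1: "Linf_bound D b (B + r n)" using bB rn[of n] by (auto intro: Linf_bound_mono)
    have b2: "Linf_bound D (\<lambda>x. \<Sum>j<n. y j * \<psi> j x) (B + r n)"
      using Linf_bound_diff[OF bB rb[of n]] by simp
    have db: "Linf_bound D (\<lambda>x. (\<Sum>j<n. y j * \<psi> j x) - b x) (r n)"
      using Linf_bound_cmult[OF rb[of n], of "-1"] by simp
    have "V_norm (upart n y - u y) \<le> Kf * exp (3 * (B + r n)) * r n"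
      unfolding upart_def u_eq_sol[OF b]
      by (rule weak_solution_lipschitz[OF b2 sol_weak_solution[OF b2] b1 sol_weak_solution[OF b1] db rn])
    moreover have "upart n y - u y \<in> H10 D"
      unfolding upart_def using b2 by (intro H10_mem sol_mem u_in_H10)
    ultimately show ?thesis
      using poincare by (meson mult_left_mono less_imp_le order_trans)
  qed
  have "(\<lambda>n. Cp * (Kf * exp (3 * (B + r n)) * r n)) \<longlonglongrightarrow> Cp * (Kf * exp (3 * (B + 0)) * 0)"
    by (intro tendsto_intros r0)
  then have "(\<lambda>n. upart n y - u y) \<longlonglongrightarrow> 0"
    using le by (intro Lim_null_comparison[of "\<lambda>n. upart n y - u y"]) (auto intro: always_eventually)
  then show ?thesis by (rule LIM_zero_cancel)
qed

lemma u_measurable: "u \<in> borel_measurable gauss"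
proof -
  define S where "S = {y. \<exists>b. Linf_sums D (\<lambda>j x. y j * \<psi> j x) b}"
  have [measurable]: "(\<lambda>y. Linf_norm D (\<lambda>x. \<Sum>j\<in>{n..<m}. y j * \<psi> j x)) \<in> borel_measurable gauss" for n m
    by (rule measurable_gauss_continuous[OF Linf_norm_sum_continuous]) simp
  have [measurable]: "upart n \<in> borel_measurable gauss" for n
    by (rule measurable_gauss_continuous[OF upart_continuous])
  have "S = {y \<in> space gauss. \<forall>k. \<exists>N. \<forall>n. n \<ge> N \<longrightarrow> (\<forall>m. m \<ge> n \<longrightarrow>
      Linf_norm D (\<lambda>x. \<Sum>j\<in>{n..<m}. y j * \<psi> j x) \<le> 1 / real (Suc k))}"
    unfolding S_def using Linf_sums_iff_Cauchy[OF term_Linf] by auto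
  also have "\<dots> \<in> sets gauss" by measurable
  finally have S: "S \<in> sets gauss" .
  have "u y = (if y \<in> S then lim (\<lambda>n. upart n y) else 0)" for y
  proof (cases "y \<in> S")
    case True
    then obtain b where "Linf_sums D (\<lambda>j x. y j * \<psi> j x) b" by (auto simp: S_def)
    then show ?thesis using limI[OF upart_converges] True by simp
  next
    case False
    then have "\<not> coeff_converges D \<psi> y" unfolding S_def coeff_converges_def by blast
    then show ?thesis using False by (simp add: u_def solution_def)
  qed
  moreover have "(\<lambda>y. if y \<in> S then lim (\<lambda>n. upart n y) else 0) \<in> borel_measurable gauss"
    using S by (intro measurable_If_set borel_measurable_lim_metric) auto
  ultimately show ?thesis by presburger
qed

text \<open>Squaring doubles the weights, which stay summable, so the exponential moment for
  \<open>2 * beta\<close> applies.\<close>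

lemma exp_Bnd_square_integrable: "integrable gauss (\<lambda>y. (exp (Bnd y))\<^sup>2)"
proof -
  have "summable (\<lambda>j. 2 * beta j)" using beta_summable by (intro summable_mult) (simp add: beta_def)
  then have "integrable gauss (\<lambda>y. exp (\<Sum>j. 2 * beta j * \<bar>y j\<bar>))"
    by (intro integrable_exp_suminf_gauss) (auto simp: beta_nonneg)
  moreover have "AE y in gauss. exp (\<Sum>j. 2 * beta j * \<bar>y j\<bar>) = (exp (Bnd y))\<^sup>2"
    using AE_Omega
    by eventually_elim (simp add: Omega_def Bnd_def mult.assoc suminf_mult exp_of_nat_mult[of 2, simplified])
  ultimately show ?thesis
    by (subst integrable_cong_AE[symmetric, of "\<lambda>y. exp (\<Sum>j. 2 * beta j * \<bar>y j\<bar>)"])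
      (auto simp: Bnd_def intro!: borel_measurable_exp borel_measurable_suminf borel_measurable_power)
qed

lemma norm_u_le: "y \<in> Omega \<Longrightarrow> norm (u y) \<le> Cp * (Kf * exp (Bnd y))"
  using poincare(1) poincare(2)[OF u_in_H10] u_V_norm by (meson mult_left_mono less_imp_le order_trans)

lemma norm_u_square_integrable: "integrable gauss (\<lambda>y. (norm (u y))\<^sup>2)"
proof (rule Bochner_Integration.integrable_bound)
  show "integrable gauss (\<lambda>y. (Cp * Kf)\<^sup>2 * (exp (Bnd y))\<^sup>2)"
    using exp_Bnd_square_integrable by simp
  show "(\<lambda>y. (norm (u y))\<^sup>2) \<in> borel_measurable gauss" using u_measurable by measurable
  show "AE y in gauss. norm ((norm (u y))\<^sup>2) \<le> norm ((Cp * Kf)\<^sup>2 * (exp (Bnd y))\<^sup>2)"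
    using AE_Omega
  proof eventually_elim
    fix y assume "y \<in> Omega"
    then have "(norm (u y))\<^sup>2 \<le> (Cp * (Kf * exp (Bnd y)))\<^sup>2"
      by (intro power_mono norm_u_le) auto
    then show "norm ((norm (u y))\<^sup>2) \<le> norm ((Cp * Kf)\<^sup>2 * (exp (Bnd y))\<^sup>2)"
      by (simp add: power_mult_distrib)
  qed
qed

lemma exp_integrable_u: "exp_integrable u"
  by (rule exp_integrable_square[OF u_measurable norm_u_square_integrable])

subsection \<open>Bounds for mixed differences\<close>

text \<open>\<open>Q\<close> consists of positions in \<open>js\<close>, not of coordinates: a
  coordinate listed several times is shifted once for each of its positions in
  \<open>Q\<close>.\<close>

definition shifted :: "real \<Rightarrow> nat list \<Rightarrow> (nat \<Rightarrow> real) \<Rightarrow> nat set \<Rightarrow> nat \<Rightarrow> real" where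
  "shifted h js y Q j = y j + h * real (card {i \<in> Q. js ! i = j})"

lemma shifted_insert:
  assumes "finite Q" "i \<notin> Q"
  shows "shifted h js y (insert i Q) = (shifted h js y Q)(js ! i := shifted h js y Q (js ! i) + h)"
proof
  fix j
  have "{k \<in> insert i Q. js ! k = j} = (if js ! i = j then insert i {k \<in> Q. js ! k = j} else {k \<in> Q. js ! k = j})"
    by auto
  then show "shifted h js y (insert i Q) j = ((shifted h js y Q)(js ! i := shifted h js y Q (js ! i) + h)) j"
    using assms by (simp add: shifted_def algebra_simps)
qed

text \<open>The base \<open>Q\<close> must be general in the induction, because differencing at
  position \<open>i\<close> evaluates the remaining differences at \<open>Q\<close> and at
  \<open>insert i Q\<close>.\<close>

lemma forward_diffs_eq_mixed_diff:
  fixes F :: "(nat \<Rightarrow> real) \<Rightarrow> 'c::real_vector"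
  assumes "distinct is" "finite Q" "set is \<inter> Q = {}"
  shows "forward_diffs h (map ((!) js) is) F (shifted h js y Q) = mixed_diff (\<lambda>Q. F (shifted h js y Q)) (set is) Q"
  using assms
proof (induction "is" arbitrary: Q)
  case (Cons i "is")
  then show ?case
    by (simp add: forward_diff_def mixed_diff_insert shifted_insert[symmetric])
qed simp

lemma u_shifted:
  assumes b: "Linf_sums D (\<lambda>j x. y j * \<psi> j x) b" and "finite Q"
  shows "Linf_sums D (\<lambda>j x. shifted h js y Q j * \<psi> j x) (\<lambda>x. b x + (\<Sum>i\<in>Q. h * \<psi> (js ! i) x))"
  using assms(2)
proof (induction Q rule: finite_induct)
  case empty
  then show ?case using b by (simp add: shifted_def)
next
  case (insert i Q)
  then show ?case
    using Linf_sums_shift[OF psi insert.IH, of "js ! i" h] by (simp add: shifted_insert add_ac)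
qed

text \<open>The positions of \<open>js\<close> label the increments for
  \<open>mixed_diff_bound\<close>. Half of the exponent in \<open>exp (Bnd y)\<close> stems from the
  energy bound and half from the return to the V norm.\<close>

lemma forward_diffs_u_bound:
  assumes y: "y \<in> Omega" and h: "0 < h" "h * (\<Sum>j\<leftarrow>js. beta j) \<le> 4 / 5"
  shows "V_norm (forward_diffs h js u y)
    \<le> Kf * exp (2 / 5) * exp (Bnd y) * (fact (length js) * 2 ^ length js) * (\<Prod>i<length js. exp (h * beta (js ! i)) - 1)"
proof -
  define I where "I = {..<length js}"
  define xi where "xi i x = h * \<psi> (js ! i) x" for i x
  define c where "c i = h * beta (js ! i)" for i
  obtain b where b: "Linf_sums D (\<lambda>j x. y j * \<psi> j x) b" using Linf_sums_Omega[OF y] by blast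
  have bB: "Linf_bound D b (Bnd y)"
    unfolding Bnd_def by (rule Linf_sums_bound[OF b term_bound]) (use y in \<open>auto simp: beta_nonneg Omega_def\<close>)
  have xib: "Linf_bound D (xi i) (c i)" for i
    unfolding xi_def c_def using term_bound[of h "js ! i"] h(1) by (simp add: mult.commute)
  have c0: "0 \<le> c i" for i using h(1) by (simp add: c_def beta_nonneg)
  have csum: "(\<Sum>i\<in>I. c i) \<le> 4 / 5"
    using h(2) by (simp add: c_def I_def sum_distrib_left[symmetric] sum_list_sum_nth atLeast0LessThan)
  define bQ where "bQ Q x = b x + (\<Sum>i\<in>Q \<inter> I. xi i x)" for Q x
  have I: "finite I" by (simp add: I_def)
  have uQ: "u (shifted h js y Q) = sol (bQ Q)" if "Q \<subseteq> I" for Q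
  proof -
    have "finite Q" "Q \<inter> I = Q" using that I finite_subset by auto
    then show ?thesis using u_eq_sol[OF u_shifted[OF b, of Q h js]] by (simp add: bQ_def[abs_def] xi_def)
  qed
  define w where "w = mixed_diff (\<lambda>Q. sol (bQ Q)) I {}"
  have "forward_diffs h (map ((!) js) [0..<length js]) u (shifted h js y {}) = mixed_diff (\<lambda>Q. u (shifted h js y Q)) (set [0..<length js]) {}"
    by (rule forward_diffs_eq_mixed_diff) auto
  moreover have "map ((!) js) [0..<length js] = js" by (rule map_nth)
  moreover have "shifted h js y {} = y" by (simp add: shifted_def fun_eq_iff)
  moreover have "set [0..<length js] = I" by (auto simp: I_def)
  ultimately have "forward_diffs h js u y = mixed_diff (\<lambda>Q. u (shifted h js y Q)) I {}" by simp
  also have "\<dots> = w"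
    unfolding w_def mixed_diff_def using uQ by (intro sum.cong refl) auto
  finally have fw: "forward_diffs h js u y = w" .
  have bQb: "Linf_bound D (bQ Q) (Bnd y + (\<Sum>i\<in>Q \<inter> I. c i))" for Q
    unfolding bQ_def using I by (intro Linf_bound_add bB Linf_bound_sum xib) auto
  have wH: "w \<in> H10 D" unfolding w_def by (rule mixed_diff_H10) (rule sol_mem[OF bQb])
  have "norm (Exp (\<lambda>x. bQ {} x / 2) (snd w)) \<le> Kf * exp (Bnd y / 2 + 2 / 5) * (fact (card I) * 2 ^ card I) * (\<Prod>i\<in>I. exp (c i) - 1)"
    unfolding w_def bQ_def by (rule mixed_diff_bound[OF I bB xib c0 csum]) auto
  moreover have "bQ {} = b" by (intro ext) (simp add: bQ_def)
  ultimately have 1: "norm (Exp (\<lambda>x. b x / 2) (snd w)) \<le> Kf * exp (Bnd y / 2 + 2 / 5) * (fact (card I) * 2 ^ card I) * (\<Prod>i\<in>I. exp (c i) - 1)"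
    by simp
  have "V_norm w \<le> exp (Bnd y / 2) * norm (Exp (\<lambda>x. b x / 2) (snd w))"
    by (rule V_norm_le_Exp[OF Linf_bound_half[OF bB] wH])
  also have "\<dots> \<le> exp (Bnd y / 2) * (Kf * exp (Bnd y / 2 + 2 / 5) * (fact (card I) * 2 ^ card I) * (\<Prod>i\<in>I. exp (c i) - 1))"
    using 1 by (intro mult_left_mono) auto
  also have "\<dots> = Kf * exp (2 / 5) * exp (Bnd y) * (fact (card I) * 2 ^ card I) * (\<Prod>i\<in>I. exp (c i) - 1)"
  proof -
    have "exp (Bnd y / 2) * exp (Bnd y / 2 + 2 / 5) = exp (2 / 5) * exp (Bnd y)"
      by (simp add: exp_add[symmetric])
    then show ?thesis by (simp add: mult_ac)
  qed
  finally show ?thesis unfolding fw by (simp add: I_def c_def)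
qed

end

section \<open>Summability of multi-indexed sequences\<close>

lemma sum_PiE_dflt_prod:
  fixes f :: "'i \<Rightarrow> 'v \<Rightarrow> real"
  assumes J: "finite J" and A: "\<And>j. j \<in> J \<Longrightarrow> finite (A j)"
  shows "(\<Sum>\<nu>\<in>{\<nu>. (\<forall>j\<in>J. \<nu> j \<in> A j) \<and> (\<forall>j. j \<notin> J \<longrightarrow> \<nu> j = z)}. \<Prod>j\<in>J. f j (\<nu> j)) = (\<Prod>j\<in>J. \<Sum>n\<in>A j. f j n)"
proof -
  define S where "S = {\<nu>. (\<forall>j\<in>J. \<nu> j \<in> A j) \<and> (\<forall>j. j \<notin> J \<longrightarrow> \<nu> j = z)}"
  have bij: "bij_betw (\<lambda>\<nu>. restrict \<nu> J) S (Pi\<^sub>E J A)"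
  proof (rule bij_betw_byWitness[where f'="\<lambda>\<nu> j. if j \<in> J then \<nu> j else z"])
    show "\<forall>\<nu>\<in>S. (\<lambda>j. if j \<in> J then restrict \<nu> J j else z) = \<nu>" by (auto simp: S_def fun_eq_iff)
    show "\<forall>\<nu>\<in>Pi\<^sub>E J A. restrict (\<lambda>j. if j \<in> J then \<nu> j else z) J = \<nu>"
      by (auto simp: fun_eq_iff PiE_def extensional_def restrict_def)
    show "(\<lambda>\<nu>. restrict \<nu> J) ` S \<subseteq> Pi\<^sub>E J A" by (auto simp: S_def)
    show "(\<lambda>\<nu> j. if j \<in> J then \<nu> j else z) ` Pi\<^sub>E J A \<subseteq> S" by (auto simp: S_def PiE_iff)
  qed
  have "(\<Sum>\<nu>\<in>S. \<Prod>j\<in>J. f j (\<nu> j)) = (\<Sum>\<nu>\<in>Pi\<^sub>E J A. \<Prod>j\<in>J. f j (\<nu> j))"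
    using sum.reindex_bij_betw[OF bij, of "\<lambda>\<nu>. \<Prod>j\<in>J. f j (\<nu> j)"] by (simp add: restrict_def cong: prod.cong)
  also have "\<dots> = (\<Prod>j\<in>J. \<Sum>n\<in>A j. f j n)"
    using assms by (intro prod_sum_PiE[symmetric]) auto
  finally show ?thesis by (simp add: S_def)
qed

text \<open>Sums of product weights over a box factorize over the coordinates, and every finite set
  of multi-indices lies in some box.\<close>

definition box :: "'i set \<Rightarrow> nat \<Rightarrow> ('i \<Rightarrow> nat) set" where
  "box J N = {\<nu>. (\<forall>j\<in>J. \<nu> j \<in> {..N}) \<and> (\<forall>j. j \<notin> J \<longrightarrow> \<nu> j = 0)}"

lemma finite_box: "finite J \<Longrightarrow> finite (box J N)"
proof -
  assume J: "finite J"
  have "box J N \<subseteq> (\<lambda>\<nu> j. if j \<in> J then \<nu> j else 0) ` (Pi\<^sub>E J (\<lambda>_. {..N}))"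
  proof
    fix \<nu> assume "\<nu> \<in> box J N"
    then have "\<nu> = (\<lambda>j. if j \<in> J then restrict \<nu> J j else 0)" "restrict \<nu> J \<in> Pi\<^sub>E J (\<lambda>_. {..N})"
      by (auto simp: box_def fun_eq_iff)
    then show "\<nu> \<in> (\<lambda>\<nu> j. if j \<in> J then \<nu> j else 0) ` (Pi\<^sub>E J (\<lambda>_. {..N}))" by blast
  qed
  then show ?thesis using J by (meson finite_PiE finite_atMost finite_imageI finite_subset)
qed

lemma finite_multi_indices_subset_box:
  assumes "finite F" "F \<subseteq> multi_indices"
  shows "\<exists>J N. finite J \<and> F \<subseteq> box J N"
proof -
  define J where "J = (\<Union>\<nu>\<in>F. {j. \<nu> j \<noteq> 0})"
  have J: "finite J" using assms by (auto simp: J_def multi_indices_def)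
  define N where "N = (\<Sum>\<nu>\<in>F. \<Sum>j\<in>J. \<nu> j)"
  have "\<nu> j \<le> N" if "\<nu> \<in> F" "j \<in> J" for \<nu> j
  proof -
    have "\<nu> j \<le> (\<Sum>j\<in>J. \<nu> j)" using that J by (intro member_le_sum) auto
    also have "\<dots> \<le> N" unfolding N_def using that assms by (intro member_le_sum[of \<nu> F "\<lambda>\<nu>. \<Sum>j\<in>J. \<nu> j"]) auto
    finally show ?thesis .
  qed
  then have "F \<subseteq> box J N" by (auto simp: box_def J_def)
  then show ?thesis using J by blast
qed

lemma prod_support_eq:
  assumes "finite J" "{j. \<nu> j \<noteq> 0} \<subseteq> J" "\<And>j. f j 0 = (1::real)"
  shows "(\<Prod>j\<in>J. f j (\<nu> j)) = (\<Prod>j | \<nu> j \<noteq> (0::nat). f j (\<nu> j))"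
  using assms by (intro prod.mono_neutral_right) auto

text \<open>The sum factorizes and each factor is at most \<open>1 + s j \<le> exp (s j)\<close>.
  The bound is independent of \<open>N\<close>, and of \<open>J\<close> as soon as the sums of
  \<open>s\<close> are bounded.\<close>

lemma sum_box_prod_le:
  fixes B :: "'i \<Rightarrow> nat \<Rightarrow> real"
  assumes J: "finite J" and B0: "\<And>j. B j 0 = 1" "\<And>j n. 0 \<le> B j n"
    and S: "\<And>j. (\<Sum>n\<in>{1..N}. B j n) \<le> s j"
  shows "(\<Sum>\<nu>\<in>box J N. \<Prod>j | \<nu> j \<noteq> 0. B j (\<nu> j)) \<le> exp (\<Sum>j\<in>J. s j)"
proof -
  have "(\<Sum>\<nu>\<in>box J N. \<Prod>j | \<nu> j \<noteq> 0. B j (\<nu> j)) = (\<Sum>\<nu>\<in>box J N. \<Prod>j\<in>J. B j (\<nu> j))"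
    using J B0 by (intro sum.cong refl prod_support_eq[symmetric]) (auto simp: box_def)
  also have "\<dots> = (\<Prod>j\<in>J. \<Sum>n\<in>{..N}. B j n)"
    unfolding box_def using J by (intro sum_PiE_dflt_prod) auto
  also have "\<dots> \<le> (\<Prod>j\<in>J. exp (s j))"
  proof (intro prod_mono conjI)
    fix j
    show "0 \<le> (\<Sum>n\<in>{..N}. B j n)" using B0 by (intro sum_nonneg)
    have "{..N} = insert 0 {1..N}" by auto
    then have "(\<Sum>n\<in>{..N}. B j n) = 1 + (\<Sum>n\<in>{1..N}. B j n)" by (simp add: B0)
    also have "\<dots> \<le> 1 + s j" using S by simp
    also have "\<dots> \<le> exp (s j)" by (rule exp_ge_add_one_self)
    finally show "(\<Sum>n\<in>{..N}. B j n) \<le> exp (s j)" .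
  qed
  also have "\<dots> = exp (\<Sum>j\<in>J. s j)" using J by (simp add: exp_sum)
  finally show ?thesis .
qed

subsection \<open>Multinomial sums\<close>

text \<open>The multinomial coefficient \<open>|\<mu>|! / \<mu>!\<close> times the monomial with
  exponent \<open>\<mu>\<close>.\<close>

definition multinomial_term :: "'i set \<Rightarrow> ('i \<Rightarrow> real) \<Rightarrow> ('i \<Rightarrow> nat) \<Rightarrow> real" where
  "multinomial_term J x \<mu> = fact (\<Sum>j\<in>J. \<mu> j) * (\<Prod>j\<in>J. x j ^ \<mu> j / fact (\<mu> j))"

definition level :: "'i set \<Rightarrow> nat \<Rightarrow> ('i \<Rightarrow> nat) set" where
  "level J k = {\<mu>. (\<Sum>j\<in>J. \<mu> j) = k \<and> (\<forall>j. j \<notin> J \<longrightarrow> \<mu> j = 0)}"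

lemma finite_level: "finite J \<Longrightarrow> finite (level J k)"
proof (rule finite_subset)
  assume J: "finite J"
  show "level J k \<subseteq> box J k"
  proof
    fix \<mu> assume \<mu>: "\<mu> \<in> level J k"
    have "\<mu> j \<le> k" if "j \<in> J" for j
      using member_le_sum[of j J \<mu>] that J \<mu> by (simp add: level_def)
    then show "\<mu> \<in> box J k" using \<mu> by (auto simp: level_def box_def)
  qed
  show "finite (box J k)" by (rule finite_box[OF J])
qed

text \<open>Pascal's rule: lowering entry \<open>i\<close> contributes the share
  \<open>\<mu> i / |\<mu>|\<close> of the term, and these shares add up to \<open>1\<close>.\<close>

lemma multinomial_term_Pascal:
  assumes J: "finite J" and k: "(\<Sum>j\<in>J. \<mu> j) = Suc k"
  shows "multinomial_term J x \<mu> = (\<Sum>i\<in>{i\<in>J. \<mu> i \<noteq> 0}. x i * multinomial_term J x (\<mu>(i := \<mu> i - 1)))"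
proof -
  define P where "P = (\<Prod>j\<in>J. x j ^ \<mu> j / fact (\<mu> j))"
  have step: "x i * multinomial_term J x (\<mu>(i := \<mu> i - 1)) = fact k * real (\<mu> i) * P" if i: "i \<in> J" "\<mu> i \<noteq> 0" for i
  proof -
    obtain m where m: "\<mu> i = Suc m" using i(2) by (cases "\<mu> i") auto
    have "(\<Sum>j\<in>J. \<mu> j) = Suc m + (\<Sum>j\<in>J - {i}. \<mu> j)"
      using i J m by (simp add: sum.remove[of J i])
    moreover have "(\<Sum>j\<in>J. (\<mu>(i := m)) j) = m + (\<Sum>j\<in>J - {i}. \<mu> j)"
      using i J by (simp add: sum.remove[of J i])
    ultimately have s: "(\<Sum>j\<in>J. (\<mu>(i := m)) j) = k" using k by simp
    have p: "P = x i ^ Suc m / fact (Suc m) * (\<Prod>j\<in>J - {i}. x j ^ \<mu> j / fact (\<mu> j))"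
      unfolding P_def using i J m by (simp add: prod.remove[of J i])
    have p': "(\<Prod>j\<in>J. x j ^ (\<mu>(i := m)) j / fact ((\<mu>(i := m)) j)) = x i ^ m / fact m * (\<Prod>j\<in>J - {i}. x j ^ \<mu> j / fact (\<mu> j))"
      using i J by (simp add: prod.remove[of J i])
    have "x i * multinomial_term J x (\<mu>(i := m)) = fact k * (x i * (x i ^ m / fact m)) * (\<Prod>j\<in>J - {i}. x j ^ \<mu> j / fact (\<mu> j))"
      unfolding multinomial_term_def s p' by simp
    also have "x i * (x i ^ m / fact m) = real (Suc m) * (x i ^ Suc m / fact (Suc m))"
      by (simp add: fact_Suc del: of_nat_Suc)
    finally have eq: "x i * multinomial_term J x (\<mu>(i := m)) = fact k * (real (Suc m) * (x i ^ Suc m / fact (Suc m))) *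
        (\<Prod>j\<in>J - {i}. x j ^ \<mu> j / fact (\<mu> j))" .
    have m1: "\<mu> i - 1 = m" using m by simp
    show ?thesis unfolding m1 unfolding m p eq by (simp only: mult_ac)
  qed
  have "(\<Sum>i\<in>{i\<in>J. \<mu> i \<noteq> 0}. x i * multinomial_term J x (\<mu>(i := \<mu> i - 1))) = (\<Sum>i\<in>{i\<in>J. \<mu> i \<noteq> 0}. fact k * real (\<mu> i) * P)"
    by (intro sum.cong refl step) auto
  also have "\<dots> = (\<Sum>i\<in>J. fact k * real (\<mu> i) * P)"
    using J by (intro sum.mono_neutral_left) auto
  also have "\<dots> = fact k * real (\<Sum>i\<in>J. \<mu> i) * P"
    by (simp add: sum_distrib_left sum_distrib_right)
  also have "\<dots> = multinomial_term J x \<mu>"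
    unfolding multinomial_term_def P_def[symmetric] k by simp
  finally show ?thesis by simp
qed

text \<open>The multinomial theorem. Pascal's rule gives a sum over pairs \<open>(\<mu>, i)\<close>,
  reindexed by lowering and raising entry \<open>i\<close>, which multiplies the lower level by the
  sum of \<open>x\<close>.\<close>

lemma sum_level_multinomial:
  assumes J: "finite J"
  shows "(\<Sum>\<mu>\<in>level J k. multinomial_term J x \<mu>) = (\<Sum>j\<in>J. x j) ^ k"
proof (induction k)
  case 0
  have "level J 0 = {\<lambda>_. 0}" using J by (auto simp: level_def fun_eq_iff)
  then show ?case by (simp add: multinomial_term_def)
next
  case (Suc k)
  have "(\<Sum>\<mu>\<in>level J (Suc k). multinomial_term J x \<mu>)
      = (\<Sum>\<mu>\<in>level J (Suc k). \<Sum>i\<in>{i\<in>J. \<mu> i \<noteq> 0}. x i * multinomial_term J x (\<mu>(i := \<mu> i - 1)))"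
    by (intro sum.cong refl multinomial_term_Pascal J) (auto simp: level_def)
  also have "\<dots> = (\<Sum>(\<mu>, i)\<in>(SIGMA \<mu>:level J (Suc k). {i\<in>J. \<mu> i \<noteq> 0}). x i * multinomial_term J x (\<mu>(i := \<mu> i - 1)))"
    using J finite_level by (intro sum.Sigma) auto
  also have "\<dots> = (\<Sum>(\<mu>, i)\<in>level J k \<times> J. x i * multinomial_term J x \<mu>)"
  proof (rule sum.reindex_bij_witness[where j="\<lambda>(\<mu>, i). (\<mu>(i := \<mu> i - 1), i)" and i="\<lambda>(\<mu>, i). (\<mu>(i := Suc (\<mu> i)), i)"]; clarsimp)
    fix \<mu> i assume *: "\<mu> \<in> level J (Suc k)" "i \<in> J" "0 < \<mu> i"
    have "(\<Sum>j\<in>J. \<mu> j) = \<mu> i + (\<Sum>j\<in>J - {i}. \<mu> j)" "(\<Sum>j\<in>J. (\<mu>(i := \<mu> i - 1)) j) = (\<mu> i - 1) + (\<Sum>j\<in>J - {i}. \<mu> j)"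
      using * J by (simp_all add: sum.remove[of J i])
    then show "\<mu>(i := \<mu> i - Suc 0) \<in> level J k"
      using * by (auto simp: level_def)
  next
    fix \<mu> i assume *: "\<mu> \<in> level J k" "i \<in> J"
    have "(\<Sum>j\<in>J. \<mu> j) = \<mu> i + (\<Sum>j\<in>J - {i}. \<mu> j)" "(\<Sum>j\<in>J. (\<mu>(i := Suc (\<mu> i))) j) = Suc (\<mu> i) + (\<Sum>j\<in>J - {i}. \<mu> j)"
      using * J by (simp_all add: sum.remove[of J i])
    then show "\<mu>(i := Suc (\<mu> i)) \<in> level J (Suc k)"
      using * by (auto simp: level_def)
  qed
  also have "\<dots> = (\<Sum>\<mu>\<in>level J k. multinomial_term J x \<mu>) * (\<Sum>i\<in>J. x i)"
    by (simp add: sum.cartesian_product[symmetric] sum_distrib_left sum_distrib_right mult.commute)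
  finally show ?case unfolding Suc.IH by simp
qed

lemma multinomial_term_nonneg: "(\<And>j. j \<in> J \<Longrightarrow> 0 \<le> x j) \<Longrightarrow> 0 \<le> multinomial_term J x \<mu>"
  by (simp add: multinomial_term_def prod_nonneg)

text \<open>Sorting the box by total degree leaves a geometric series in the sum of
  \<open>x\<close>.\<close>

lemma sum_box_multinomial_le:
  assumes J: "finite J" and x: "\<And>j. j \<in> J \<Longrightarrow> 0 \<le> x j" and X: "(\<Sum>j\<in>J. x j) \<le> 1 / 2"
  shows "(\<Sum>\<mu>\<in>box J r. multinomial_term J x \<mu>) \<le> 2"
proof -
  define K where "K = card J * r"
  have sub: "box J r \<subseteq> (\<Union>k\<in>{..K}. level J k)"
  proof
    fix \<mu> assume \<mu>: "\<mu> \<in> box J r"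
    have "(\<Sum>j\<in>J. \<mu> j) \<le> card J * r" using \<mu> sum_bounded_above[of J \<mu> r] by (simp add: box_def)
    then show "\<mu> \<in> (\<Union>k\<in>{..K}. level J k)" using \<mu> by (auto simp: box_def level_def K_def)
  qed
  have "(\<Sum>\<mu>\<in>box J r. multinomial_term J x \<mu>) \<le> (\<Sum>\<mu>\<in>(\<Union>k\<in>{..K}. level J k). multinomial_term J x \<mu>)"
    using sub J x finite_level by (intro sum_mono2 multinomial_term_nonneg) auto
  also have "\<dots> = (\<Sum>k\<le>K. \<Sum>\<mu>\<in>level J k. multinomial_term J x \<mu>)"
    using J finite_level by (intro sum.UNION_disjoint) (auto simp: level_def)
  also have "\<dots> = (\<Sum>k\<le>K. (\<Sum>j\<in>J. x j) ^ k)" by (simp add: sum_level_multinomial[OF J])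
  also have "\<dots> \<le> (\<Sum>k\<le>K. (1/2) ^ k)"
    using X x by (intro sum_mono power_mono sum_nonneg) auto
  also have "\<dots> \<le> (\<Sum>k. (1/2) ^ k)" by (intro sum_le_suminf) auto
  also have "\<dots> = 2" by (simp add: suminf_geometric)
  finally show ?thesis .
qed

text \<open>Lets the square of a multinomial term be bounded by the term itself in the l^2
  estimate.\<close>

lemma multinomial_term_le_1:
  assumes J: "finite J" and x: "\<And>j. j \<in> J \<Longrightarrow> 0 \<le> x j" and X: "(\<Sum>j\<in>J. x j) \<le> 1" and \<mu>: "\<And>j. j \<notin> J \<Longrightarrow> \<mu> j = 0"
  shows "multinomial_term J x \<mu> \<le> 1"
proof -
  define k where "k = (\<Sum>j\<in>J. \<mu> j)"
  have "\<mu> \<in> level J k" using \<mu> by (auto simp: level_def k_def)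
  then have "multinomial_term J x \<mu> \<le> (\<Sum>\<mu>\<in>level J k. multinomial_term J x \<mu>)"
    using finite_level[OF J] x by (intro member_le_sum multinomial_term_nonneg) auto
  also have "\<dots> \<le> 1" unfolding sum_level_multinomial[OF J] using X x by (intro power_le_one sum_nonneg)
  finally show ?thesis .
qed

subsection \<open>The weights\<close>

text \<open>The quotient \<open>\<nu>!/\<kappa>!\<close> in one coordinate, a falling factorial of
  order at most \<open>r\<close>; it grows like the \<open>r\<close>-th power of
  \<open>n\<close>.\<close>

definition omega :: "nat \<Rightarrow> nat \<Rightarrow> real" where
  "omega r n = fact n / fact (n - min n r)"

lemma omega_ge_1: "1 \<le> omega r n"
  by (simp add: omega_def fact_mono)

lemma omega_0 [simp]: "omega r 0 = 1"
  by (simp add: omega_def)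

text \<open>The quotient is a product of \<open>r\<close> factors, each at least
  \<open>m + 1\<close>.\<close>

lemma omega_ge_power: "real (Suc m) ^ r \<le> omega r (m + r)"
proof -
  have "real (Suc m) ^ r * fact m \<le> fact (m + r)"
  proof (induction r)
    case (Suc r)
    have "real (Suc m) ^ Suc r * fact m = real (Suc m) * (real (Suc m) ^ r * fact m)" by simp
    also have "\<dots> \<le> real (Suc (m + r)) * fact (m + r)" using Suc by (intro mult_mono) auto
    finally show ?case by simp
  qed simp
  then show ?thesis by (simp add: omega_def field_simps)
qed

text \<open>The first \<open>r\<close> terms are at most \<open>1\<close>; the rest is dominated by
  a convergent series of powers with exponent \<open>r * t\<close>.\<close>

lemma omega_sum_bounded:
  assumes "0 < t" "1 < real r * t"
  shows "\<exists>S\<ge>1. \<forall>N. (\<Sum>n\<le>N. omega r n powr - t) \<le> S"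
proof -
  have sm: "summable (\<lambda>m. real (Suc m) powr - (real r * t))"
    using assms(2) summable_real_powr_iff[of "- (real r * t)"] summable_Suc_iff[of "\<lambda>m. real m powr - (real r * t)"] by simp
  define S where "S = real r + 1 + (\<Sum>m. real (Suc m) powr - (real r * t))"
  have "(\<Sum>n\<le>N. omega r n powr - t) \<le> S" for N
  proof -
    have "(\<Sum>n\<le>N. omega r n powr - t) \<le> (\<Sum>n<r + Suc N. omega r n powr - t)"
      by (intro sum_mono2) auto
    also have "\<dots> = (\<Sum>n<r. omega r n powr - t) + (\<Sum>m<Suc N. omega r (m + r) powr - t)"
    proof -
      have "{..<r + Suc N} = {..<r} \<union> {0 + r..<Suc N + r}" by auto
      moreover have "(\<Sum>n\<in>{..<r} \<union> {0 + r..<Suc N + r}. omega r n powr - t)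
          = (\<Sum>n<r. omega r n powr - t) + (\<Sum>n\<in>{0 + r..<Suc N + r}. omega r n powr - t)"
        by (intro sum.union_disjoint) auto
      moreover have "(\<Sum>n\<in>{0 + r..<Suc N + r}. omega r n powr - t) = (\<Sum>m\<in>{0..<Suc N}. omega r (m + r) powr - t)"
        by (rule sum.shift_bounds_nat_ivl)
      ultimately show ?thesis by (simp only: atLeast0LessThan)
    qed
    also have "\<dots> \<le> (\<Sum>n<r. 1) + (\<Sum>m<Suc N. real (Suc m) powr - (real r * t))"
    proof (intro add_mono sum_mono)
      fix n
      show "omega r n powr - t \<le> 1"
        using omega_ge_1[of r n] assms(1) by (simp add: powr_minus_divide ge_one_powr_ge_zero)
    next
      fix m
      have "real (Suc m) powr - (real r * t) = (real (Suc m) powr real r) powr - t"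
        by (simp add: powr_powr)
      also have "real (Suc m) powr real r = real (Suc m) ^ r" by (rule powr_realpow) simp
      finally show "omega r (m + r) powr - t \<le> real (Suc m) powr - (real r * t)"
        using omega_ge_power[of m r] assms(1) by (auto intro!: powr_mono2')
    qed
    also have "\<dots> \<le> S"
      unfolding S_def using sum_le_suminf[OF sm, of "{..<Suc N}"] by simp
    finally show ?thesis .
  qed
  moreover have "1 \<le> S" unfolding S_def using suminf_nonneg[OF sm] by simp
  ultimately show ?thesis by blast
qed

text \<open>The multinomial term sees \<open>\<nu>\<close> only through its cutoff
  \<open>\<mu>\<close>, so the sum is grouped by \<open>\<mu>\<close>. A coordinate with
  \<open>\<mu> j < r\<close> has at most one preimage; one with \<open>\<mu> j = r\<close> has a
  tail whose weights sum to at most \<open>S \<le> S ^ \<mu> j\<close>. These factors are absorbed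
  by replacing \<open>x j\<close> with \<open>S * x j\<close>.\<close>

lemma sum_multinomial_omega_le:
  fixes x :: "'i \<Rightarrow> real"
  assumes J: "finite J" and x: "\<And>j. j \<in> J \<Longrightarrow> 0 \<le> x j" and r: "0 < r" and S: "1 \<le> S" "\<And>N. (\<Sum>n\<le>N. omega r n powr - t) \<le> S"
    and t: "0 < t" and X: "(\<Sum>j\<in>J. S * x j) \<le> 1 / 2"
  shows "(\<Sum>\<nu>\<in>box J N. multinomial_term J x (\<lambda>j. min (\<nu> j) r) * (\<Prod>j\<in>J. omega r (\<nu> j) powr - t)) \<le> 2"
proof -
  define cut where "cut \<nu> = (\<lambda>j. min (\<nu> j) r)" for \<nu> :: "'i \<Rightarrow> nat"
  define w where "w n = omega r n powr - t" for n
  have w: "0 \<le> w n" "w n \<le> 1" for n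
    using omega_ge_1[of r n] t by (auto simp: w_def powr_minus_divide ge_one_powr_ge_zero)
  have cutb: "cut ` box J N \<subseteq> box J r" by (auto simp: box_def cut_def)
  have "(\<Sum>\<nu>\<in>box J N. multinomial_term J x (cut \<nu>) * (\<Prod>j\<in>J. w (\<nu> j)))
      = (\<Sum>\<mu>\<in>box J r. \<Sum>\<nu>\<in>{\<nu>\<in>box J N. cut \<nu> = \<mu>}. multinomial_term J x (cut \<nu>) * (\<Prod>j\<in>J. w (\<nu> j)))"
    by (rule sum.group[OF finite_box[OF J] finite_box[OF J] cutb, symmetric])
  also have "\<dots> \<le> (\<Sum>\<mu>\<in>box J r. multinomial_term J (\<lambda>j. S * x j) \<mu>)"
  proof (rule sum_mono)
    fix \<mu> assume \<mu>: "\<mu> \<in> box J r"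
    define A where "A j = {n. n \<le> N \<and> min n r = \<mu> j}" for j
    have fib: "{\<nu>\<in>box J N. cut \<nu> = \<mu>} = {\<nu>. (\<forall>j\<in>J. \<nu> j \<in> A j) \<and> (\<forall>j. j \<notin> J \<longrightarrow> \<nu> j = 0)}"
      using \<mu> by (auto simp: box_def A_def cut_def fun_eq_iff)
    have "(\<Sum>\<nu>\<in>{\<nu>\<in>box J N. cut \<nu> = \<mu>}. \<Prod>j\<in>J. w (\<nu> j)) = (\<Prod>j\<in>J. \<Sum>n\<in>A j. w n)"
      unfolding fib using J by (intro sum_PiE_dflt_prod) (auto simp: A_def)
    then have "(\<Sum>\<nu>\<in>{\<nu>\<in>box J N. cut \<nu> = \<mu>}. multinomial_term J x (cut \<nu>) * (\<Prod>j\<in>J. w (\<nu> j)))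
        = multinomial_term J x \<mu> * (\<Prod>j\<in>J. \<Sum>n\<in>A j. w n)"
      by (simp add: sum_distrib_left[symmetric])
    also have "multinomial_term J x \<mu> * (\<Prod>j\<in>J. \<Sum>n\<in>A j. w n) \<le> multinomial_term J x \<mu> * (\<Prod>j\<in>J. S ^ \<mu> j)"
    proof (intro mult_left_mono prod_mono conjI multinomial_term_nonneg x)
      fix j assume j: "j \<in> J"
      show "0 \<le> (\<Sum>n\<in>A j. w n)" using w by (intro sum_nonneg)
      show "(\<Sum>n\<in>A j. w n) \<le> S ^ \<mu> j"
      proof (cases "\<mu> j < r")
        case True
        then have "A j \<subseteq> {\<mu> j}" by (auto simp: A_def min_def split: if_splits)
        then have "(\<Sum>n\<in>A j. w n) \<le> (\<Sum>n\<in>{\<mu> j}. w n)" using w by (intro sum_mono2) auto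
        also have "\<dots> \<le> 1" using w by simp
        also have "1 \<le> S ^ \<mu> j" using S(1) by (rule one_le_power)
        finally show ?thesis .
      next
        case False
        then have "\<mu> j = r" using \<mu> j by (auto simp: box_def)
        have "(\<Sum>n\<in>A j. w n) \<le> (\<Sum>n\<le>N. w n)" using w by (intro sum_mono2) (auto simp: A_def)
        also have "\<dots> \<le> S" using S(2) by (simp add: w_def)
        also have "S \<le> S ^ \<mu> j" using S(1) \<open>\<mu> j = r\<close> r self_le_power[of S r] by simp
        finally show ?thesis .
      qed
    qed
    also have "\<dots> = multinomial_term J (\<lambda>j. S * x j) \<mu>"
      by (simp add: multinomial_term_def prod.distrib[symmetric] power_mult_distrib mult_ac)
    finally show "(\<Sum>\<nu>\<in>{\<nu>\<in>box J N. cut \<nu> = \<mu>}. multinomial_term J x (cut \<nu>) * (\<Prod>j\<in>J. w (\<nu> j)))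
        \<le> multinomial_term J (\<lambda>j. S * x j) \<mu>" .
  qed
  also have "\<dots> \<le> 2"
    using S(1) x by (intro sum_box_multinomial_le[OF J _ X]) auto
  finally show ?thesis by (simp add: cut_def w_def)
qed

text \<open>If \<open>b \<le> a powr (1 / s)\<close> fails then \<open>a < b powr s\<close>; either way \<open>(a b)\<^sup>p\<close> is controlled by one factor.\<close>

lemma product_powr_le:
  fixes a b p :: real
  assumes "0 \<le> a" "0 \<le> b" "0 < p" "p < 2"
  shows "(a * b) powr p \<le> a\<^sup>2 + b powr (2 * p / (2 - p))"
proof (cases "a = 0 \<or> b = 0")
  case False
  then have ab: "0 < a" "0 < b" using assms by auto
  define s where "s = p / (2 - p)"
  have s: "0 < s" using assms by (simp add: s_def)
  show ?thesis
  proof (cases "a \<le> b powr s")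
    case True
    have "(a * b) powr p \<le> (b powr s * b) powr p"
      using True ab assms by (intro powr_mono2 mult_right_mono) auto
    also have "\<dots> = b powr ((s + 1) * p)"
      using ab by (simp add: powr_mult powr_powr powr_add[symmetric] algebra_simps)
    also have "(s + 1) * p = 2 * p / (2 - p)"
      using assms by (simp add: s_def field_simps)
    finally show ?thesis by (simp add: add_increasing)
  next
    case False
    then have "b powr s < a" by simp
    then have "(b powr s) powr (1 / s) \<le> a powr (1 / s)"
      using s by (intro powr_mono2) auto
    then have "b \<le> a powr (1 / s)" using ab s by (simp add: powr_powr)
    then have "(a * b) powr p \<le> (a * a powr (1 / s)) powr p"
      using ab assms by (intro powr_mono2 mult_left_mono) auto
    also have "\<dots> = a powr ((1 + 1 / s) * p)"
      using ab by (simp add: powr_mult powr_powr powr_add[symmetric] algebra_simps)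
    also have "(1 + 1 / s) * p = 2"
      using assms by (simp add: s_def field_simps)
    also have "a powr 2 = a\<^sup>2" using ab by (simp add: powr_numeral)
    finally show ?thesis by (simp add: add_increasing2)
  qed
qed auto

section \<open>Bounds for the Hermite coefficients\<close>

lemma list_with_counts:
  fixes \<mu> :: "nat \<Rightarrow> nat" and b :: "nat \<Rightarrow> real"
  assumes "finite J"
  shows "\<exists>js. set js \<subseteq> J \<and> (\<forall>j\<in>J. count_list js j = \<mu> j) \<and> length js = (\<Sum>j\<in>J. \<mu> j)
    \<and> prod_list (map b js) = (\<Prod>j\<in>J. b j ^ \<mu> j)"
  using assms
proof (induction J rule: finite_induct)
  case (insert i J)
  then obtain js where js: "set js \<subseteq> J" "\<forall>j\<in>J. count_list js j = \<mu> j" "length js = (\<Sum>j\<in>J. \<mu> j)"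
    "prod_list (map b js) = (\<Prod>j\<in>J. b j ^ \<mu> j)" by blast
  have "count_list (replicate n i) j = (if i = j then n else 0)" for n j by (induction n) auto
  moreover have "prod_list (map b (replicate n i)) = b i ^ n" for n by (induction n) auto
  moreover have "count_list js i = 0" using js(1) insert.hyps by (auto simp: count_list_0_iff)
  ultimately show ?case
    using js insert.hyps by (intro exI[of _ "replicate (\<mu> i) i @ js"]) (auto simp: prod.insert)
qed auto

context parametric_elliptic
begin

definition hc :: "(nat \<Rightarrow> nat) \<Rightarrow> 'a H1" where
  "hc \<nu> = hermite_coeff D \<psi> f \<nu>"

lemma hc_eq: "hc \<nu> = (\<integral>y. hermite_prod \<nu> y *\<^sub>R u y \<partial>gauss)"
  by (simp add: hc_def hermite_coeff_def u_def)

lemma integrable_hermite_prod_u: "\<nu> \<in> multi_indices \<Longrightarrow> integrable gauss (\<lambda>y. hermite_prod \<nu> y *\<^sub>R u y)"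
  using exp_integrable_prod[OF exp_integrable_u, of "{j. \<nu> j \<noteq> 0}" "\<lambda>j. hermite (\<nu> j)"]
  by (simp add: hermite_prod_def multi_indices_def exp_growth_hermite)

lemma hc_H10: "\<nu> \<in> multi_indices \<Longrightarrow> hc \<nu> \<in> H10 D"
  unfolding hc_eq
  by (rule integral_in_closed_subspace[OF subspace_H10 closed_H10 integrable_hermite_prod_u])
    (auto intro!: AE_I2 H10_mem u_in_H10)

lemma V_norm_integral_le:
  assumes "integrable gauss F" shows "V_norm (\<integral>y. F y \<partial>gauss) \<le> (\<integral>y. V_norm (F y) \<partial>gauss)"
proof -
  have "snd (\<integral>y. F y \<partial>gauss) = (\<integral>y. snd (F y) \<partial>gauss)"
    using integral_bounded_linear[OF bounded_linear_snd assms] by simp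
  then show ?thesis using integral_norm_bound[of gauss "\<lambda>y. snd (F y)"] by (simp add: V_norm_def)
qed

lemma V_norm_scaleR: "V_norm (c *\<^sub>R v) = \<bar>c\<bar> * V_norm v"
  by (simp add: V_norm_def)

text \<open>Half of the sum of squares bounds the integral of a product; this avoids a Cauchy-Schwarz
  inequality at the price of a worse constant.\<close>

definition C1 :: real where
  "C1 = Kf * exp (2 / 5) * ((1 + (\<integral>y. (exp (Bnd y))\<^sup>2 \<partial>gauss)) / 2)"

lemma C1_nonneg: "0 \<le> C1"
  unfolding C1_def using f_bound(1) by (intro mult_nonneg_nonneg) auto

text \<open>\<open>hermite_prod \<kappa>\<close> has unit L^2 norm, so the bound is uniform in
  \<open>\<kappa>\<close>.\<close>

lemma integral_hermite_forward_diffs_bound: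
  assumes \<kappa>: "\<kappa> \<in> multi_indices" and h: "0 < h" "h * (\<Sum>j\<leftarrow>js. beta j) \<le> 4 / 5"
  shows "V_norm (\<integral>y. hermite_prod \<kappa> y *\<^sub>R forward_diffs h js u y \<partial>gauss)
    \<le> C1 * (fact (length js) * 2 ^ length js * (\<Prod>i<length js. exp (h * beta (js ! i)) - 1))"
proof -
  define P where "P = fact (length js) * 2 ^ length js * (\<Prod>i<length js. exp (h * beta (js ! i)) - 1)"
  have P0: "0 \<le> P"
    unfolding P_def using h(1) beta_nonneg by (intro mult_nonneg_nonneg prod_nonneg) auto
  have Hsq: "integrable gauss (\<lambda>y. (hermite_prod \<kappa> y)\<^sup>2)" "(\<integral>y. (hermite_prod \<kappa> y)\<^sup>2 \<partial>gauss) = 1"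
    using integrable_hermite_prod_mult[OF \<kappa> \<kappa>] integral_hermite_prod_mult[OF \<kappa> \<kappa>] by (auto simp: power2_eq_square)
  have ei: "exp_integrable (forward_diffs h js u)"
    by (rule exp_integrable_forward_diffs[OF exp_integrable_u])
  have int: "integrable gauss (\<lambda>y. hermite_prod \<kappa> y *\<^sub>R forward_diffs h js u y)"
    using exp_integrable_prod[OF ei, of "{j. \<kappa> j \<noteq> 0}" "\<lambda>j. hermite (\<kappa> j)"] \<kappa>
    by (simp add: hermite_prod_def multi_indices_def exp_growth_hermite)
  have "V_norm (\<integral>y. hermite_prod \<kappa> y *\<^sub>R forward_diffs h js u y \<partial>gauss)
      \<le> (\<integral>y. V_norm (hermite_prod \<kappa> y *\<^sub>R forward_diffs h js u y) \<partial>gauss)"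
    by (rule V_norm_integral_le[OF int])
  also have "\<dots> \<le> (\<integral>y. Kf * exp (2 / 5) * P / 2 * ((hermite_prod \<kappa> y)\<^sup>2 + (exp (Bnd y))\<^sup>2) \<partial>gauss)"
  proof (rule integral_mono_AE)
    show "integrable gauss (\<lambda>y. V_norm (hermite_prod \<kappa> y *\<^sub>R forward_diffs h js u y))"
      unfolding V_norm_def
      by (intro integrable_norm integrable_bounded_linear[OF bounded_linear_snd] int)
    show "integrable gauss (\<lambda>y. Kf * exp (2 / 5) * P / 2 * ((hermite_prod \<kappa> y)\<^sup>2 + (exp (Bnd y))\<^sup>2))"
      using Hsq exp_Bnd_square_integrable by (intro integrable_mult_right Bochner_Integration.integrable_add)
    show "AE y in gauss. V_norm (hermite_prod \<kappa> y *\<^sub>R forward_diffs h js u y)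
        \<le> Kf * exp (2 / 5) * P / 2 * ((hermite_prod \<kappa> y)\<^sup>2 + (exp (Bnd y))\<^sup>2)"
      using AE_Omega
    proof eventually_elim
      fix y assume y: "y \<in> Omega"
      have "V_norm (forward_diffs h js u y) \<le> Kf * exp (2 / 5) * exp (Bnd y) * P"
        using forward_diffs_u_bound[OF y h] by (simp add: P_def mult.assoc)
      then have "\<bar>hermite_prod \<kappa> y\<bar> * V_norm (forward_diffs h js u y) \<le> \<bar>hermite_prod \<kappa> y\<bar> * (Kf * exp (2 / 5) * exp (Bnd y) * P)"
        by (rule mult_left_mono) simp
      also have "\<dots> = Kf * exp (2 / 5) * P / 2 * (2 * \<bar>hermite_prod \<kappa> y\<bar> * exp (Bnd y))" by simp
      also have "\<dots> \<le> Kf * exp (2 / 5) * P / 2 * (\<bar>hermite_prod \<kappa> y\<bar>\<^sup>2 + (exp (Bnd y))\<^sup>2)"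
        using f_bound(1) P0 by (intro mult_left_mono sum_squares_bound) auto
      finally show "V_norm (hermite_prod \<kappa> y *\<^sub>R forward_diffs h js u y)
          \<le> Kf * exp (2 / 5) * P / 2 * ((hermite_prod \<kappa> y)\<^sup>2 + (exp (Bnd y))\<^sup>2)"
        by (simp add: V_norm_scaleR)
    qed
  qed
  also have "\<dots> = C1 * P"
    using Hsq exp_Bnd_square_integrable by (simp add: C1_def)
  finally show ?thesis by (simp add: P_def)
qed

lemma tendsto_exp_quotient:
  assumes h: "\<And>n. 0 < h n" "h \<longlonglongrightarrow> 0"
  shows "(\<lambda>n. (exp (h n * b) - 1) / h n) \<longlonglongrightarrow> (b :: real)"
proof -
  have "((\<lambda>t. exp (t * b)) has_real_derivative b) (at 0)"
    by (auto intro!: derivative_eq_intros)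
  then have "((\<lambda>t. (exp (t * b) - 1) / t) \<longlongrightarrow> b) (at 0)"
    by (simp add: has_field_derivative_iff)
  moreover have "filterlim h (at 0) sequentially"
    using h by (auto simp: filterlim_at intro!: always_eventually) (metis less_irrefl)
  ultimately show ?thesis by (rule filterlim_compose)
qed

text \<open>Pairing differences of \<open>u\<close> of order \<open>js\<close> with the Hermite
  polynomial of index \<open>\<kappa>\<close> and dividing by the matching power of
  \<open>h\<close>: as \<open>h\<close> tends to zero the adjoint differences raise the index to
  \<open>\<nu>\<close> and produce the square roots, while the bound for the differences keeps its
  limit.\<close>

lemma hc_bound_aux:
  assumes J: "finite J" "set js \<subseteq> J" and \<kappa>: "\<And>j. j \<notin> J \<Longrightarrow> \<kappa> j = 0" and \<nu>: "\<And>j. \<nu> j = \<kappa> j + count_list js j"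
  shows "(\<Prod>j\<in>J. sqrt (fact (\<nu> j) / fact (\<kappa> j))) * V_norm (hc \<nu>)
    \<le> C1 * (fact (length js) * 2 ^ length js * prod_list (map beta js))"
proof -
  define m where "m j = count_list js j" for j
  have mi: "\<mu> \<in> multi_indices" if \<mu>: "\<And>j. j \<notin> J \<Longrightarrow> \<mu> j = 0" for \<mu> :: "nat \<Rightarrow> nat"
  proof -
    have "{j. \<mu> j \<noteq> 0} \<subseteq> J"
    proof
      fix j assume "j \<in> {j. \<mu> j \<noteq> 0}"
      then show "j \<in> J" using \<mu>[of j] by auto
    qed
    then have "finite {j. \<mu> j \<noteq> 0}" using J(1) by (rule finite_subset)
    then show ?thesis by (simp add: multi_indices_def)
  qed
  have \<kappa>m: "\<kappa> \<in> multi_indices" using \<kappa> by (rule mi)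
  have m0: "m j = 0" if "j \<notin> J" for j using that J(2) by (auto simp: m_def count_list_0_iff)
  have \<nu>0: "\<nu> j = 0" if "j \<notin> J" for j using \<nu>[of j] \<kappa>[OF that] m0[OF that] by (simp add: m_def)
  have msum: "(\<Sum>j\<in>J. m j) = length js" unfolding m_def by (rule sum_count_set[OF J(2,1)])
  define S where "S = (\<Sum>j\<leftarrow>js. beta j)"
  have S0: "0 \<le> S" unfolding S_def by (intro sum_list_nonneg) (auto simp: beta_nonneg)
  \<comment> \<open>Steps tending to zero, at most \<open>1\<close> for the uniform Hermite bound,
    and so small that the increments satisfy the threshold \<open>4 / 5\<close> of the difference
    estimate.\<close>
  define h where "h n = 1 / ((2 + 2 * S) * real (Suc n))" for n
  have h: "0 < h n" "h n \<le> 1" "h n * S \<le> 4 / 5" for n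
  proof -
    have pos: "0 < 2 + 2 * S" using S0 by simp
    show "0 < h n" using pos by (simp add: h_def)
    have le: "h n \<le> 1 / (2 + 2 * S)"
      unfolding h_def using pos by (intro divide_left_mono) (auto simp: mult_le_cancel_left1)
    also have "\<dots> \<le> 1" using pos S0 by (simp add: field_simps)
    finally show "h n \<le> 1" .
    have "h n * S \<le> 1 / (2 + 2 * S) * S" using le S0 by (intro mult_right_mono)
    also have "\<dots> \<le> 4 / 5" using pos S0 by (simp add: field_simps)
    finally show "h n * S \<le> 4 / 5" .
  qed
  have h0: "h \<longlonglongrightarrow> 0"
  proof -
    have "(\<lambda>n. 1 / (2 + 2 * S) * (1 / real (Suc n))) \<longlonglongrightarrow> 1 / (2 + 2 * S) * 0"
      by (intro tendsto_intros LIMSEQ_Suc[OF lim_1_over_n])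
    then show ?thesis by (simp add: h_def[abs_def])
  qed
  define G where "G n i x = (adjoint_diff (h n) ^^ m i) (hermite (\<kappa> i)) x / h n ^ m i" for n i x
  define L where "L i = sqrt (fact (\<nu> i) / fact (\<kappa> i))" for i
  have G_lim: "(\<lambda>n. G n i x) \<longlonglongrightarrow> L i * hermite (\<nu> i) x" for i x
    unfolding G_def L_def using adjoint_diff_pow_hermite_limit[OF h(1) h0, of "m i" "\<kappa> i" x] \<nu>[of i] by (simp add: m_def)
  have G_growth: "exp_growth (G n i)" for n i
  proof -
    have "exp_growth (\<lambda>x. 1 / h n ^ m i)"
      unfolding exp_growth_def
      by (intro conjI exI[of _ "\<bar>1 / h n ^ m i\<bar>"] exI[of _ "0::real"]) auto
    from exp_growth_mult[OF this exp_growth_adjoint_diff_pow[OF exp_growth_hermite]]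
    have "exp_growth (\<lambda>x. (1 / h n ^ m i) * (adjoint_diff (h n) ^^ m i) (hermite (\<kappa> i)) x)" .
    then show ?thesis by (simp add: G_def[abs_def])
  qed
  have "\<exists>C c. 0 \<le> C \<and> 0 \<le> c \<and> (\<forall>n x. \<bar>G n i x\<bar> \<le> C * exp (c * \<bar>x\<bar>))" for i
    using adjoint_diff_pow_hermite_bound[of "m i" "\<kappa> i"] h(1,2) unfolding G_def by blast
  then obtain C c where Cc: "\<And>i. 0 \<le> C i" "\<And>i. 0 \<le> c i" "\<And>n i x. \<bar>G n i x\<bar> \<le> C i * exp (c i * \<bar>x\<bar>)" by metis
  have um: "u \<in> borel_measurable gauss" by (rule u_measurable)
  define T where "T n = (\<integral>y. hermite_prod \<kappa> y *\<^sub>R forward_diffs (h n) js u y \<partial>gauss)" for n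
  \<comment> \<open>The power of \<open>h\<close> distributes over the coordinates according to the
    multiplicities \<open>m i\<close>, one factor for each adjoint difference.\<close>
  have T_eq: "(1 / h n ^ length js) *\<^sub>R T n = (\<integral>y. (\<Prod>i\<in>J. G n i (y i)) *\<^sub>R u y \<partial>gauss)" for n
  proof -
    have "T n = (\<integral>y. (\<Prod>i\<in>J. hermite (\<kappa> i) (y i)) *\<^sub>R forward_diffs (h n) js u y \<partial>gauss)"
      unfolding T_def using \<kappa> by (intro Bochner_Integration.integral_cong refl) (subst hermite_prod_eq[OF J(1)], auto intro: ccontr)
    also have "\<dots> = (\<integral>y. (\<Prod>i\<in>J. (adjoint_diff (h n) ^^ m i) (hermite (\<kappa> i)) (y i)) *\<^sub>R u y \<partial>gauss)"
      unfolding m_def by (rule integral_prod_forward_diffs[OF exp_integrable_u J exp_growth_hermite])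
    finally have "(1 / h n ^ length js) *\<^sub>R T n =
        (\<integral>y. (1 / h n ^ length js) *\<^sub>R ((\<Prod>i\<in>J. (adjoint_diff (h n) ^^ m i) (hermite (\<kappa> i)) (y i)) *\<^sub>R u y) \<partial>gauss)"
      by (simp only: integral_scaleR_right)
    also have "\<dots> = (\<integral>y. (\<Prod>i\<in>J. G n i (y i)) *\<^sub>R u y \<partial>gauss)"
    proof (intro Bochner_Integration.integral_cong refl)
      fix y
      have "h n ^ length js = (\<Prod>i\<in>J. h n ^ m i)" by (simp add: msum[symmetric] power_sum)
      then show "(1 / h n ^ length js) *\<^sub>R ((\<Prod>i\<in>J. (adjoint_diff (h n) ^^ m i) (hermite (\<kappa> i)) (y i)) *\<^sub>R u y)
          = (\<Prod>i\<in>J. G n i (y i)) *\<^sub>R u y"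
        by (simp add: G_def prod_dividef)
    qed
    finally show ?thesis .
  qed
  have "(\<lambda>n. \<integral>y. (\<Prod>i\<in>J. G n i (y i)) *\<^sub>R u y \<partial>gauss) \<longlonglongrightarrow> (\<integral>y. (\<Prod>i\<in>J. L i * hermite (\<nu> i) (y i)) *\<^sub>R u y \<partial>gauss)"
  proof (rule integral_dominated_convergence[where w="\<lambda>y. norm ((\<Prod>i\<in>J. C i * exp (c i * \<bar>y i\<bar>)) *\<^sub>R u y)"])
    show "(\<lambda>y. (\<Prod>i\<in>J. L i * hermite (\<nu> i) (y i)) *\<^sub>R u y) \<in> borel_measurable gauss"
      by (intro borel_measurable_scaleR um measurable_gauss_prod[of J "\<lambda>i x. L i * hermite (\<nu> i) x"]) measurable
    show "(\<lambda>y. (\<Prod>i\<in>J. G n i (y i)) *\<^sub>R u y) \<in> borel_measurable gauss" for n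
      using G_growth by (intro borel_measurable_scaleR um measurable_gauss_prod[of J "G n"]) (auto simp: exp_growth_def)
    have "exp_growth (\<lambda>x. C i * exp (c i * \<bar>x\<bar>))" for i
      unfolding exp_growth_def using Cc(1,2)[of i]
      by (intro conjI exI[of _ "C i"] exI[of _ "c i"]) (auto simp: abs_mult)
    then show "integrable gauss (\<lambda>y. norm ((\<Prod>i\<in>J. C i * exp (c i * \<bar>y i\<bar>)) *\<^sub>R u y))"
      by (intro integrable_norm exp_integrable_prod[OF exp_integrable_u J(1), of "\<lambda>i x. C i * exp (c i * \<bar>x\<bar>)"])
    show "AE y in gauss. (\<lambda>n. (\<Prod>i\<in>J. G n i (y i)) *\<^sub>R u y) \<longlonglongrightarrow> (\<Prod>i\<in>J. L i * hermite (\<nu> i) (y i)) *\<^sub>R u y"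
      by (intro AE_I2 tendsto_intros G_lim)
    show "AE y in gauss. norm ((\<Prod>i\<in>J. G n i (y i)) *\<^sub>R u y) \<le> norm ((\<Prod>i\<in>J. C i * exp (c i * \<bar>y i\<bar>)) *\<^sub>R u y)" for n
    proof (rule AE_I2)
      fix y
      have "\<bar>\<Prod>i\<in>J. G n i (y i)\<bar> \<le> (\<Prod>i\<in>J. C i * exp (c i * \<bar>y i\<bar>))"
        unfolding abs_prod using Cc by (intro prod_mono) auto
      then have "\<bar>\<Prod>i\<in>J. G n i (y i)\<bar> \<le> \<bar>\<Prod>i\<in>J. C i * exp (c i * \<bar>y i\<bar>)\<bar>" by linarith
      then show "norm ((\<Prod>i\<in>J. G n i (y i)) *\<^sub>R u y) \<le> norm ((\<Prod>i\<in>J. C i * exp (c i * \<bar>y i\<bar>)) *\<^sub>R u y)"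
        unfolding norm_scaleR by (intro mult_right_mono) auto
    qed
  qed
  also have "(\<integral>y. (\<Prod>i\<in>J. L i * hermite (\<nu> i) (y i)) *\<^sub>R u y \<partial>gauss) = (\<Prod>i\<in>J. L i) *\<^sub>R hc \<nu>"
  proof -
    have "(\<Prod>i\<in>J. L i * hermite (\<nu> i) (y i)) *\<^sub>R u y = (\<Prod>i\<in>J. L i) *\<^sub>R (hermite_prod \<nu> y *\<^sub>R u y)" for y
      using \<nu>0 by (subst hermite_prod_eq[OF J(1)]) (auto simp: prod.distrib intro: ccontr)
    then show ?thesis by (simp only: integral_scaleR_right hc_eq)
  qed
  finally have "(\<lambda>n. V_norm ((1 / h n ^ length js) *\<^sub>R T n)) \<longlonglongrightarrow> V_norm ((\<Prod>i\<in>J. L i) *\<^sub>R hc \<nu>)"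
    unfolding T_eq V_norm_def by (intro tendsto_norm tendsto_snd)
  \<comment> \<open>Each factor \<open>exp (h * beta) - 1\<close> of the difference bound takes one
    of the divisions by \<open>h\<close> and tends to \<open>beta\<close>.\<close>
  moreover have "(\<lambda>n. C1 * (fact (length js) * 2 ^ length js * (\<Prod>i<length js. (exp (h n * beta (js ! i)) - 1) / h n)))
      \<longlonglongrightarrow> C1 * (fact (length js) * 2 ^ length js * (\<Prod>i<length js. beta (js ! i)))"
    by (intro tendsto_intros tendsto_exp_quotient h h0)
  moreover have "V_norm ((1 / h n ^ length js) *\<^sub>R T n)
      \<le> C1 * (fact (length js) * 2 ^ length js * (\<Prod>i<length js. (exp (h n * beta (js ! i)) - 1) / h n))" for n
  proof -
    have "V_norm ((1 / h n ^ length js) *\<^sub>R T n) = 1 / h n ^ length js * V_norm (T n)"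
      using h(1)[of n] by (simp add: V_norm_scaleR)
    also have "\<dots> \<le> 1 / h n ^ length js * (C1 * (fact (length js) * 2 ^ length js * (\<Prod>i<length js. exp (h n * beta (js ! i)) - 1)))"
      unfolding T_def using h[of n]
      by (intro mult_left_mono integral_hermite_forward_diffs_bound[OF \<kappa>m]) (auto simp: S_def)
    also have "\<dots> = C1 * (fact (length js) * 2 ^ length js * (\<Prod>i<length js. (exp (h n * beta (js ! i)) - 1) / h n))"
      by (simp add: prod_dividef)
    finally show ?thesis .
  qed
  ultimately have "V_norm ((\<Prod>i\<in>J. L i) *\<^sub>R hc \<nu>) \<le> C1 * (fact (length js) * 2 ^ length js * (\<Prod>i<length js. beta (js ! i)))"
    by (intro LIMSEQ_le) auto
  moreover have "(\<Prod>i<length js. beta (js ! i)) = prod_list (map beta js)"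
    by (simp add: prod.list_conv_set_nth atLeast0LessThan)
  moreover have "0 \<le> (\<Prod>i\<in>J. L i)" unfolding L_def by (intro prod_nonneg) auto
  ultimately show ?thesis by (simp add: V_norm_scaleR L_def)
qed

text \<open>The instance \<open>\<kappa> = \<nu> - min \<nu> r\<close>: the square roots combine to
  that of \<open>omega\<close>, and dividing by them turns the order of the difference into decay in
  \<open>\<nu>\<close>.\<close>

lemma hc_bound:
  assumes J: "finite J" and \<nu>: "\<And>j. j \<notin> J \<Longrightarrow> \<nu> j = 0"
  shows "V_norm (hc \<nu>) \<le> C1 * (fact (\<Sum>j\<in>J. min (\<nu> j) r) * (\<Prod>j\<in>J. (2 * beta j) ^ min (\<nu> j) r * omega r (\<nu> j) powr - (1 / 2)))"
proof -
  define \<mu> where "\<mu> j = min (\<nu> j) r" for j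
  obtain js where js: "set js \<subseteq> J" "\<forall>j\<in>J. count_list js j = \<mu> j" "length js = (\<Sum>j\<in>J. \<mu> j)"
    "prod_list (map beta js) = (\<Prod>j\<in>J. beta j ^ \<mu> j)"
    using list_with_counts[OF J, of \<mu> beta] by blast
  have count0: "count_list js j = 0" if "j \<notin> J" for j using that js(1) by (auto simp: count_list_0_iff)
  define L where "L = (\<Prod>j\<in>J. sqrt (omega r (\<nu> j)))"
  have "(\<Prod>j\<in>J. sqrt (fact (\<nu> j) / fact (\<nu> j - \<mu> j))) * V_norm (hc \<nu>)
    \<le> C1 * (fact (length js) * 2 ^ length js * prod_list (map beta js))"
  proof (rule hc_bound_aux[OF J js(1)])
    show "\<nu> j - \<mu> j = 0" if "j \<notin> J" for j using \<nu>[OF that] by simp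
    show "\<nu> j = (\<nu> j - \<mu> j) + count_list js j" for j
      using js(2) count0[of j] \<nu>[of j] by (cases "j \<in> J") (auto simp: \<mu>_def)
  qed
  then have 1: "L * V_norm (hc \<nu>) \<le> C1 * (fact (\<Sum>j\<in>J. \<mu> j) * (\<Prod>j\<in>J. (2 * beta j) ^ \<mu> j))"
    by (simp add: L_def omega_def \<mu>_def js(3,4) power_mult_distrib prod.distrib power_sum mult.assoc)
  have opos: "0 < omega r n" for n using omega_ge_1[of r n] by linarith
  then have L0: "0 < L" unfolding L_def by (intro prod_pos) auto
  have Linv: "1 / L = (\<Prod>j\<in>J. omega r (\<nu> j) powr - (1 / 2))"
    unfolding L_def using opos by (simp add: prod_dividef[symmetric] powr_minus_divide powr_half_sqrt less_imp_le flip: prod_inversef)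
      (simp add: prod_dividef)
  have "V_norm (hc \<nu>) \<le> C1 * (fact (\<Sum>j\<in>J. \<mu> j) * (\<Prod>j\<in>J. (2 * beta j) ^ \<mu> j)) * (1 / L)"
    using 1 L0 by (simp add: field_simps)
  then show ?thesis unfolding Linv by (simp add: \<mu>_def prod.distrib mult.assoc)
qed

text \<open>The bound of \<open>hc_bound\<close> is written as \<open>A \<nu> * B \<nu>\<close>,
  with \<open>A\<close> in l^2 and \<open>B\<close> in l^t. The decay
  \<open>omega powr - (1/2)\<close> is shared equally between the two factors.\<close>

theorem hc_powr_sums_bounded:
  fixes p q :: real
  assumes p: "0 < p" "p < 2" and q: "1 / q = 1 / p + 1 / 2" and sq: "summable (\<lambda>j. beta j powr q)"
  shows "\<exists>K\<ge>0. \<forall>F. finite F \<longrightarrow> F \<subseteq> multi_indices \<longrightarrow> (\<Sum>\<nu>\<in>F. V_norm (hc \<nu>) powr p) \<le> K"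
proof -
  have "0 < 1 / q" unfolding q using p by (intro add_pos_pos) auto
  then have q0: "0 < q" by simp
  have q_eq: "q = 2 * p / (2 + p)"
  proof -
    have "1 / q = (2 + p) / (2 * p)" unfolding q using p by (simp add: field_simps)
    then show ?thesis using q0 p by (simp add: field_simps)
  qed
  have q1: "q < 1" unfolding q_eq using p by (simp add: field_simps)
  \<comment> \<open>The Hoelder partner of \<open>2\<close> for the exponent \<open>p\<close>;
    \<open>tq\<close> then places \<open>beta powr (1 - q)\<close> in l^t.\<close>
  define t where "t = 2 * p / (2 - p)"
  have t0: "0 < t" using p by (simp add: t_def)
  have tq: "(1 - q) * t = q"
  proof -
    have "1 - q = (2 - p) / (2 + p)" unfolding q_eq using p by (simp add: field_simps)
    then show ?thesis unfolding t_def using p by (simp add: q_eq)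
  qed
  \<comment> \<open>Squaring \<open>A\<close> leaves \<open>omega powr - (1/2)\<close> and raising
    \<open>B\<close> to the power \<open>t\<close> leaves \<open>omega powr - (t/4)\<close>; both
    become summable in each coordinate.\<close>
  obtain r :: nat where r: "max 2 (4 / t) < real r" using reals_Archimedean2 by blast
  have r0: "0 < r" "1 < real r * (1 / 2)" "1 < real r * (t / 4)"
    using r t0 by (auto simp: field_simps)
  obtain S1 where S1: "1 \<le> S1" "\<And>N. (\<Sum>n\<le>N. omega r n powr - (1 / 2)) \<le> S1"
    using omega_sum_bounded[of "1 / 2" r] r0(2) by auto
  obtain S2 where S2: "1 \<le> S2" "\<And>N. (\<Sum>n\<le>N. omega r n powr - (t / 4)) \<le> S2"
    using omega_sum_bounded[of "t / 4" r] r0(3) t0 by auto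
  define Sq where "Sq = suminf (\<lambda>j. beta j powr q)"
  have Sq: "(\<Sum>j\<in>J. beta j powr q) \<le> Sq" if "finite J" for J
    unfolding Sq_def using that by (intro sum_le_suminf[OF sq]) auto
  have Sq0: "0 \<le> Sq" using Sq[of "{}"] by simp
  \<comment> \<open>Makes \<open>S1\<close> times the sum of \<open>x\<close> at most
    \<open>1 / 2\<close>, as the geometric series requires; the inverse of \<open>\<epsilon>\<close>
    goes into \<open>y\<close>.\<close>
  define \<epsilon> where "\<epsilon> = 1 / (4 * S1 * (Sq + 1))"
  have e0: "0 < \<epsilon>" unfolding \<epsilon>_def using S1(1) Sq0 by (intro divide_pos_pos mult_pos_pos) auto
  define x where "x j = 2 * \<epsilon> * beta j powr q" for j
  define y where "y j = beta j powr (1 - q) / \<epsilon>" for j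
  have x0: "0 \<le> x j" and y0: "0 \<le> y j" for j using e0 by (auto simp: x_def y_def)
  have xy: "x j * y j = 2 * beta j" for j
  proof (cases "beta j = 0")
    case False
    then have "0 < beta j" using beta_nonneg[of j] by simp
    then have "beta j powr q * beta j powr (1 - q) = beta j" by (simp add: powr_add[symmetric])
    then show ?thesis using e0 by (simp add: x_def y_def)
  qed (use q0 in \<open>simp add: x_def\<close>)
  have xsum: "(\<Sum>j\<in>J. S1 * x j) \<le> 1 / 2" if "finite J" for J
  proof -
    have "(\<Sum>j\<in>J. S1 * x j) = 2 * \<epsilon> * S1 * (\<Sum>j\<in>J. beta j powr q)"
      by (simp add: x_def sum_distrib_left mult_ac)
    also have "\<dots> \<le> 2 * \<epsilon> * S1 * (Sq + 1)"
      using Sq[OF that] e0 S1(1) by (intro mult_left_mono) auto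
    also have "\<dots> = 1 / 2"
    proof -
      define w where "w = S1 * (Sq + 1)"
      have "0 < w" unfolding w_def using S1(1) Sq0 by (intro mult_pos_pos) auto
      then have "2 * (1 / (4 * w)) * w = 1 / 2" by simp
      moreover have "\<epsilon> = 1 / (4 * w)" by (simp add: \<epsilon>_def w_def mult.assoc)
      moreover have "2 * \<epsilon> * S1 * (Sq + 1) = 2 * \<epsilon> * w" by (simp add: w_def)
      ultimately show ?thesis by (simp only:)
    qed
    finally show ?thesis .
  qed
  have yt: "y j powr t = beta j powr q / \<epsilon> powr t" for j
    using e0 by (simp add: y_def powr_divide powr_powr tq)
  \<comment> \<open>A common bound of all \<open>y j\<close>, kept at least \<open>1\<close> so that
    its powers increase.\<close>
  define Y where "Y = 1 + (Sq / \<epsilon> powr t) powr (1 / t)"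
  have Y1: "1 \<le> Y" by (simp add: Y_def)
  have yY: "y j \<le> Y" for j
  proof -
    have "y j = (y j powr t) powr (1 / t)" using t0 y0[of j] by (simp add: powr_powr)
    also have "\<dots> \<le> (Sq / \<epsilon> powr t) powr (1 / t)"
      unfolding yt using Sq[of "{j}"] t0 by (intro powr_mono2 divide_right_mono) auto
    finally show ?thesis by (simp add: Y_def)
  qed
  define Bf where "Bf j n = (fact (min n r) * y j ^ min n r * omega r n powr - (1 / 4)) powr t" for j n
  define M where "M = (fact r * Y ^ r) powr t"
  define s where "s j = M * S2 * y j powr t" for j
  have opos: "0 < omega r n" for n using omega_ge_1[of r n] by linarith
  have Bf_sum: "(\<Sum>n\<in>{1..N}. Bf j n) \<le> s j" for j N
  proof -
    \<comment> \<open>Only one factor \<open>y j\<close> is kept, available since \<open>n\<close>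
      is at least \<open>1\<close>: its \<open>t\<close>-th power is what can be summed over
      \<open>j\<close>. The remaining powers and the factorial are bounded because the order is cut
      at \<open>r\<close>.\<close>
    have "Bf j n \<le> M * y j powr t * omega r n powr - (t / 4)" if n: "n \<in> {1..N}" for n
    proof -
      obtain m where m: "min n r = Suc m" using n r0(1) by (cases "min n r") (auto simp: min_def split: if_splits)
      have "y j ^ Suc m \<le> y j * Y ^ m"
        using yY[of j] y0[of j] by (auto intro!: mult_left_mono power_mono)
      also have "\<dots> \<le> y j * Y ^ r"
        using m Y1 y0[of j] by (intro mult_left_mono power_increasing) auto
      finally have "fact (Suc m) * y j ^ Suc m \<le> fact r * (y j * Y ^ r)"
        using m y0[of j] by (intro mult_mono fact_mono) auto
      then have "fact (min n r) * y j ^ min n r * omega r n powr - (1 / 4) \<le> (fact r * Y ^ r) * y j * omega r n powr - (1 / 4)"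
        unfolding m by (intro mult_right_mono) (auto simp: mult_ac)
      then have "Bf j n \<le> ((fact r * Y ^ r) * y j * omega r n powr - (1 / 4)) powr t"
        unfolding Bf_def using t0 y0[of j] by (intro powr_mono2) auto
      also have "\<dots> = M * y j powr t * omega r n powr - (t / 4)"
        using y0[of j] Y1 by (simp add: M_def powr_mult powr_powr)
      finally show ?thesis .
    qed
    then have "(\<Sum>n\<in>{1..N}. Bf j n) \<le> (\<Sum>n\<in>{1..N}. M * y j powr t * omega r n powr - (t / 4))"
      by (rule sum_mono)
    also have "\<dots> \<le> (\<Sum>n\<le>N. M * y j powr t * omega r n powr - (t / 4))"
      by (intro sum_mono2) (auto simp: M_def)
    also have "\<dots> = M * y j powr t * (\<Sum>n\<le>N. omega r n powr - (t / 4))" by (simp add: sum_distrib_left)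
    also have "\<dots> \<le> M * y j powr t * S2" using S2(2) by (intro mult_left_mono) (auto simp: M_def)
    finally show ?thesis by (simp add: s_def mult_ac)
  qed
  define K where "K = C1 powr p * (2 + exp (M * S2 * (Sq / \<epsilon> powr t)))"
  have "(\<Sum>\<nu>\<in>F. V_norm (hc \<nu>) powr p) \<le> K" if F: "finite F" "F \<subseteq> multi_indices" for F
  proof -
    obtain J N where J: "finite J" "F \<subseteq> box J N" using finite_multi_indices_subset_box[OF F] by blast
    define A where "A \<nu> = multinomial_term J x (\<lambda>j. min (\<nu> j) r) * (\<Prod>j\<in>J. omega r (\<nu> j) powr - (1 / 4))" for \<nu>
    define B where "B \<nu> = (\<Prod>j\<in>J. fact (min (\<nu> j) r) * y j ^ min (\<nu> j) r * omega r (\<nu> j) powr - (1 / 4))" for \<nu>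
    have mt: "0 \<le> multinomial_term J x \<mu>" for \<mu> using x0 by (intro multinomial_term_nonneg)
    have A0: "0 \<le> A \<nu>" for \<nu> unfolding A_def by (intro mult_nonneg_nonneg mt prod_nonneg) auto
    have B0: "0 \<le> B \<nu>" for \<nu> unfolding B_def using y0 by (intro prod_nonneg) auto
    have xs: "(\<Sum>j\<in>J. x j) \<le> 1"
    proof -
      have "(\<Sum>j\<in>J. x j) \<le> (\<Sum>j\<in>J. S1 * x j)"
      proof (rule sum_mono)
        show "x j \<le> S1 * x j" for j using mult_right_mono[OF S1(1) x0[of j]] by simp
      qed
      then show ?thesis using xsum[OF J(1)] by simp
    qed
    have pw: "V_norm (hc \<nu>) powr p \<le> C1 powr p * ((A \<nu>)\<^sup>2 + B \<nu> powr t)" if \<nu>: "\<nu> \<in> box J N" for \<nu>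
    proof -
      have "(\<Prod>j\<in>J. (2 * beta j) ^ min (\<nu> j) r * omega r (\<nu> j) powr - (1 / 2)) * fact (\<Sum>j\<in>J. min (\<nu> j) r) = A \<nu> * B \<nu>"
      proof -
        have "(2 * beta j) ^ min (\<nu> j) r * omega r (\<nu> j) powr - (1 / 2) =
            (x j ^ min (\<nu> j) r / fact (min (\<nu> j) r) * omega r (\<nu> j) powr - (1 / 4)) *
            (fact (min (\<nu> j) r) * y j ^ min (\<nu> j) r * omega r (\<nu> j) powr - (1 / 4))" for j
        proof -
          have "omega r (\<nu> j) powr - (1 / 2) = omega r (\<nu> j) powr - (1 / 4) * omega r (\<nu> j) powr - (1 / 4)"
            by (simp add: powr_add[symmetric])
          then show ?thesis unfolding xy[symmetric] power_mult_distrib by simp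
        qed
        then have "(\<Prod>j\<in>J. (2 * beta j) ^ min (\<nu> j) r * omega r (\<nu> j) powr - (1 / 2)) =
            (\<Prod>j\<in>J. x j ^ min (\<nu> j) r / fact (min (\<nu> j) r)) * (\<Prod>j\<in>J. omega r (\<nu> j) powr - (1 / 4)) * B \<nu>"
          by (simp only: prod.distrib[symmetric] B_def)
        then show ?thesis
          unfolding A_def multinomial_term_def by (simp only: mult_ac)
      qed
      then have "V_norm (hc \<nu>) \<le> C1 * (A \<nu> * B \<nu>)"
        using hc_bound[OF J(1), of \<nu> r] \<nu> by (simp add: box_def mult.commute)
      then have "V_norm (hc \<nu>) powr p \<le> (C1 * (A \<nu> * B \<nu>)) powr p"
        using p by (intro powr_mono2) (auto simp: V_norm_def)
      also have "\<dots> = C1 powr p * (A \<nu> * B \<nu>) powr p"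
        using C1_nonneg A0[of \<nu>] B0[of \<nu>] by (simp add: powr_mult)
      also have "\<dots> \<le> C1 powr p * ((A \<nu>)\<^sup>2 + B \<nu> powr t)"
        unfolding t_def by (intro mult_left_mono product_powr_le A0 B0 p) auto
      finally show ?thesis .
    qed
    have A_sum: "(\<Sum>\<nu>\<in>box J N. (A \<nu>)\<^sup>2) \<le> 2"
    proof -
      have "(A \<nu>)\<^sup>2 \<le> multinomial_term J x (\<lambda>j. min (\<nu> j) r) * (\<Prod>j\<in>J. omega r (\<nu> j) powr - (1 / 2))" if "\<nu> \<in> box J N" for \<nu>
      proof -
        define T where "T = multinomial_term J x (\<lambda>j. min (\<nu> j) r)"
        have T: "0 \<le> T" "T \<le> 1"
          unfolding T_def using that x0 xs by (auto intro!: mt multinomial_term_le_1[OF J(1)] simp: box_def)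
        have "(\<Prod>j\<in>J. omega r (\<nu> j) powr - (1 / 4))\<^sup>2 = (\<Prod>j\<in>J. omega r (\<nu> j) powr - (1 / 2))"
          unfolding power2_eq_square prod.distrib[symmetric] by (simp add: powr_add[symmetric])
        then have "(A \<nu>)\<^sup>2 = (T * T) * (\<Prod>j\<in>J. omega r (\<nu> j) powr - (1 / 2))"
          by (simp add: A_def T_def power_mult_distrib power2_eq_square)
        also have "\<dots> \<le> (T * 1) * (\<Prod>j\<in>J. omega r (\<nu> j) powr - (1 / 2))"
          using T by (intro mult_right_mono mult_left_mono prod_nonneg) auto
        finally show ?thesis by (simp add: T_def)
      qed
      then have "(\<Sum>\<nu>\<in>box J N. (A \<nu>)\<^sup>2) \<le> (\<Sum>\<nu>\<in>box J N. multinomial_term J x (\<lambda>j. min (\<nu> j) r) * (\<Prod>j\<in>J. omega r (\<nu> j) powr - (1 / 2)))"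
        by (rule sum_mono)
      also have "\<dots> \<le> 2"
        by (rule sum_multinomial_omega_le[OF J(1) x0 r0(1) S1 _ xsum[OF J(1)]]) simp
      finally show ?thesis .
    qed
    have B_sum: "(\<Sum>\<nu>\<in>box J N. B \<nu> powr t) \<le> exp (M * S2 * (Sq / \<epsilon> powr t))"
    proof -
      have "B \<nu> powr t = (\<Prod>j | \<nu> j \<noteq> 0. Bf j (\<nu> j))" if "\<nu> \<in> box J N" for \<nu>
      proof -
        have "B \<nu> powr t = (\<Prod>j\<in>J. Bf j (\<nu> j))"
          unfolding B_def Bf_def using y0 by (subst prod_powr_distrib) auto
        also have "\<dots> = (\<Prod>j | \<nu> j \<noteq> 0. Bf j (\<nu> j))"
          using that by (intro prod_support_eq J) (auto simp: box_def Bf_def)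
        finally show ?thesis .
      qed
      then have "(\<Sum>\<nu>\<in>box J N. B \<nu> powr t) = (\<Sum>\<nu>\<in>box J N. \<Prod>j | \<nu> j \<noteq> 0. Bf j (\<nu> j))" by simp
      also have "\<dots> \<le> exp (\<Sum>j\<in>J. s j)"
        by (rule sum_box_prod_le[OF J(1) _ _ Bf_sum]) (auto simp: Bf_def)
      also have "(\<Sum>j\<in>J. s j) = M * S2 * ((\<Sum>j\<in>J. beta j powr q) / \<epsilon> powr t)"
        by (simp add: s_def yt sum_distrib_left sum_divide_distrib)
      also have "exp \<dots> \<le> exp (M * S2 * (Sq / \<epsilon> powr t))"
        using Sq[OF J(1)] S2(1) by (auto intro!: mult_left_mono divide_right_mono simp: M_def)
      finally show ?thesis .
    qed
    have "(\<Sum>\<nu>\<in>F. V_norm (hc \<nu>) powr p) \<le> (\<Sum>\<nu>\<in>box J N. V_norm (hc \<nu>) powr p)"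
      using J by (intro sum_mono2 finite_box) auto
    also have "\<dots> \<le> (\<Sum>\<nu>\<in>box J N. C1 powr p * ((A \<nu>)\<^sup>2 + B \<nu> powr t))"
      by (intro sum_mono pw)
    also have "\<dots> = C1 powr p * ((\<Sum>\<nu>\<in>box J N. (A \<nu>)\<^sup>2) + (\<Sum>\<nu>\<in>box J N. B \<nu> powr t))"
      by (simp only: sum_distrib_left[symmetric] sum.distrib)
    also have "\<dots> \<le> K" unfolding K_def using A_sum B_sum by (intro mult_left_mono add_mono) auto
    finally show ?thesis .
  qed
  moreover have "0 \<le> K" unfolding K_def by (intro mult_nonneg_nonneg add_nonneg_nonneg) auto
  ultimately show ?thesis by blast
qed

end

subsection \<open>Best n-term approximation\<close>

text \<open>Stechkin's argument: every entry outside \<open>\<Lambda>\<close> is below all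
  \<open>n\<close> selected ones, so its \<open>p\<close>-th power is at most \<open>K / n\<close>;
  the surplus exponent \<open>2 - p\<close> converts this into the rate.\<close>

lemma n_largest_tail_le:
  fixes c :: "'i \<Rightarrow> real"
  assumes n: "n_largest I c n \<Lambda>" "1 \<le> n" and c0: "\<And>i. 0 \<le> c i" and p: "0 < p" "p < 2" and K: "0 \<le> K"
    and sum: "\<And>F. finite F \<Longrightarrow> F \<subseteq> I \<Longrightarrow> (\<Sum>i\<in>F. c i powr p) \<le> K"
    and F: "finite F" "F \<subseteq> I - \<Lambda>"
  shows "(\<Sum>i\<in>F. (c i)\<^sup>2) \<le> K powr (2 / p) * real n powr - (2 / p - 1)"
proof -
  have L: "\<Lambda> \<subseteq> I" "finite \<Lambda>" "card \<Lambda> = n" "\<And>i j. i \<in> \<Lambda> \<Longrightarrow> j \<in> I - \<Lambda> \<Longrightarrow> c j \<le> c i"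
    using n(1) by (auto simp: n_largest_def)
  have term_le: "(c j)\<^sup>2 \<le> c j powr p * (K / n) powr ((2 - p) / p)" if j: "j \<in> F" for j
  proof -
    have "real n * c j powr p = (\<Sum>i\<in>\<Lambda>. c j powr p)" using L(3) by simp
    also have "\<dots> \<le> (\<Sum>i\<in>\<Lambda>. c i powr p)"
      using L(4) j F(2) c0 p by (intro sum_mono powr_mono2) auto
    also have "\<dots> \<le> K" by (rule sum[OF L(2,1)])
    finally have "c j powr p \<le> K / n" using n(2) by (simp add: field_simps)
    then have "(c j powr p) powr ((2 - p) / p) \<le> (K / n) powr ((2 - p) / p)"
      using p by (intro powr_mono2) auto
    then have "c j powr (2 - p) \<le> (K / n) powr ((2 - p) / p)" using p by (simp add: powr_powr)
    then have "c j powr p * c j powr (2 - p) \<le> c j powr p * (K / n) powr ((2 - p) / p)"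
      by (intro mult_left_mono) auto
    moreover have "c j powr p * c j powr (2 - p) = (c j)\<^sup>2"
      using c0[of j] by (cases "c j = 0") (auto simp: powr_add[symmetric] powr_numeral)
    ultimately show ?thesis by simp
  qed
  have "(\<Sum>i\<in>F. (c i)\<^sup>2) \<le> (\<Sum>i\<in>F. c i powr p) * (K / n) powr ((2 - p) / p)"
    unfolding sum_distrib_right by (rule sum_mono[OF term_le])
  also have "\<dots> \<le> K * (K / n) powr ((2 - p) / p)"
    using F by (intro mult_right_mono sum) auto
  also have "\<dots> = K powr (2 / p) * real n powr - (2 / p - 1)"
  proof (cases "K = 0")
    case False
    have e: "(2 - p) / p = 2 / p - 1" using p by (simp add: field_simps)
    have "K * K powr (2 / p - 1) = K powr (2 / p)"
      using False K powr_add[of K 1 "2 / p - 1"] by simp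
    moreover have "(K / n) powr (2 / p - 1) = K powr (2 / p - 1) * real n powr - (2 / p - 1)"
      unfolding powr_minus_divide[of "real n" "2 / p - 1"] using K by (simp add: powr_divide)
    ultimately show ?thesis unfolding e by simp
  qed simp
  finally show ?thesis .
qed

context parametric_elliptic
begin

lemma hermite_partial_sum_eq: "hermite_partial_sum D \<psi> f \<Lambda> y = (\<Sum>\<nu>\<in>\<Lambda>. hermite_prod \<nu> y *\<^sub>R hc \<nu>)"
  by (simp add: hermite_partial_sum_def hc_def)

text \<open>The V norm is the Hilbert norm of the gradient component alone, so Parseval is applied
  to \<open>snd (u y)\<close> rather than to the pair.\<close>

lemma gauss_L2_gradient: "gauss_L2 (\<lambda>y. snd (u y))"
proof
  show m: "(\<lambda>y. snd (u y)) \<in> borel_measurable gauss"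
    using u_measurable by (rule borel_measurable_continuous_on[OF continuous_on_snd[OF continuous_on_id]])
  show "integrable gauss (\<lambda>y. (norm (snd (u y)))\<^sup>2)"
  proof (intro Bochner_Integration.integrable_bound[OF norm_u_square_integrable] AE_I2)
    fix y
    have "norm (snd (u y)) \<le> norm (u y)" using norm_snd_le[of "snd (u y)" "fst (u y)"] by simp
    then show "norm ((norm (snd (u y)))\<^sup>2) \<le> norm ((norm (u y))\<^sup>2)" by (simp add: power_mono)
  qed (intro borel_measurable_power measurable_compose[OF m borel_measurable_norm])
qed

lemma error_L2_V:
  assumes \<Lambda>: "finite \<Lambda>" "\<Lambda> \<subseteq> multi_indices"
    and B: "\<And>F. finite F \<Longrightarrow> F \<subseteq> multi_indices - \<Lambda> \<Longrightarrow> (\<Sum>\<nu>\<in>F. (V_norm (hc \<nu>))\<^sup>2) \<le> B"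
  shows "(\<lambda>y. solution D \<psi> f y - hermite_partial_sum D \<psi> f \<Lambda> y) \<in> L2_V D"
    and "L2_V_norm (\<lambda>y. solution D \<psi> f y - hermite_partial_sum D \<psi> f \<Lambda> y) \<le> sqrt B"
proof -
  interpret G: gauss_L2 "\<lambda>y. snd (u y)" by (rule gauss_L2_gradient)
  have coef: "G.coef \<nu> = snd (hc \<nu>)" if "\<nu> \<in> multi_indices" for \<nu>
    unfolding G.coef_def hc_eq
    using integral_bounded_linear[OF bounded_linear_snd integrable_hermite_prod_u[OF that]] by simp
  have ps: "hermite_partial_sum D \<psi> f \<Lambda> y \<in> H10 D" "snd (hermite_partial_sum D \<psi> f \<Lambda> y) = G.psum \<Lambda> y" for y
  proof -
    show "hermite_partial_sum D \<psi> f \<Lambda> y \<in> H10 D"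
      unfolding hermite_partial_sum_eq using \<Lambda> by (intro H10_sum H10_mem hc_H10) auto
    have "snd (hermite_partial_sum D \<psi> f \<Lambda> y) = (\<Sum>\<nu>\<in>\<Lambda>. hermite_prod \<nu> y *\<^sub>R snd (hc \<nu>))"
      unfolding hermite_partial_sum_eq by (simp add: snd_sum)
    also have "\<dots> = G.psum \<Lambda> y"
      unfolding G.psum_def using \<Lambda> coef by (intro sum.cong refl) auto
    finally show "snd (hermite_partial_sum D \<psi> f \<Lambda> y) = G.psum \<Lambda> y" .
  qed
  have V: "V_norm (solution D \<psi> f y - hermite_partial_sum D \<psi> f \<Lambda> y) = norm (snd (u y) - G.psum \<Lambda> y)" for y
    using ps by (simp add: V_norm_def u_def)
  have "hermite_partial_sum D \<psi> f \<Lambda> \<in> borel_measurable gauss"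
    unfolding hermite_partial_sum_eq[abs_def] by measurable
  moreover have "solution D \<psi> f \<in> borel_measurable gauss"
    using u_measurable by (simp add: u_def[abs_def])
  ultimately have "(\<lambda>y. solution D \<psi> f y - hermite_partial_sum D \<psi> f \<Lambda> y) \<in> borel_measurable gauss"
    by measurable
  moreover have "solution D \<psi> f y - hermite_partial_sum D \<psi> f \<Lambda> y \<in> H10 D" for y
    using u_in_H10[of y] ps(1)[of y] H10_mem(3) by (simp add: u_def)
  ultimately show "(\<lambda>y. solution D \<psi> f y - hermite_partial_sum D \<psi> f \<Lambda> y) \<in> L2_V D"
    using G.psum_error_integrable[OF \<Lambda>] by (simp add: L2_V_def V)
  have "(\<Sum>\<nu>\<in>F. (norm (G.coef \<nu>))\<^sup>2) \<le> B" if "finite F" "F \<subseteq> multi_indices - \<Lambda>" for F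
  proof -
    have "(\<Sum>\<nu>\<in>F. (norm (G.coef \<nu>))\<^sup>2) = (\<Sum>\<nu>\<in>F. (V_norm (hc \<nu>))\<^sup>2)"
      using that coef by (intro sum.cong refl) (auto simp: V_norm_def)
    then show ?thesis using B[OF that] by simp
  qed
  then have "(\<integral>y. (norm (snd (u y) - G.psum \<Lambda> y))\<^sup>2 \<partial>gauss) \<le> B"
    by (rule G.psum_error_le[OF \<Lambda>])
  then show "L2_V_norm (\<lambda>y. solution D \<psi> f y - hermite_partial_sum D \<psi> f \<Lambda> y) \<le> sqrt B"
    by (simp add: L2_V_norm_def V)
qed

end

text \<open>The terms are eventually below \<open>1\<close>, where lowering the exponent to
  \<open>q\<close> only increases them. This provides the l^1 condition under which the parameter
  series converges almost surely.\<close>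

lemma summable_of_summable_powr:
  fixes b :: "nat \<Rightarrow> real"
  assumes b: "\<And>j. 0 \<le> b j" and q: "0 < q" "q \<le> 1" and sm: "summable (\<lambda>j. b j powr q)"
  shows "summable b"
proof (rule summable_comparison_test_ev[OF _ sm])
  have "(\<lambda>j. b j powr q) \<longlonglongrightarrow> 0" by (rule summable_LIMSEQ_zero[OF sm])
  then have "\<forall>\<^sub>F j in sequentially. b j powr q < 1" by (rule order_tendstoD) simp
  then show "\<forall>\<^sub>F j in sequentially. norm (b j) \<le> b j powr q"
  proof eventually_elim
    fix j assume lt: "b j powr q < 1"
    have "b j < 1"
    proof (rule ccontr)
      assume "\<not> b j < 1"
      then have "1 \<le> b j powr q" using q by (intro ge_one_powr_ge_zero) auto
      then show False using lt by simp
    qed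
    show "norm (b j) \<le> b j powr q"
    proof (cases "b j = 0")
      case False
      then have "b j powr 1 \<le> b j powr q" using b[of j] \<open>b j < 1\<close> q by (intro powr_mono') auto
      then show ?thesis using b[of j] by simp
    qed simp
  qed
qed

theorem corollary6p3:
  fixes D :: "'a::euclidean_space set"
    and \<psi> :: "nat \<Rightarrow> 'a \<Rightarrow> real"
    and f :: "'a H1 \<Rightarrow> real"
    and p q :: real
  assumes "bounded_Lipschitz_domain D"
    and "f \<in> Hminus1 D"
    and "\<And>j. \<psi> j \<in> Linf D"
    and "0 < p" and "p < 2"
    and "1 / q = 1 / p + 1 / 2"
    and "summable (\<lambda>j. Linf_norm D (\<psi> j) powr q)"
  shows "(\<lambda>\<nu>. V_norm (hermite_coeff D \<psi> f \<nu>) powr p) summable_on multi_indices \<and>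
    (\<exists>C. \<forall>n\<ge>1. \<forall>\<Lambda>. n_largest multi_indices (\<lambda>\<nu>. V_norm (hermite_coeff D \<psi> f \<nu>)) n \<Lambda> \<longrightarrow>
      (\<lambda>y. solution D \<psi> f y - hermite_partial_sum D \<psi> f \<Lambda> y) \<in> L2_V D \<and>
      L2_V_norm (\<lambda>y. solution D \<psi> f y - hermite_partial_sum D \<psi> f \<Lambda> y)
        \<le> C * real n powr - (1 / q - 1))"
proof -
  have D: "open D" "bounded D" using assms(1) by (auto simp: bounded_Lipschitz_domain_def)
  obtain Cp where Cp: "0 < Cp" "\<And>v. v \<in> H10 D \<Longrightarrow> norm v \<le> Cp * V_norm v"
    using poincare_H10[OF D(2)] by blast
  obtain K0 where K0: "\<And>v. v \<in> H10 D \<Longrightarrow> \<bar>f v\<bar> \<le> K0 * V_norm v"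
    using assms(2) unfolding Hminus1_def by blast
  have "0 < 1 / q" unfolding assms(6) using assms(4) by (intro add_pos_pos) auto
  then have q0: "0 < q" by simp
  have "1 / 2 < 1 / p" using assms(4,5) by (simp add: field_simps)
  then have "1 < 1 / q" unfolding assms(6) by simp
  then have q1: "q \<le> 1" using q0 by (simp add: field_simps)
  interpret domain D
    by standard (rule sets_completionI_sets, simp add: D(1) borel_open)
  \<comment> \<open>\<open>Hminus1\<close> leaves the sign of its constant open, while
    \<open>elliptic\<close> wants it nonnegative.\<close>
  interpret parametric_elliptic D f "max K0 0" Cp \<psi>
  proof
    show "\<bar>f v\<bar> \<le> max K0 0 * V_norm v" if "v \<in> H10 D" for v
    proof -
      have "K0 * V_norm v \<le> max K0 0 * V_norm v" by (intro mult_right_mono) (auto simp: V_norm_def)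
      then show ?thesis using K0[OF that] by linarith
    qed
    show "summable (\<lambda>j. Linf_norm D (\<psi> j))"
      by (rule summable_of_summable_powr[OF Linf_norm_nonneg q0 q1 assms(7)])
  qed (use assms(2,3) Cp in \<open>auto simp: Hminus1_def simp del: split_paired_All\<close>)
  obtain K where K: "0 \<le> K" "\<And>F. finite F \<Longrightarrow> F \<subseteq> multi_indices \<Longrightarrow> (\<Sum>\<nu>\<in>F. V_norm (hc \<nu>) powr p) \<le> K"
    using hc_powr_sums_bounded[OF assms(4,5,6)] assms(7) by (auto simp: beta_def)
  have "(\<lambda>\<nu>. V_norm (hc \<nu>) powr p) summable_on multi_indices"
    by (rule nonneg_bdd_above_summable_on) (use K in \<open>auto intro!: bdd_aboveI[of _ K]\<close>)
  moreover have "(\<lambda>y. solution D \<psi> f y - hermite_partial_sum D \<psi> f \<Lambda> y) \<in> L2_V D \<and>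
      L2_V_norm (\<lambda>y. solution D \<psi> f y - hermite_partial_sum D \<psi> f \<Lambda> y) \<le> K powr (1 / p) * real n powr - (1 / q - 1)"
    if n: "1 \<le> n" and \<Lambda>: "n_largest multi_indices (\<lambda>\<nu>. V_norm (hc \<nu>)) n \<Lambda>" for n \<Lambda>
  proof -
    \<comment> \<open>Stechkin's bound for the squared error. Its square root decays with exponent
      \<open>1 / p - 1 / 2\<close>, which equals \<open>1 / q - 1\<close>.\<close>
    define B where "B = K powr (2 / p) * real n powr - (2 / p - 1)"
    have fin: "finite \<Lambda>" "\<Lambda> \<subseteq> multi_indices" using \<Lambda> by (auto simp: n_largest_def)
    have tail: "(\<Sum>\<nu>\<in>F. (V_norm (hc \<nu>))\<^sup>2) \<le> B" if "finite F" "F \<subseteq> multi_indices - \<Lambda>" for F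
      unfolding B_def by (rule n_largest_tail_le[OF \<Lambda> n _ assms(4,5) K that]) (simp add: V_norm_def)
    have "sqrt B = K powr (1 / p) * real n powr - (1 / q - 1)"
    proof -
      have "sqrt B = B powr (1 / 2)" by (simp add: B_def powr_half_sqrt)
      also have "\<dots> = (K powr (2 / p)) powr (1 / 2) * (real n powr - (2 / p - 1)) powr (1 / 2)"
        unfolding B_def by (simp add: powr_mult)
      also have "\<dots> = K powr (2 / p * (1 / 2)) * real n powr (- (2 / p - 1) * (1 / 2))"
        by (simp only: powr_powr)
      also have "2 / p * (1 / 2) = 1 / p" by simp
      also have "- (2 / p - 1) * (1 / 2) = - (1 / q - 1)"
        unfolding assms(6) by (simp add: field_simps)
      finally show ?thesis .
    qed
    then show ?thesis using error_L2_V[OF fin tail] by simp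
  qed
  ultimately show ?thesis unfolding hc_def by blast
qed

end
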